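(* Let $(u,\pi)$ be a suitable weak solution of the three-dimensional incompressible Navier-Stokes equations in $Q=B(1)\times(-1,0)$, with $\pi\in L^{3/2}(Q)$, which is smooth on compact subsets of $Q$, and is axisymmetric about the $z$-axis. Let $\ell:(-1,0)\to(0,\infty)$ be an Euler length. Suppose that there exist constants $C_0,C_2>0$ such that $$\|u(\cdot,t)\|_{L^\infty(B(1))}\le C_0\frac{\ell(t)}{(-t)},\qquad \|\nabla^2u(\cdot,t)\|_{L^\infty(B(1))}\le C_2\frac{1}{(-t)\,\ell(t)}$$ for all $t\in(-1,0)$. Then $(0,0)$ is a regular point.
   Context: Notation: $B(\rho)=\{x\in\mathbb{R}^3:|x|<\rho\}$, $Q(\rho)=B(\rho)\times(-\rho^2,0)$, $Q=Q(1)$. Navier-Stokes equations (no force, unit viscosity): $\partial_tu+(u\cdot\nabla)u-\Delta u+\nabla\pi=0$, $\mathrm{div}\,u=0$, with $u:Q\to\mathbb{R}^3$, $\pi:Q\to\mathbb{R}$. Suitable weak solution is meant in the sense of Caffarelli-Kohn-Nirenberg, with $\pi\in L^{3/2}(Q)$: $u\in L^\infty_tL^2_x\cap L^2_tH^1_x$ on $Q$, the equations hold in the sense of distributions, and the local energy inequality $2\iint|\nabla u|^2\varphi\le\iint\big(|u|^2(\partial_t\varphi+\Delta\varphi)+(|u|^2+2\pi)u\cdot\nabla\varphi\big)$ holds for all $0\le\varphi\in C_0^\infty(Q)$. No regularity is assumed at time $t=0$. Axisymmetric: with $x=(x',z)$, $r=|x'|$ and cylindrical frame $(e_r,e_\theta,e_z)$,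 $u=u_re_r+u_\theta e_\theta+u_ze_z$ where $u_r,u_\theta,u_z$ depend only on $(r,z,t)$ (the swirl $u_\theta$ may be nonzero); likewise $\pi=\pi(r,z,t)$. Euler length: a continuous function $\ell:(-1,0)\to(0,\infty)$ which is non-increasing, satisfies $\ell(2t)\le D\,\ell(t)$ for all $t\in(-1/2,0)$ with some constant $D\in[1,\infty)$, and satisfies $\lim_{t\uparrow0}\ell(t)=0$ and $\lim_{t\uparrow0}\frac{(-t)}{\ell(t)^2}=0$. Regular point: $(0,0)$ is regular if $\operatorname{ess\,sup}_{Q(\rho)}|u|<\infty$ for some $\rho>0$. $|\nabla^2u|$ denotes the Euclidean norm of the tensor $(\partial_i\partial_ju_k)_{i,j,k}$. *)

theory Defs
  imports "HOL-Analysis.Analysis" "HOL-Probability.Essential_Supremum"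
begin

text \<open>
  Space-time points are pairs \<open>(x, t)\<close>. Velocity and pressure are total functions on space-time of
  which only the values on \<open>parabolic_cylinder 1\<close> ever matter.
\<close>

type_synonym spacetime = "(real^3) \<times> real"

definition parabolic_cylinder :: "real \<Rightarrow> spacetime set" where
  "parabolic_cylinder \<rho> = ball 0 \<rho> \<times> {-(\<rho>\<^sup>2)<..<0}"

abbreviation Q :: "spacetime set" where
  "Q \<equiv> parabolic_cylinder 1"


subsection \<open>Classical derivatives and smooth functions\<close>

definition dx :: "3 \<Rightarrow> (spacetime \<Rightarrow> 'b::real_normed_vector) \<Rightarrow> spacetime \<Rightarrow> 'b" where
  "dx i f z = frechet_derivative f (at z) (axis i 1, 0)"

definition dt :: "(spacetime \<Rightarrow> 'b::real_normed_vector) \<Rightarrow> spacetime \<Rightarrow> 'b" where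
  "dt f z = frechet_derivative f (at z) (0, 1)"

definition grad :: "(spacetime \<Rightarrow> real) \<Rightarrow> spacetime \<Rightarrow> real^3" where
  "grad f z = (\<chi> i. dx i f z)"

definition laplacian :: "(spacetime \<Rightarrow> real) \<Rightarrow> spacetime \<Rightarrow> real" where
  "laplacian f z = (\<Sum>i\<in>UNIV. dx i (dx i f) z)"

text \<open>The norm of the type \<open>real^3^3^3\<close> is the Euclidean norm of the array of all entries.\<close>

definition second_gradient :: "(spacetime \<Rightarrow> real^3) \<Rightarrow> spacetime \<Rightarrow> real^3^3^3" where
  "second_gradient u z = (\<chi> i j k. dx i (dx j u) z $ k)"

text \<open>Only meaningful on open sets \<open>S\<close>, as the derivatives are those of the unrestricted function.\<close>

primrec times_differentiable_on ::
    "nat \<Rightarrow> 'a::real_normed_vector set \<Rightarrow> ('a \<Rightarrow> 'b::real_normed_vector) \<Rightarrow> bool" where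
  "times_differentiable_on 0 S f \<longleftrightarrow> continuous_on S f"
| "times_differentiable_on (Suc n) S f \<longleftrightarrow>
     (\<forall>x\<in>S. f differentiable (at x)) \<and>
     (\<forall>v. times_differentiable_on n S (\<lambda>x. frechet_derivative f (at x) v))"

definition smooth_on :: "'a::real_normed_vector set \<Rightarrow> ('a \<Rightarrow> 'b::real_normed_vector) \<Rightarrow> bool" where
  "smooth_on S f \<longleftrightarrow> (\<forall>n. times_differentiable_on n S f)"

definition test_function :: "'a::real_normed_vector set \<Rightarrow> ('a \<Rightarrow> real) \<Rightarrow> bool" where
  "test_function S \<phi> \<longleftrightarrow>
     smooth_on UNIV \<phi> \<and> compact (closure (support_on UNIV \<phi>)) \<and> closure (support_on UNIV \<phi>) \<subseteq> S"


subsection \<open>Suitable weak solutions\<close>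

definition in_Lp :: "real \<Rightarrow> 'a::euclidean_space set \<Rightarrow> ('a \<Rightarrow> 'b::euclidean_space) \<Rightarrow> bool" where
  "in_Lp p S f \<longleftrightarrow>
     f \<in> borel_measurable (lebesgue_on S) \<and> integrable (lebesgue_on S) (\<lambda>z. norm (f z) powr p)"

definition in_LinfL2 :: "(spacetime \<Rightarrow> real^3) \<Rightarrow> bool" where
  "in_LinfL2 u \<longleftrightarrow>
     u \<in> borel_measurable (lebesgue_on Q) \<and>
     (\<exists>K::real. AE t in lebesgue_on {-1<..<0}.
        (\<integral>\<^sup>+x. ennreal ((norm (u (x, t)))\<^sup>2) \<partial>lebesgue_on (ball 0 1)) \<le> ennreal K)"

text \<open>
  \<open>G\<close> is the weak spatial Jacobian matrix of \<open>u\<close>, with \<open>G z $ k $ i\<close> the derivative of \<open>u\<^sub>k\<close> in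
  direction \<open>x\<^sub>i\<close>. Membership of \<open>u\<close> in \<open>L\<^sup>2\<^sub>t H\<^sup>1\<^sub>x\<close> on \<open>Q\<close> means that such a \<open>G\<close> exists.
\<close>

definition L2H1_gradient :: "(spacetime \<Rightarrow> real^3) \<Rightarrow> (spacetime \<Rightarrow> real^3^3) \<Rightarrow> bool" where
  "L2H1_gradient u G \<longleftrightarrow>
     in_Lp 2 Q u \<and> in_Lp 2 Q G \<and>
     (\<forall>i k \<phi>. test_function Q \<phi> \<longrightarrow>
        (LINT z|lebesgue_on Q. u z $ k * dx i \<phi> z) = - (LINT z|lebesgue_on Q. G z $ k $ i * \<phi> z))"

text \<open>
  The weak form of the momentum equation is stated for each component \<open>k\<close>; its nonlinear term is
  \<open>((u \<cdot> \<nabla>)u)\<^sub>k = (G *v u)\<^sub>k\<close>.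
\<close>

definition suitable_weak_solution :: "(spacetime \<Rightarrow> real^3) \<Rightarrow> (spacetime \<Rightarrow> real) \<Rightarrow> bool" where
  "suitable_weak_solution u p \<longleftrightarrow>
     in_LinfL2 u \<and> in_Lp (3/2) Q p \<and>
     (\<exists>G. L2H1_gradient u G \<and>
        (\<forall>k \<phi>. test_function Q \<phi> \<longrightarrow>
           (LINT z|lebesgue_on Q. - (u z $ k * dt \<phi> z) + (G z *v u z) $ k * \<phi> z
              - u z $ k * laplacian \<phi> z - p z * dx k \<phi> z) = 0) \<and>
        (\<forall>\<phi>. test_function Q \<phi> \<longrightarrow> (LINT z|lebesgue_on Q. u z \<bullet> grad \<phi> z) = 0) \<and>
        (\<forall>\<phi>. test_function Q \<phi> \<and> (\<forall>z. 0 \<le> \<phi> z) \<longrightarrow>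
           2 * (LINT z|lebesgue_on Q. (norm (G z))\<^sup>2 * \<phi> z)
             \<le> (LINT z|lebesgue_on Q. (norm (u z))\<^sup>2 * (dt \<phi> z + laplacian \<phi> z)
                  + ((norm (u z))\<^sup>2 + 2 * p z) * (u z \<bullet> grad \<phi> z))))"


subsection \<open>Axial symmetry\<close>

definition cyl_radius :: "real^3 \<Rightarrow> real" where
  "cyl_radius x = sqrt ((x $ 1)\<^sup>2 + (x $ 2)\<^sup>2)"

definition e_r :: "real^3 \<Rightarrow> real^3" where
  "e_r x = vector [x $ 1 / cyl_radius x, x $ 2 / cyl_radius x, 0]"

definition e_theta :: "real^3 \<Rightarrow> real^3" where
  "e_theta x = vector [- (x $ 2) / cyl_radius x, x $ 1 / cyl_radius x, 0]"

definition e_z :: "real^3" where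
  "e_z = vector [0, 0, 1]"

text \<open>The cylindrical frame exists only off the axis, so \<open>u\<close> is decomposed only there.\<close>

definition axisymmetric :: "(spacetime \<Rightarrow> real^3) \<Rightarrow> (spacetime \<Rightarrow> real) \<Rightarrow> bool" where
  "axisymmetric u p \<longleftrightarrow>
     (\<exists>u\<^sub>r u\<^sub>\<theta> u\<^sub>z :: real \<Rightarrow> real \<Rightarrow> real \<Rightarrow> real.
        \<forall>(x, t)\<in>Q. cyl_radius x \<noteq> 0 \<longrightarrow>
          u (x, t) = u\<^sub>r (cyl_radius x) (x $ 3) t *\<^sub>R e_r x
                   + u\<^sub>\<theta> (cyl_radius x) (x $ 3) t *\<^sub>R e_theta x
                   + u\<^sub>z (cyl_radius x) (x $ 3) t *\<^sub>R e_z) \<and>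
     (\<exists>p' :: real \<Rightarrow> real \<Rightarrow> real \<Rightarrow> real. \<forall>(x, t)\<in>Q. p (x, t) = p' (cyl_radius x) (x $ 3) t)"


subsection \<open>Euler lengths and regular points\<close>

definition euler_length :: "(real \<Rightarrow> real) \<Rightarrow> bool" where
  "euler_length l \<longleftrightarrow>
     continuous_on {-1<..<0} l \<and>
     (\<forall>t\<in>{-1<..<0}. 0 < l t) \<and>
     antimono_on {-1<..<0} l \<and>
     (\<exists>D\<ge>1. \<forall>t\<in>{-1/2<..<0}. l (2 * t) \<le> D * l t) \<and>
     (l \<longlongrightarrow> 0) (at_left 0) \<and>
     ((\<lambda>t. - t / (l t)\<^sup>2) \<longlongrightarrow> 0) (at_left 0)"

definition Linf_norm :: "'a::euclidean_space set \<Rightarrow> ('a \<Rightarrow> 'b::real_normed_vector) \<Rightarrow> ereal" where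
  "Linf_norm S f = esssup (lebesgue_on S) (\<lambda>x. ereal (norm (f x)))"

definition regular_at_origin :: "(spacetime \<Rightarrow> real^3) \<Rightarrow> bool" where
  "regular_at_origin u \<longleftrightarrow> (\<exists>\<rho>>0. \<rho> \<le> 1 \<and> Linf_norm (parabolic_cylinder \<rho>) u < \<infinity>)"

end

theory Submission
  imports Defs
begin

text \<open>
  The quantities \<open>\<Gamma> = r u\<^sub>\<theta>\<close> and \<open>H = r \<omega>\<^sub>\<theta>\<close> solve drift-diffusion equations off the axis: the one
  for \<open>\<Gamma>\<close> has no source, the one for \<open>H\<close> has the stretching term \<open>2 (u\<^sub>r / r) H\<close> and the source
  \<open>2 \<Gamma> \<partial>\<^sub>z\<Gamma> / r\<^sup>2\<close>. A maximum principle for \<open>\<Gamma> r\<^sup>-\<^sup>a\<close> and \<open>H r\<^sup>-\<^sup>a\<close>, \<open>0 \<le> a < 2\<close>, localised by a cutoff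
  that moves inwards faster than the flow, controls them as long as \<open>u\<^sub>r / r\<close> is controlled. In the
  other direction, the part of \<open>u\<close> without swirl is recovered from \<open>H\<close>: it is solenoidal with curl
  bounded by \<open>|H| / r\<close> and has finite local energy, so averaging it against a bump bounds it pointwise.

  Interpolation gives \<open>|\<nabla>u| \<lesssim> 1 / (-t)\<close>, and then \<open>|u| \<lesssim> (-t)\<^bsup>-3/5\<^esup>\<close>, so the drift is integrable in time.
  Hence \<open>\<Gamma>\<close> is bounded. Since \<open>-t\<close> is negligible against \<open>\<ell>(t)\<^sup>2\<close>, it follows in turn that \<open>\<Gamma>\<close> is
  \<open>o(r\<^sup>2 / (-t))\<close>, that \<open>H\<close> is \<open>o(r\<^sup>2 / ((-t) \<ell>))\<close>, and that \<open>u\<^sub>r / r\<close> is \<open>o(1 / (-t))\<close>. Stretching with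
  such a small constant costs only a small power of \<open>-t\<close>, which gives \<open>|u| \<lesssim> (-t)\<^bsup>-1/16\<^esup>\<close> for the part without
  swirl. Then \<open>u\<^sub>r / r\<close> is integrable in time and a second pass bounds \<open>u\<close>.
\<close>

subsection \<open>Calculus of smooth functions\<close>

text \<open>Every rate is critical: |u_r / r| \<lesssim> 1 / (-t) lets stretching amplify H by a
  power of 1 / (-t) governed by the constant, so this constant must become small before a barrier
  closes. Smallness has two origins. A bounded Gamma is small against r^2 / (-t) from distances of
  order l on, and the bound on second derivatives carries this down to the axis. A weight r^(-a)
  turns the stretching factor 2 of H into 2 - a; but Gamma and H are only O(r^2), and a < 2 is what
  makes the weighted quantity vanish on the axis and attain its maximum off it, hence a = 2 -
  \<sigma> and a limit. The rate l / (-t) of u need not be integrable in time. The energy repairs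
  this: averages over radius s cost s / (-t) through the curl and s^(-3/2) through the energy, and s
  = (-t)^(2/5) balances both at (-t)^(-3/5), whose integral gives the power in the cutoff. No
  boundary values on the side of a cylinder are known, so all estimates are interior, and the errors
  of the cutoff enter the barriers as sources.\<close>

definition dir_deriv :: "'a::real_normed_vector \<Rightarrow> ('a \<Rightarrow> 'b::real_normed_vector) \<Rightarrow> 'a \<Rightarrow> 'b"
  where "dir_deriv v f z = frechet_derivative f (at z) v"

lemma dx_eq: "dx i f = dir_deriv (axis i 1, 0) f"
  by (simp add: dx_def dir_deriv_def fun_eq_iff)

lemma dt_eq: "dt f = dir_deriv (0, 1) f"
  by (simp add: dt_def dir_deriv_def fun_eq_iff)

lemma has_derivative_dir_deriv:
  "f differentiable (at z) \<Longrightarrow> (f has_derivative (\<lambda>v. dir_deriv v f z)) (at z)"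
  by (simp add: dir_deriv_def frechet_derivative_works[symmetric])

lemma dir_derivI: "(f has_derivative f') (at z) \<Longrightarrow> dir_deriv v f z = f' v"
  using frechet_derivative_at by (metis dir_deriv_def)

lemma dir_deriv_cong_open:
  assumes "open S" "z \<in> S" "\<And>x. x \<in> S \<Longrightarrow> f x = g x"
  shows "dir_deriv v f z = dir_deriv v g z"
proof -
  have "\<And>h. (f has_derivative h) (at z) \<longleftrightarrow> (g has_derivative h) (at z)"
    using has_derivative_transform_within_open[OF _ assms(1,2)] assms(3) by metis
  then show ?thesis unfolding dir_deriv_def frechet_derivative_def by simp
qed

lemma times_differentiable_on_Suc':
  "times_differentiable_on (Suc n) S f \<longleftrightarrow>
    (\<forall>x\<in>S. f differentiable (at x)) \<and> (\<forall>v. times_differentiable_on n S (dir_deriv v f))"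
  by (simp add: dir_deriv_def[abs_def])

declare times_differentiable_on.simps(2)[simp del]

lemma times_differentiable_on_cong:
  assumes "open S" "\<And>x. x \<in> S \<Longrightarrow> f x = g x"
  shows "times_differentiable_on n S f \<longleftrightarrow> times_differentiable_on n S g"
  using assms(2)
proof (induction n arbitrary: f g)
  case 0 then show ?case by (simp cong: continuous_on_cong)
next
  case (Suc n)
  have "f differentiable at x \<longleftrightarrow> g differentiable at x" if "x \<in> S" for x
    unfolding differentiable_def
    using has_derivative_transform_within_open[OF _ assms(1) that] Suc.prems by metis
  moreover have "times_differentiable_on n S (dir_deriv v f) \<longleftrightarrow>
      times_differentiable_on n S (dir_deriv v g)" for v
    by (rule Suc.IH) (rule dir_deriv_cong_open[OF assms(1)], auto simp: Suc.prems)
  ultimately show ?case unfolding times_differentiable_on_Suc' by auto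
qed

lemma times_differentiable_on_subset:
  "times_differentiable_on n S f \<Longrightarrow> T \<subseteq> S \<Longrightarrow> times_differentiable_on n T f"
  by (induction n arbitrary: f)
    (auto simp: times_differentiable_on_Suc' intro: continuous_on_subset)

lemma times_differentiable_on_Un:
  "open S \<Longrightarrow> open T \<Longrightarrow> times_differentiable_on n S f \<Longrightarrow> times_differentiable_on n T f
    \<Longrightarrow> times_differentiable_on n (S \<union> T) f"
  by (induction n arbitrary: f)
    (auto simp: times_differentiable_on_Suc' intro: continuous_on_open_Un)

lemma times_differentiable_on_imp_continuous:
  "times_differentiable_on n S f \<Longrightarrow> continuous_on S f"
  by (cases n) (auto simp: times_differentiable_on_Suc' continuous_at_imp_continuous_on
      differentiable_imp_continuous_within)

lemma times_differentiable_on_Suc_imp: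
  "times_differentiable_on (Suc n) S f \<Longrightarrow> times_differentiable_on n S f"
proof (induction n arbitrary: f)
  case 0 then show ?case using times_differentiable_on_imp_continuous by auto
next
  case (Suc n) then show ?case by (auto simp: times_differentiable_on_Suc')
qed

lemma times_differentiable_on_linear:
  assumes "bounded_linear L" "open S" "times_differentiable_on n S f"
  shows "times_differentiable_on n S (\<lambda>x. L (f x))"
  using assms(3)
proof (induction n arbitrary: f)
  case 0 then show ?case using assms(1)
    by (simp add: bounded_linear.continuous_on)
next
  case (Suc n)
  have d: "((\<lambda>x. L (f x)) has_derivative (\<lambda>v. L (dir_deriv v f x))) (at x)" if "x \<in> S" for x
    using Suc.prems that unfolding times_differentiable_on_Suc'
    by (auto intro!: bounded_linear.has_derivative[OF assms(1)] has_derivative_dir_deriv)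
  have "times_differentiable_on n S (dir_deriv v (\<lambda>x. L (f x)))" for v
  proof -
    have "times_differentiable_on n S (\<lambda>x. L (dir_deriv v f x))"
      using Suc unfolding times_differentiable_on_Suc' by blast
    then show ?thesis
      by (subst times_differentiable_on_cong[OF assms(2)]) (rule dir_derivI[OF d])
  qed
  then show ?case using d unfolding times_differentiable_on_Suc' differentiable_def by blast
qed

lemma times_differentiable_on_const:
  "open S \<Longrightarrow> times_differentiable_on n S (\<lambda>x. c)"
proof (induction n arbitrary: c)
  case (Suc n)
  have "dir_deriv v (\<lambda>x. c) = (\<lambda>x. 0)" for v :: 'a
    by (intro ext dir_derivI) auto
  then show ?case using Suc by (simp add: times_differentiable_on_Suc')
qed simp

lemma times_differentiable_on_id:
  "open S \<Longrightarrow> times_differentiable_on n S (\<lambda>x. x)"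
proof (cases n)
  case (Suc m)
  assume "open S"
  have "dir_deriv v (\<lambda>x. x) = (\<lambda>x. v)" for v :: 'a
    by (intro ext dir_derivI) auto
  then show ?thesis using Suc \<open>open S\<close>
    by (simp add: times_differentiable_on_Suc' times_differentiable_on_const)
qed (simp add: continuous_on_id)

lemma times_differentiable_on_add:
  assumes "open S" "times_differentiable_on n S f" "times_differentiable_on n S g"
  shows "times_differentiable_on n S (\<lambda>x. f x + g x)"
  using assms(2,3)
proof (induction n arbitrary: f g)
  case 0 then show ?case by (simp add: continuous_on_add)
next
  case (Suc n)
  have d: "((\<lambda>x. f x + g x) has_derivative (\<lambda>v. dir_deriv v f x + dir_deriv v g x)) (at x)"
    if "x \<in> S" for x
    using Suc.prems that unfolding times_differentiable_on_Suc'
    by (auto intro!: has_derivative_add has_derivative_dir_deriv)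
  have "times_differentiable_on n S (dir_deriv v (\<lambda>x. f x + g x))" for v
  proof -
    have "times_differentiable_on n S (\<lambda>x. dir_deriv v f x + dir_deriv v g x)"
      using Suc unfolding times_differentiable_on_Suc' by blast
    then show ?thesis
      by (subst times_differentiable_on_cong[OF assms(1)]) (rule dir_derivI[OF d])
  qed
  then show ?case using d unfolding times_differentiable_on_Suc' differentiable_def by blast
qed

lemma times_differentiable_on_mult:
  fixes f g :: "'a::real_normed_vector \<Rightarrow> real"
  assumes "open S" "times_differentiable_on n S f" "times_differentiable_on n S g"
  shows "times_differentiable_on n S (\<lambda>x. f x * g x)"
  using assms(2,3)
proof (induction n arbitrary: f g)
  case 0 then show ?case by (simp add: continuous_on_mult)
next
  case (Suc n)
  have d: "((\<lambda>x. f x * g x) has_derivative (\<lambda>v. f x * dir_deriv v g x + dir_deriv v f x * g x)) (at x)"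
    if "x \<in> S" for x
    using Suc.prems that unfolding times_differentiable_on_Suc'
    by (auto intro!: has_derivative_mult has_derivative_dir_deriv)
  have "times_differentiable_on n S (dir_deriv v (\<lambda>x. f x * g x))" for v
  proof -
    have "times_differentiable_on n S (\<lambda>x. f x * dir_deriv v g x + dir_deriv v f x * g x)"
      using Suc.IH Suc.prems times_differentiable_on_Suc_imp[OF Suc.prems(1)]
        times_differentiable_on_Suc_imp[OF Suc.prems(2)]
      unfolding times_differentiable_on_Suc'
      by (intro times_differentiable_on_add[OF assms(1)]) blast+
    then show ?thesis
      by (subst times_differentiable_on_cong[OF assms(1)]) (rule dir_derivI[OF d])
  qed
  then show ?case using d unfolding times_differentiable_on_Suc' differentiable_def by blast
qed

lemma smooth_on_cong: "open S \<Longrightarrow> (\<And>x. x \<in> S \<Longrightarrow> f x = g x) \<Longrightarrow> smooth_on S f \<longleftrightarrow> smooth_on S g"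
  unfolding smooth_on_def using times_differentiable_on_cong by blast

lemma smooth_on_subset: "smooth_on S f \<Longrightarrow> T \<subseteq> S \<Longrightarrow> smooth_on T f"
  unfolding smooth_on_def using times_differentiable_on_subset by blast

lemma smooth_on_Un: "open S \<Longrightarrow> open T \<Longrightarrow> smooth_on S f \<Longrightarrow> smooth_on T f \<Longrightarrow> smooth_on (S \<union> T) f"
  unfolding smooth_on_def using times_differentiable_on_Un by blast

lemma smooth_on_linear: "bounded_linear L \<Longrightarrow> open S \<Longrightarrow> smooth_on S f \<Longrightarrow> smooth_on S (\<lambda>x. L (f x))"
  unfolding smooth_on_def using times_differentiable_on_linear by blast

lemma smooth_on_const: "open S \<Longrightarrow> smooth_on S (\<lambda>x. c)"
  unfolding smooth_on_def using times_differentiable_on_const by blast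

lemma smooth_on_id: "open S \<Longrightarrow> smooth_on S (\<lambda>x. x)"
  unfolding smooth_on_def using times_differentiable_on_id by blast

lemma smooth_on_add: "open S \<Longrightarrow> smooth_on S f \<Longrightarrow> smooth_on S g \<Longrightarrow> smooth_on S (\<lambda>x. f x + g x)"
  unfolding smooth_on_def using times_differentiable_on_add by blast

lemma smooth_on_mult:
  fixes f g :: "'a::real_normed_vector \<Rightarrow> real"
  shows "open S \<Longrightarrow> smooth_on S f \<Longrightarrow> smooth_on S g \<Longrightarrow> smooth_on S (\<lambda>x. f x * g x)"
  unfolding smooth_on_def using times_differentiable_on_mult by blast

lemma smooth_on_minus: "open S \<Longrightarrow> smooth_on S f \<Longrightarrow> smooth_on S (\<lambda>x. - f x)"
  using smooth_on_linear[OF bounded_linear_minus[OF bounded_linear_ident]] .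

lemma smooth_on_diff: "open S \<Longrightarrow> smooth_on S f \<Longrightarrow> smooth_on S g \<Longrightarrow> smooth_on S (\<lambda>x. f x - g x)"
  using smooth_on_add[OF _ _ smooth_on_minus, of S f g] by simp

lemma smooth_on_sum:
  "open S \<Longrightarrow> (\<And>i. i \<in> I \<Longrightarrow> smooth_on S (f i)) \<Longrightarrow> smooth_on S (\<lambda>x. \<Sum>i\<in>I. f i x)"
  by (induction I rule: infinite_finite_induct) (auto simp: smooth_on_const smooth_on_add)

lemma smooth_on_dir_deriv: "smooth_on S f \<Longrightarrow> smooth_on S (dir_deriv v f)"
  unfolding smooth_on_def using times_differentiable_on_Suc' by blast

lemma smooth_on_imp_differentiable: "smooth_on S f \<Longrightarrow> z \<in> S \<Longrightarrow> f differentiable (at z)"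
  unfolding smooth_on_def using times_differentiable_on_Suc' by blast

lemma smooth_on_imp_continuous: "smooth_on S f \<Longrightarrow> continuous_on S f"
  unfolding smooth_on_def using times_differentiable_on_imp_continuous by blast

lemma smooth_on_has_derivative:
  "smooth_on S f \<Longrightarrow> z \<in> S \<Longrightarrow> (f has_derivative (\<lambda>v. dir_deriv v f z)) (at z)"
  by (simp add: has_derivative_dir_deriv smooth_on_imp_differentiable)

lemma dir_deriv_linear: "f differentiable (at z) \<Longrightarrow> linear (\<lambda>v. dir_deriv v f z)"
  using has_derivative_dir_deriv has_derivative_linear by blast

lemma dir_deriv_add:
  "f differentiable (at z) \<Longrightarrow> g differentiable (at z) \<Longrightarrow>
    dir_deriv v (\<lambda>x. f x + g x) z = dir_deriv v f z + dir_deriv v g z"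
  by (rule dir_derivI) (auto intro: has_derivative_add has_derivative_dir_deriv)

lemma dir_deriv_diff:
  "f differentiable (at z) \<Longrightarrow> g differentiable (at z) \<Longrightarrow>
    dir_deriv v (\<lambda>x. f x - g x) z = dir_deriv v f z - dir_deriv v g z"
  by (rule dir_derivI) (auto intro: has_derivative_diff has_derivative_dir_deriv)

lemma dir_deriv_minus:
  "f differentiable (at z) \<Longrightarrow> dir_deriv v (\<lambda>x. - f x) z = - dir_deriv v f z"
  by (rule dir_derivI) (auto intro: has_derivative_minus has_derivative_dir_deriv)

lemma dir_deriv_mult:
  fixes f g :: "'a::real_normed_vector \<Rightarrow> real"
  shows "f differentiable (at z) \<Longrightarrow> g differentiable (at z) \<Longrightarrow>
    dir_deriv v (\<lambda>x. f x * g x) z = dir_deriv v f z * g z + f z * dir_deriv v g z"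
  by (subst dir_derivI[OF has_derivative_mult[OF has_derivative_dir_deriv has_derivative_dir_deriv]]) auto

lemma dir_deriv_comp_linear:
  "bounded_linear L \<Longrightarrow> f differentiable (at z) \<Longrightarrow>
    dir_deriv v (\<lambda>x. L (f x)) z = L (dir_deriv v f z)"
  by (rule dir_derivI) (auto intro: bounded_linear.has_derivative has_derivative_dir_deriv)

section \<open>Restriction to lines and symmetry of second derivatives\<close>

lemma DERIV_along_line:
  assumes "f differentiable (at (a + s *\<^sub>R v))"
  shows "((\<lambda>s. f (a + s *\<^sub>R v)) has_vector_derivative dir_deriv v f (a + s *\<^sub>R v)) (at s)"
proof -
  have "((\<lambda>s. a + s *\<^sub>R v) has_derivative (\<lambda>h. h *\<^sub>R v)) (at s)"
    by (auto intro!: derivative_eq_intros)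
  from has_derivative_compose[OF this has_derivative_dir_deriv[OF assms]]
  have "((\<lambda>s. f (a + s *\<^sub>R v)) has_derivative (\<lambda>h. dir_deriv (h *\<^sub>R v) f (a + s *\<^sub>R v))) (at s)" .
  moreover have "dir_deriv (h *\<^sub>R v) f (a + s *\<^sub>R v) = h *\<^sub>R dir_deriv v f (a + s *\<^sub>R v)" for h
    using linear_scale[OF dir_deriv_linear[OF assms]] by blast
  ultimately show ?thesis by (simp add: has_vector_derivative_def)
qed

lemma DERIV_along_line_real:
  fixes f :: "'a::real_normed_vector \<Rightarrow> real"
  assumes "f differentiable (at (a + s *\<^sub>R v))"
  shows "((\<lambda>s. f (a + s *\<^sub>R v)) has_real_derivative dir_deriv v f (a + s *\<^sub>R v)) (at s)"
  using DERIV_along_line[OF assms] by (simp add: has_real_derivative_iff_has_vector_derivative)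

text \<open>The mean value theorem is applied twice: along \<open>v\<close> to the increment of
  \<open>f\<close> in direction \<open>w\<close>, then along \<open>w\<close> to the derivative in
  direction \<open>v\<close>. Of the intermediate point only its distance from \<open>z\<close>
  matters for the limit.\<close>

lemma second_difference:
  fixes f :: "'a::real_normed_vector \<Rightarrow> real"
  assumes f: "smooth_on (ball z r) f" and h: "h > 0" "h * (norm v + norm w) < r"
  shows "\<exists>y. dist z y \<le> h * (norm v + norm w) \<and>
    f (z + h *\<^sub>R v + h *\<^sub>R w) - f (z + h *\<^sub>R v) - f (z + h *\<^sub>R w) + f z
      = h * h * dir_deriv w (dir_deriv v f) y"
proof -
  have inb: "norm (s *\<^sub>R v + t *\<^sub>R w) \<le> h * (norm v + norm w)" if "0 \<le> s" "s \<le> h" "0 \<le> t" "t \<le> h" for s t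
  proof -
    have "norm (s *\<^sub>R v + t *\<^sub>R w) \<le> s * norm v + t * norm w"
      using norm_triangle_ineq[of "s *\<^sub>R v" "t *\<^sub>R w"] that by simp
    also have "\<dots> \<le> h * (norm v + norm w)"
      using that by (simp add: distrib_left add_mono mult_right_mono)
    finally show ?thesis .
  qed
  have inball: "z + s *\<^sub>R v + t *\<^sub>R w \<in> ball z r" if "0 \<le> s" "s \<le> h" "0 \<le> t" "t \<le> h" for s t
    using inb[OF that] h by (simp add: dist_norm algebra_simps norm_minus_commute)
  define g where "g s = f ((z + h *\<^sub>R w) + s *\<^sub>R v) - f (z + s *\<^sub>R v)" for s
  have dg: "DERIV g s :> dir_deriv v f ((z + h *\<^sub>R w) + s *\<^sub>R v) - dir_deriv v f (z + s *\<^sub>R v)"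
    if "0 \<le> s" "s \<le> h" for s
  proof -
    have d: "f differentiable at (z + h *\<^sub>R w + s *\<^sub>R v)" "f differentiable at (z + s *\<^sub>R v)"
      using inball[of s h] inball[of s 0] that h(1)
      by (auto intro!: smooth_on_imp_differentiable[OF f] simp: algebra_simps)
    show ?thesis unfolding g_def
      by (rule DERIV_diff[OF DERIV_along_line_real[OF d(1)] DERIV_along_line_real[OF d(2)]])
  qed
  obtain s where s: "0 < s" "s < h"
    "g h - g 0 = (h - 0) * (dir_deriv v f ((z + h *\<^sub>R w) + s *\<^sub>R v) - dir_deriv v f (z + s *\<^sub>R v))"
    using MVT2[OF h(1), of g "\<lambda>s. dir_deriv v f ((z + h *\<^sub>R w) + s *\<^sub>R v) - dir_deriv v f (z + s *\<^sub>R v)", OF dg]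
    by blast
  have dk: "DERIV (\<lambda>t. dir_deriv v f ((z + s *\<^sub>R v) + t *\<^sub>R w)) t :> dir_deriv w (dir_deriv v f) ((z + s *\<^sub>R v) + t *\<^sub>R w)"
    if "0 \<le> t" "t \<le> h" for t
  proof -
    have "dir_deriv v f differentiable at (z + s *\<^sub>R v + t *\<^sub>R w)"
      using inball[of s t] that s by (auto intro!: smooth_on_imp_differentiable[OF smooth_on_dir_deriv[OF f]])
    then show ?thesis by (rule DERIV_along_line_real)
  qed
  obtain t where t: "0 < t" "t < h"
    "dir_deriv v f ((z + s *\<^sub>R v) + h *\<^sub>R w) - dir_deriv v f ((z + s *\<^sub>R v) + 0 *\<^sub>R w)
       = (h - 0) * dir_deriv w (dir_deriv v f) ((z + s *\<^sub>R v) + t *\<^sub>R w)"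
    using MVT2[OF h(1), of "\<lambda>t. dir_deriv v f ((z + s *\<^sub>R v) + t *\<^sub>R w)"
        "\<lambda>t. dir_deriv w (dir_deriv v f) ((z + s *\<^sub>R v) + t *\<^sub>R w)", OF dk]
    by blast
  have "f (z + h *\<^sub>R v + h *\<^sub>R w) - f (z + h *\<^sub>R v) - f (z + h *\<^sub>R w) + f z
      = h * h * dir_deriv w (dir_deriv v f) ((z + s *\<^sub>R v) + t *\<^sub>R w)"
    using s(3) t(3) unfolding g_def by (simp add: algebra_simps)
  moreover have "dist z ((z + s *\<^sub>R v) + t *\<^sub>R w) \<le> h * (norm v + norm w)"
    using inb[of s t] s t unfolding dist_commute[of z] by (simp add: dist_norm add.assoc)
  ultimately show ?thesis by blast
qed

text \<open>The second difference is symmetric in \<open>v\<close> and \<open>w\<close>. Divided by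
  h^2 it tends to either mixed derivative, according to which direction is differentiated first, and
  limits are unique.\<close>

lemma dir_deriv_commute:
  fixes f :: "'a::real_normed_vector \<Rightarrow> real"
  assumes f: "smooth_on S f" and S: "open S" "z \<in> S"
  shows "dir_deriv v (dir_deriv w f) z = dir_deriv w (dir_deriv v f) z"
proof -
  obtain r where r: "r > 0" "ball z r \<subseteq> S" using S openE by blast
  have fb: "smooth_on (ball z r) f" using smooth_on_subset[OF f r(2)] .
  define q where "q h = (f (z + h *\<^sub>R v + h *\<^sub>R w) - f (z + h *\<^sub>R v) - f (z + h *\<^sub>R w) + f z) / (h * h)" for h
  have lim: "(q \<longlongrightarrow> dir_deriv w (dir_deriv v f) z) (at_right 0)"
    if qv: "\<And>h. q h = (f (z + h *\<^sub>R v + h *\<^sub>R w) - f (z + h *\<^sub>R v) - f (z + h *\<^sub>R w) + f z) / (h * h)" for q v w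
  proof (rule tendstoI)
    fix e :: real assume e: "e > 0"
    have "isCont (dir_deriv w (dir_deriv v f)) z"
      using smooth_on_imp_continuous[OF smooth_on_dir_deriv[OF smooth_on_dir_deriv[OF f]]] S
      by (simp add: continuous_on_eq_continuous_at)
    then obtain d where d: "d > 0" "\<And>y. dist y z < d \<Longrightarrow> dist (dir_deriv w (dir_deriv v f) y) (dir_deriv w (dir_deriv v f) z) < e"
      using e unfolding continuous_at_eps_delta by blast
    have "\<forall>\<^sub>F h in at_right 0. h * (norm v + norm w) < min d r"
    proof (rule order_tendstoD(2))
      have "((\<lambda>h. h * (norm v + norm w)) \<longlongrightarrow> 0 * (norm v + norm w)) (at_right 0)"
        by (intro tendsto_intros)
      then show "((\<lambda>h. h * (norm v + norm w)) \<longlongrightarrow> 0) (at_right 0)" by simp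
    qed (use d r in auto)
    moreover have "\<forall>\<^sub>F h in at_right (0::real). h > 0" by (simp add: eventually_at_right_less)
    ultimately show "\<forall>\<^sub>F h in at_right 0. dist (q h) (dir_deriv w (dir_deriv v f) z) < e"
    proof eventually_elim
      case (elim h)
      then obtain y where y: "dist z y \<le> h * (norm v + norm w)"
        "f (z + h *\<^sub>R v + h *\<^sub>R w) - f (z + h *\<^sub>R v) - f (z + h *\<^sub>R w) + f z
          = h * h * dir_deriv w (dir_deriv v f) y" using second_difference[OF fb, of h v w] by auto
      have "q h = dir_deriv w (dir_deriv v f) y" using y(2) elim by (simp add: qv)
      then show ?case using d(2)[of y] y(1) elim by (simp add: dist_commute)
    qed
  qed
  have 1: "(q \<longlongrightarrow> dir_deriv w (dir_deriv v f) z) (at_right 0)" using lim q_def by blast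
  have 2: "(q \<longlongrightarrow> dir_deriv v (dir_deriv w f) z) (at_right 0)"
    by (rule lim) (simp add: q_def algebra_simps)
  show ?thesis using tendsto_unique[OF _ 2 1] by simp
qed

subsection \<open>Bump functions\<close>

text \<open>The classical flat function exp(-1/s) with polynomial factors in 1/s. The whole family
  is closed under differentiation, so smoothness of the case \<open>P = 1\<close> comes from one
  induction that is general in \<open>P\<close>.\<close>

definition flat_exp :: "real poly \<Rightarrow> real \<Rightarrow> real"
  where "flat_exp P s = (if s > 0 then poly P (1 / s) / exp (1 / s) else 0)"

text \<open>The extra factor \<open>x ^ k\<close> is what makes the induction close: splitting off
  one coefficient of the polynomial leaves the same claim with \<open>Suc k\<close>.\<close>

lemma poly_over_exp_tendsto: "((\<lambda>x::real. x ^ k * poly P x / exp x) \<longlongrightarrow> 0) at_top"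
proof (induction P arbitrary: k)
  case (pCons a P)
  have "((\<lambda>x. a * (x ^ k / exp x) + x ^ Suc k * poly P x / exp x) \<longlongrightarrow> a * 0 + 0) at_top"
    by (intro tendsto_intros tendsto_power_div_exp_0 pCons.IH)
  then show ?case by (simp add: algebra_simps add_divide_distrib)
qed simp

lemma flat_exp_right_limit: "(flat_exp P \<longlongrightarrow> 0) (at_right 0)"
proof -
  have "((\<lambda>s. poly P (inverse s) / exp (inverse s)) \<longlongrightarrow> 0) (at_right 0)"
    using filterlim_compose[OF poly_over_exp_tendsto[of 0 P] filterlim_inverse_at_top_right] by simp
  then show ?thesis
    by (rule filterlim_cong[THEN iffD1, OF refl refl, rotated])
      (auto simp: flat_exp_def inverse_eq_divide eventually_at_right_less intro: eventually_mono[OF eventually_at_right_less])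
qed

lemma flat_exp_deriv:
  "(flat_exp P has_real_derivative flat_exp ([:0, 0, 1:] * (P - pderiv P)) s) (at s)"
proof -
  consider "s > 0" | "s < 0" | "s = 0" by linarith
  then show ?thesis
  proof cases
    case 1
    let ?D = "((poly (pderiv P) (1/s) * (- 1 / s\<^sup>2)) * exp (1/s) - poly P (1/s) * (exp (1/s) * (- 1 / s\<^sup>2))) / (exp (1/s) * exp (1/s))"
    have "((\<lambda>s. poly P (1 / s) / exp (1 / s)) has_real_derivative ?D) (at s)"
      using 1 by (auto intro!: derivative_eq_intros poly_DERIV[THEN DERIV_chain2] simp: power2_eq_square)
    moreover have "?D = flat_exp ([:0, 0, 1:] * (P - pderiv P)) s"
      using 1 by (simp add: flat_exp_def field_simps power2_eq_square)
    ultimately have "((\<lambda>s. poly P (1 / s) / exp (1 / s)) has_real_derivative flat_exp ([:0, 0, 1:] * (P - pderiv P)) s) (at s)"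
      by (simp only:)
    then show ?thesis
      by (rule has_field_derivative_transform_within_open[of _ _ _ "{0<..}"]) (use 1 in \<open>auto simp: flat_exp_def\<close>)
  next
    case 2
    have "((\<lambda>s. 0) has_real_derivative flat_exp ([:0, 0, 1:] * (P - pderiv P)) s) (at s)"
      using 2 by (simp add: flat_exp_def)
    then show ?thesis
      by (rule has_field_derivative_transform_within_open[of _ _ _ "{..<0}"]) (use 2 in \<open>auto simp: flat_exp_def\<close>)
  next
    case 3
    \<comment> \<open>For h > 0 this quotient is \<open>flat_exp ([:0,1:] * P) h\<close>, the factor
      1/h having been absorbed into the polynomial, so it tends to 0 like every member of the
      family.\<close>
    have "((\<lambda>h. (flat_exp P (0 + h) - flat_exp P 0) / h) \<longlongrightarrow> 0) (at_right 0)"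
      by (rule filterlim_cong[THEN iffD1, OF refl refl _ flat_exp_right_limit[of "[:0,1:] * P"]])
        (auto simp: flat_exp_def intro: eventually_mono[OF eventually_at_right_less])
    moreover have "((\<lambda>h. (flat_exp P (0 + h) - flat_exp P 0) / h) \<longlongrightarrow> 0) (at_left 0)"
      by (rule filterlim_cong[THEN iffD1, OF refl refl _ tendsto_const[of 0]])
        (auto simp: flat_exp_def eventually_at_filter)
    ultimately show ?thesis using 3
      by (auto simp: DERIV_def flat_exp_def filterlim_split_at)
  qed
qed

lemma times_differentiable_on_flat_exp:
  fixes q :: "'a::real_normed_vector \<Rightarrow> real"
  assumes q: "smooth_on UNIV q"
  shows "times_differentiable_on n UNIV (\<lambda>x. flat_exp P (q x))"
proof (induction n arbitrary: P)
  case 0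
  have "continuous_on UNIV (flat_exp P)"
    using flat_exp_deriv DERIV_isCont continuous_at_imp_continuous_on by blast
  then show ?case
    using continuous_on_compose2[OF _ smooth_on_imp_continuous[OF q]] by auto
next
  case (Suc n)
  let ?P = "[:0, 0, 1:] * (P - pderiv P)"
  have d: "((\<lambda>x. flat_exp P (q x)) has_derivative (\<lambda>v. flat_exp ?P (q x) * dir_deriv v q x)) (at x)" for x
    using has_derivative_compose[OF smooth_on_has_derivative[OF q UNIV_I] flat_exp_deriv[unfolded has_field_derivative_def]] .
  have "dir_deriv v (\<lambda>x. flat_exp P (q x)) = (\<lambda>x. flat_exp ?P (q x) * dir_deriv v q x)" for v
    by (intro ext dir_derivI d)
  moreover have "times_differentiable_on n UNIV (\<lambda>x. flat_exp ?P (q x) * dir_deriv v q x)" for v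
    using smooth_on_dir_deriv[OF q] unfolding smooth_on_def
    by (intro times_differentiable_on_mult Suc.IH) auto
  ultimately show ?case using d unfolding times_differentiable_on_Suc' differentiable_def by (auto simp del: mult_pCons_left)
qed

lemma test_functionI:
  assumes "smooth_on UNIV \<phi>" "compact K" "K \<subseteq> S" "\<And>x. x \<notin> K \<Longrightarrow> \<phi> x = 0"
  shows "test_function S \<phi>"
proof -
  have "closure (support_on UNIV \<phi>) \<subseteq> K"
    using assms(2,4) by (intro closure_minimal subsetI) (metis in_support_on, simp add: compact_imp_closed)
  then have "compact (closure (support_on UNIV \<phi>))" "closure (support_on UNIV \<phi>) \<subseteq> S"
    using compact_Int_closed[OF assms(2) closed_closure, of "support_on UNIV \<phi>"] assms(3)
    by (auto simp: Int_absorb1)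
  then show ?thesis using assms(1) by (simp add: test_function_def)
qed

lemma test_functionD:
  assumes "test_function S \<phi>"
  obtains K where "smooth_on UNIV \<phi>" "compact K" "K \<subseteq> S" "\<And>x. x \<notin> K \<Longrightarrow> \<phi> x = 0"
proof
  show "smooth_on UNIV \<phi>" "compact (closure (support_on UNIV \<phi>))" "closure (support_on UNIV \<phi>) \<subseteq> S"
    using assms by (auto simp: test_function_def)
  show "\<phi> x = 0" if "x \<notin> closure (support_on UNIV \<phi>)" for x
    by (metis UNIV_I closure_subset in_support_on subsetD that)
qed

lemma exists_bump:
  fixes z :: "'a::euclidean_space"
  assumes r: "r > 0" "cball z r \<subseteq> S"
  obtains \<phi> where "test_function S \<phi>" "\<And>x. 0 \<le> \<phi> x" "\<phi> z > 0" "\<And>x. x \<notin> cball z r \<Longrightarrow> \<phi> x = 0"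
proof
  \<comment> \<open>The square of the norm is expanded in coordinates because smoothness is
    available for sums and products of linear functions; \<open>q\<close> is positive exactly inside
    the ball.\<close>
  define q where "q x = r\<^sup>2 - (\<Sum>b\<in>Basis. ((x - z) \<bullet> b) * ((x - z) \<bullet> b))" for x
  have q_eq: "q x = r\<^sup>2 - (dist z x)\<^sup>2" for x
    using euclidean_inner[of "x - z" "x - z"]
    by (simp add: q_def dist_norm norm_minus_commute[of z] power2_norm_eq_inner)
  have q: "smooth_on UNIV q" unfolding q_def
    by (intro smooth_on_diff smooth_on_sum smooth_on_mult smooth_on_const smooth_on_linear[OF bounded_linear_inner_left]
        smooth_on_id) auto
  let ?\<phi> = "\<lambda>x. flat_exp 1 (q x)"
  show "0 \<le> ?\<phi> x" for x by (simp add: flat_exp_def)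
  show "?\<phi> z > 0" using r by (simp add: flat_exp_def q_eq)
  show z: "?\<phi> x = 0" if "x \<notin> cball z r" for x
    using that r by (auto simp: flat_exp_def q_eq power_mono_iff not_less not_le intro!: power_mono)
  show "test_function S ?\<phi>"
    by (rule test_functionI[OF _ compact_cball r(2) z])
      (simp add: smooth_on_def times_differentiable_on_flat_exp[OF q])
qed

subsection \<open>Integrals of compactly supported functions\<close>

text \<open>The weak equations speak of Lebesgue integrals, while differentiation under the integral
  and affine substitution are done with gauge integrals over boxes. For continuous functions of
  compact support all of them agree, which allows passing back and forth.\<close>

lemma compact_support_integral:
  fixes f :: "'a::euclidean_space \<Rightarrow> real"
  assumes c: "continuous_on UNIV f" and K: "K \<subseteq> cbox a b" "\<And>x. x \<notin> K \<Longrightarrow> f x = 0"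
  shows "integrable lborel f" "integrable lebesgue f" "integral\<^sup>L lborel f = integral (cbox a b) f"
    "integral\<^sup>L lebesgue f = integral (cbox a b) f" "(f has_integral integral (cbox a b) f) UNIV"
proof -
  have bm: "f \<in> borel_measurable borel" using c by (rule borel_measurable_continuous_onI)
  have f: "(\<lambda>x. indicator (cbox a b) x *\<^sub>R f x) = f"
    using K by (auto simp: fun_eq_iff indicator_def)
  have "integrable lborel (\<lambda>x. indicator (cbox a b) x *\<^sub>R f x)"
    using borel_integrable_compact[OF compact_cbox continuous_on_subset[OF c subset_UNIV], of a b]
    by (metis (no_types, lifting) ext indicator_times_eq_if(1) real_scaleR_def scaleR_zero_left scaleR_one indicator_simps)
  then show i: "integrable lborel f" unfolding f .
  then show "integrable lebesgue f" by (simp add: integrable_completion bm)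
  have h: "(f has_integral integral\<^sup>L lborel f) UNIV" by (rule has_integral_integral_lborel[OF i])
  have "(f has_integral integral\<^sup>L lborel f) (cbox a b)"
  proof -
    have "(\<lambda>x. if x \<in> cbox a b then f x else 0) = f" using K by (auto simp: fun_eq_iff)
    then show ?thesis using h has_integral_restrict_UNIV[of "cbox a b" f] by simp
  qed
  then show e: "integral\<^sup>L lborel f = integral (cbox a b) f" by (simp add: integral_unique)
  then show "integral\<^sup>L lebesgue f = integral (cbox a b) f" by (simp add: integral_completion bm)
  show "(f has_integral integral (cbox a b) f) UNIV" using h e by simp
qed

lemma lebesgue_on_support:
  fixes f :: "'a::euclidean_space \<Rightarrow> real"
  assumes "S \<in> sets lebesgue" "\<And>x. x \<notin> S \<Longrightarrow> f x = 0"
  shows "integral\<^sup>L (lebesgue_on S) f = integral\<^sup>L lebesgue f"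
    "integrable (lebesgue_on S) f \<longleftrightarrow> integrable lebesgue f"
proof -
  have f: "(\<lambda>x. indicator S x *\<^sub>R f x) = f"
    using assms(2) by (auto simp: fun_eq_iff indicator_def)
  show "integral\<^sup>L (lebesgue_on S) f = integral\<^sup>L lebesgue f"
    "integrable (lebesgue_on S) f \<longleftrightarrow> integrable lebesgue f"
    using assms(1) by (simp_all add: integral_restrict_space integrable_restrict_space f del: real_scaleR_def)
qed

lemma compact_support_on:
  fixes f :: "'a::euclidean_space \<Rightarrow> real"
  assumes c: "continuous_on UNIV f" and K: "compact K" "K \<subseteq> S" "\<And>x. x \<notin> K \<Longrightarrow> f x = 0" and S: "S \<in> sets lebesgue"
  shows "integrable (lebesgue_on S) f" "integral\<^sup>L (lebesgue_on S) f = integral\<^sup>L lborel f"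
proof -
  obtain a where a: "K \<subseteq> cbox (- a) a" using bounded_subset_cbox_symmetric compact_imp_bounded[OF K(1)] by metis
  note i = compact_support_integral[OF c a K(3)]
  have z: "f x = 0" if "x \<notin> S" for x using that K by blast
  show "integrable (lebesgue_on S) f" "integral\<^sup>L (lebesgue_on S) f = integral\<^sup>L lborel f"
    using lebesgue_on_support[of S f, OF S z] i by auto
qed

text \<open>Translation invariance: the integral of \<open>g (y + s *\<^sub>R v)\<close> does not
  depend on \<open>s\<close>, and its derivative at s = 0 is the integral of the directional
  derivative.\<close>

lemma integral_dir_deriv_eq_0:
  fixes g :: "'a::euclidean_space \<Rightarrow> real"
  assumes d: "\<And>x. g differentiable (at x)" and c: "continuous_on UNIV (dir_deriv v g)"
    and K: "compact K" "\<And>x. x \<notin> K \<Longrightarrow> g x = 0"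
  shows "integral\<^sup>L lborel (dir_deriv v g) = 0" "\<And>x. x \<notin> K \<Longrightarrow> dir_deriv v g x = 0"
proof -
  have cg: "continuous_on UNIV g" using d differentiable_imp_continuous_within continuous_at_imp_continuous_on by blast
  show z: "dir_deriv v g x = 0" if "x \<notin> K" for x
  proof -
    have "dir_deriv v g x = dir_deriv v (\<lambda>x. 0) x"
      by (rule dir_deriv_cong_open[of "- K"]) (use K that in \<open>auto simp: open_Compl compact_imp_closed\<close>)
    then show ?thesis using dir_derivI[OF has_derivative_const[of 0]] by metis
  qed
  \<comment> \<open>This set contains the supports of all translates with parameter in [-1, 1], so
    one box serves for every \<open>s\<close> near 0.\<close>
  let ?K = "(\<lambda>(s, y). y - s *\<^sub>R v) ` ({-1..1} \<times> K)"
  have "compact ?K" using K(1)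
    by (intro compact_continuous_image compact_Times continuous_intros) (auto simp: split_beta intro!: continuous_intros)
  then obtain a where a: "?K \<subseteq> cbox (- a) a" using bounded_subset_cbox_symmetric compact_imp_bounded by metis
  have Ka: "K \<subseteq> cbox (- a) a"
  proof
    fix y assume "y \<in> K"
    then have "(\<lambda>(s, y). y - s *\<^sub>R v) (0, y) \<in> ?K" by (intro imageI) auto
    then show "y \<in> cbox (- a) a" using a by auto
  qed
  define F where "F s = integral (cbox (- a) a) (\<lambda>y. g (y + s *\<^sub>R v))" for s :: real
  have F: "F s = integral\<^sup>L lborel g" if "s \<in> {-1<..<1}" for s
  proof -
    have "g (y + s *\<^sub>R v) = 0" if "y \<notin> ?K" for y
    proof (rule K(2), rule notI)
      assume "y + s *\<^sub>R v \<in> K"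
      then have "(\<lambda>(s, y). y - s *\<^sub>R v) (s, y + s *\<^sub>R v) \<in> ?K" using \<open>s \<in> {-1<..<1}\<close> by (intro imageI) auto
      then show False using that by simp
    qed
    then have "integral\<^sup>L lborel (\<lambda>y. g (y + s *\<^sub>R v)) = F s" unfolding F_def
      by (intro compact_support_integral(3)[OF _ a] continuous_on_compose2[OF cg] continuous_intros) auto
    moreover have "integral\<^sup>L lborel (\<lambda>y. g (s *\<^sub>R v + y)) = integral\<^sup>L lborel g"
      using integral_distr[of "(+) (s *\<^sub>R v)" lborel borel g] lborel_distr_plus[of "s *\<^sub>R v"]
        borel_measurable_continuous_onI[OF cg] by simp
    ultimately show ?thesis by (simp add: add.commute)
  qed
  have "((\<lambda>s. integral (cbox (- a) a) (\<lambda>y. g (y + s *\<^sub>R v))) has_field_derivative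
      integral (cbox (- a) a) (\<lambda>y. dir_deriv v g (y + 0 *\<^sub>R v))) (at 0 within {-1<..<1})"
  proof (rule leibniz_rule_field_derivative)
    show "((\<lambda>s. g (t + s *\<^sub>R v)) has_field_derivative dir_deriv v g (t + s *\<^sub>R v)) (at s within {-1<..<1})" for s t
      by (rule has_field_derivative_at_within[OF DERIV_along_line_real[OF d]])
    show "(\<lambda>y. g (y + s *\<^sub>R v)) integrable_on cbox (- a) a" for s
      by (intro integrable_continuous continuous_on_compose2[OF cg] continuous_intros) auto
    show "continuous_on ({-1<..<1} \<times> cbox (- a) a) (\<lambda>(s, t). dir_deriv v g (t + s *\<^sub>R v))"
      unfolding split_beta by (intro continuous_on_compose2[OF c] continuous_intros) auto
  qed auto
  then have "(F has_field_derivative integral (cbox (- a) a) (dir_deriv v g)) (at 0)"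
    unfolding F_def[symmetric] by (simp add: at_within_open[of 0 "{-1<..<1}"])
  moreover have "(F has_field_derivative 0) (at 0)"
    by (rule has_field_derivative_transform_within_open[of "\<lambda>_. integral\<^sup>L lborel g" _ _ "{-1<..<1}"]) (auto simp: F)
  ultimately have "integral (cbox (- a) a) (dir_deriv v g) = 0" using DERIV_unique by blast
  then show "integral\<^sup>L lborel (dir_deriv v g) = 0"
    using compact_support_integral(3)[OF c Ka z] by simp
qed

lemma continuous_on_mult_support:
  fixes f \<phi> :: "'a::euclidean_space \<Rightarrow> real"
  assumes "open S" "continuous_on S f" "continuous_on UNIV \<phi>" "compact K" "K \<subseteq> S" "\<And>x. x \<notin> K \<Longrightarrow> \<phi> x = 0"
  shows "continuous_on UNIV (\<lambda>x. f x * \<phi> x)"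
proof -
  have "continuous_on S (\<lambda>x. f x * \<phi> x)"
    using assms(2,3) by (intro continuous_on_mult) (auto intro: continuous_on_subset)
  moreover have "continuous_on (- K) (\<lambda>x. f x * \<phi> x) \<longleftrightarrow> continuous_on (- K) (\<lambda>x. 0::real)"
    using assms(6) by (intro continuous_on_cong) auto
  ultimately have "continuous_on (S \<union> - K) (\<lambda>x. f x * \<phi> x)"
    using assms by (intro continuous_on_open_Un) (auto simp: open_Compl compact_imp_closed)
  moreover have "S \<union> - K = UNIV" using assms(5) by auto
  ultimately show ?thesis by simp
qed

text \<open>Nothing is known about \<open>f\<close> outside \<open>S\<close>. The product is smooth
  on \<open>S\<close> and zero on the complement of the support of \<phi>; these are two open sets
  that cover the space. Later this makes a velocity component times \<phi> admissible in the weak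
  formulation.\<close>

lemma test_function_mult:
  assumes "open S" "smooth_on S f" "test_function S \<phi>"
  shows "test_function S (\<lambda>x. f x * \<phi> x)"
proof -
  obtain K where K: "smooth_on UNIV \<phi>" "compact K" "K \<subseteq> S" "\<And>x. x \<notin> K \<Longrightarrow> \<phi> x = 0"
    using test_functionD[OF assms(3)] by metis
  have oK: "open (- K)" using K by (simp add: open_Compl compact_imp_closed)
  have "smooth_on S (\<lambda>x. f x * \<phi> x)"
    using assms smooth_on_subset[OF K(1)] by (intro smooth_on_mult) auto
  moreover have "smooth_on (- K) (\<lambda>x. f x * \<phi> x) \<longleftrightarrow> smooth_on (- K) (\<lambda>x. 0::real)"
    using K by (intro smooth_on_cong oK) auto
  then have "smooth_on (- K) (\<lambda>x. f x * \<phi> x)" using smooth_on_const[OF oK] by blast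
  ultimately have "smooth_on (S \<union> - K) (\<lambda>x. f x * \<phi> x)"
    using assms(1) oK by (intro smooth_on_Un) auto
  moreover have "S \<union> - K = UNIV" using K(3) by auto
  ultimately show ?thesis using K by (intro test_functionI[of _ K]) auto
qed

lemma test_function_dir_deriv:
  assumes "test_function S \<phi>" shows "test_function S (dir_deriv v \<phi>)"
proof -
  obtain K where K: "smooth_on UNIV \<phi>" "compact K" "K \<subseteq> S" "\<And>x. x \<notin> K \<Longrightarrow> \<phi> x = 0"
    using test_functionD[OF assms(1)] by metis
  have "dir_deriv v \<phi> x = 0" if "x \<notin> K" for x
  proof -
    have "dir_deriv v \<phi> x = dir_deriv v (\<lambda>x. 0) x"
      by (rule dir_deriv_cong_open[of "- K"]) (use K that in \<open>auto simp: open_Compl compact_imp_closed\<close>)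
    then show ?thesis using dir_derivI[OF has_derivative_const[of 0]] by metis
  qed
  then show ?thesis using K by (intro test_functionI[of _ K]) (auto intro: smooth_on_dir_deriv)
qed

lemma integrable_mult_test:
  fixes f :: "'a::euclidean_space \<Rightarrow> real"
  assumes "open S" "continuous_on S f" "test_function S \<phi>"
  shows "integrable (lebesgue_on S) (\<lambda>x. f x * \<phi> x)"
proof -
  obtain K where K: "smooth_on UNIV \<phi>" "compact K" "K \<subseteq> S" "\<And>x. x \<notin> K \<Longrightarrow> \<phi> x = 0"
    using test_functionD[OF assms(3)] by metis
  have "continuous_on UNIV (\<lambda>x. f x * \<phi> x)"
    by (rule continuous_on_mult_support[OF assms(1,2) smooth_on_imp_continuous[OF K(1)] K(2-4)])
  then show ?thesis
    by (rule compact_support_on[OF _ K(2,3)]) (use K assms(1) in auto)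
qed

lemma integral_by_parts_test:
  fixes f :: "'a::euclidean_space \<Rightarrow> real"
  assumes S: "open S" and f: "smooth_on S f" and \<phi>: "test_function S \<phi>"
  shows "(LINT x|lebesgue_on S. f x * dir_deriv v \<phi> x) = - (LINT x|lebesgue_on S. dir_deriv v f x * \<phi> x)"
proof -
  obtain K where K: "smooth_on UNIV (\<lambda>x. f x * \<phi> x)" "compact K" "K \<subseteq> S" "\<And>x. x \<notin> K \<Longrightarrow> f x * \<phi> x = 0"
    using test_functionD[OF test_function_mult[OF S f \<phi>]] by metis
  have s: "smooth_on UNIV \<phi>" using \<phi> by (simp add: test_function_def)
  note sm = smooth_on_imp_continuous[OF smooth_on_dir_deriv[OF K(1)]]
  note i = integral_dir_deriv_eq_0[OF smooth_on_imp_differentiable[OF K(1) UNIV_I] sm K(2,4)]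
  have mS: "S \<in> sets lebesgue" using S by auto
  have "(LINT x|lebesgue_on S. dir_deriv v (\<lambda>x. f x * \<phi> x) x) = integral\<^sup>L lborel (dir_deriv v (\<lambda>x. f x * \<phi> x))"
    by (rule compact_support_on(2)[OF sm K(2,3) i(2) mS])
  also have "\<dots> = 0" by (rule i(1))
  finally have "(LINT x|lebesgue_on S. dir_deriv v (\<lambda>x. f x * \<phi> x) x) = 0" .
  moreover have "(LINT x|lebesgue_on S. dir_deriv v (\<lambda>x. f x * \<phi> x) x)
      = (LINT x|lebesgue_on S. dir_deriv v f x * \<phi> x + f x * dir_deriv v \<phi> x)"
    by (intro Bochner_Integration.integral_cong refl dir_deriv_mult smooth_on_imp_differentiable[OF f] smooth_on_imp_differentiable[OF s]) auto
  moreover have "\<dots> = (LINT x|lebesgue_on S. dir_deriv v f x * \<phi> x) + (LINT x|lebesgue_on S. f x * dir_deriv v \<phi> x)"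
    by (intro Bochner_Integration.integral_add integrable_mult_test[OF S] \<phi> test_function_dir_deriv
        smooth_on_imp_continuous smooth_on_dir_deriv f)
  ultimately show ?thesis by simp
qed

text \<open>The fundamental lemma of the calculus of variations. If \<open>f z\<close> were
  positive, a bump supported where \<open>f\<close> is positive would give a continuous nonnegative
  product with integral 0 that is positive at \<open>z\<close>.\<close>

lemma continuous_eq_0_if_test_integrals_0:
  fixes f :: "'a::euclidean_space \<Rightarrow> real"
  assumes S: "open S" and f: "continuous_on S f"
    and 0: "\<And>\<phi>. test_function S \<phi> \<Longrightarrow> (LINT x|lebesgue_on S. f x * \<phi> x) = 0" and z: "z \<in> S"
  shows "f z = 0"
proof -
  have pos: False if f: "continuous_on S f" and 0: "\<And>\<phi>. test_function S \<phi> \<Longrightarrow> (LINT x|lebesgue_on S. f x * \<phi> x) = 0" and fz: "f z > 0"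
    for f :: "'a \<Rightarrow> real"
  proof -
    have "open {x \<in> S. f x > 0}" using continuous_open_preimage[OF f S, of "{0<..}"]
      by (simp add: vimage_def Int_def conj_commute)
    then obtain r where r: "r > 0" "cball z r \<subseteq> {x \<in> S. f x > 0}"
      using open_contains_cball_eq z fz by blast
    then have rS: "cball z r \<subseteq> S" by auto
    obtain \<phi> where \<phi>: "test_function S \<phi>" "\<And>x. 0 \<le> \<phi> x" "\<phi> z > 0" "\<And>x. x \<notin> cball z r \<Longrightarrow> \<phi> x = 0"
      using exists_bump[OF r(1) rS] by metis
    let ?g = "\<lambda>x. f x * \<phi> x"
    have s\<phi>: "continuous_on UNIV \<phi>" using \<phi>(1) by (simp add: test_function_def smooth_on_imp_continuous)
    have cg: "continuous_on UNIV ?g"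
      by (rule continuous_on_mult_support[OF S f s\<phi> compact_cball rS \<phi>(4)])
    have g0: "?g x = 0" if "x \<notin> cball z r" for x using \<phi>(4)[OF that] by simp
    obtain a where a: "cball z r \<subseteq> cbox (- a) a" using bounded_subset_cbox_symmetric bounded_cball by metis
    have "integral\<^sup>L lborel ?g = 0"
      using compact_support_on(2)[OF cg compact_cball rS g0] 0[OF \<phi>(1)] S by simp
    then have "(?g has_integral 0) (cbox (- a) a)"
      using compact_support_integral(3)[OF cg a g0] integrable_integral[OF integrable_continuous[OF continuous_on_subset[OF cg subset_UNIV]], of "-a" a]
      by simp
    moreover have "0 \<le> ?g x" for x using r \<phi>(2)[of x] \<phi>(4)[of x] by (cases "x \<in> cball z r") (auto simp: less_imp_le subset_iff)
    moreover have zin: "z \<in> cball z r" using r by simp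
    moreover have "box (- a) a \<noteq> {}"
    proof -
      have "z \<in> interior (cball z r)" using r by simp
      then have "z \<in> interior (cbox (- a) a)" using interior_mono[OF a] by blast
      then show ?thesis by (auto simp: interior_cbox)
    qed
    ultimately have "?g z = 0"
      using has_integral_0_cbox_imp_0[of "-a" a ?g z] continuous_on_subset[OF cg subset_UNIV] a by blast
    then show False using fz \<phi>(3) by simp
  qed
  show ?thesis
  proof (rule ccontr)
    assume "f z \<noteq> 0"
    then consider "f z > 0" | "- f z > 0" by linarith
    then show False
    proof cases
      case 1 then show False using pos f 0 by blast
    next
      case 2
      show False
        by (rule pos[of "\<lambda>x. - f x"]) (use 2 0 f in \<open>auto intro: continuous_on_minus\<close>)
    qed
  qed
qed

subsection \<open>Elementary one-dimensional estimates\<close>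

text \<open>The derivative equals a difference quotient at some intermediate point and varies by at
  most \<open>B * h\<close> on the interval. The length \<open>h\<close> stays free, so that each
  application can balance the two terms.\<close>

lemma derivative_interpolation:
  fixes f :: "real \<Rightarrow> real"
  assumes h: "h > 0"
    and f: "\<And>s. 0 \<le> s \<Longrightarrow> s \<le> h \<Longrightarrow> (f has_real_derivative f' s) (at s)"
    and f': "\<And>s. 0 \<le> s \<Longrightarrow> s \<le> h \<Longrightarrow> (f' has_real_derivative f'' s) (at s)"
    and A: "\<bar>f 0\<bar> \<le> A" "\<bar>f h\<bar> \<le> A" and B: "\<And>s. 0 \<le> s \<Longrightarrow> s \<le> h \<Longrightarrow> \<bar>f'' s\<bar> \<le> B"
  shows "\<bar>f' 0\<bar> \<le> 2 * A / h + B * h"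
proof -
  obtain s where s: "0 < s" "s < h" "f h - f 0 = (h - 0) * f' s"
    using MVT2[OF h, of f f', OF f] by blast
  obtain t where t: "0 < t" "t < s" "f' s - f' 0 = (s - 0) * f'' t"
    using MVT2[OF s(1), of f' f'', OF f'] s by force
  have "f' s = (f h - f 0) / h" using s h by (simp add: field_simps)
  then have "\<bar>f' s\<bar> \<le> 2 * A / h" using A h by (simp add: abs_divide divide_right_mono)
  moreover have "\<bar>s * f'' t\<bar> \<le> h * B"
    unfolding abs_mult using s t B[of t] by (intro mult_mono) auto
  ultimately show ?thesis using t(3) by (simp add: mult.commute abs_le_iff)
qed

text \<open>Since \<open>f 0 = 0\<close>, both quotients are values of f' by the mean value theorem,
  and f' varies by at most \<open>B * R\<close>. This is the device that transports a bound on f / r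
  from one distance \<open>R\<close> to all smaller distances.\<close>

lemma quotient_oscillation:
  fixes f :: "real \<Rightarrow> real"
  assumes r: "0 < r" "r \<le> R" and f0: "f 0 = 0"
    and f: "\<And>s. 0 \<le> s \<Longrightarrow> s \<le> R \<Longrightarrow> (f has_real_derivative f' s) (at s)"
    and f': "\<And>s. 0 \<le> s \<Longrightarrow> s \<le> R \<Longrightarrow> (f' has_real_derivative f'' s) (at s)"
    and B: "\<And>s. 0 \<le> s \<Longrightarrow> s \<le> R \<Longrightarrow> \<bar>f'' s\<bar> \<le> B"
  shows "\<bar>f r / r - f R / R\<bar> \<le> B * R"
proof -
  have quot: "\<exists>s. 0 < s \<and> s < q \<and> f q / q = f' s" if q: "0 < q" "q \<le> R" for q
  proof -
    obtain s where s: "0 < s" "s < q" "f q - f 0 = (q - 0) * f' s"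
      using MVT2[OF q(1), of f f', OF f] q by force
    then show ?thesis using q f0 by (auto simp: field_simps)
  qed
  obtain s where s: "0 < s" "s < r" "f r / r = f' s" using quot r by blast
  obtain t where t: "0 < t" "t < R" "f R / R = f' t" using quot[of R] r by auto
  have "norm (f' s - f' t) \<le> B * norm (s - t)"
    by (rule field_differentiable_bound[of "{0..R}" f' f''])
      (use B s t r in \<open>auto intro: has_field_derivative_at_within[OF f']\<close>)
  moreover have "B * norm (s - t) \<le> B * R"
    using B[of 0] r s t by (intro mult_left_mono) auto
  ultimately show ?thesis using s t by simp
qed

text \<open>Only the derivative of g' at 0 is required: if it were positive, g' would be positive
  just to the right of its zero and \<open>g\<close> would rise above its maximum.\<close>

lemma second_derivative_test:
  fixes g :: "real \<Rightarrow> real"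
  assumes d: "\<delta> > 0" and g: "\<And>h. \<bar>h\<bar> < \<delta> \<Longrightarrow> (g has_real_derivative g' h) (at h)"
    and g': "(g' has_real_derivative D) (at 0)" and max: "\<And>h. \<bar>h\<bar> < \<delta> \<Longrightarrow> g h \<le> g 0"
  shows "g' 0 = 0" "D \<le> 0"
proof -
  show 0: "g' 0 = 0"
    by (rule DERIV_local_max[OF g d]) (use d max in auto)
  show "D \<le> 0"
  proof (rule ccontr)
    assume "\<not> D \<le> 0"
    then obtain e where e: "e > 0" "\<And>h. h > 0 \<Longrightarrow> h < e \<Longrightarrow> g' 0 < g' (0 + h)"
      using DERIV_pos_inc_right[OF g'] by auto
    define h where "h = min e \<delta> / 2"
    have h: "0 < h" "h < e" "h < \<delta>" using e d by (auto simp: h_def)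
    obtain s where s: "0 < s" "s < h" "g h - g 0 = (h - 0) * g' s"
      using MVT2[OF h(1), of g g', OF g] h by force
    have "g' s > 0" using e(2)[of s] s h 0 by simp
    then have "h * g' s > 0" using h(1) by simp
    then have "g h > g 0" using s(3) by simp
    then show False using max[of h] h by simp
  qed
qed

text \<open>First and second order conditions along one coordinate at a maximum of cutoff^2 times
  \<open>f\<close> times weight. \<open>A\<close> collects what the cutoff contains besides -y^2,
  and \<open>q\<close> is the square of the other horizontal coordinate, so that y^2 + q is r^2.
  Taking the logarithm makes the three factors additive.\<close>

lemma weighted_coordinate_test:
  fixes f f' :: "real \<Rightarrow> real"
  assumes d: "\<delta> > 0" and f: "\<And>h. \<bar>h\<bar> < \<delta> \<Longrightarrow> (f has_real_derivative f' h) (at h)"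
    and f': "(f' has_real_derivative f'') (at 0)" and f0: "f 0 > 0" and A: "A - y\<^sup>2 > 0" and q: "y\<^sup>2 + q > 0"
    and max: "\<And>h. \<bar>h\<bar> < \<delta> \<Longrightarrow> (A - (y + h)\<^sup>2)\<^sup>2 * f h * ((y + h)\<^sup>2 + q) powr (- a / 2)
       \<le> (A - y\<^sup>2)\<^sup>2 * f 0 * (y\<^sup>2 + q) powr (- a / 2)"
  shows "f' 0 / f 0 = 4 * y / (A - y\<^sup>2) + a * y / (y\<^sup>2 + q)"
    "f'' / f 0 \<le> (f' 0 / f 0)\<^sup>2 + 4 / (A - y\<^sup>2) + 8 * y\<^sup>2 / (A - y\<^sup>2)\<^sup>2 + a * (q - y\<^sup>2) / (y\<^sup>2 + q)\<^sup>2"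
proof -
  have "isCont f 0" using f[of 0] d by (intro DERIV_isCont) auto
  then have lf: "(f \<longlongrightarrow> f 0) (at 0)" by (simp add: isCont_def)
  have "((\<lambda>h. A - (y + h)\<^sup>2) \<longlongrightarrow> A - (y + 0)\<^sup>2) (at 0)" by (intro tendsto_intros)
  then have "\<forall>\<^sub>F h in at 0. A - (y + h)\<^sup>2 > 0" by (rule order_tendstoD(1)) (use A in simp)
  moreover have "((\<lambda>h. (y + h)\<^sup>2 + q) \<longlongrightarrow> (y + 0)\<^sup>2 + q) (at 0)" by (intro tendsto_intros)
  then have "\<forall>\<^sub>F h in at 0. (y + h)\<^sup>2 + q > 0" by (rule order_tendstoD(1)) (use q in simp)
  ultimately have "\<forall>\<^sub>F h in at 0. f h > 0 \<and> A - (y + h)\<^sup>2 > 0 \<and> (y + h)\<^sup>2 + q > 0"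
    using order_tendstoD(1)[OF lf f0] by (simp add: eventually_conj_iff)
  then obtain e where e: "e > 0" "\<And>h. h \<noteq> 0 \<Longrightarrow> \<bar>h\<bar> < e \<Longrightarrow> f h > 0 \<and> A - (y + h)\<^sup>2 > 0 \<and> (y + h)\<^sup>2 + q > 0"
    unfolding eventually_at dist_real_def by (metis UNIV_I diff_zero)
  define \<epsilon> where "\<epsilon> = min \<delta> e"
  have pos: "f h > 0" "A - (y + h)\<^sup>2 > 0" "(y + h)\<^sup>2 + q > 0" if "\<bar>h\<bar> < \<epsilon>" for h
  proof -
    show "f h > 0" "A - (y + h)\<^sup>2 > 0" "(y + h)\<^sup>2 + q > 0"
      using e(2)[of h] that f0 A q by (cases "h = 0", simp, simp add: \<epsilon>_def)+
  qed
  have \<epsilon>: "\<epsilon> > 0" using d e by (simp add: \<epsilon>_def)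
  define g where "g h = 2 * ln (A - (y + h)\<^sup>2) + ln (f h) - a / 2 * ln ((y + h)\<^sup>2 + q)" for h
  define g' where "g' h = - 4 * (y + h) / (A - (y + h)\<^sup>2) + f' h / f h - a * (y + h) / ((y + h)\<^sup>2 + q)" for h
  have eg: "exp (g h) = (A - (y + h)\<^sup>2)\<^sup>2 * f h * ((y + h)\<^sup>2 + q) powr (- a / 2)" if "\<bar>h\<bar> < \<epsilon>" for h
  proof -
    have "exp (g h) = exp (2 * ln (A - (y + h)\<^sup>2)) * exp (ln (f h)) * exp (- a / 2 * ln ((y + h)\<^sup>2 + q))"
      unfolding g_def by (simp only: exp_add[symmetric]) simp
    moreover have "exp (2 * ln (A - (y + h)\<^sup>2)) = (A - (y + h)\<^sup>2)\<^sup>2"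
      unfolding exp_double using pos(2)[OF that] by (simp only: exp_ln)
    moreover have "exp (ln (f h)) = f h" using pos(1)[OF that] by (simp only: exp_ln)
    moreover have "exp (- a / 2 * ln ((y + h)\<^sup>2 + q)) = ((y + h)\<^sup>2 + q) powr (- a / 2)"
      using pos(3)[OF that] by (simp only: powr_def) simp
    ultimately show ?thesis by simp
  qed
  have dg: "(g has_real_derivative g' h) (at h)" if "\<bar>h\<bar> < \<epsilon>" for h
  proof -
    have a1: "((\<lambda>h. A - (y + h)\<^sup>2) has_real_derivative - (2 * (y + h))) (at h)"
      by (auto intro!: derivative_eq_intros)
    have a2: "((\<lambda>h. (y + h)\<^sup>2 + q) has_real_derivative 2 * (y + h)) (at h)"
      by (auto intro!: derivative_eq_intros)
    have a3: "(f has_real_derivative f' h) (at h)" using f that by (simp add: \<epsilon>_def)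
    have D: "(g has_real_derivative 2 * (inverse (A - (y + h)\<^sup>2) * - (2 * (y + h))) + inverse (f h) * f' h
        - a / 2 * (inverse ((y + h)\<^sup>2 + q) * (2 * (y + h)))) (at h)"
      unfolding g_def
      by (intro DERIV_diff DERIV_add DERIV_cmult DERIV_chain2[OF DERIV_ln[OF pos(2)[OF that]] a1]
          DERIV_chain2[OF DERIV_ln[OF pos(1)[OF that]] a3] DERIV_chain2[OF DERIV_ln[OF pos(3)[OF that]] a2])
    have eq: "2 * (inverse P * - (2 * z)) + inverse F * G - a / 2 * (inverse W * (2 * z))
        = - 4 * z / P + G / F - a * z / W" for P z F G W :: real
      by (simp add: inverse_eq_divide)
    show ?thesis unfolding g'_def by (rule DERIV_cong[OF D eq])
  qed
  let ?D = "- 4 / (A - y\<^sup>2) - 8 * y\<^sup>2 / (A - y\<^sup>2)\<^sup>2 + (f'' / f 0 - (f' 0 / f 0)\<^sup>2) - a * (q - y\<^sup>2) / (y\<^sup>2 + q)\<^sup>2"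
  have df: "(f has_real_derivative f' 0) (at 0)" using f d by simp
  have d1: "((\<lambda>h. - 4 * (y + h) / (A - (y + h)\<^sup>2)) has_real_derivative - 4 / (A - y\<^sup>2) - 8 * y\<^sup>2 / (A - y\<^sup>2)\<^sup>2) (at 0)"
  proof -
    have n: "((\<lambda>h. - 4 * (y + h)) has_real_derivative - 4) (at 0)" by (auto intro!: derivative_eq_intros)
    have m: "((\<lambda>h. A - (y + h)\<^sup>2) has_real_derivative - (2 * y)) (at 0)" by (auto intro!: derivative_eq_intros)
    have A': "A - (y + 0)\<^sup>2 \<noteq> 0" using A by simp
    have e: "- 4 / (A - y\<^sup>2) - 8 * y\<^sup>2 / (A - y\<^sup>2)\<^sup>2
      = (- 4 * (A - (y + 0)\<^sup>2) - - 4 * (y + 0) * - (2 * y)) / ((A - (y + 0)\<^sup>2) * (A - (y + 0)\<^sup>2))"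
    proof -
      have "- 4 / P - 8 * y\<^sup>2 / P\<^sup>2 = (- 4 * P - - 4 * y * - (2 * y)) / (P * P)" if "P \<noteq> 0" for P
        using that by (simp add: diff_divide_distrib power2_eq_square)
      from this[of "A - y\<^sup>2"] show ?thesis using A by simp
    qed
    show ?thesis unfolding e by (rule DERIV_divide[OF n m A'])
  qed
  have d2: "((\<lambda>h. f' h / f h) has_real_derivative f'' / f 0 - (f' 0 / f 0)\<^sup>2) (at 0)"
  proof -
    have e: "f'' / f 0 - (f' 0 / f 0)\<^sup>2 = (f'' * f 0 - f' 0 * f' 0) / (f 0 * f 0)"
      using f0 by (simp add: diff_divide_distrib power2_eq_square)
    show ?thesis unfolding e by (rule DERIV_divide[OF f' df]) (use f0 in simp)
  qed
  have d3: "((\<lambda>h. a * (y + h) / ((y + h)\<^sup>2 + q)) has_real_derivative a * (q - y\<^sup>2) / (y\<^sup>2 + q)\<^sup>2) (at 0)"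
  proof -
    have n: "((\<lambda>h. a * (y + h)) has_real_derivative a) (at 0)" by (auto intro!: derivative_eq_intros)
    have m: "((\<lambda>h. (y + h)\<^sup>2 + q) has_real_derivative 2 * y) (at 0)" by (auto intro!: derivative_eq_intros)
    have q': "(y + 0)\<^sup>2 + q \<noteq> 0" using q by simp
    have "a * (q - y\<^sup>2) = a * ((y + 0)\<^sup>2 + q) - a * (y + 0) * (2 * y)"
      by (simp add: algebra_simps power2_eq_square)
    then have e: "a * (q - y\<^sup>2) / (y\<^sup>2 + q)\<^sup>2
      = (a * ((y + 0)\<^sup>2 + q) - a * (y + 0) * (2 * y)) / (((y + 0)\<^sup>2 + q) * ((y + 0)\<^sup>2 + q))"
      by (simp add: power2_eq_square)
    show ?thesis unfolding e by (rule DERIV_divide[OF n m q'])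
  qed
  have dg': "(g' has_real_derivative ?D) (at 0)"
    unfolding g'_def by (intro DERIV_diff DERIV_add d1 d2 d3)
  have mg: "g h \<le> g 0" if "\<bar>h\<bar> < \<epsilon>" for h
  proof -
    have "exp (g h) \<le> exp (g 0)" using max[of h] eg[OF that] eg[of 0] \<epsilon> that by (simp add: \<epsilon>_def)
    then show ?thesis by simp
  qed
  note T = second_derivative_test[OF \<epsilon> dg dg' mg]
  show "f' 0 / f 0 = 4 * y / (A - y\<^sup>2) + a * y / (y\<^sup>2 + q)" using T(1) by (simp add: g'_def)
  show "f'' / f 0 \<le> (f' 0 / f 0)\<^sup>2 + 4 / (A - y\<^sup>2) + 8 * y\<^sup>2 / (A - y\<^sup>2)\<^sup>2 + a * (q - y\<^sup>2) / (y\<^sup>2 + q)\<^sup>2"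
    using T(2) by simp
qed

subsection \<open>Composition with affine maps\<close>

lemma dir_deriv_affine:
  assumes "bounded_linear L" "f differentiable (at (L x + c))"
  shows "dir_deriv v (\<lambda>x. f (L x + c)) x = dir_deriv (L v) f (L x + c)"
    "(\<lambda>x. f (L x + c)) differentiable (at x)"
proof -
  have "((\<lambda>x. L x + c) has_derivative L) (at x)"
    using bounded_linear.has_derivative[OF assms(1) has_derivative_ident] has_derivative_add_const by blast
  from has_derivative_compose[OF this has_derivative_dir_deriv[OF assms(2)]]
  have d: "((\<lambda>x. f (L x + c)) has_derivative (\<lambda>v. dir_deriv (L v) f (L x + c))) (at x)" .
  then show "dir_deriv v (\<lambda>x. f (L x + c)) x = dir_deriv (L v) f (L x + c)" by (rule dir_derivI)
  show "(\<lambda>x. f (L x + c)) differentiable (at x)" using d differentiable_def by blast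
qed

lemma smooth_on_affine:
  assumes L: "bounded_linear L" and S: "open T" "\<And>x. x \<in> T \<Longrightarrow> L x + c \<in> S" and f: "smooth_on S f"
  shows "smooth_on T (\<lambda>x. f (L x + c))"
proof -
  have "times_differentiable_on n T (\<lambda>x. f (L x + c))" if "times_differentiable_on n S f" for n and f :: "'b \<Rightarrow> 'c"
    using that
  proof (induction n arbitrary: f)
    case 0
    have "continuous_on T L" using L by (simp add: linear_continuous_on)
    then show ?case using 0 S(2) by (auto intro!: continuous_on_compose2[of S f] continuous_intros)
  next
    case (Suc n)
    have df: "f differentiable (at (L x + c))" if "x \<in> T" for x
      using Suc.prems S(2)[OF that] unfolding times_differentiable_on_Suc' by blast
    have "times_differentiable_on n T (dir_deriv v (\<lambda>x. f (L x + c)))" for v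
    proof -
      have "times_differentiable_on n T (\<lambda>x. dir_deriv (L v) f (L x + c))"
        using Suc unfolding times_differentiable_on_Suc' by blast
      then show ?thesis
        by (subst times_differentiable_on_cong[OF S(1)]) (rule dir_deriv_affine[OF L df])
    qed
    then show ?case using dir_deriv_affine(2)[OF L df] unfolding times_differentiable_on_Suc' by blast
  qed
  then show ?thesis using f unfolding smooth_on_def by blast
qed

lemma interpolation_along_line:
  fixes g :: "'a::real_normed_vector \<Rightarrow> real"
  assumes g: "smooth_on S g" and h: "h > 0" and S: "\<And>s. 0 \<le> s \<Longrightarrow> s \<le> h \<Longrightarrow> a + s *\<^sub>R v \<in> S"
    and A: "\<bar>g a\<bar> \<le> A" "\<bar>g (a + h *\<^sub>R v)\<bar> \<le> A"
    and B: "\<And>s. 0 \<le> s \<Longrightarrow> s \<le> h \<Longrightarrow> \<bar>dir_deriv v (dir_deriv v g) (a + s *\<^sub>R v)\<bar> \<le> B"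
  shows "\<bar>dir_deriv v g a\<bar> \<le> 2 * A / h + B * h"
  using derivative_interpolation[OF h, of "\<lambda>s. g (a + s *\<^sub>R v)" "\<lambda>s. dir_deriv v g (a + s *\<^sub>R v)"
      "\<lambda>s. dir_deriv v (dir_deriv v g) (a + s *\<^sub>R v)" A B,
      OF DERIV_along_line_real[OF smooth_on_imp_differentiable[OF g S]]
        DERIV_along_line_real[OF smooth_on_imp_differentiable[OF smooth_on_dir_deriv[OF g] S]] _ _ B]
  using A by simp

lemma quotient_oscillation_along_line:
  fixes g :: "'a::real_normed_vector \<Rightarrow> real"
  assumes g: "smooth_on S g" and r: "0 < r" "r \<le> R" and S: "\<And>s. 0 \<le> s \<Longrightarrow> s \<le> R \<Longrightarrow> a + s *\<^sub>R v \<in> S"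
    and 0: "g a = 0"
    and B: "\<And>s. 0 \<le> s \<Longrightarrow> s \<le> R \<Longrightarrow> \<bar>dir_deriv v (dir_deriv v g) (a + s *\<^sub>R v)\<bar> \<le> B"
  shows "\<bar>g (a + r *\<^sub>R v) / r - g (a + R *\<^sub>R v) / R\<bar> \<le> B * R"
  using quotient_oscillation[OF r, of "\<lambda>s. g (a + s *\<^sub>R v)" "\<lambda>s. dir_deriv v g (a + s *\<^sub>R v)"
      "\<lambda>s. dir_deriv v (dir_deriv v g) (a + s *\<^sub>R v)" B,
      OF _ DERIV_along_line_real[OF smooth_on_imp_differentiable[OF g S]]
        DERIV_along_line_real[OF smooth_on_imp_differentiable[OF smooth_on_dir_deriv[OF g] S]] B]
  using 0 by simp

subsection \<open>A weighted maximum principle\<close>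

text \<open>The square of r is used throughout because it is a polynomial, hence smooth across the
  axis. A power r^a therefore appears as \<open>axis_dist2 x powr (a / 2)\<close>.\<close>

definition axis_dist2 :: "real^3 \<Rightarrow> real" where "axis_dist2 x = (x $ 1)\<^sup>2 + (x $ 2)\<^sup>2"

definition radial_part :: "real^3 \<Rightarrow> real^3 \<Rightarrow> real" where "radial_part x v = x $ 1 * v $ 1 + x $ 2 * v $ 2"

lemma axis_dist2_nonneg [simp]: "0 \<le> axis_dist2 x" by (simp add: axis_dist2_def)

lemma continuous_on_axis_dist2 [continuous_intros]:
  "continuous_on S f \<Longrightarrow> continuous_on S (\<lambda>x. axis_dist2 (f x))"
  unfolding axis_dist2_def by (intro continuous_intros)

lemma norm_sq_vec3: "(norm (x::real^3))\<^sup>2 = (x $ 1)\<^sup>2 + (x $ 2)\<^sup>2 + (x $ 3)\<^sup>2"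
  unfolding power2_norm_eq_inner inner_vec_def by (simp add: sum_3 power2_eq_square)

text \<open>The cutoff moves inwards at a speed dominating \<open>\<parallel>u\<parallel>\<close>, so that transport only helps.\<close>

definition cutoff :: "real \<Rightarrow> real \<Rightarrow> spacetime \<Rightarrow> real"
  where "cutoff \<rho> c z = \<rho>\<^sup>2 - (norm (fst z))\<^sup>2 + c * (- snd z) powr (2/5)"

text \<open>Logarithmic derivatives at the maximum are inserted into the equation. The motion of the
  cutoff pays for its transport by \<open>u\<close>. The weight changes the factor b of u_r / r into
  b - a and contributes -a (2 - a) / q, whose sign is favourable exactly for a between 0 and 2. What
  remains of the cutoff is below 44 / \<psi>^2.\<close>

lemma weighted_max_algebra:
  fixes \<psi> :: real
  assumes \<psi>: "\<psi> > 0" "\<psi> \<le> 1" and q: "q > 0" "q = x1\<^sup>2 + x2\<^sup>2" and n: "x1\<^sup>2 + x2\<^sup>2 + x3\<^sup>2 \<le> 1" and a: "0 \<le> a" "a < 2"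
    and g1: "X1 / X = 4 * x1 / \<psi> + a * x1 / q" and g2: "X2 / X = 4 * x2 / \<psi> + a * x2 / q" and g3: "X3 / X = 4 * x3 / \<psi>"
    and h1: "X11 / X \<le> (X1 / X)\<^sup>2 + 4 / \<psi> + 8 * x1\<^sup>2 / \<psi>\<^sup>2 + a * (x2\<^sup>2 - x1\<^sup>2) / q\<^sup>2"
    and h2: "X22 / X \<le> (X2 / X)\<^sup>2 + 4 / \<psi> + 8 * x2\<^sup>2 / \<psi>\<^sup>2 + a * (x1\<^sup>2 - x2\<^sup>2) / q\<^sup>2"
    and h3: "X33 / X \<le> (X3 / X)\<^sup>2 + 4 / \<psi> + 8 * x3\<^sup>2 / \<psi>\<^sup>2"
    and t: "M' / M \<le> 2 * \<psi>t / \<psi> + Xt / X" and X: "X > 0"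
    and drift: "\<psi>t \<le> 2 * (u1 * x1 + u2 * x2 + u3 * x3)"
    and pde: "Xt + (u1 * X1 + u2 * X2 + u3 * X3) = X11 + X22 + X33 - 2 / q * (x1 * X1 + x2 * X2) + b * (Y / q) * X + R"
    and Y: "Y = x1 * u1 + x2 * u2"
  shows "M' / M \<le> (b - a) * (Y / q) + 44 / \<psi>\<^sup>2 + R / X"
proof -
  define p1 p2 p3 where p: "p1 = X1 / X" "p2 = X2 / X" "p3 = X3 / X"
  define s where "s = 1 / \<psi>"
  define k where "k = 1 / q"
  have s: "s \<ge> 1" using \<psi> by (simp add: s_def)
  have k: "k > 0" "k * q = 1" using q by (auto simp: k_def)
  have P1: "p1 = 4 * x1 * s + a * x1 * k" and P2: "p2 = 4 * x2 * s + a * x2 * k" and P3: "p3 = 4 * x3 * s"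
    using g1 g2 g3 by (simp_all add: p s_def k_def)
  have kq: "k * (x1\<^sup>2 + x2\<^sup>2) = 1" using k q by simp
  have "Xt / X = X11 / X + X22 / X + X33 / X - 2 * k * (x1 * p1 + x2 * p2) + b * (Y * k) + R / X - (u1 * p1 + u2 * p2 + u3 * p3)"
  proof -
    have e: "Xt = X11 + X22 + X33 - 2 / q * (x1 * X1 + x2 * X2) + b * (Y / q) * X + R - (u1 * X1 + u2 * X2 + u3 * X3)"
      using pde by simp
    show ?thesis unfolding e p k_def using X by (simp add: add_divide_distrib diff_divide_distrib ring_distribs)
  qed
  moreover have "X11 / X + X22 / X + X33 / X \<le> p1\<^sup>2 + p2\<^sup>2 + p3\<^sup>2 + 12 * s + 8 * (x1\<^sup>2 + x2\<^sup>2 + x3\<^sup>2) * s\<^sup>2"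
  proof -
    have "4 / \<psi> = 4 * s" and e: "8 * x\<^sup>2 / \<psi>\<^sup>2 = 8 * x\<^sup>2 * s\<^sup>2" for x by (simp_all add: s_def power_divide)
    moreover have "a * (x2\<^sup>2 - x1\<^sup>2) / q\<^sup>2 + a * (x1\<^sup>2 - x2\<^sup>2) / q\<^sup>2 = 0"
      by (simp add: add_divide_distrib[symmetric] ring_distribs[symmetric])
    ultimately show ?thesis using h1 h2 h3 unfolding p[symmetric] e by (simp add: algebra_simps)
  qed
  moreover have "2 * \<psi>t / \<psi> \<le> 4 * (u1 * x1 + u2 * x2 + u3 * x3) * s"
    using drift \<psi> by (simp add: s_def divide_right_mono)
  ultimately have "M' / M \<le> 4 * (u1 * x1 + u2 * x2 + u3 * x3) * s + p1\<^sup>2 + p2\<^sup>2 + p3\<^sup>2 + 12 * s + 8 * (x1\<^sup>2 + x2\<^sup>2 + x3\<^sup>2) * s\<^sup>2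
      - 2 * k * (x1 * p1 + x2 * p2) + b * (Y * k) + R / X - (u1 * p1 + u2 * p2 + u3 * p3)"
    using t by linarith
  \<comment> \<open>The products of \<open>u\<close> with x / \<psi> cancel: the bound on the time
    derivative of the cutoff was arranged to match its transport term.\<close>
  also have "\<dots> = 24 * (x1\<^sup>2 + x2\<^sup>2 + x3\<^sup>2) * s\<^sup>2 + 12 * s + 8 * a * s * (k * (x1\<^sup>2 + x2\<^sup>2)) + a\<^sup>2 * k * (k * (x1\<^sup>2 + x2\<^sup>2))
      - 8 * s * (k * (x1\<^sup>2 + x2\<^sup>2)) - 2 * a * k * (k * (x1\<^sup>2 + x2\<^sup>2)) + (b - a) * (Y * k) + R / X"
    unfolding P1 P2 P3 Y by (simp add: power2_eq_square) algebra
  also have "\<dots> = 24 * (x1\<^sup>2 + x2\<^sup>2 + x3\<^sup>2) * s\<^sup>2 + (4 + 8 * a) * s - a * (2 - a) * k + (b - a) * (Y * k) + R / X"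
    unfolding kq by (simp add: algebra_simps power2_eq_square)
  \<comment> \<open>Here |x| \<le> 1, a < 2 and \<psi> \<le> 1, the last giving s \<le> s^2. The two
    coefficients add up to 44.\<close>
  also have "\<dots> \<le> 24 * s\<^sup>2 + 20 * s\<^sup>2 + (b - a) * (Y * k) + R / X"
  proof -
    have "24 * (x1\<^sup>2 + x2\<^sup>2 + x3\<^sup>2) * s\<^sup>2 \<le> 24 * s\<^sup>2" using mult_left_mono[OF mult_right_mono[OF n zero_le_power2[of s]], of 24] by (simp only: mult.assoc) simp
    moreover have "(4 + 8 * a) * s \<le> 20 * s\<^sup>2"
      unfolding power2_eq_square mult.assoc[symmetric] using a s by (intro mult_mono mult_ge1_I) auto
    moreover have "0 \<le> a * (2 - a) * k" using a k by simp
    ultimately show ?thesis by linarith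
  qed
  finally show ?thesis by (simp add: s_def k_def power_divide)
qed

text \<open>If the bound failed, the quotient of the cut-off weighted quantity by \<open>M\<close>
  would have a maximum above 1. It cannot lie near the axis, where the quotient is small by
  \<open>XB\<close>, nor on the edge of the cutoff, nor at the initial time by \<open>init\<close>.
  At the remaining points the spatial test and the equation contradict \<open>bal\<close>, because
  the surplus of M' over \<kappa> M is positive.\<close>

lemma weighted_max_principle:
  fixes X R :: "spacetime \<Rightarrow> real" and u :: "spacetime \<Rightarrow> real^3" and M M' \<kappa> :: "real \<Rightarrow> real"
  assumes t: "-1 < t0" "t0 < t1" "t1 < 0" and a: "0 \<le> a" "a < 2" and d: "0 < d" "d < 1"
    and c: "0 \<le> c" "5 * C \<le> c" and dom: "\<rho>\<^sup>2 + c * (- t0) powr (2/5) \<le> d\<^sup>2"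
    and drift: "\<And>x t. norm x \<le> d \<Longrightarrow> t0 \<le> t \<Longrightarrow> t \<le> t1 \<Longrightarrow> norm (u (x, t)) \<le> C * (- t) powr (-3/5)"
    and X: "smooth_on Q X"
    and XB: "\<And>x t. norm x \<le> d \<Longrightarrow> t0 \<le> t \<Longrightarrow> t \<le> t1 \<Longrightarrow> \<bar>X (x, t)\<bar> \<le> B * axis_dist2 x"
    and pde: "\<And>x t. norm x \<le> d \<Longrightarrow> axis_dist2 x > 0 \<Longrightarrow> t0 \<le> t \<Longrightarrow> t \<le> t1 \<Longrightarrow>
      dt X (x, t) + u (x, t) \<bullet> grad X (x, t) = laplacian X (x, t)
        - 2 / axis_dist2 x * radial_part x (grad X (x, t)) + b * (radial_part x (u (x, t)) / axis_dist2 x) * X (x, t) + R (x, t)"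
    and \<kappa>: "\<And>x t. norm x \<le> d \<Longrightarrow> axis_dist2 x > 0 \<Longrightarrow> t0 \<le> t \<Longrightarrow> t \<le> t1 \<Longrightarrow>
      \<bar>b - a\<bar> * \<bar>radial_part x (u (x, t)) / axis_dist2 x\<bar> \<le> \<kappa> t"
    and M: "\<And>t. t0 \<le> t \<Longrightarrow> t \<le> t1 \<Longrightarrow> 0 < M t" "\<And>t. t0 \<le> t \<Longrightarrow> t \<le> t1 \<Longrightarrow> (M has_real_derivative M' t) (at t)"
      "\<And>t. t0 \<le> t \<Longrightarrow> t \<le> t1 \<Longrightarrow> 0 < M' t - \<kappa> t * M t"
    and bal: "\<And>x t. norm x \<le> d \<Longrightarrow> axis_dist2 x > 0 \<Longrightarrow> t0 \<le> t \<Longrightarrow> t \<le> t1 \<Longrightarrow>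
      (44 * \<bar>X (x, t)\<bar> + \<bar>R (x, t)\<bar>) * axis_dist2 x powr (- a / 2) \<le> M' t - \<kappa> t * M t"
    and init: "\<And>x. norm x \<le> d \<Longrightarrow> axis_dist2 x > 0 \<Longrightarrow> \<bar>X (x, t0)\<bar> * axis_dist2 x powr (- a / 2) \<le> M t0"
    and pt: "norm x0 \<le> d" "axis_dist2 x0 > 0" "t0 \<le> s0" "s0 \<le> t1" "0 \<le> cutoff \<rho> c (x0, s0)"
  shows "(cutoff \<rho> c (x0, s0))\<^sup>2 * X (x0, s0) * axis_dist2 x0 powr (- a / 2) \<le> M s0"
proof (rule ccontr)
  assume viol: "\<not> ?thesis"
  let ?\<psi> = "cutoff \<rho> c"
  define G where "G z = (?\<psi> z)\<^sup>2 * X z * axis_dist2 (fst z) powr (- a / 2)" for z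
  define F where "F z = G z / M (snd z)" for z
  have cM: "continuous_on {t0..t1} M" using M(2) by (intro continuous_at_imp_continuous_on ballI DERIV_isCont) auto
  obtain tm where tm: "tm \<in> {t0..t1}" "\<And>t. t \<in> {t0..t1} \<Longrightarrow> M tm \<le> M t"
    using continuous_attains_inf[OF compact_Icc _ cM] t by auto
  define m0 where "m0 = M tm"
  have m0: "m0 > 0" "\<And>t. t0 \<le> t \<Longrightarrow> t \<le> t1 \<Longrightarrow> m0 \<le> M t" using tm M by (auto simp: m0_def)
  have B0: "0 \<le> B"
  proof -
    have "0 \<le> B * axis_dist2 x0" using XB[OF pt(1,3,4)] by (meson abs_ge_zero order_trans)
    then show ?thesis using pt(2) by (simp add: zero_le_mult_iff)
  qed
  have \<psi>le: "?\<psi> (x, s) \<le> \<rho>\<^sup>2 + c * (- t0) powr (2/5) - (norm x)\<^sup>2" if "t0 \<le> s" "s \<le> t1" for x s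
    unfolding cutoff_def using that t c by (auto intro!: mult_left_mono powr_mono2)
  have \<psi>1: "?\<psi> (x, s) \<le> 1" if "t0 \<le> s" "s \<le> t1" for x s
  proof -
    have "d\<^sup>2 \<le> 1" using d by (simp add: power_le_one)
    then show ?thesis using \<psi>le[OF that, of x] dom zero_le_power2[of "norm x"] by linarith
  qed
  define e where "e = 1 - a / 2"
  have e: "e > 0" using a by (simp add: e_def)
  \<comment> \<open>By \<open>XB\<close> the weighted quantity is at most \<open>B\<close> times the
    positive power \<open>e\<close> of r^2. Where r^2 \<le> \<open>q0\<close> this is at most the
    minimum of \<open>M\<close>, so a tube around the singular axis can be removed; the minimum with
    \<open>axis_dist2 x0\<close> keeps the given point in the remaining compact set.\<close>
  define q0 where "q0 = min (axis_dist2 x0) ((m0 / (B + 1)) powr (1 / e))"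
  have q0: "q0 > 0" using m0 B0 pt by (simp add: q0_def)
  have Fsmall: "F (x, s) \<le> 1" if "norm x \<le> d" "t0 \<le> s" "s \<le> t1" "0 \<le> ?\<psi> (x, s)" "0 < axis_dist2 x" "axis_dist2 x \<le> q0" for x s
  proof -
    have "axis_dist2 x powr e \<le> ((m0 / (B + 1)) powr (1 / e)) powr e"
      using that e by (intro powr_mono2) (auto simp: q0_def)
    also have "\<dots> = m0 / (B + 1)" using e m0 B0 by (simp add: powr_powr)
    finally have 1: "axis_dist2 x powr e \<le> m0 / (B + 1)" .
    have "G (x, s) \<le> 1 * (B * axis_dist2 x) * axis_dist2 x powr (- a / 2)"
      unfolding G_def fst_conv
    proof (intro mult_right_mono)
      have "(?\<psi> (x, s))\<^sup>2 \<le> 1" using that \<psi>1 by (simp add: power_le_one)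
      moreover have "X (x, s) \<le> B * axis_dist2 x" using XB[of x s] that by simp
      ultimately show "(?\<psi> (x, s))\<^sup>2 * X (x, s) \<le> 1 * (B * axis_dist2 x)"
        using mult_left_mono[of "X (x, s)" "B * axis_dist2 x" "(?\<psi> (x, s))\<^sup>2"]
          mult_right_mono[of "(?\<psi> (x, s))\<^sup>2" 1 "B * axis_dist2 x"] B0 by (auto intro: order_trans)
    qed auto
    also have "\<dots> = B * axis_dist2 x powr e"
    proof -
      have "axis_dist2 x powr e = axis_dist2 x powr 1 * axis_dist2 x powr (- a / 2)"
        unfolding powr_add[symmetric] e_def by simp
      then show ?thesis using that by simp
    qed
    also have "\<dots> \<le> B * (m0 / (B + 1))" using B0 1 by (intro mult_left_mono)
    also have "\<dots> \<le> m0" using B0 m0 by (simp add: field_simps)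
    also have "\<dots> \<le> M s" using m0 that by simp
    finally show ?thesis using M(1)[of s] that by (simp add: F_def)
  qed
  have c\<psi>: "continuous_on (UNIV \<times> {t0..t1}) ?\<psi>"
    unfolding cutoff_def using t by (auto intro!: continuous_intros)
  define P where "P = {z \<in> cball 0 d \<times> {t0..t1}. 0 \<le> ?\<psi> z \<and> q0 \<le> axis_dist2 (fst z)}"
  have cl: "closed ((cball (0::real^3) d \<times> {t0..t1}) \<inter> ?\<psi> -` {0..})"
    by (rule continuous_closed_preimage[OF continuous_on_subset[OF c\<psi>]]) (auto intro: closed_Times)
  have cl2: "closed {z::spacetime. q0 \<le> axis_dist2 (fst z)}"
    by (intro closed_Collect_le continuous_intros)
  have P: "compact P"
  proof -
    have "P = (cball 0 d \<times> {t0..t1}) \<inter> (((cball (0::real^3) d \<times> {t0..t1}) \<inter> ?\<psi> -` {0..}) \<inter> {z. q0 \<le> axis_dist2 (fst z)})"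
      by (auto simp: P_def)
    then show ?thesis using cl cl2 by (auto intro!: compact_Int_closed compact_Times closed_Int)
  qed
  have PQ: "z \<in> Q" if "z \<in> cball 0 d \<times> {t0..t1}" for z
    using that d t by (cases z) (auto simp: parabolic_cylinder_def)
  have cF: "continuous_on P F"
    unfolding F_def G_def
  proof (intro continuous_intros)
    show "continuous_on P ?\<psi>" by (rule continuous_on_subset[OF c\<psi>]) (auto simp: P_def)
    show "continuous_on P X" using PQ
      by (intro continuous_on_subset[OF smooth_on_imp_continuous[OF X]]) (auto simp: P_def)
    show "continuous_on P (\<lambda>z. M (snd z))"
      by (intro continuous_on_compose2[OF cM] continuous_intros) (auto simp: P_def)
    show "\<forall>z\<in>P. axis_dist2 (fst z) \<noteq> 0" using q0 by (auto simp: P_def)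
    show "\<forall>z\<in>P. M (snd z) \<noteq> 0" using M(1) by (force simp: P_def)
  qed
  have x0P: "(x0, s0) \<in> P" using pt by (auto simp: P_def q0_def)
  obtain z where z: "z \<in> P" "\<And>y. y \<in> P \<Longrightarrow> F y \<le> F z"
    using continuous_attains_sup[OF P _ cF] x0P by blast
  obtain x s where zxs: "z = (x, s)" by (cases z)
  have "F (x0, s0) > 1" using viol M(1)[of s0] pt by (simp add: F_def G_def)
  then have Fz: "F (x, s) > 1" using z(2)[OF x0P] zxs by simp
  have xs: "norm x \<le> d" "t0 \<le> s" "s \<le> t1" "0 \<le> ?\<psi> (x, s)" "q0 \<le> axis_dist2 x"
    using z zxs by (auto simp: P_def)
  have Ms: "M s > 0" using M xs by simp
  have q: "q0 < axis_dist2 x" using Fsmall[of x s] xs q0 Fz by (smt (verit))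
  have Gz: "G (x, s) > M s" using Fz Ms by (simp add: F_def)
  have \<psi>0: "?\<psi> (x, s) > 0" using Gz Ms xs by (cases "?\<psi> (x, s) = 0") (auto simp: G_def)
  have X0: "X (x, s) > 0"
  proof (rule ccontr)
    assume "\<not> ?thesis"
    then have "G (x, s) \<le> 0" unfolding G_def by (intro mult_nonpos_nonneg mult_nonneg_nonpos) auto
    then show False using Gz Ms by simp
  qed
  have xd: "norm x < d"
  proof -
    have "(norm x)\<^sup>2 < d\<^sup>2" using \<psi>le[OF xs(2,3), of x] \<psi>0 dom by linarith
    then show ?thesis using d power_less_imp_less_base by (metis less_eq_real_def)
  qed
  have st: "t0 < s"
  proof (rule ccontr)
    assume "\<not> t0 < s"
    then have s: "s = t0" using xs by simp
    have "(?\<psi> (x, s))\<^sup>2 \<le> 1" using xs \<psi>1 by (simp add: power_le_one)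
    then have "G (x, s) \<le> 1 * X (x, s) * axis_dist2 x powr (- a / 2)"
      unfolding G_def fst_conv using X0 by (intro mult_right_mono) auto
    also have "\<dots> \<le> M s" using init[of x] xs q q0 X0 s by simp
    finally show False using Gz by simp
  qed
  have zQ: "(x, s) \<in> Q" using PQ[of "(x,s)"] xs by simp
  \<comment> \<open>At the maximum all spatial constraints defining \<open>P\<close> are strict, so
    a whole neighbourhood at time \<open>s\<close> lies in \<open>P\<close> and the maximum is
    interior in space.\<close>
  define U where "U = {y. norm y < d \<and> ?\<psi> (y, s) > 0 \<and> q0 < axis_dist2 y}"
  have oU: "open U" unfolding U_def cutoff_def fst_conv snd_conv
    by (intro open_Collect_conj open_Collect_less continuous_intros)
  have xU: "x \<in> U" using xd \<psi>0 q by (simp add: U_def)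
  obtain \<delta> where \<delta>: "\<delta> > 0" "ball x \<delta> \<subseteq> U" using oU xU openE by blast
  have GU: "G (y, s) \<le> G (x, s)" if "y \<in> U" for y
  proof -
    have "(y, s) \<in> P" using that xs by (auto simp: U_def P_def)
    then have "F (y, s) \<le> F (x, s)" using z zxs by simp
    then show ?thesis using Ms by (simp add: F_def divide_le_cancel)
  qed
  have near: "x + h *\<^sub>R axis i 1 \<in> U" if "\<bar>h\<bar> < \<delta>" for h and i :: 3
    using \<delta> that by (intro subsetD[OF \<delta>(2)]) (simp add: dist_norm norm_axis_1)
  have dX: "((\<lambda>h. X (x + h *\<^sub>R axis i 1, s)) has_real_derivative dx i X (x + h *\<^sub>R axis i 1, s)) (at h)"
      "((\<lambda>h. dx i X (x + h *\<^sub>R axis i 1, s)) has_real_derivative dx i (dx i X) (x + h *\<^sub>R axis i 1, s)) (at h)"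
    if "\<bar>h\<bar> < \<delta>" for h i
  proof -
    have e: "(x, s) + h *\<^sub>R (axis i 1, 0) = (x + h *\<^sub>R axis i 1, s)" for h by simp
    have "x + h *\<^sub>R axis i 1 \<in> cball 0 d" using near[OF that, of i] by (simp add: U_def)
    then have Qh: "(x, s) + h *\<^sub>R (axis i 1, 0) \<in> Q" unfolding e using xs by (intro PQ) auto
    show "((\<lambda>h. X (x + h *\<^sub>R axis i 1, s)) has_real_derivative dx i X (x + h *\<^sub>R axis i 1, s)) (at h)"
      using DERIV_along_line_real[OF smooth_on_imp_differentiable[OF X Qh]] unfolding e dx_eq .
    show "((\<lambda>h. dx i X (x + h *\<^sub>R axis i 1, s)) has_real_derivative dx i (dx i X) (x + h *\<^sub>R axis i 1, s)) (at h)"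
      using DERIV_along_line_real[OF smooth_on_imp_differentiable[OF smooth_on_dir_deriv[OF X] Qh]] unfolding e dx_eq .
  qed
  note n3 = norm_sq_vec3
  let ?A = "\<lambda>i. ?\<psi> (x, s) + (x $ i)\<^sup>2"
  have component: "(x + h *\<^sub>R axis i 1) $ j = (if j = i then x $ i + h else x $ j)" for h and i j :: 3
    by (simp add: axis_def)
  have max1: "(?A 1 - (x $ 1 + h)\<^sup>2)\<^sup>2 * X (x + h *\<^sub>R axis 1 1, s) * ((x $ 1 + h)\<^sup>2 + (x $ 2)\<^sup>2) powr (- a / 2)
     \<le> (?A 1 - (x $ 1)\<^sup>2)\<^sup>2 * X (x + 0 *\<^sub>R axis 1 1, s) * ((x $ 1)\<^sup>2 + (x $ 2)\<^sup>2) powr (- a / 2)" if "\<bar>h\<bar> < \<delta>" for h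
    using GU[OF near[OF that, of 1]] unfolding G_def cutoff_def n3 axis_dist2_def fst_conv snd_conv component by (simp add: algebra_simps)
  have max2: "(?A 2 - (x $ 2 + h)\<^sup>2)\<^sup>2 * X (x + h *\<^sub>R axis 2 1, s) * ((x $ 2 + h)\<^sup>2 + (x $ 1)\<^sup>2) powr (- a / 2)
     \<le> (?A 2 - (x $ 2)\<^sup>2)\<^sup>2 * X (x + 0 *\<^sub>R axis 2 1, s) * ((x $ 2)\<^sup>2 + (x $ 1)\<^sup>2) powr (- a / 2)" if "\<bar>h\<bar> < \<delta>" for h
    using GU[OF near[OF that, of 2]] unfolding G_def cutoff_def n3 axis_dist2_def fst_conv snd_conv component by (simp add: algebra_simps)
  \<comment> \<open>The weight does not depend on the third coordinate and is cancelled first. The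
    coordinate test is then used with exponent 0, and the added 1 merely keeps the base of
    \<open>powr\<close> positive.\<close>
  have max3: "(?A 3 - (x $ 3 + h)\<^sup>2)\<^sup>2 * X (x + h *\<^sub>R axis 3 1, s) * ((x $ 3 + h)\<^sup>2 + ((x $ 3)\<^sup>2 + 1)) powr (- 0 / 2)
     \<le> (?A 3 - (x $ 3)\<^sup>2)\<^sup>2 * X (x + 0 *\<^sub>R axis 3 1, s) * ((x $ 3)\<^sup>2 + ((x $ 3)\<^sup>2 + 1)) powr (- 0 / 2)" if "\<bar>h\<bar> < \<delta>" for h
  proof -
    have pw: "axis_dist2 x powr (- a / 2) > 0" using q q0 by simp
    have "(?A 3 - (x $ 3 + h)\<^sup>2)\<^sup>2 * X (x + h *\<^sub>R axis 3 1, s) * axis_dist2 x powr (- a / 2)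
       \<le> (?A 3 - (x $ 3)\<^sup>2)\<^sup>2 * X (x, s) * axis_dist2 x powr (- a / 2)"
      using GU[OF near[OF that, of 3]] unfolding G_def cutoff_def n3 axis_dist2_def fst_conv snd_conv component by (simp add: algebra_simps)
    then have "(?A 3 - (x $ 3 + h)\<^sup>2)\<^sup>2 * X (x + h *\<^sub>R axis 3 1, s) \<le> (?A 3 - (x $ 3)\<^sup>2)\<^sup>2 * X (x, s)"
      using pw by (simp only: mult_le_cancel_right_pos)
    moreover have "(x $ 3 + h)\<^sup>2 + ((x $ 3)\<^sup>2 + 1) > 0" "(x $ 3)\<^sup>2 + ((x $ 3)\<^sup>2 + 1) > 0" by (simp_all add: add_nonneg_pos)
    then have "((x $ 3 + h)\<^sup>2 + ((x $ 3)\<^sup>2 + 1)) powr (- 0 / 2) = 1" "((x $ 3)\<^sup>2 + ((x $ 3)\<^sup>2 + 1)) powr (- 0 / 2) = 1"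
      by (simp_all only: div_0 minus_zero powr_zero_eq_one less_imp_neq[symmetric] if_False not_False_eq_True)
    ultimately show ?thesis by simp
  qed
  have Xp: "X (x + 0 *\<^sub>R axis i 1, s) > 0" for i using X0 by simp
  have Ap: "?A i - (x $ i)\<^sup>2 > 0" for i using \<psi>0 by simp
  have qp: "(x $ 1)\<^sup>2 + (x $ 2)\<^sup>2 > 0" "(x $ 2)\<^sup>2 + (x $ 1)\<^sup>2 > 0" "(x $ 3)\<^sup>2 + ((x $ 3)\<^sup>2 + 1) > 0"
    using q q0 by (auto simp: axis_dist2_def add_nonneg_pos)
  have d0: "\<bar>0::real\<bar> < \<delta>" using \<delta> by simp
  note T1 = weighted_coordinate_test[OF \<delta>(1) dX(1) dX(2)[OF d0] Xp Ap qp(1) max1, simplified]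
  note T2 = weighted_coordinate_test[OF \<delta>(1) dX(1) dX(2)[OF d0] Xp Ap qp(2) max2, simplified]
  note T3 = weighted_coordinate_test[OF \<delta>(1) dX(1) dX(2)[OF d0] Xp Ap qp(3) max3, simplified]
  define \<psi>t where "\<psi>t = - (2/5 * c * (- s) powr (-3/5))"
  have s0: "s < 0" using xs t by simp
  have d\<psi>: "((\<lambda>r. ?\<psi> (x, r)) has_real_derivative \<psi>t) (at s)"
    unfolding cutoff_def \<psi>t_def fst_conv snd_conv using s0 by (auto intro!: derivative_eq_intros simp: powr_diff[symmetric])
  have dtX: "((\<lambda>r. X (x, r)) has_real_derivative dt X (x, s)) (at s)"
  proof -
    have e: "(x, 0) + r *\<^sub>R (0, 1) = (x, r)" for r by simp
    have "(x, 0) + s *\<^sub>R (0, 1) \<in> Q" unfolding e by (rule zQ)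
    from DERIV_along_line_real[OF smooth_on_imp_differentiable[OF X this]] show ?thesis unfolding e dt_eq .
  qed
  define k where "k r = (?\<psi> (x, r))\<^sup>2 * X (x, r) / M r" for r
  have dk: "(k has_real_derivative ((2 * ?\<psi> (x, s) * \<psi>t * X (x, s) + (?\<psi> (x, s))\<^sup>2 * dt X (x, s)) * M s
      - (?\<psi> (x, s))\<^sup>2 * X (x, s) * M' s) / (M s * M s)) (at s)" (is "(k has_real_derivative ?k') (at s)")
    unfolding k_def
  proof (rule DERIV_divide[OF _ M(2)])
    have "((\<lambda>r. (?\<psi> (x, r))\<^sup>2) has_real_derivative 2 * ?\<psi> (x, s) * \<psi>t) (at s)"
      using DERIV_power[OF d\<psi>, of 2] by (simp add: mult.commute mult.left_commute)
    from DERIV_mult[OF this dtX]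
    show "((\<lambda>r. (?\<psi> (x, r))\<^sup>2 * X (x, r)) has_real_derivative 2 * ?\<psi> (x, s) * \<psi>t * X (x, s) + (?\<psi> (x, s))\<^sup>2 * dt X (x, s)) (at s)"
      by (simp add: mult.commute)
  qed (use xs Ms in auto)
  \<comment> \<open>Only one-sided information in time is available, since \<open>s\<close> may be
    the last time \<open>t1\<close>. Looking backwards is legitimate: the cutoff was larger earlier,
    so \<open>(x, s - h)\<close> still belongs to \<open>P\<close>.\<close>
  have k': "?k' \<ge> 0"
  proof (rule ccontr)
    assume "\<not> ?k' \<ge> 0"
    then obtain \<eta> where \<eta>: "\<eta> > 0" "\<And>h. h > 0 \<Longrightarrow> h < \<eta> \<Longrightarrow> k s < k (s - h)"
      using DERIV_neg_dec_left[OF dk] by auto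
    define h where "h = min \<eta> (s - t0) / 2"
    have h: "h > 0" "h < \<eta>" "t0 \<le> s - h" using \<eta>(1) st unfolding h_def by (auto simp: min_def field_simps)
    have "(- s) powr (2/5) \<le> (- (s - h)) powr (2/5)" using s0 h by (intro powr_mono2) auto
    then have "?\<psi> (x, s) \<le> ?\<psi> (x, s - h)" using c by (simp add: cutoff_def mult_left_mono)
    then have "(x, s - h) \<in> P" using xs h \<psi>0 by (auto simp: P_def)
    then have "F (x, s - h) \<le> F (x, s)" using z zxs by simp
    then have "k (s - h) * axis_dist2 x powr (- a / 2) \<le> k s * axis_dist2 x powr (- a / 2)"
      by (simp add: F_def G_def k_def)
    then have "k (s - h) \<le> k s" using q q0 by (simp add: mult_le_cancel_right)
    then show False using \<eta>(2)[OF h(1,2)] by simp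
  qed
  have tt: "M' s / M s \<le> 2 * \<psi>t / ?\<psi> (x, s) + dt X (x, s) / X (x, s)"
  proof -
    have "0 \<le> (2 * ?\<psi> (x, s) * \<psi>t * X (x, s) + (?\<psi> (x, s))\<^sup>2 * dt X (x, s)) * M s - (?\<psi> (x, s))\<^sup>2 * X (x, s) * M' s"
      using k' Ms by (simp only: zero_le_divide_iff) (smt (verit) mult_pos_pos)
    moreover have "M'' / m \<le> 2 * pt / p + xt / y"
      if "0 \<le> (2 * p * pt * y + p\<^sup>2 * xt) * m - p\<^sup>2 * y * M''" "p > 0" "y > 0" "m > 0" for M'' m pt p xt y :: real
    proof -
      have "0 \<le> ((2 * p * pt * y + p\<^sup>2 * xt) * m - p\<^sup>2 * y * M'') / (p\<^sup>2 * y * m)" using that by simp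
      also have "\<dots> = 2 * pt / p + xt / y - M'' / m" using that by (simp add: field_simps power2_eq_square)
      finally show ?thesis by simp
    qed
    ultimately show ?thesis using \<psi>0 X0 Ms by blast
  qed
  define v where "v = u (x, s)"
  have v: "norm v \<le> C * (- s) powr (-3/5)" unfolding v_def using drift xs by simp
  have dr: "\<psi>t \<le> 2 * (v $ 1 * x $ 1 + v $ 2 * x $ 2 + v $ 3 * x $ 3)"
  proof -
    have "\<bar>v \<bullet> x\<bar> \<le> norm v * norm x" by (rule Cauchy_Schwarz_ineq2)
    also have "\<dots> \<le> norm v * 1" using xs d by (intro mult_left_mono) auto
    also have "\<dots> \<le> C * (- s) powr (-3/5)" using v by simp
    also have "\<dots> \<le> c / 5 * (- s) powr (-3/5)" using c by (intro mult_right_mono) auto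
    finally have "\<bar>v \<bullet> x\<bar> \<le> c / 5 * (- s) powr (-3/5)" .
    then have "- (c / 5 * (- s) powr (-3/5)) \<le> v \<bullet> x" by linarith
    moreover have "- (2 / 5 * c * y) \<le> 2 * w" if "- (c / 5 * y) \<le> w" for y w
      using that by (simp add: field_simps)
    ultimately show ?thesis unfolding \<psi>t_def inner_vec_def sum_3 inner_real_def by blast
  qed
  have qpos: "0 < axis_dist2 x" using q q0 by simp
  have n1: "(x $ 1)\<^sup>2 + (x $ 2)\<^sup>2 + (x $ 3)\<^sup>2 \<le> 1"
    unfolding n3[symmetric] using xs d by (intro power_le_one) auto
  have "M' s / M s \<le> (b - a) * (radial_part x v / axis_dist2 x) + 44 / (?\<psi> (x, s))\<^sup>2 + R (x, s) / X (x, s)"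
  proof (rule weighted_max_algebra[OF \<psi>0 \<psi>1[OF xs(2,3)] qpos _ n1 a T1(1)[folded axis_dist2_def] _ T3(1) T1(2)[folded axis_dist2_def] _ T3(2) tt X0 dr])
    show "axis_dist2 x = (x $ 1)\<^sup>2 + (x $ 2)\<^sup>2" by (simp add: axis_dist2_def)
    show "dx 2 X (x, s) / X (x, s) = 4 * x $ 2 / ?\<psi> (x, s) + a * x $ 2 / axis_dist2 x"
      using T2(1) by (simp add: axis_dist2_def add.commute)
    show "dx 2 (dx 2 X) (x, s) / X (x, s) \<le> (dx 2 X (x, s) / X (x, s))\<^sup>2 + 4 / ?\<psi> (x, s) + 8 * (x $ 2)\<^sup>2 / (?\<psi> (x, s))\<^sup>2
        + a * ((x $ 1)\<^sup>2 - (x $ 2)\<^sup>2) / (axis_dist2 x)\<^sup>2"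
      using T2(2) by (simp add: axis_dist2_def add.commute)
    show "dt X (x, s) + (v $ 1 * dx 1 X (x, s) + v $ 2 * dx 2 X (x, s) + v $ 3 * dx 3 X (x, s)) =
       dx 1 (dx 1 X) (x, s) + dx 2 (dx 2 X) (x, s) + dx 3 (dx 3 X) (x, s)
        - 2 / axis_dist2 x * (x $ 1 * dx 1 X (x, s) + x $ 2 * dx 2 X (x, s)) + b * (radial_part x v / axis_dist2 x) * X (x, s) + R (x, s)"
      using pde[OF xs(1) qpos xs(2,3)] by (simp add: v_def inner_vec_def sum_3 grad_def laplacian_def radial_part_def)
    show "radial_part x v = x $ 1 * v $ 1 + x $ 2 * v $ 2" by (simp add: radial_part_def)
  qed
  also have "(b - a) * (radial_part x v / axis_dist2 x) \<le> \<kappa> s"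
  proof -
    have "(b - a) * (radial_part x v / axis_dist2 x) \<le> \<bar>(b - a) * (radial_part x v / axis_dist2 x)\<bar>" by (rule abs_ge_self)
    also have "\<dots> \<le> \<kappa> s" using \<kappa>[OF xs(1) qpos xs(2,3)] by (simp add: abs_mult v_def)
    finally show ?thesis .
  qed
  finally have key: "M' s / M s \<le> \<kappa> s + 44 / (?\<psi> (x, s))\<^sup>2 + R (x, s) / X (x, s)" by simp
  define w where "w = axis_dist2 x powr (- a / 2)"
  have w: "w > 0" using qpos by (simp add: w_def)
  have G: "G (x, s) = (?\<psi> (x, s))\<^sup>2 * X (x, s) * w" by (simp add: G_def w_def)
  have "M' s / M s * G (x, s) \<le> (\<kappa> s + 44 / (?\<psi> (x, s))\<^sup>2 + R (x, s) / X (x, s)) * G (x, s)"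
    using key Gz Ms by (intro mult_right_mono) auto
  also have "\<dots> = \<kappa> s * G (x, s) + 44 * X (x, s) * w + (?\<psi> (x, s))\<^sup>2 * R (x, s) * w"
    unfolding G using \<psi>0 X0 by (simp add: field_simps)
  also have "\<dots> \<le> \<kappa> s * G (x, s) + (M' s - \<kappa> s * M s)"
  proof -
    have "(?\<psi> (x, s))\<^sup>2 \<le> 1" using xs \<psi>1 by (simp add: power_le_one)
    then have "(?\<psi> (x, s))\<^sup>2 * R (x, s) \<le> 1 * \<bar>R (x, s)\<bar>"
      using mult_left_mono[OF abs_ge_self[of "R (x, s)"], of "(?\<psi> (x, s))\<^sup>2"]
        mult_right_mono[of "(?\<psi> (x, s))\<^sup>2" 1 "\<bar>R (x, s)\<bar>"] by simp
    then have "(?\<psi> (x, s))\<^sup>2 * R (x, s) * w \<le> \<bar>R (x, s)\<bar> * w" using w by (intro mult_right_mono) auto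
    moreover have "(44 * X (x, s) + \<bar>R (x, s)\<bar>) * w \<le> M' s - \<kappa> s * M s"
      using bal[OF xs(1) qpos xs(2,3)] X0 by (simp add: w_def)
    ultimately show ?thesis by (simp add: algebra_simps)
  qed
  finally have "(M' s - \<kappa> s * M s) * G (x, s) \<le> (M' s - \<kappa> s * M s) * M s"
    using Ms by (simp add: field_simps)
  then show False using M(3)[OF xs(2,3)] Gz by (simp add: mult_le_cancel_left)
qed

subsection \<open>Mollification of solenoidal fields with bounded curl\<close>

text \<open>A radial profile with explicit gradient. It is only once continuously differentiable,
  which suffices because a single derivative is ever moved onto it.\<close>

definition bump_weight :: "real^3 \<Rightarrow> real" where "bump_weight y = (max 0 (1 - y \<bullet> y))\<^sup>2"

abbreviation unit_cube :: "(real^3) set" where "unit_cube \<equiv> cbox (- 1) 1"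

lemma positive_part_square_deriv:
  "((\<lambda>s::real. (max 0 s)\<^sup>2) has_real_derivative 2 * max 0 s) (at s)"
proof -
  consider "s > 0" | "s < 0" | "s = 0" by linarith
  then show ?thesis
  proof cases
    case 1
    have "((\<lambda>s::real. s\<^sup>2) has_real_derivative 2 * max 0 s) (at s)"
      using 1 by (auto intro!: derivative_eq_intros)
    then show ?thesis
      by (rule has_field_derivative_transform_within_open[of _ _ _ "{0<..}"]) (use 1 in auto)
  next
    case 2
    have "((\<lambda>s::real. 0) has_real_derivative 2 * max 0 s) (at s)" using 2 by simp
    then show ?thesis
      by (rule has_field_derivative_transform_within_open[of _ _ _ "{..<0}"]) (use 2 in auto)
  next
    case 3
    have "((\<lambda>h::real. ((max 0 (0 + h))\<^sup>2 - (max 0 0)\<^sup>2) / h) \<longlongrightarrow> 0) (at 0)"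
    proof (rule tendsto_0_le[where f="\<lambda>h. h" and K=1])
      show "\<forall>\<^sub>F h in at (0::real). norm (((max 0 (0 + h))\<^sup>2 - (max 0 0)\<^sup>2) / h) \<le> norm h * 1"
        by (auto simp: eventually_at_filter max_def power2_eq_square)
    qed simp
    then show ?thesis using 3 by (simp add: DERIV_def)
  qed
qed

lemma bump_weight_has_derivative:
  "(bump_weight has_derivative (\<lambda>v. - 4 * max 0 (1 - y \<bullet> y) * (y \<bullet> v))) (at y)"
proof -
  have "((\<lambda>y::real^3. 1 - y \<bullet> y) has_derivative (\<lambda>v. - 2 * (y \<bullet> v))) (at y)"
    by (auto intro!: derivative_eq_intros simp: inner_commute)
  from has_derivative_compose[OF this positive_part_square_deriv[unfolded has_field_derivative_def]]
  show ?thesis unfolding bump_weight_def[abs_def]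
    by (rule has_derivative_eq_rhs) (simp add: fun_eq_iff)
qed

lemma bump_weight_bounds: "0 \<le> bump_weight y" "bump_weight y \<le> 1"
  by (auto simp: bump_weight_def power_le_one)

lemma bump_weight_support: "y \<notin> cball 0 1 \<Longrightarrow> bump_weight y = 0"
proof -
  assume "y \<notin> cball 0 1"
  then have "1 < (norm y)\<^sup>2" by (simp add: one_less_power)
  then show ?thesis by (simp add: bump_weight_def power2_norm_eq_inner)
qed

lemma continuous_on_bump_weight [continuous_intros]:
  "continuous_on S f \<Longrightarrow> continuous_on S (\<lambda>x. bump_weight (f x))"
  unfolding bump_weight_def by (intro continuous_intros)

lemma bump_weight_dir_deriv: "dir_deriv v bump_weight y = - 4 * max 0 (1 - y \<bullet> y) * (y \<bullet> v)"
  by (rule dir_derivI[OF bump_weight_has_derivative])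

lemma unit_cube_bounds: "cball 0 1 \<subseteq> unit_cube" "unit_cube \<subseteq> ball 0 2"
proof -
  show "cball 0 1 \<subseteq> unit_cube"
  proof
    fix y :: "real^3" assume "y \<in> cball 0 1"
    then have "\<bar>y $ i\<bar> \<le> 1" for i using component_le_norm_cart[of y i] by simp
    then show "y \<in> unit_cube" by (simp add: mem_box_cart abs_le_iff minus_le_iff)
  qed
  show "unit_cube \<subseteq> ball 0 2"
  proof
    fix y assume "y \<in> unit_cube"
    then have y: "\<bar>y $ i\<bar> \<le> 1" for i by (auto simp: mem_box_cart abs_le_iff minus_le_iff)
    have "(norm y)\<^sup>2 = (\<Sum>i\<in>UNIV. (y $ i)\<^sup>2)"
      unfolding power2_norm_eq_inner inner_vec_def by (simp add: power2_eq_square)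
    also have "\<dots> \<le> (\<Sum>i\<in>(UNIV::3 set). 1)" using y by (intro sum_mono) (simp add: abs_square_le_1)
    also have "\<dots> = 3" by simp
    finally have "(norm y)\<^sup>2 < 2\<^sup>2" by simp
    then have "norm y < 2" by (rule power_less_imp_less_base) simp
    then show "y \<in> ball 0 2" by simp
  qed
qed

lemma unit_cube_content: "measure lborel unit_cube = 8"
  by (subst content_cbox_cart) (auto simp: interval_ne_empty_cart prod_constant)

lemma unit_cube_component: "y \<in> unit_cube \<Longrightarrow> \<bar>y $ i\<bar> \<le> 1"
  by (auto simp: mem_box_cart abs_le_iff minus_le_iff)

lemma integral_unit_cube_bound:
  fixes f :: "real^3 \<Rightarrow> real"
  assumes "continuous_on unit_cube f" "\<And>y. y \<in> unit_cube \<Longrightarrow> \<bar>f y\<bar> \<le> B" "0 \<le> B"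
  shows "\<bar>integral unit_cube f\<bar> \<le> 8 * B"
proof -
  have "norm (integral unit_cube f) \<le> B * measure lborel unit_cube"
    by (rule has_integral_bound[OF assms(3) integrable_integral[OF integrable_continuous[OF assms(1)]]])
      (use assms(2) in auto)
  then show ?thesis by (simp add: unit_cube_content)
qed

definition bump_mass :: real where "bump_mass = integral unit_cube bump_weight"

lemma bump_mass_pos: "bump_mass > 0"
proof -
  have c: "continuous_on unit_cube bump_weight" using continuous_on_bump_weight[OF continuous_on_id] by simp
  have "bump_mass \<ge> 0" unfolding bump_mass_def
    by (rule integral_nonneg[OF integrable_continuous[OF c]]) (simp add: bump_weight_bounds)
  moreover have "bump_mass \<noteq> 0"
  proof
    assume "bump_mass = 0"
    then have "(bump_weight has_integral 0) unit_cube"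
      using integrable_integral[OF integrable_continuous[OF c]] by (simp add: bump_mass_def)
    moreover have "(0::real^3) \<in> unit_cube" using unit_cube_bounds(1) by force
    moreover have "box (- 1) (1 :: real^3) \<noteq> {}" by (simp add: interval_ne_empty_cart)
    ultimately have "bump_weight 0 = 0"
      using has_integral_0_cbox_imp_0[OF c] bump_weight_bounds by blast
    then show False by (simp add: bump_weight_def)
  qed
  ultimately show ?thesis by simp
qed

text \<open>The version for test functions does not cover the bump weight, which is not smooth;
  continuity of the one derivative of \<phi> that occurs is enough.\<close>

lemma integral_by_parts_C1:
  fixes f \<phi> :: "'a::euclidean_space \<Rightarrow> real"
  assumes S: "open S" "cbox a b \<subseteq> S" and f: "smooth_on S f" and K: "compact K" "K \<subseteq> cbox a b"
    and \<phi>: "\<And>y. \<phi> differentiable (at y)" "continuous_on UNIV (dir_deriv v \<phi>)" "\<And>y. y \<notin> K \<Longrightarrow> \<phi> y = 0"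
  shows "integral (cbox a b) (\<lambda>y. f y * dir_deriv v \<phi> y) = - integral (cbox a b) (\<lambda>y. dir_deriv v f y * \<phi> y)"
proof -
  let ?g = "\<lambda>y. f y * \<phi> y" and ?h = "\<lambda>y. f y * dir_deriv v \<phi> y + dir_deriv v f y * \<phi> y"
  have KS: "K \<subseteq> S" using S K by auto
  have oK: "open (- K)" using K by (simp add: open_Compl compact_imp_closed)
  have d\<phi>0: "dir_deriv v \<phi> y = 0" if "y \<notin> K" for y
  proof -
    have "dir_deriv v \<phi> y = dir_deriv v (\<lambda>x. 0) y"
      by (rule dir_deriv_cong_open[OF oK]) (use \<phi>(3) that in auto)
    then show ?thesis using dir_derivI[OF has_derivative_const[of 0]] by metis
  qed
  have c\<phi>: "continuous_on UNIV \<phi>"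
    using \<phi>(1) differentiable_imp_continuous_within continuous_at_imp_continuous_on by blast
  have c1: "continuous_on UNIV (\<lambda>y. f y * dir_deriv v \<phi> y)"
    by (rule continuous_on_mult_support[OF S(1) smooth_on_imp_continuous[OF f] \<phi>(2) K(1) KS d\<phi>0])
  have c2: "continuous_on UNIV (\<lambda>y. dir_deriv v f y * \<phi> y)"
    by (rule continuous_on_mult_support[OF S(1) smooth_on_imp_continuous[OF smooth_on_dir_deriv[OF f]] c\<phi> K(1) KS \<phi>(3)])
  have inS: "(?g has_derivative (\<lambda>v. f y * dir_deriv v \<phi> y + dir_deriv v f y * \<phi> y)) (at y)" if "y \<in> S" for y
    by (intro has_derivative_mult has_derivative_dir_deriv \<phi>(1) smooth_on_imp_differentiable[OF f that])
  have offK: "(?g has_derivative (\<lambda>v. 0)) (at y)" if "y \<notin> K" for y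
    by (rule has_derivative_transform_within_open[OF has_derivative_const[of 0] oK]) (use \<phi>(3) that in auto)
  have dg: "?g differentiable (at y)" for y
    using inS offK KS unfolding differentiable_def by (cases "y \<in> K") blast+
  have eq: "dir_deriv v ?g y = ?h y" for y
  proof (cases "y \<in> K")
    case True then show ?thesis using dir_derivI[OF inS] KS by blast
  next
    case False then show ?thesis using dir_derivI[OF offK] d\<phi>0 \<phi>(3) by simp
  qed
  then have "dir_deriv v ?g = ?h" by auto
  then have "continuous_on UNIV (dir_deriv v ?g)" using continuous_on_add[OF c1 c2] by simp
  from integral_dir_deriv_eq_0[OF dg this K(1)] \<phi>(3)
  have "integral\<^sup>L lborel (dir_deriv v ?g) = 0" by simp
  then have "integral (cbox a b) ?h = 0"
    using compact_support_integral(3)[OF continuous_on_add[OF c1 c2] K(2)] d\<phi>0 \<phi>(3) \<open>dir_deriv v ?g = ?h\<close> by simp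
  moreover have "integral (cbox a b) ?h = integral (cbox a b) (\<lambda>y. f y * dir_deriv v \<phi> y) + integral (cbox a b) (\<lambda>y. dir_deriv v f y * \<phi> y)"
    by (intro integral_add integrable_continuous continuous_on_subset[OF c1] continuous_on_subset[OF c2]) auto
  ultimately show ?thesis by simp
qed

lemma dir_deriv_components:
  fixes w :: "real^3 \<Rightarrow> real"
  assumes "w differentiable (at z)"
  shows "dir_deriv y w z = (\<Sum>j\<in>UNIV. y $ j * dir_deriv (axis j 1) w z)"
proof -
  have "y = (\<Sum>j\<in>UNIV. y $ j *\<^sub>R axis j 1)" using basis_expansion[of y] by (simp add: scalar_mult_eq_scaleR)
  then have "dir_deriv y w z = dir_deriv (\<Sum>j\<in>UNIV. y $ j *\<^sub>R axis j 1) w z" by simp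
  also have "\<dots> = (\<Sum>j\<in>UNIV. y $ j *\<^sub>R dir_deriv (axis j 1) w z)"
    using linear_sum[OF dir_deriv_linear[OF assms], of "\<lambda>j. y $ j *\<^sub>R axis j 1" UNIV]
      linear_scale[OF dir_deriv_linear[OF assms]] by (simp only:)
  finally show ?thesis by simp
qed

lemma bump_moment_dir_deriv:
  fixes j k :: 3
  shows "(\<lambda>y. bump_weight y * y $ j) differentiable (at y)"
    "dir_deriv (axis k 1) (\<lambda>y. bump_weight y * y $ j) y
      = - 4 * max 0 (1 - y \<bullet> y) * y $ k * y $ j + (if j = k then bump_weight y else 0)"
proof -
  have c: "((\<lambda>y::real^3. y $ j) has_derivative (\<lambda>v. v $ j)) (at y)"
    using bounded_linear_imp_has_derivative[OF bounded_linear_vec_nth] .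
  note d = has_derivative_mult[OF bump_weight_has_derivative c]
  show "(\<lambda>y. bump_weight y * y $ j) differentiable (at y)" using d differentiable_def by blast
  show "dir_deriv (axis k 1) (\<lambda>y. bump_weight y * y $ j) y
      = - 4 * max 0 (1 - y \<bullet> y) * y $ k * y $ j + (if j = k then bump_weight y else 0)"
  proof -
    have "y \<bullet> axis k 1 = y $ k" "axis k 1 $ j = (if j = k then 1 else (0::real))"
      by (simp add: inner_axis, simp add: axis_def)
    then show ?thesis by (subst dir_derivI[OF d]) simp
  qed
qed

section \<open>Averages of a solenoidal field against a scaled bump\<close>

lemma scaled_smooth:
  fixes f :: "real^3 \<Rightarrow> real"
  assumes f: "smooth_on S f" and B: "ball x (2 * s) \<subseteq> S" and s: "s > 0"
  shows "smooth_on (ball 0 2) (\<lambda>y. f (x + s *\<^sub>R y))"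
    "y \<in> ball 0 2 \<Longrightarrow> dir_deriv e (\<lambda>y. f (x + s *\<^sub>R y)) y = s * dir_deriv e f (x + s *\<^sub>R y)"
proof -
  have L: "bounded_linear (\<lambda>y::real^3. s *\<^sub>R y)" by (rule bounded_linear_scaleR_right)
  have in_S: "s *\<^sub>R y + x \<in> S" if "y \<in> ball 0 2" for y
    using that s by (intro subsetD[OF B]) (simp add: dist_norm)
  show "smooth_on (ball 0 2) (\<lambda>y. f (x + s *\<^sub>R y))"
    using smooth_on_affine[where T="ball 0 2", OF L open_ball in_S f] by (simp add: add.commute)
  assume y: "y \<in> ball 0 2"
  have d: "f differentiable (at (s *\<^sub>R y + x))" by (rule smooth_on_imp_differentiable[OF f in_S[OF y]])
  have "dir_deriv (s *\<^sub>R e) f (s *\<^sub>R y + x) = s *\<^sub>R dir_deriv e f (s *\<^sub>R y + x)"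
    using linear_scale[OF dir_deriv_linear[OF d]] .
  then show "dir_deriv e (\<lambda>y. f (x + s *\<^sub>R y)) y = s * dir_deriv e f (x + s *\<^sub>R y)"
    using dir_deriv_affine(1)[OF L d] by (simp add: add.commute)
qed

text \<open>The weight is radial, so the vector field y times \<open>bump_weight\<close> has a
  symmetric Jacobian. Moving the derivative onto it, exchanging the indices by this symmetry, and
  moving it back replaces the transposed gradient by the divergence of \<open>w\<close>.\<close>

lemma bump_divergence:
  fixes w :: "3 \<Rightarrow> real^3 \<Rightarrow> real"
  assumes w: "\<And>j. smooth_on S (w j)" and B: "ball x (2 * s) \<subseteq> S" and s: "s > 0"
    and div: "\<And>z. z \<in> S \<Longrightarrow> (\<Sum>j\<in>UNIV. dir_deriv (axis j 1) (w j) z) = 0"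
  shows "integral unit_cube (\<lambda>y. bump_weight y * (\<Sum>j\<in>UNIV. y $ j * dir_deriv (axis k 1) (w j) (x + s *\<^sub>R y))) = 0"
proof -
  let ?f = "\<lambda>j y. w j (x + s *\<^sub>R y)" and ?\<phi> = "\<lambda>j (y::real^3). bump_weight y * y $ j"
  note sf = scaled_smooth(1)[OF w B s]
  note df = scaled_smooth(2)[OF w B s]
  have inS: "x + s *\<^sub>R y \<in> S" if "y \<in> unit_cube" for y
    using subsetD[OF unit_cube_bounds(2) that] s by (intro subsetD[OF B]) (simp add: dist_norm)
  have cd: "continuous_on UNIV (dir_deriv (axis k 1) (?\<phi> j))" for j k
    unfolding bump_moment_dir_deriv(2) by (cases "j = k") (auto intro!: continuous_intros)
  have \<phi>0: "?\<phi> j y = 0" if "y \<notin> cball 0 1" for j y using bump_weight_support[OF that] by simp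
  have ibp: "integral unit_cube (\<lambda>y. ?f j y * dir_deriv (axis k 1) (?\<phi> i) y)
      = - integral unit_cube (\<lambda>y. dir_deriv (axis k 1) (?f j) y * ?\<phi> i y)" for i j k
    by (rule integral_by_parts_C1[OF open_ball unit_cube_bounds(2) sf compact_cball unit_cube_bounds(1) bump_moment_dir_deriv(1) cd \<phi>0])
  have sym: "dir_deriv (axis k 1) (?\<phi> j) y = dir_deriv (axis j 1) (?\<phi> k) y" for j y
    unfolding bump_moment_dir_deriv(2) by auto
  have int: "(\<lambda>y. dir_deriv (axis k 1) (?f j) y * ?\<phi> i y) integrable_on unit_cube" for i j k
    by (intro integrable_continuous continuous_intros continuous_on_subset[OF smooth_on_imp_continuous[OF smooth_on_dir_deriv[OF sf]] unit_cube_bounds(2)])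
  have "integral unit_cube (\<lambda>y. \<Sum>j\<in>UNIV. dir_deriv (axis k 1) (?f j) y * ?\<phi> j y)
      = (\<Sum>j\<in>UNIV. integral unit_cube (\<lambda>y. dir_deriv (axis k 1) (?f j) y * ?\<phi> j y))"
    by (rule integral_sum) (auto intro: int)
  also have "\<dots> = (\<Sum>j\<in>UNIV. integral unit_cube (\<lambda>y. dir_deriv (axis j 1) (?f j) y * ?\<phi> k y))"
  proof (rule sum.cong[OF refl])
    fix j
    have "integral unit_cube (\<lambda>y. ?f j y * dir_deriv (axis k 1) (?\<phi> j) y)
        = integral unit_cube (\<lambda>y. ?f j y * dir_deriv (axis j 1) (?\<phi> k) y)"
      by (rule integral_cong) (subst sym, rule refl)
    then show "integral unit_cube (\<lambda>y. dir_deriv (axis k 1) (?f j) y * ?\<phi> j y)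
        = integral unit_cube (\<lambda>y. dir_deriv (axis j 1) (?f j) y * ?\<phi> k y)"
      using ibp[of j k j] ibp[of j j k] by linarith
  qed
  also have "\<dots> = integral unit_cube (\<lambda>y. \<Sum>j\<in>UNIV. dir_deriv (axis j 1) (?f j) y * ?\<phi> k y)"
    by (rule integral_sum[symmetric]) (auto intro: int)
  also have "\<dots> = integral unit_cube (\<lambda>y. 0)"
  proof (rule integral_cong)
    fix y assume y: "y \<in> unit_cube"
    have "(\<Sum>j\<in>UNIV. dir_deriv (axis j 1) (?f j) y * ?\<phi> k y) = s * (\<Sum>j\<in>UNIV. dir_deriv (axis j 1) (w j) (x + s *\<^sub>R y)) * ?\<phi> k y"
      using df[of y] subsetD[OF unit_cube_bounds(2) y] by (simp add: sum_distrib_left sum_distrib_right)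
    then show "(\<Sum>j\<in>UNIV. dir_deriv (axis j 1) (?f j) y * ?\<phi> k y) = 0" using div[OF inS[OF y]] by simp
  qed
  finally have "integral unit_cube (\<lambda>y. \<Sum>j\<in>UNIV. dir_deriv (axis k 1) (?f j) y * ?\<phi> j y) = 0" by simp
  moreover have "integral unit_cube (\<lambda>y. \<Sum>j\<in>UNIV. dir_deriv (axis k 1) (?f j) y * ?\<phi> j y)
    = integral unit_cube (\<lambda>y. s * (bump_weight y * (\<Sum>j\<in>UNIV. y $ j * dir_deriv (axis k 1) (w j) (x + s *\<^sub>R y))))"
  proof (rule integral_cong)
    fix y assume y: "y \<in> unit_cube"
    show "(\<Sum>j\<in>UNIV. dir_deriv (axis k 1) (?f j) y * ?\<phi> j y)
        = s * (bump_weight y * (\<Sum>j\<in>UNIV. y $ j * dir_deriv (axis k 1) (w j) (x + s *\<^sub>R y)))"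
      using df[of y] subsetD[OF unit_cube_bounds(2) y] by (simp add: sum_distrib_left algebra_simps)
  qed
  ultimately show ?thesis using s by simp
qed

text \<open>The derivative of the average with respect to the radius averages y . grad w_k. The same
  expression with transposed gradient averages to zero by \<open>bump_divergence\<close>;
  subtracting it leaves entries of the curl only. Thus a solenoidal field stays close to its
  averages as soon as its curl is bounded, with no control of the full gradient.\<close>

lemma bump_average_deviation:
  fixes w :: "3 \<Rightarrow> real^3 \<Rightarrow> real"
  assumes w: "\<And>j. smooth_on S (w j)" and B: "ball x (2 * s) \<subseteq> S" and s: "s > 0"
    and div: "\<And>z. z \<in> S \<Longrightarrow> (\<Sum>j\<in>UNIV. dir_deriv (axis j 1) (w j) z) = 0"
    and curl: "\<And>z j k. z \<in> ball x (2 * s) \<Longrightarrow> \<bar>dir_deriv (axis j 1) (w k) z - dir_deriv (axis k 1) (w j) z\<bar> \<le> m"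
  shows "\<bar>integral unit_cube (\<lambda>y. bump_weight y * w k (x + s *\<^sub>R y)) - bump_mass * w k x\<bar> \<le> 24 * m * s"
proof -
  have inB: "x + r *\<^sub>R y \<in> ball x (2 * s)" if "y \<in> unit_cube" "0 \<le> r" "r \<le> s" for y r
  proof -
    have "r * norm y \<le> s * norm y" using that by (intro mult_right_mono) auto
    also have "\<dots> < s * 2" using subsetD[OF unit_cube_bounds(2) that(1)] s by simp
    finally show ?thesis using that by (simp add: dist_norm)
  qed
  have inS: "x + r *\<^sub>R y \<in> S" if "y \<in> unit_cube" "0 \<le> r" "r \<le> s" for y r using inB[OF that] B by blast
  have m0: "0 \<le> m" using curl[of x 1 1] s by simp
  let ?F = "\<lambda>r. integral unit_cube (\<lambda>y. bump_weight y * w k (x + r *\<^sub>R y))"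
  let ?F' = "\<lambda>r. integral unit_cube (\<lambda>y. bump_weight y * (\<Sum>j\<in>UNIV. y $ j * dir_deriv (axis j 1) (w k) (x + r *\<^sub>R y)))"
  have cdw: "continuous_on ({0..s} \<times> unit_cube) (\<lambda>z. dir_deriv (axis j 1) (w i) (x + fst z *\<^sub>R snd z))" for i j
    by (rule continuous_on_compose2[OF smooth_on_imp_continuous[OF smooth_on_dir_deriv[OF w]]])
      (auto intro!: continuous_intros inS)
  have dF: "(?F has_field_derivative ?F' r) (at r within {0..s})" if "r \<in> {0..s}" for r
  proof (rule leibniz_rule_field_derivative)
    fix r y assume ry: "r \<in> {0..s}" "y \<in> unit_cube"
    have df: "w k differentiable (at (x + r *\<^sub>R y))" using inS ry by (intro smooth_on_imp_differentiable[OF w]) auto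
    show "((\<lambda>r. bump_weight y * w k (x + r *\<^sub>R y)) has_field_derivative
        bump_weight y * (\<Sum>j\<in>UNIV. y $ j * dir_deriv (axis j 1) (w k) (x + r *\<^sub>R y))) (at r within {0..s})"
      unfolding dir_deriv_components[OF df, symmetric]
      by (rule has_field_derivative_at_within[OF DERIV_cmult[OF DERIV_along_line_real[OF df]]])
  next
    fix r assume "r \<in> {0..s}"
    then show "(\<lambda>y. bump_weight y * w k (x + r *\<^sub>R y)) integrable_on unit_cube"
      by (intro integrable_continuous continuous_intros continuous_on_compose2[OF smooth_on_imp_continuous[OF w]]) (auto intro: inS)
  next
    show "continuous_on ({0..s} \<times> unit_cube) (\<lambda>(r, y). bump_weight y * (\<Sum>j\<in>UNIV. y $ j * dir_deriv (axis j 1) (w k) (x + r *\<^sub>R y)))"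
      unfolding split_beta by (intro continuous_intros cdw)
  qed (use that in auto)
  have F'b: "\<bar>?F' r\<bar> \<le> 24 * m" if "0 < r" "r \<le> s" for r
  proof -
    let ?c = "\<lambda>j k y. dir_deriv (axis j 1) (w k) (x + r *\<^sub>R y)"
    have cc: "continuous_on unit_cube (?c j i)" for i j
      by (rule continuous_on_compose2[OF smooth_on_imp_continuous[OF smooth_on_dir_deriv[OF w]]])
        (use that in \<open>auto intro!: continuous_intros inS\<close>)
    have Br: "ball x (2 * r) \<subseteq> S" using B that by (intro subset_trans[OF subset_ball B]) auto
    have "?F' r = ?F' r - integral unit_cube (\<lambda>y. bump_weight y * (\<Sum>j\<in>UNIV. y $ j * ?c k j y))"
      using bump_divergence[OF w Br that(1) div] by simp
    also have "\<dots> = integral unit_cube (\<lambda>y. bump_weight y * (\<Sum>j\<in>UNIV. y $ j * ?c j k y) - bump_weight y * (\<Sum>j\<in>UNIV. y $ j * ?c k j y))"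
      by (rule integral_diff[symmetric]) (intro integrable_continuous continuous_intros cc)+
    finally have e: "?F' r = integral unit_cube (\<lambda>y. bump_weight y * (\<Sum>j\<in>UNIV. y $ j * ?c j k y) - bump_weight y * (\<Sum>j\<in>UNIV. y $ j * ?c k j y))" .
    \<comment> \<open>The factor 8 is the volume of the cube; 3 counts the curl entries, each
      weighted by a coordinate of size at most 1.\<close>
    have "\<bar>?F' r\<bar> \<le> 8 * (3 * m)" unfolding e
    proof (rule integral_unit_cube_bound)
      fix y assume y: "y \<in> unit_cube"
      have "bump_weight y * (\<Sum>j\<in>UNIV. y $ j * ?c j k y) - bump_weight y * (\<Sum>j\<in>UNIV. y $ j * ?c k j y)
        = bump_weight y * (\<Sum>j\<in>UNIV. y $ j * (?c j k y - ?c k j y))"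
        by (simp add: right_diff_distrib sum_subtractf)
      moreover have "\<bar>bump_weight y * (\<Sum>j\<in>UNIV. y $ j * (?c j k y - ?c k j y))\<bar> \<le> 1 * (\<Sum>j\<in>(UNIV::3 set). 1 * m)"
        unfolding abs_mult
      proof (intro mult_mono)
        show "\<bar>\<Sum>j\<in>UNIV. y $ j * (?c j k y - ?c k j y)\<bar> \<le> (\<Sum>j\<in>(UNIV::3 set). 1 * m)"
          using unit_cube_component[OF y] curl[OF inB[OF y, of r]] that
          by (intro order_trans[OF sum_abs] sum_mono) (auto simp: abs_mult intro!: mult_mono[where b="1::real", simplified])
      qed (auto simp: bump_weight_bounds)
      ultimately show "\<bar>bump_weight y * (\<Sum>j\<in>UNIV. y $ j * ?c j k y) - bump_weight y * (\<Sum>j\<in>UNIV. y $ j * ?c k j y)\<bar> \<le> 3 * m" by simp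
    next
      show "continuous_on unit_cube (\<lambda>y. bump_weight y * (\<Sum>j\<in>UNIV. y $ j * ?c j k y) - bump_weight y * (\<Sum>j\<in>UNIV. y $ j * ?c k j y))"
        by (intro continuous_intros cc)
      show "0 \<le> 3 * m" using m0 by simp
    qed
    then show ?thesis by simp
  qed
  have "continuous_on {0..s} ?F"
    unfolding continuous_on_eq_continuous_within using DERIV_continuous[OF dF] by blast
  note cF = this
  have dF': "(?F has_field_derivative ?F' r) (at r)" if "0 < r" "r < s" for r
    using dF[of r] that at_within_Icc_at[of 0 r s] by simp
  have "?F differentiable (at r)" if "0 < r" "r < s" for r
    using dF'[OF that] real_differentiable_def by blast
  from MVT[OF s cF this] obtain l z where z: "0 < z" "z < s" "DERIV ?F z :> l" "?F s - ?F 0 = (s - 0) * l"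
    by blast
  then have e: "?F s - ?F 0 = s * ?F' z" using DERIV_unique[OF z(3) dF'[OF z(1,2)]] by simp
  have "\<bar>?F s - ?F 0\<bar> \<le> s * (24 * m)"
    unfolding e abs_mult using F'b[of z] z s by (intro mult_mono) auto
  moreover have "?F 0 = bump_mass * w k x" by (simp add: bump_mass_def)
  ultimately show ?thesis by (simp only: mult.commute)
qed

lemma unit_cube_affine_integral:
  fixes g :: "real^3 \<Rightarrow> real"
  assumes g: "continuous_on (cbox (x - s *\<^sub>R 1) (x + s *\<^sub>R 1)) g" and s: "s > 0"
  shows "integral unit_cube (\<lambda>y. g (x + s *\<^sub>R y)) = integral (cbox (x - s *\<^sub>R 1) (x + s *\<^sub>R 1)) g / s ^ 3"
proof -
  have "(x - s *\<^sub>R 1 - x) /\<^sub>R s = - 1" "(x + s *\<^sub>R 1 - x) /\<^sub>R s = 1" using s by simp_all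
  then have "((\<lambda>y. g (s *\<^sub>R y + x)) has_integral (integral (cbox (x - s *\<^sub>R 1) (x + s *\<^sub>R 1)) g /\<^sub>R s ^ 3)) unit_cube"
    using has_integral_affinity'[OF integrable_integral[OF integrable_continuous[OF g]] s, of x] by simp
  then show ?thesis by (simp add: integral_unique add.commute divide_inverse mult.commute)
qed

lemma cube_in_ball:
  fixes x :: "real^3"
  assumes s: "s > 0" and z: "z \<in> cbox (x - s *\<^sub>R 1) (x + s *\<^sub>R 1)"
  shows "z \<in> ball x (2 * s)"
proof -
  define y where "y = (1 / s) *\<^sub>R (z - x)"
  have zy: "z = x + s *\<^sub>R y" using s by (simp add: y_def)
  have "y \<in> unit_cube" unfolding mem_box_cart
  proof
    fix i
    have "(x - s *\<^sub>R 1) $ i \<le> z $ i" "z $ i \<le> (x + s *\<^sub>R 1) $ i" using z by (auto simp: mem_box_cart)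
    then have "s * - 1 \<le> s * y $ i" "s * y $ i \<le> s * 1" by (simp_all add: zy)
    then show "(- 1 :: real^3) $ i \<le> y $ i \<and> y $ i \<le> (1 :: real^3) $ i"
      using s by (simp only: mult_le_cancel_left_pos) simp
  qed
  then have "norm y < 2" using unit_cube_bounds(2) by auto
  then show ?thesis using s by (simp add: zy dist_norm)
qed

text \<open>The average at radius \<open>s\<close> is controlled by the energy. Young's inequality
  is used with the parameter \<mu> = s^(-3/2), for which \<mu>^2 s^3 = 1, so that its constant part
  and its energy part scale alike. The radius remains free for balancing against the curl.\<close>

lemma bounded_curl_L2_bound:
  fixes w :: "3 \<Rightarrow> real^3 \<Rightarrow> real"
  assumes w: "\<And>j. smooth_on S (w j)" and B: "ball x (2 * s) \<subseteq> S" and s: "s > 0"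
    and div: "\<And>z. z \<in> S \<Longrightarrow> (\<Sum>j\<in>UNIV. dir_deriv (axis j 1) (w j) z) = 0"
    and curl: "\<And>z j k. z \<in> ball x (2 * s) \<Longrightarrow> \<bar>dir_deriv (axis j 1) (w k) z - dir_deriv (axis k 1) (w j) z\<bar> \<le> m"
    and E: "integral (cbox (x - s *\<^sub>R 1) (x + s *\<^sub>R 1)) (\<lambda>z. (w k z)\<^sup>2) \<le> E"
  shows "bump_mass * \<bar>w k x\<bar> \<le> 24 * m * s + (4 + E / 2) * s powr (-3/2)"
proof -
  define \<mu> where "\<mu> = s powr (-3/2)"
  have \<mu>: "\<mu> > 0" using s by (simp add: \<mu>_def)
  have \<mu>2: "\<mu> * \<mu> * s ^ 3 = 1"
    using s unfolding \<mu>_def powr_add[symmetric] by (simp add: powr_minus powr_numeral)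
  have sub: "cbox (x - s *\<^sub>R 1) (x + s *\<^sub>R 1) \<subseteq> S" using cube_in_ball[OF s] B by blast
  have cw2: "continuous_on (cbox (x - s *\<^sub>R 1) (x + s *\<^sub>R 1)) (\<lambda>z. (w k z)\<^sup>2)"
    by (intro continuous_intros continuous_on_subset[OF smooth_on_imp_continuous[OF w] sub])
  have cw: "continuous_on unit_cube (\<lambda>y. w k (x + s *\<^sub>R y))"
    by (rule continuous_on_subset[OF smooth_on_imp_continuous[OF scaled_smooth(1)[OF w B s]] unit_cube_bounds(2)])
  have "norm (integral unit_cube (\<lambda>y. bump_weight y * w k (x + s *\<^sub>R y)))
      \<le> integral unit_cube (\<lambda>y. \<mu> / 2 + 1 / (2 * \<mu>) * (w k (x + s *\<^sub>R y))\<^sup>2)"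
  proof (rule integral_norm_bound_integral)
    show "(\<lambda>y. bump_weight y * w k (x + s *\<^sub>R y)) integrable_on unit_cube"
      "(\<lambda>y. \<mu> / 2 + 1 / (2 * \<mu>) * (w k (x + s *\<^sub>R y))\<^sup>2) integrable_on unit_cube"
      by (intro integrable_continuous continuous_intros cw)+
    fix y
    have "norm (bump_weight y * w k (x + s *\<^sub>R y)) \<le> 1 * \<bar>w k (x + s *\<^sub>R y)\<bar>"
      unfolding real_norm_def abs_mult using bump_weight_bounds[of y] by (intro mult_right_mono) auto
    also have "\<dots> \<le> \<mu> / 2 + 1 / (2 * \<mu>) * (w k (x + s *\<^sub>R y))\<^sup>2"
    proof -
      have "0 \<le> (\<mu> - \<bar>w k (x + s *\<^sub>R y)\<bar>)\<^sup>2 / (2 * \<mu>)" using \<mu> by simp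
      also have "\<dots> = \<mu> / 2 + 1 / (2 * \<mu>) * (w k (x + s *\<^sub>R y))\<^sup>2 - \<bar>w k (x + s *\<^sub>R y)\<bar>"
        using \<mu> by (simp add: power2_diff field_simps) (simp add: power2_eq_square)
      finally show ?thesis by simp
    qed
    finally show "norm (bump_weight y * w k (x + s *\<^sub>R y)) \<le> \<mu> / 2 + 1 / (2 * \<mu>) * (w k (x + s *\<^sub>R y))\<^sup>2" .
  qed
  also have "\<dots> = 4 * \<mu> + 1 / (2 * \<mu>) * integral unit_cube (\<lambda>y. (w k (x + s *\<^sub>R y))\<^sup>2)"
  proof -
    have "integral unit_cube (\<lambda>y. \<mu> / 2 + 1 / (2 * \<mu>) * (w k (x + s *\<^sub>R y))\<^sup>2)
      = integral unit_cube (\<lambda>y. \<mu> / 2) + integral unit_cube (\<lambda>y. 1 / (2 * \<mu>) * (w k (x + s *\<^sub>R y))\<^sup>2)"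
      by (intro integral_add integrable_continuous continuous_intros cw)
    then show ?thesis by (simp add: unit_cube_content)
  qed
  also have "\<dots> = 4 * \<mu> + 1 / (2 * \<mu>) * (integral (cbox (x - s *\<^sub>R 1) (x + s *\<^sub>R 1)) (\<lambda>z. (w k z)\<^sup>2) / s ^ 3)"
    by (subst unit_cube_affine_integral[OF cw2 s]) simp
  also have "\<dots> \<le> 4 * \<mu> + 1 / (2 * \<mu>) * (E / s ^ 3)"
    using E s \<mu> by (intro add_left_mono mult_left_mono divide_right_mono) auto
  also have "1 / (2 * \<mu>) * (E / s ^ 3) = (\<mu> * \<mu> * s ^ 3) * (1 / (2 * \<mu>) * (E / s ^ 3))" unfolding \<mu>2 by simp
  also have "\<dots> = E / 2 * \<mu>" using \<mu> s by (simp add: field_simps)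
  finally have "\<bar>integral unit_cube (\<lambda>y. bump_weight y * w k (x + s *\<^sub>R y))\<bar> \<le> 4 * \<mu> + E / 2 * \<mu>" by simp
  moreover have "\<bar>bump_mass * w k x\<bar> = bump_mass * \<bar>w k x\<bar>" using bump_mass_pos by (simp add: abs_mult)
  ultimately show ?thesis using bump_average_deviation[OF w B s div curl, of k]
    unfolding \<mu>_def[symmetric] distrib_right by linarith
qed

text \<open>Averages at radius \<open>s\<close> are Lipschitz in the centre with constant of order V
  / s, because the derivative can be moved onto the bump; the factor 32 is 8 times the bound 4 on
  its gradient. Each endpoint costs the deviation \<open>24 * m * s\<close>. The gain \<tau> / s is
  what later shows that a component vanishing on the axis is small near it.\<close>

lemma bounded_curl_difference_bound:
  fixes w :: "3 \<Rightarrow> real^3 \<Rightarrow> real"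
  assumes w: "\<And>j. smooth_on S (w j)" and s: "s > 0" and \<tau>: "\<tau> \<ge> 0" and e: "norm e = 1"
    and B: "\<And>r. 0 \<le> r \<Longrightarrow> r \<le> \<tau> \<Longrightarrow> ball (x + r *\<^sub>R e) (2 * s) \<subseteq> S"
    and div: "\<And>z. z \<in> S \<Longrightarrow> (\<Sum>j\<in>UNIV. dir_deriv (axis j 1) (w j) z) = 0"
    and curl: "\<And>z j k. z \<in> S \<Longrightarrow> \<bar>dir_deriv (axis j 1) (w k) z - dir_deriv (axis k 1) (w j) z\<bar> \<le> m"
    and V: "\<And>z. z \<in> S \<Longrightarrow> \<bar>w k z\<bar> \<le> V"
  shows "bump_mass * \<bar>w k (x + \<tau> *\<^sub>R e) - w k x\<bar> \<le> 48 * m * s + 32 * V * \<tau> / s"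
proof -
  let ?G = "\<lambda>r. integral unit_cube (\<lambda>y. bump_weight y * w k (x + r *\<^sub>R e + s *\<^sub>R y))"
  let ?G' = "\<lambda>r. integral unit_cube (\<lambda>y. bump_weight y * dir_deriv e (w k) (x + r *\<^sub>R e + s *\<^sub>R y))"
  have inS: "x + r *\<^sub>R e + s *\<^sub>R y \<in> S" if "y \<in> unit_cube" "0 \<le> r" "r \<le> \<tau>" for y r
    using subsetD[OF unit_cube_bounds(2) that(1)] s by (intro subsetD[OF B[OF that(2,3)]]) (simp add: dist_norm)
  have V0: "0 \<le> V"
  proof -
    have "x \<in> S" using B[of 0] \<tau> s by auto
    then show ?thesis using V[of x] by linarith
  qed
  have dG: "(?G has_field_derivative ?G' r) (at r within {0..\<tau>})" if "r \<in> {0..\<tau>}" for r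
  proof (rule leibniz_rule_field_derivative)
    fix r y assume ry: "r \<in> {0..\<tau>}" "y \<in> unit_cube"
    have c: "x + r *\<^sub>R e + s *\<^sub>R y = (x + s *\<^sub>R y) + r *\<^sub>R e" for r by simp
    have "w k differentiable (at (x + r *\<^sub>R e + s *\<^sub>R y))" using inS ry by (intro smooth_on_imp_differentiable[OF w]) auto
    from DERIV_along_line_real[OF this[unfolded c]]
    show "((\<lambda>r. bump_weight y * w k (x + r *\<^sub>R e + s *\<^sub>R y)) has_field_derivative
        bump_weight y * dir_deriv e (w k) (x + r *\<^sub>R e + s *\<^sub>R y)) (at r within {0..\<tau>})"
      unfolding c by (rule has_field_derivative_at_within[OF DERIV_cmult])
  next
    fix r assume "r \<in> {0..\<tau>}"
    then show "(\<lambda>y. bump_weight y * w k (x + r *\<^sub>R e + s *\<^sub>R y)) integrable_on unit_cube"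
      by (intro integrable_continuous continuous_intros continuous_on_compose2[OF smooth_on_imp_continuous[OF w]]) (auto intro: inS)
  next
    show "continuous_on ({0..\<tau>} \<times> unit_cube) (\<lambda>(r, y). bump_weight y * dir_deriv e (w k) (x + r *\<^sub>R e + s *\<^sub>R y))"
      unfolding split_beta by (intro continuous_intros continuous_on_compose2[OF smooth_on_imp_continuous[OF smooth_on_dir_deriv[OF w]]])
        (auto intro: inS)
  qed (use that in auto)
  have G'b: "\<bar>?G' r\<bar> \<le> 32 * V / s" if r: "0 \<le> r" "r \<le> \<tau>" for r
  proof -
    let ?f = "\<lambda>y. w k (x + r *\<^sub>R e + s *\<^sub>R y)"
    note sf = scaled_smooth[OF w B[OF r] s]
    have db: "bump_weight differentiable (at y)" for y
      using bump_weight_has_derivative differentiable_def by blast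
    have cb: "continuous_on UNIV (dir_deriv e bump_weight)"
      unfolding bump_weight_dir_deriv by (intro continuous_intros)
    have ibp: "integral unit_cube (\<lambda>y. ?f y * dir_deriv e bump_weight y) = - integral unit_cube (\<lambda>y. dir_deriv e ?f y * bump_weight y)"
      by (rule integral_by_parts_C1[OF open_ball unit_cube_bounds(2) sf(1) compact_cball unit_cube_bounds(1) db cb bump_weight_support])
    have "integral unit_cube (\<lambda>y. dir_deriv e ?f y * bump_weight y) = integral unit_cube (\<lambda>y. s * (bump_weight y * dir_deriv e (w k) (x + r *\<^sub>R e + s *\<^sub>R y)))"
      by (rule integral_cong) (use sf(2) unit_cube_bounds(2) in \<open>simp add: subset_iff\<close>)
    then have e1: "s * ?G' r = - integral unit_cube (\<lambda>y. ?f y * dir_deriv e bump_weight y)" using ibp by simp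
    have b1: "\<bar>integral unit_cube (\<lambda>y. ?f y * dir_deriv e bump_weight y)\<bar> \<le> 8 * (V * 4)"
    proof (rule integral_unit_cube_bound)
      show "continuous_on unit_cube (\<lambda>y. ?f y * dir_deriv e bump_weight y)"
        by (intro continuous_intros continuous_on_subset[OF smooth_on_imp_continuous[OF sf(1)] unit_cube_bounds(2)]
            continuous_on_subset[OF cb]) auto
      fix y assume y: "y \<in> unit_cube"
      have "\<bar>dir_deriv e bump_weight y\<bar> \<le> 4"
      proof (cases "y \<bullet> y < 1")
        case True
        then have "(norm y)\<^sup>2 < 1\<^sup>2" unfolding power2_norm_eq_inner by simp
        then have "norm y < 1" by (rule power_less_imp_less_base) simp
        then have "\<bar>y \<bullet> e\<bar> \<le> 1" using Cauchy_Schwarz_ineq2[of y e] e by simp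
        moreover have "\<bar>max 0 (1 - y \<bullet> y)\<bar> \<le> 1" using True by auto
        ultimately have "\<bar>max 0 (1 - y \<bullet> y)\<bar> * \<bar>y \<bullet> e\<bar> \<le> 1 * 1" by (intro mult_mono) auto
        then show ?thesis by (simp add: bump_weight_dir_deriv abs_mult)
      next
        case False then show ?thesis by (simp add: bump_weight_dir_deriv)
      qed
      then show "\<bar>?f y * dir_deriv e bump_weight y\<bar> \<le> V * 4"
        unfolding abs_mult using V[OF inS[OF y r]] V0 by (intro mult_mono) auto
    qed (use V0 in simp)
    have "\<bar>s * ?G' r\<bar> = \<bar>integral unit_cube (\<lambda>y. ?f y * dir_deriv e bump_weight y)\<bar>"
      by (simp only: e1 abs_minus_cancel)
    then have "\<bar>s * ?G' r\<bar> \<le> 32 * V" using b1 by linarith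
    then have "\<bar>?G' r\<bar> * s \<le> 32 * V" unfolding abs_mult abs_of_pos[OF s] by (subst mult.commute)
    then show ?thesis by (subst pos_le_divide_eq[OF s])
  qed
  have "norm (?G \<tau> - ?G 0) \<le> 32 * V / s * norm (\<tau> - 0)"
  proof (rule field_differentiable_bound)
    show "convex {0..\<tau>}" "\<tau> \<in> {0..\<tau>}" "0 \<in> {0..\<tau>}" using \<tau> by auto
    show "(?G has_field_derivative ?G' r) (at r within {0..\<tau>})" if "r \<in> {0..\<tau>}" for r by (rule dG[OF that])
    show "norm (?G' r) \<le> 32 * V / s" if "r \<in> {0..\<tau>}" for r using G'b[of r] that unfolding real_norm_def atLeastAtMost_iff by blast
  qed
  moreover have "32 * V / s * norm (\<tau> - 0) = 32 * V * \<tau> / s" using \<tau> by simp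
  ultimately have 1: "\<bar>?G \<tau> - ?G 0\<bar> \<le> 32 * V * \<tau> / s" by (simp only: real_norm_def)
  have 2: "\<bar>?G r - bump_mass * w k (x + r *\<^sub>R e)\<bar> \<le> 24 * m * s" if r: "0 \<le> r" "r \<le> \<tau>" for r
    by (rule bump_average_deviation[OF w B[OF r] s div curl]) (use B[OF r] in auto)
  have "\<bar>bump_mass * w k (x + \<tau> *\<^sub>R e) - bump_mass * w k x\<bar> \<le> 48 * m * s + 32 * V * \<tau> / s"
  proof -
    have tri: "\<bar>c - d\<bar> \<le> 48 * m * s + p" if "\<bar>a - b\<bar> \<le> p" "\<bar>a - c\<bar> \<le> 24 * m * s" "\<bar>b - d\<bar> \<le> 24 * m * s" for a b c d p :: real
      using that by linarith
    have x0: "x + 0 *\<^sub>R e = x" by simp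
    show ?thesis using tri[OF 1 2[OF \<tau> order_refl] 2[OF order_refl \<tau>]] unfolding x0 .
  qed
  then show ?thesis unfolding right_diff_distrib[symmetric] abs_mult abs_of_pos[OF bump_mass_pos] .
qed

subsection \<open>The equations in classical form\<close>

abbreviation component :: "(spacetime \<Rightarrow> real^3) \<Rightarrow> 3 \<Rightarrow> spacetime \<Rightarrow> real" where "component u k \<equiv> \<lambda>z. u z $ k"
abbreviation coord :: "3 \<Rightarrow> spacetime \<Rightarrow> real" where "coord k \<equiv> \<lambda>z. fst z $ k"

lemma open_Q [simp]: "open Q"
  unfolding parabolic_cylinder_def by (intro open_Times) auto

lemma Q_lebesgue [simp]: "Q \<in> sets lebesgue" by auto

lemma smooth_on_comp: "smooth_on Q u \<Longrightarrow> smooth_on Q (component u k)"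
  using smooth_on_linear[OF bounded_linear_vec_nth open_Q] .

lemma smooth_on_dx: "smooth_on S f \<Longrightarrow> smooth_on S (dx i f)"
  unfolding dx_eq by (rule smooth_on_dir_deriv)

lemma smooth_on_dt: "smooth_on S f \<Longrightarrow> smooth_on S (dt f)"
  unfolding dt_eq by (rule smooth_on_dir_deriv)

lemma dx_cong: "(\<And>z. z \<in> Q \<Longrightarrow> f z = g z) \<Longrightarrow> z \<in> Q \<Longrightarrow> dx i f z = dx i g z"
  unfolding dx_eq by (rule dir_deriv_cong_open[OF open_Q])

lemma dx_component: "smooth_on Q u \<Longrightarrow> z \<in> Q \<Longrightarrow> dx i u z $ k = dx i (component u k) z"
  unfolding dx_eq using dir_deriv_comp_linear[OF bounded_linear_vec_nth smooth_on_imp_differentiable] by metis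

text \<open>Entries of the weak gradient are only known to be square integrable. The cylinder has
  finite measure, so |G| \<le> 1 + |G|^2 makes them integrable against a bounded function.\<close>

lemma integrable_L2_mult_test:
  fixes g :: "spacetime \<Rightarrow> real" and G :: "spacetime \<Rightarrow> 'b::euclidean_space"
  assumes G: "in_Lp 2 Q G" and g: "g \<in> borel_measurable (lebesgue_on Q)" "\<And>z. \<bar>g z\<bar> \<le> norm (G z)"
    and \<phi>: "test_function Q \<phi>"
  shows "integrable (lebesgue_on Q) (\<lambda>z. g z * \<phi> z)"
proof -
  obtain K where K: "smooth_on UNIV \<phi>" "compact K" "K \<subseteq> Q" "\<And>x. x \<notin> K \<Longrightarrow> \<phi> x = 0"
    using test_functionD[OF \<phi>] by metis
  have c: "continuous_on UNIV \<phi>" using smooth_on_imp_continuous[OF K(1)] .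
  have "bounded (\<phi> ` K)" by (rule compact_imp_bounded[OF compact_continuous_image[OF continuous_on_subset[OF c] K(2)]]) simp
  then obtain B where B: "B > 0" "\<And>x. x \<in> K \<Longrightarrow> \<bar>\<phi> x\<bar> \<le> B" by (auto simp: bounded_pos)
  then have B': "\<bar>\<phi> x\<bar> \<le> B" for x using K(4)[of x] by (cases "x \<in> K") auto
  have "bounded Q" unfolding parabolic_cylinder_def by (intro bounded_Times) auto
  then have "Q \<in> lmeasurable" using Q_lebesgue by (rule bounded_set_imp_lmeasurable)
  then interpret finite_measure "lebesgue_on Q" by (rule finite_measure_lebesgue_on)
  have "integrable (lebesgue_on Q) (\<lambda>z. B * (1 + norm (G z) powr 2))"
    using G unfolding in_Lp_def
    by (intro integrable_mult_right Bochner_Integration.integrable_add integrable_const) auto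
  then show ?thesis
  proof (rule Bochner_Integration.integrable_bound)
    have "\<phi> \<in> borel_measurable (lebesgue_on Q)"
      by (rule continuous_imp_measurable_on_sets_lebesgue[OF continuous_on_subset[OF c]]) auto
    then show "(\<lambda>z. g z * \<phi> z) \<in> borel_measurable (lebesgue_on Q)" using g by simp
    show "AE z in lebesgue_on Q. norm (g z * \<phi> z) \<le> norm (B * (1 + norm (G z) powr 2))"
    proof (rule AE_I2)
      fix z
      have n: "norm (G z) \<le> 1 + norm (G z) powr 2"
      proof (cases "norm (G z) \<le> 1")
        case False
        then have "norm (G z) powr 1 \<le> norm (G z) powr 2" by (intro powr_mono) auto
        then show ?thesis using False by simp
      qed (simp add: add_increasing2)
      have "norm (g z * \<phi> z) \<le> norm (G z) * B"
        using g(2)[of z] B'[of z] by (simp add: abs_mult mult_mono)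
      also have "\<dots> \<le> (1 + norm (G z) powr 2) * B" using n B by (intro mult_right_mono) auto
      finally show "norm (g z * \<phi> z) \<le> norm (B * (1 + norm (G z) powr 2))" using B by (simp add: abs_mult mult.commute)
    qed
  qed
qed

lemma test_dx: "test_function Q \<phi> \<Longrightarrow> test_function Q (dx i \<phi>)"
  unfolding dx_eq by (rule test_function_dir_deriv)

lemma test_dt: "test_function Q \<phi> \<Longrightarrow> test_function Q (dt \<phi>)"
  unfolding dt_eq by (rule test_function_dir_deriv)

lemma integrable_smooth_test:
  fixes f :: "spacetime \<Rightarrow> real"
  shows "smooth_on Q f \<Longrightarrow> test_function Q \<phi> \<Longrightarrow> integrable (lebesgue_on Q) (\<lambda>x. f x * \<phi> x)"
  by (rule integrable_mult_test[OF open_Q smooth_on_imp_continuous])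

lemma ibp_dx:
  fixes f :: "spacetime \<Rightarrow> real"
  shows "smooth_on Q f \<Longrightarrow> test_function Q \<phi> \<Longrightarrow> (LINT x|lebesgue_on Q. f x * dx i \<phi> x) = - (LINT x|lebesgue_on Q. dx i f x * \<phi> x)"
  unfolding dx_eq by (rule integral_by_parts_test[OF open_Q])

lemma ibp_dt:
  fixes f :: "spacetime \<Rightarrow> real"
  shows "smooth_on Q f \<Longrightarrow> test_function Q \<phi> \<Longrightarrow> (LINT x|lebesgue_on Q. f x * dt \<phi> x) = - (LINT x|lebesgue_on Q. dt f x * \<phi> x)"
  unfolding dt_eq by (rule integral_by_parts_test[OF open_Q])

lemma classical_divergence:
  assumes sol: "suitable_weak_solution u p" and u: "smooth_on Q u" and z: "z \<in> Q"
  shows "(\<Sum>i\<in>UNIV. dx i (component u i) z) = 0"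
proof (rule continuous_eq_0_if_test_integrals_0[OF open_Q _ _ z])
  note su = smooth_on_comp[OF u]
  show "continuous_on Q (\<lambda>z. \<Sum>i\<in>UNIV. dx i (component u i) z)"
    by (intro continuous_on_sum smooth_on_imp_continuous[OF smooth_on_dx[OF su]])
  fix \<phi> :: "spacetime \<Rightarrow> real" assume \<phi>: "test_function Q \<phi>"
  have "(LINT z|lebesgue_on Q. (\<Sum>i\<in>UNIV. dx i (component u i) z) * \<phi> z)
      = (\<Sum>i\<in>UNIV. LINT z|lebesgue_on Q. dx i (component u i) z * \<phi> z)"
    unfolding sum_distrib_right
    by (rule Bochner_Integration.integral_sum) (rule integrable_smooth_test[OF smooth_on_dx[OF su] \<phi>])
  also have "\<dots> = - (\<Sum>i\<in>UNIV. LINT z|lebesgue_on Q. component u i z * dx i \<phi> z)"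
    unfolding ibp_dx[OF su \<phi>] by (simp add: sum_negf)
  also have "(\<Sum>i\<in>UNIV. LINT z|lebesgue_on Q. component u i z * dx i \<phi> z) = (LINT z|lebesgue_on Q. (\<Sum>i\<in>UNIV. component u i z * dx i \<phi> z))"
    by (rule Bochner_Integration.integral_sum[symmetric]) (rule integrable_smooth_test[OF su test_dx[OF \<phi>]])
  also have "\<dots> = (LINT z|lebesgue_on Q. u z \<bullet> grad \<phi> z)" by (simp add: inner_vec_def grad_def)
  also have "\<dots> = 0" using sol \<phi> by (auto simp: suitable_weak_solution_def)
  finally show "(LINT z|lebesgue_on Q. (\<Sum>i\<in>UNIV. dx i (component u i) z) * \<phi> z) = 0" by simp
qed

text \<open>The only term that is not classical from the outset is \<open>G z *v u z\<close>. Since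
  \<open>u\<close> is smooth, a component of it times \<phi> is itself a test function, and the
  definition of the weak gradient with this test function replaces \<open>G\<close> by the classical
  derivative. All other terms are integrated by parts.\<close>

lemma classical_momentum:
  assumes sol: "suitable_weak_solution u p" and u: "smooth_on Q u" and p: "smooth_on Q p" and z: "z \<in> Q"
  shows "dt (component u k) z + (\<Sum>i\<in>UNIV. component u i z * dx i (component u k) z) - (\<Sum>i\<in>UNIV. dx i (dx i (component u k)) z) + dx k p z = 0"
proof (rule continuous_eq_0_if_test_integrals_0[OF open_Q _ _ z])
  note su = smooth_on_comp[OF u]
  note [simp] = smooth_on_imp_continuous su smooth_on_dx smooth_on_dt p
  show "continuous_on Q (\<lambda>z. dt (component u k) z + (\<Sum>i\<in>UNIV. component u i z * dx i (component u k) z) - (\<Sum>i\<in>UNIV. dx i (dx i (component u k)) z) + dx k p z)"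
    by (intro smooth_on_imp_continuous smooth_on_add smooth_on_diff smooth_on_sum smooth_on_mult open_Q su smooth_on_dx smooth_on_dt p)
  fix \<phi> :: "spacetime \<Rightarrow> real" assume \<phi>: "test_function Q \<phi>"
  obtain G where G: "L2H1_gradient u G" and
    weak: "(LINT z|lebesgue_on Q. - (u z $ k * dt \<phi> z) + (G z *v u z) $ k * \<phi> z - u z $ k * laplacian \<phi> z - p z * dx k \<phi> z) = 0"
    using sol \<phi> unfolding suitable_weak_solution_def by blast
  have G2: "in_Lp 2 Q G" using G by (simp add: L2H1_gradient_def)
  have Gm: "(\<lambda>z. G z $ k $ i) \<in> borel_measurable (lebesgue_on Q)" for i
  proof -
    have "(\<lambda>z. G z) \<in> borel_measurable (lebesgue_on Q)" using G2 by (simp add: in_Lp_def)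
    then show ?thesis
      by (rule measurable_compose) (intro borel_measurable_continuous_onI continuous_intros)
  qed
  have Gb: "\<bar>G z $ k $ i\<bar> \<le> norm (G z)" for z i
    using Finite_Cartesian_Product.norm_nth_le[of "G z $ k" i] Finite_Cartesian_Product.norm_nth_le[of "G z" k] by simp
  have u\<phi>: "test_function Q (\<lambda>z. component u i z * \<phi> z)" for i by (rule test_function_mult[OF open_Q su \<phi>])
  note intG = integrable_L2_mult_test[OF G2 Gm Gb u\<phi>]
  have Geq: "(LINT z|lebesgue_on Q. G z $ k $ i * (component u i z * \<phi> z)) = (LINT z|lebesgue_on Q. component u i z * dx i (component u k) z * \<phi> z)" for i
  proof -
    have "(LINT z|lebesgue_on Q. component u k z * dx i (\<lambda>z. component u i z * \<phi> z) z) = - (LINT z|lebesgue_on Q. G z $ k $ i * (component u i z * \<phi> z))"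
      using G u\<phi>[of i] by (simp add: L2H1_gradient_def)
    then show ?thesis using ibp_dx[OF su u\<phi>, of k i i] by (simp add: mult_ac)
  qed
  let ?I = "\<lambda>f. LINT z|lebesgue_on Q. f z"
  have t1: "?I (\<lambda>z. component u k z * dt \<phi> z) = - ?I (\<lambda>z. dt (component u k) z * \<phi> z)" by (rule ibp_dt[OF su \<phi>])
  have t2: "?I (\<lambda>z. (G z *v u z) $ k * \<phi> z) = ?I (\<lambda>z. (\<Sum>i\<in>UNIV. component u i z * dx i (component u k) z) * \<phi> z)"
    and i2: "integrable (lebesgue_on Q) (\<lambda>z. (G z *v u z) $ k * \<phi> z)"
  proof -
    have e: "(G z *v u z) $ k * \<phi> z = (\<Sum>i\<in>UNIV. G z $ k $ i * (component u i z * \<phi> z))" for z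
      by (simp add: matrix_vector_mult_def sum_distrib_right mult.assoc)
    show "integrable (lebesgue_on Q) (\<lambda>z. (G z *v u z) $ k * \<phi> z)" unfolding e by (intro Bochner_Integration.integrable_sum intG)
    have "?I (\<lambda>z. (G z *v u z) $ k * \<phi> z) = (\<Sum>i\<in>UNIV. ?I (\<lambda>z. G z $ k $ i * (component u i z * \<phi> z)))"
      unfolding e by (intro Bochner_Integration.integral_sum intG)
    also have "\<dots> = (\<Sum>i\<in>UNIV. ?I (\<lambda>z. component u i z * dx i (component u k) z * \<phi> z))" by (simp only: Geq)
    also have "\<dots> = ?I (\<lambda>z. \<Sum>i\<in>UNIV. component u i z * dx i (component u k) z * \<phi> z)"
      by (intro Bochner_Integration.integral_sum[symmetric] integrable_smooth_test smooth_on_mult open_Q \<phi>) simp_all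
    finally show "?I (\<lambda>z. (G z *v u z) $ k * \<phi> z) = ?I (\<lambda>z. (\<Sum>i\<in>UNIV. component u i z * dx i (component u k) z) * \<phi> z)"
      by (simp only: sum_distrib_right)
  qed
  have t3: "?I (\<lambda>z. component u k z * laplacian \<phi> z) = ?I (\<lambda>z. (\<Sum>i\<in>UNIV. dx i (dx i (component u k)) z) * \<phi> z)"
    and i3: "integrable (lebesgue_on Q) (\<lambda>z. component u k z * laplacian \<phi> z)"
  proof -
    have e: "component u k z * laplacian \<phi> z = (\<Sum>i\<in>UNIV. component u k z * dx i (dx i \<phi>) z)" for z
      by (simp add: laplacian_def sum_distrib_left)
    show "integrable (lebesgue_on Q) (\<lambda>z. component u k z * laplacian \<phi> z)" unfolding e
      by (intro Bochner_Integration.integrable_sum integrable_smooth_test su test_dx \<phi>)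
    have "?I (\<lambda>z. component u k z * laplacian \<phi> z) = (\<Sum>i\<in>UNIV. ?I (\<lambda>z. component u k z * dx i (dx i \<phi>) z))"
      unfolding e by (intro Bochner_Integration.integral_sum integrable_smooth_test su test_dx \<phi>)
    also have "\<dots> = (\<Sum>i\<in>UNIV. ?I (\<lambda>z. dx i (dx i (component u k)) z * \<phi> z))"
      by (simp add: ibp_dx[OF su test_dx[OF \<phi>]] ibp_dx[OF smooth_on_dx[OF su] \<phi>])
    also have "\<dots> = ?I (\<lambda>z. \<Sum>i\<in>UNIV. dx i (dx i (component u k)) z * \<phi> z)"
      by (intro Bochner_Integration.integral_sum[symmetric] integrable_smooth_test \<phi>) simp_all
    finally show "?I (\<lambda>z. component u k z * laplacian \<phi> z) = ?I (\<lambda>z. (\<Sum>i\<in>UNIV. dx i (dx i (component u k)) z) * \<phi> z)"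
      by (simp only: sum_distrib_right)
  qed
  have t4: "?I (\<lambda>z. p z * dx k \<phi> z) = - ?I (\<lambda>z. dx k p z * \<phi> z)" by (rule ibp_dx[OF p \<phi>])
  have i1: "integrable (lebesgue_on Q) (\<lambda>z. component u k z * dt \<phi> z)" by (rule integrable_smooth_test[OF su test_dt[OF \<phi>]])
  have i4: "integrable (lebesgue_on Q) (\<lambda>z. p z * dx k \<phi> z)" by (rule integrable_smooth_test[OF p test_dx[OF \<phi>]])
  have "0 = - ?I (\<lambda>z. component u k z * dt \<phi> z) + ?I (\<lambda>z. (G z *v u z) $ k * \<phi> z) - ?I (\<lambda>z. component u k z * laplacian \<phi> z) - ?I (\<lambda>z. p z * dx k \<phi> z)"
    using weak i1 i2 i3 i4 by simp
  also have "\<dots> = ?I (\<lambda>z. dt (component u k) z * \<phi> z) + ?I (\<lambda>z. (\<Sum>i\<in>UNIV. component u i z * dx i (component u k) z) * \<phi> z)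
     - ?I (\<lambda>z. (\<Sum>i\<in>UNIV. dx i (dx i (component u k)) z) * \<phi> z) + ?I (\<lambda>z. dx k p z * \<phi> z)"
    unfolding t1 t2 t3 t4 by simp
  also have "\<dots> = ?I (\<lambda>z. dt (component u k) z * \<phi> z + (\<Sum>i\<in>UNIV. component u i z * dx i (component u k) z) * \<phi> z
     - (\<Sum>i\<in>UNIV. dx i (dx i (component u k)) z) * \<phi> z + dx k p z * \<phi> z)"
  proof -
    have j: "integrable (lebesgue_on Q) (\<lambda>z. dt (component u k) z * \<phi> z)"
      "integrable (lebesgue_on Q) (\<lambda>z. (\<Sum>i\<in>UNIV. component u i z * dx i (component u k) z) * \<phi> z)"
      "integrable (lebesgue_on Q) (\<lambda>z. (\<Sum>i\<in>UNIV. dx i (dx i (component u k)) z) * \<phi> z)"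
      "integrable (lebesgue_on Q) (\<lambda>z. dx k p z * \<phi> z)"
      by (intro integrable_smooth_test \<phi> smooth_on_sum smooth_on_mult open_Q; simp)+
    show ?thesis by (simp only: Bochner_Integration.integral_add Bochner_Integration.integral_diff Bochner_Integration.integrable_add Bochner_Integration.integrable_diff j)
  qed
  finally show "?I (\<lambda>z. (dt (component u k) z + (\<Sum>i\<in>UNIV. component u i z * dx i (component u k) z) - (\<Sum>i\<in>UNIV. dx i (dx i (component u k)) z) + dx k p z) * \<phi> z) = 0"
    by (simp only: distrib_right left_diff_distrib)
qed

subsection \<open>Axial symmetry in infinitesimal form\<close>

definition rot :: "real \<Rightarrow> real^3 \<Rightarrow> real^3" where
  "rot \<theta> x = vector [cos \<theta> * x $ 1 - sin \<theta> * x $ 2, sin \<theta> * x $ 1 + cos \<theta> * x $ 2, x $ 3]"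

definition refl :: "spacetime \<Rightarrow> spacetime" where
  "refl z = (vector [fst z $ 1, - (fst z $ 2), fst z $ 3], snd z)"

text \<open>The derivative with respect to the angle. In this form axial symmetry is a linear
  identity that holds on the axis as well and can be differentiated freely.\<close>

definition rot_deriv :: "(spacetime \<Rightarrow> real) \<Rightarrow> spacetime \<Rightarrow> real" where
  "rot_deriv f z = coord 1 z * dx 2 f z - coord 2 z * dx 1 f z"

lemma rot_components [simp]: "rot \<theta> x $ 1 = cos \<theta> * x $ 1 - sin \<theta> * x $ 2"
  "rot \<theta> x $ 2 = sin \<theta> * x $ 1 + cos \<theta> * x $ 2" "rot \<theta> x $ 3 = x $ 3"
  by (simp_all add: rot_def)

lemma axis_dist2_rot [simp]: "axis_dist2 (rot \<theta> x) = axis_dist2 x"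
proof -
  have "axis_dist2 (rot \<theta> x) = ((sin \<theta>)\<^sup>2 + (cos \<theta>)\<^sup>2) * axis_dist2 x"
    unfolding axis_dist2_def rot_components by algebra
  then show ?thesis by simp
qed

lemma cyl_radius_eq: "cyl_radius x = sqrt (axis_dist2 x)" by (simp add: cyl_radius_def axis_dist2_def)

lemma norm_rot [simp]: "norm (rot \<theta> x) = norm x"
proof -
  have "(norm (rot \<theta> x))\<^sup>2 = (norm x)\<^sup>2"
    unfolding norm_sq_vec3 using axis_dist2_rot[of \<theta> x] unfolding axis_dist2_def by simp
  then show ?thesis by (simp add: power2_eq_iff_nonneg)
qed

lemma rot_in_Q: "(x, t) \<in> Q \<Longrightarrow> (rot \<theta> x, t) \<in> Q" by (simp add: parabolic_cylinder_def)

lemma rot_derivative: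
  fixes f :: "spacetime \<Rightarrow> real"
  assumes f: "f differentiable (at (x, t))"
  shows "((\<lambda>\<theta>. f (rot \<theta> x, t)) has_real_derivative rot_deriv f (x, t)) (at 0)"
proof -
  have r: "rot \<theta> x = (\<Sum>j\<in>UNIV. rot \<theta> x $ j *\<^sub>R axis j 1)" for \<theta>
    using basis_expansion[of "rot \<theta> x"] by (simp add: scalar_mult_eq_scaleR)
  have "((\<lambda>\<theta>. (\<Sum>j\<in>UNIV. rot \<theta> x $ j *\<^sub>R axis j 1 :: real^3, t)) has_vector_derivative ((- (x $ 2)) *\<^sub>R axis 1 1 + x $ 1 *\<^sub>R axis 2 1, 0)) (at 0)"
    unfolding sum_3 rot_components
    by (auto intro!: derivative_eq_intros simp: has_vector_derivative_def scaleR_prod_def algebra_simps)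
  then have d: "((\<lambda>\<theta>. (rot \<theta> x, t)) has_derivative (\<lambda>h. h *\<^sub>R ((- (x $ 2)) *\<^sub>R axis 1 1 + x $ 1 *\<^sub>R axis 2 1, 0))) (at 0)"
    unfolding r[symmetric] has_vector_derivative_def .
  have r0: "rot 0 x = x" by (simp add: vec_eq_iff forall_3)
  have f': "(f has_derivative (\<lambda>v. dir_deriv v f (x, t))) (at (rot 0 x, t))"
    unfolding r0 by (rule has_derivative_dir_deriv[OF f])
  note l = dir_deriv_linear[OF f]
  have lin: "dir_deriv (h *\<^sub>R ((- (x $ 2)) *\<^sub>R axis 1 1 + x $ 1 *\<^sub>R axis 2 1, 0)) f (x, t) = h * rot_deriv f (x, t)" for h
  proof -
    have e: "(h *\<^sub>R ((- (x $ 2)) *\<^sub>R axis 1 1 + x $ 1 *\<^sub>R axis 2 1, 0) :: spacetime) = h *\<^sub>R ((- (x $ 2)) *\<^sub>R (axis 1 1, 0) + x $ 1 *\<^sub>R (axis 2 1, 0))"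
      by simp
    show ?thesis unfolding e linear_scale[OF l] linear_add[OF l] by (simp add: rot_deriv_def dx_eq)
  qed
  show ?thesis unfolding has_field_derivative_def
    by (rule has_derivative_eq_rhs[OF has_derivative_compose[OF d f']], rule ext) (subst lin, rule mult.commute)
qed

text \<open>The cylindrical frame exists only off the axis. Closed conditions are extended to the
  axis by continuity, approaching it along the first coordinate direction.\<close>

lemma off_axis_dense:
  assumes c: "continuous_on Q f" and off: "\<And>x t. (x, t) \<in> Q \<Longrightarrow> axis_dist2 x > 0 \<Longrightarrow> f (x, t) \<in> C" and C: "closed C" and z: "(x, t) \<in> Q"
  shows "f (x, t) \<in> C"
proof (cases "axis_dist2 x > 0")
  case False
  then have x: "x $ 1 = 0" "x $ 2 = 0" by (auto simp: axis_dist2_def not_less sum_power2_le_zero_iff)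
  define g where "g h = (x + h *\<^sub>R axis 1 1, t)" for h :: real
  have g0: "g 0 = (x, t)" by (simp add: g_def)
  have "(g \<longlongrightarrow> g 0) (at_right 0)" unfolding g_def by (intro tendsto_intros)
  then have g: "(g \<longlongrightarrow> (x, t)) (at_right 0)" by (simp add: g0)
  have "isCont f (x, t)" using c z by (simp add: continuous_on_eq_continuous_at)
  then have lim: "((\<lambda>h. f (g h)) \<longlongrightarrow> f (x, t)) (at_right 0)" using g isCont_tendsto_compose by blast
  have "\<forall>\<^sub>F h in at_right 0. g h \<in> Q" using topological_tendstoD[OF g open_Q z] .
  then have "\<forall>\<^sub>F h in at_right 0. f (g h) \<in> C"
    using eventually_at_right_less[of "0::real"]
  proof eventually_elim
    case (elim h)
    then show ?case unfolding g_def using x by (intro off) (auto simp: axis_dist2_def axis_def)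
  qed
  then show ?thesis using Lim_in_closed_set[OF C] lim by (metis trivial_limit_at_right_real)
qed (use off z in auto)

section \<open>Rules for space-time derivatives and rotations\<close>

lemma dx_coord: "dx i (coord j) z = (if i = j then 1 else 0)"
proof -
  have "bounded_linear (\<lambda>z::spacetime. fst z $ j)"
    by (intro bounded_linear_compose[OF bounded_linear_vec_nth bounded_linear_fst])
  from dir_derivI[OF bounded_linear_imp_has_derivative[OF this]]
  show ?thesis by (simp add: dx_eq axis_def)
qed

lemma dt_coord: "dt (coord j) z = 0"
proof -
  have "bounded_linear (\<lambda>z::spacetime. fst z $ j)"
    by (intro bounded_linear_compose[OF bounded_linear_vec_nth bounded_linear_fst])
  from dir_derivI[OF bounded_linear_imp_has_derivative[OF this]]
  show ?thesis by (simp add: dt_eq)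
qed

lemma smooth_coord: "smooth_on Q (coord j)"
  using smooth_on_linear[OF bounded_linear_compose[OF bounded_linear_vec_nth bounded_linear_fst] open_Q smooth_on_id[OF open_Q]] .

lemma dx_calc:
  fixes f g :: "spacetime \<Rightarrow> real"
  assumes "smooth_on Q f" "smooth_on Q g" "z \<in> Q"
  shows "dx i (\<lambda>z. f z + g z) z = dx i f z + dx i g z" "dx i (\<lambda>z. f z - g z) z = dx i f z - dx i g z"
    "dx i (\<lambda>z. f z * g z) z = dx i f z * g z + f z * dx i g z"
    "dt (\<lambda>z. f z + g z) z = dt f z + dt g z" "dt (\<lambda>z. f z - g z) z = dt f z - dt g z"
    "dt (\<lambda>z. f z * g z) z = dt f z * g z + f z * dt g z"
    "dx i (\<lambda>z. - f z) z = - dx i f z"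
  using assms unfolding dx_eq dt_eq
  by (simp_all add: dir_deriv_add dir_deriv_diff dir_deriv_mult dir_deriv_minus smooth_on_imp_differentiable)

lemma dx_commute: "smooth_on Q f \<Longrightarrow> z \<in> Q \<Longrightarrow> dx i (dx j f) z = dx j (dx i f) z" for f :: "spacetime \<Rightarrow> real"
  unfolding dx_eq by (rule dir_deriv_commute[OF _ open_Q])

lemma dx_dt_commute: "smooth_on Q f \<Longrightarrow> z \<in> Q \<Longrightarrow> dx i (dt f) z = dt (dx i f) z" for f :: "spacetime \<Rightarrow> real"
  unfolding dx_eq dt_eq by (rule dir_deriv_commute[OF _ open_Q])

lemma dx_laplace_commute:
  fixes f :: "spacetime \<Rightarrow> real"
  assumes f: "smooth_on Q f" "z \<in> Q"
  shows "dx j (dx i (dx i f)) z = dx i (dx i (dx j f)) z"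
proof -
  have "dx j (dx i (dx i f)) z = dx i (dx j (dx i f)) z" by (rule dx_commute[OF smooth_on_dx[OF f(1)] f(2)])
  also have "\<dots> = dx i (dx i (dx j f)) z" by (rule dx_cong[OF _ f(2)]) (rule dx_commute[OF f(1)])
  finally show ?thesis .
qed

lemma dxdx_diff:
  fixes f g :: "spacetime \<Rightarrow> real"
  assumes fg: "smooth_on Q f" "smooth_on Q g" "z \<in> Q"
  shows "dx i (dx i (\<lambda>z. f z - g z)) z = dx i (dx i f) z - dx i (dx i g) z"
proof -
  have "dx i (dx i (\<lambda>z. f z - g z)) z = dx i (\<lambda>z. dx i f z - dx i g z) z"
    by (rule dx_cong[OF _ fg(3)]) (rule dx_calc(2)[OF fg(1,2)])
  then show ?thesis by (simp add: dx_calc fg smooth_on_dx)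
qed

lemma dxdx_coord_mult:
  fixes f :: "spacetime \<Rightarrow> real"
  assumes f: "smooth_on Q f" "z \<in> Q"
  shows "dx i (dx i (\<lambda>z. coord j z * f z)) z = (if i = j then 2 * dx i f z else 0) + coord j z * dx i (dx i f) z"
proof -
  note [simp] = smooth_coord smooth_on_dx f smooth_on_mult dx_coord
  have "dx i (dx i (\<lambda>z. coord j z * f z)) z = dx i (\<lambda>z. (if i = j then f z else 0) + coord j z * dx i f z) z"
    by (rule dx_cong[OF _ f(2)]) (simp add: dx_calc)
  also have "\<dots> = (if i = j then 2 * dx i f z else 0) + coord j z * dx i (dx i f) z"
    by (cases "i = j") (simp_all add: dx_calc)
  finally show ?thesis .
qed

lemma rot_deriv_dx:
  fixes f :: "spacetime \<Rightarrow> real"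
  assumes f: "smooth_on Q f" "z \<in> Q"
  shows "rot_deriv (dx 1 f) z = dx 1 (rot_deriv f) z - dx 2 f z" "rot_deriv (dx 2 f) z = dx 2 (rot_deriv f) z + dx 1 f z"
    "rot_deriv (dx 3 f) z = dx 3 (rot_deriv f) z"
  unfolding rot_deriv_def[abs_def]
  by (simp_all add: dx_calc smooth_coord smooth_on_dx f smooth_on_mult dx_coord dx_commute[OF f, of 1 2] dx_commute[OF f, of 1 3] dx_commute[OF f, of 2 3])

lemma smooth_on_rot_deriv: "smooth_on Q f \<Longrightarrow> smooth_on Q (rot_deriv f)"
  unfolding rot_deriv_def[abs_def] by (intro smooth_on_diff smooth_on_mult open_Q smooth_coord smooth_on_dx)

text \<open>Infinitesimal equivariance under rotations: \<open>a\<close> and \<open>b\<close> are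
  the horizontal Cartesian components of an axially symmetric vector field. Velocity and vorticity
  are both of this kind, and \<open>dx 3\<close> preserves it, so all estimates near the axis are
  proved once for such pairs.\<close>

definition rotating_pair :: "(spacetime \<Rightarrow> real) \<Rightarrow> (spacetime \<Rightarrow> real) \<Rightarrow> bool" where
  "rotating_pair a b \<longleftrightarrow> smooth_on Q a \<and> smooth_on Q b \<and>
     (\<forall>z\<in>Q. rot_deriv a z = - b z) \<and> (\<forall>z\<in>Q. rot_deriv b z = a z)"

text \<open>r times the angular component of the field; its companion \<open>radial\<close> is r
  times the radial component.\<close>

definition swirl :: "(spacetime \<Rightarrow> real) \<Rightarrow> (spacetime \<Rightarrow> real) \<Rightarrow> spacetime \<Rightarrow> real" where
  "swirl a b z = coord 1 z * b z - coord 2 z * a z"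

definition radial :: "(spacetime \<Rightarrow> real) \<Rightarrow> (spacetime \<Rightarrow> real) \<Rightarrow> spacetime \<Rightarrow> real" where
  "radial a b z = coord 1 z * a z + coord 2 z * b z"

lemma rotating_pairD:
  assumes "rotating_pair a b"
  shows "smooth_on Q a" "smooth_on Q b" "z \<in> Q \<Longrightarrow> coord 1 z * dx 2 a z - coord 2 z * dx 1 a z = - b z"
    "z \<in> Q \<Longrightarrow> coord 1 z * dx 2 b z - coord 2 z * dx 1 b z = a z"
  using assms by (auto simp: rotating_pair_def rot_deriv_def)

lemma rotating_pair_axis:
  assumes "rotating_pair a b" "z \<in> Q" "coord 1 z = 0" "coord 2 z = 0"
  shows "a z = 0" "b z = 0"
  using rotating_pairD(3,4)[OF assms(1,2)] assms(3,4) by simp_all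

lemma rotating_pair_dx3: "rotating_pair a b \<Longrightarrow> rotating_pair (dx 3 a) (dx 3 b)"
proof -
  assume ab: "rotating_pair a b"
  note s = rotating_pairD(1,2)[OF ab]
  have "rot_deriv (dx 3 a) z = - dx 3 b z" "rot_deriv (dx 3 b) z = dx 3 a z" if z: "z \<in> Q" for z
  proof -
    have "dx 3 (rot_deriv a) z = dx 3 (\<lambda>z. - b z) z" "dx 3 (rot_deriv b) z = dx 3 a z"
      using ab by (intro dx_cong[OF _ z]; simp add: rotating_pair_def)+
    then show "rot_deriv (dx 3 a) z = - dx 3 b z" "rot_deriv (dx 3 b) z = dx 3 a z"
      using rot_deriv_dx(3)[OF s(1) z] rot_deriv_dx(3)[OF s(2) z] dx_calc(7)[OF s(2) s(2) z] by simp_all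
  qed
  then show ?thesis using s by (auto simp: rotating_pair_def smooth_on_dx)
qed

lemma smooth_on_swirl: "rotating_pair a b \<Longrightarrow> smooth_on Q (swirl a b)"
  unfolding swirl_def[abs_def] by (intro smooth_on_diff smooth_on_mult open_Q smooth_coord rotating_pairD)

lemma smooth_on_radial: "rotating_pair a b \<Longrightarrow> smooth_on Q (radial a b)"
  unfolding radial_def[abs_def] by (intro smooth_on_add smooth_on_mult open_Q smooth_coord rotating_pairD)

lemma swirl_derivs:
  assumes ab: "rotating_pair a b" and z: "z \<in> Q"
  shows "dt (swirl a b) z = coord 1 z * dt b z - coord 2 z * dt a z"
    "dx i (swirl a b) z = (if i = 1 then b z else 0) - (if i = 2 then a z else 0) + coord 1 z * dx i b z - coord 2 z * dx i a z"
    "dx i (dx i (swirl a b)) z = (if i = 1 then 2 * dx 1 b z else 0) - (if i = 2 then 2 * dx 2 a z else 0)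
       + coord 1 z * dx i (dx i b) z - coord 2 z * dx i (dx i a) z"
proof -
  note s [simp] = rotating_pairD(1,2)[OF ab]
  note [simp] = smooth_coord smooth_on_mult dx_coord dt_coord z
  show "dt (swirl a b) z = coord 1 z * dt b z - coord 2 z * dt a z"
    unfolding swirl_def[abs_def] by (simp add: dx_calc)
  show "dx i (swirl a b) z = (if i = 1 then b z else 0) - (if i = 2 then a z else 0) + coord 1 z * dx i b z - coord 2 z * dx i a z"
    unfolding swirl_def[abs_def] by (simp add: dx_calc)
  show "dx i (dx i (swirl a b)) z = (if i = 1 then 2 * dx 1 b z else 0) - (if i = 2 then 2 * dx 2 a z else 0)
       + coord 1 z * dx i (dx i b) z - coord 2 z * dx i (dx i a) z"
    unfolding swirl_def[abs_def] by (subst dxdx_diff) (simp_all add: dxdx_coord_mult)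
qed

text \<open>Equivariance replaces the undifferentiated terms by angular derivatives. The horizontal
  gradient is thus radial, with the third component of the curl as its factor; this is how the term
  (2 / r) times the radial derivative enters the equations for Gamma and H.\<close>

lemma swirl_horizontal_derivs:
  assumes ab: "rotating_pair a b" and z: "z \<in> Q"
  shows "dx 1 (swirl a b) z = coord 1 z * (dx 1 b z - dx 2 a z)" "dx 2 (swirl a b) z = coord 2 z * (dx 1 b z - dx 2 a z)"
    "dx 3 (swirl a b) z = swirl (dx 3 a) (dx 3 b) z"
  using rotating_pairD(3,4)[OF ab z] by (simp_all add: swirl_derivs[OF ab z] swirl_def algebra_simps)

lemma radial_derivs:
  assumes ab: "rotating_pair a b" and z: "z \<in> Q"
  shows "dx i (radial a b) z = (if i = 1 then a z else 0) + (if i = 2 then b z else 0) + coord 1 z * dx i a z + coord 2 z * dx i b z"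
  unfolding radial_def[abs_def]
  by (simp add: dx_calc rotating_pairD(1,2)[OF ab] smooth_coord smooth_on_mult dx_coord z)

text \<open>Symmetry is recorded infinitesimally, which is what the differential identities consume.
  The single finite relation is the value of \<open>u\<close> at the mirror image, needed to split
  off the swirl.\<close>

locale axisymmetric_flow =
  fixes u :: "spacetime \<Rightarrow> real^3" and p :: "spacetime \<Rightarrow> real"
  assumes su: "smooth_on Q u" and sp: "smooth_on Q p"
    and divergence: "z \<in> Q \<Longrightarrow> dx 1 (component u 1) z + dx 2 (component u 2) z + dx 3 (component u 3) z = 0"
    and momentum: "z \<in> Q \<Longrightarrow> dt (component u k) z + (component u 1 z * dx 1 (component u k) z + component u 2 z * dx 2 (component u k) z + component u 3 z * dx 3 (component u k) z)
        - (dx 1 (dx 1 (component u k)) z + dx 2 (dx 2 (component u k)) z + dx 3 (dx 3 (component u k)) z) + dx k p z = 0"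
    and rot_u: "z \<in> Q \<Longrightarrow> rot_deriv (component u 1) z = - component u 2 z" "z \<in> Q \<Longrightarrow> rot_deriv (component u 2) z = component u 1 z"
      "z \<in> Q \<Longrightarrow> rot_deriv (component u 3) z = 0" and rot_p: "z \<in> Q \<Longrightarrow> rot_deriv p z = 0"
    and refl_u: "(x, t) \<in> Q \<Longrightarrow> axis_dist2 x > 0 \<Longrightarrow> u (refl (x, t)) = vector
        [(x $ 1 * radial (component u 1) (component u 2) (x, t) + x $ 2 * swirl (component u 1) (component u 2) (x, t)) / axis_dist2 x,
         (x $ 1 * swirl (component u 1) (component u 2) (x, t) - x $ 2 * radial (component u 1) (component u 2) (x, t)) / axis_dist2 x, u (x, t) $ 3]"
begin

lemma sc [simp]: "smooth_on Q (component u k)" by (rule smooth_on_comp[OF su])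

definition vort1 where "vort1 z = dx 2 (component u 3) z - dx 3 (component u 2) z"
definition vort2 where "vort2 z = dx 3 (component u 1) z - dx 1 (component u 3) z"
definition vort3 where "vort3 z = dx 1 (component u 2) z - dx 2 (component u 1) z"
text \<open>
  With \<open>\<omega> = curl u\<close>, the next three functions are \<open>r u\<^sub>\<theta>\<close>, \<open>r u\<^sub>r\<close> and \<open>r \<omega>\<^sub>\<theta>\<close>, which unlike
  \<open>u\<^sub>\<theta>\<close>, \<open>u\<^sub>r\<close> and \<open>\<omega>\<^sub>\<theta>\<close> are smooth across the axis.
\<close>

definition Gam where "Gam = swirl (component u 1) (component u 2)"
definition Rad where "Rad = radial (component u 1) (component u 2)"
definition Hel where "Hel = swirl vort1 vort2"

lemma pair_u: "rotating_pair (component u 1) (component u 2)"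
  by (simp add: rotating_pair_def rot_u)

lemma smooth_vort: "smooth_on Q vort1" "smooth_on Q vort2" "smooth_on Q vort3"
  unfolding vort1_def[abs_def] vort2_def[abs_def] vort3_def[abs_def] by (intro smooth_on_diff open_Q smooth_on_dx sc)+

lemma smooth_Gam: "smooth_on Q Gam" unfolding Gam_def by (rule smooth_on_swirl[OF pair_u])

lemma rot_deriv_diff:
  assumes "smooth_on Q f" "smooth_on Q g" "z \<in> Q"
  shows "rot_deriv (\<lambda>z. f z - g z) z = rot_deriv f z - rot_deriv g z"
  using assms by (simp add: rot_deriv_def dx_calc algebra_simps)

lemma pair_vort: "rotating_pair vort1 vort2"
proof -
  have "rot_deriv vort1 z = - vort2 z" "rot_deriv vort2 z = vort1 z" if z: "z \<in> Q" for z
  proof -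
    have c1: "dx i (rot_deriv (component u 1)) z = - dx i (component u 2) z" for i
      using dx_cong[OF rot_u(1) z, where i=i] dx_calc(7)[OF sc[of 2] sc[of 2] z, of i] by simp
    have c2: "dx i (rot_deriv (component u 2)) z = dx i (component u 1) z" for i by (rule dx_cong[OF rot_u(2) z])
    have c3: "dx i (rot_deriv (component u 3)) z = 0" for i
    proof -
      have "dx i (rot_deriv (component u 3)) z = dx i (\<lambda>z. 0) z" by (rule dx_cong[OF rot_u(3) z])
      then show ?thesis using dir_derivI[OF has_derivative_const[of 0]] unfolding dx_eq by metis
    qed
    show "rot_deriv vort1 z = - vort2 z" "rot_deriv vort2 z = vort1 z"
      unfolding vort1_def[abs_def] vort2_def[abs_def]
      by (simp_all add: rot_deriv_diff smooth_on_dx z rot_deriv_dx c1 c2 c3)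
  qed
  then show ?thesis using smooth_vort by (simp add: rotating_pair_def)
qed

lemma smooth_Hel: "smooth_on Q Hel" unfolding Hel_def by (rule smooth_on_swirl[OF pair_vort])

text \<open>x1 times the second momentum equation minus x2 times the first. The pressure contributes
  its angular derivative, which vanishes. The Laplacian of the product produces twice the third
  vorticity component, rewritten here as a radial derivative of \<open>Gam\<close>.\<close>

lemma Gam_equation:
  assumes z: "z \<in> Q" and r: "axis_dist2 (fst z) > 0"
  shows "dt Gam z + u z \<bullet> grad Gam z = laplacian Gam z - 2 / axis_dist2 (fst z) * radial_part (fst z) (grad Gam z)"
proof -
  have h: "2 / axis_dist2 (fst z) * radial_part (fst z) (grad Gam z) = 2 * (dx 1 (component u 2) z - dx 2 (component u 1) z)"
  proof -
    have "radial_part (fst z) (grad Gam z) = axis_dist2 (fst z) * (dx 1 (component u 2) z - dx 2 (component u 1) z)"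
      by (simp add: radial_part_def grad_def Gam_def swirl_horizontal_derivs[OF pair_u z] axis_dist2_def algebra_simps power2_eq_square)
    then show ?thesis using r by simp
  qed
  have rp: "coord 1 z * dx 2 p z = coord 2 z * dx 1 p z" using rot_p[OF z] by (simp add: rot_deriv_def)
  define x1 x2 where x: "x1 = coord 1 z" "x2 = coord 2 z"
  have m2: "x1 * (dt (component u 2) z + (component u 1 z * dx 1 (component u 2) z + component u 2 z * dx 2 (component u 2) z + component u 3 z * dx 3 (component u 2) z)
        - (dx 1 (dx 1 (component u 2)) z + dx 2 (dx 2 (component u 2)) z + dx 3 (dx 3 (component u 2)) z) + dx 2 p z) = 0"
    using momentum[OF z, of 2] by simp
  have m1: "x2 * (dt (component u 1) z + (component u 1 z * dx 1 (component u 1) z + component u 2 z * dx 2 (component u 1) z + component u 3 z * dx 3 (component u 1) z)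
        - (dx 1 (dx 1 (component u 1)) z + dx 2 (dx 2 (component u 1)) z + dx 3 (dx 3 (component u 1)) z) + dx 1 p z) = 0"
    using momentum[OF z, of 1] by simp
  show ?thesis unfolding h
    using m1 m2 rp
    by (simp add: inner_vec_def sum_3 grad_def laplacian_def Gam_def swirl_derivs[OF pair_u z] x[symmetric] algebra_simps)
qed

text \<open>The antisymmetrised derivative of the momentum equation; the pressure disappears by
  symmetry of its second derivatives. Working with a general pair of indices covers both horizontal
  vorticity components at once.\<close>

lemma vorticity_equation:
  fixes j k :: 3
  assumes z: "z \<in> Q"
  defines "W \<equiv> \<lambda>z. dx j (component u k) z - dx k (component u j) z"
  shows "dt W z + (component u 1 z * dx 1 W z + component u 2 z * dx 2 W z + component u 3 z * dx 3 W z) - (dx 1 (dx 1 W) z + dx 2 (dx 2 W) z + dx 3 (dx 3 W) z)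
     = dx k (component u 1) z * dx 1 (component u j) z + dx k (component u 2) z * dx 2 (component u j) z + dx k (component u 3) z * dx 3 (component u j) z
     - (dx j (component u 1) z * dx 1 (component u k) z + dx j (component u 2) z * dx 2 (component u k) z + dx j (component u 3) z * dx 3 (component u k) z)"
proof -
  note [simp] = smooth_on_dx smooth_on_dt smooth_on_add smooth_on_diff smooth_on_mult sp z
  let ?M = "\<lambda>k z. dt (component u k) z + (component u 1 z * dx 1 (component u k) z + component u 2 z * dx 2 (component u k) z + component u 3 z * dx 3 (component u k) z)
        - (dx 1 (dx 1 (component u k)) z + dx 2 (dx 2 (component u k)) z + dx 3 (dx 3 (component u k)) z) + dx k p z"
  have M0: "dx i (?M k) z = 0" for i k
  proof -
    have "dx i (?M k) z = dx i (\<lambda>z. 0) z" by (rule dx_cong[OF momentum z])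
    then show ?thesis using dir_derivI[OF has_derivative_const[of 0]] unfolding dx_eq by metis
  qed
  have E: "dx i (?M k) z = dt (dx i (component u k)) z
      + (dx i (component u 1) z * dx 1 (component u k) z + dx i (component u 2) z * dx 2 (component u k) z + dx i (component u 3) z * dx 3 (component u k) z)
      + (component u 1 z * dx 1 (dx i (component u k)) z + component u 2 z * dx 2 (dx i (component u k)) z + component u 3 z * dx 3 (dx i (component u k)) z)
      - (dx 1 (dx 1 (dx i (component u k))) z + dx 2 (dx 2 (dx i (component u k))) z + dx 3 (dx 3 (dx i (component u k))) z) + dx i (dx k p) z" for i k
    by (simp add: dx_calc dx_dt_commute dx_laplace_commute[of "component u k" z i] dx_commute[of "component u k" z i 1] dx_commute[of "component u k" z i 2] dx_commute[of "component u k" z i 3])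
  have W: "dt W z = dt (dx j (component u k)) z - dt (dx k (component u j)) z"
    "dx i W z = dx i (dx j (component u k)) z - dx i (dx k (component u j)) z"
    "dx i (dx i W) z = dx i (dx i (dx j (component u k))) z - dx i (dx i (dx k (component u j))) z" for i
    unfolding W_def by (simp_all add: dx_calc dxdx_diff)
  have pc: "dx j (dx k p) z = dx k (dx j p) z" by (rule dx_commute[OF sp z])
  show ?thesis unfolding W using M0[of j k, unfolded E] M0[of k j, unfolded E] pc by (simp add: algebra_simps)
qed

text \<open>Incompressibility turns the quadratic right-hand side into the stretching term \<omega>
  . grad u.\<close>

lemma vort_equations:
  assumes z: "z \<in> Q"
  shows "dt vort1 z + (component u 1 z * dx 1 vort1 z + component u 2 z * dx 2 vort1 z + component u 3 z * dx 3 vort1 z) - (dx 1 (dx 1 vort1) z + dx 2 (dx 2 vort1) z + dx 3 (dx 3 vort1) z)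
     = vort1 z * dx 1 (component u 1) z + vort2 z * dx 2 (component u 1) z + vort3 z * dx 3 (component u 1) z"
    "dt vort2 z + (component u 1 z * dx 1 vort2 z + component u 2 z * dx 2 vort2 z + component u 3 z * dx 3 vort2 z) - (dx 1 (dx 1 vort2) z + dx 2 (dx 2 vort2) z + dx 3 (dx 3 vort2) z)
     = vort1 z * dx 1 (component u 2) z + vort2 z * dx 2 (component u 2) z + vort3 z * dx 3 (component u 2) z"
proof -
  have d: "dx 1 (component u 1) z = - dx 2 (component u 2) z - dx 3 (component u 3) z" using divergence[OF z] by simp
  show "dt vort1 z + (component u 1 z * dx 1 vort1 z + component u 2 z * dx 2 vort1 z + component u 3 z * dx 3 vort1 z) - (dx 1 (dx 1 vort1) z + dx 2 (dx 2 vort1) z + dx 3 (dx 3 vort1) z)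
     = vort1 z * dx 1 (component u 1) z + vort2 z * dx 2 (component u 1) z + vort3 z * dx 3 (component u 1) z"
    using vorticity_equation[OF z, of 2 3] unfolding vort1_def[abs_def, symmetric]
    by (simp add: vort1_def vort2_def vort3_def d algebra_simps)
  show "dt vort2 z + (component u 1 z * dx 1 vort2 z + component u 2 z * dx 2 vort2 z + component u 3 z * dx 3 vort2 z) - (dx 1 (dx 1 vort2) z + dx 2 (dx 2 vort2) z + dx 3 (dx 3 vort2) z)
     = vort1 z * dx 1 (component u 2) z + vort2 z * dx 2 (component u 2) z + vort3 z * dx 3 (component u 2) z"
    using vorticity_equation[OF z, of 3 1] unfolding vort2_def[abs_def, symmetric]
    by (simp add: vort1_def vort2_def vort3_def d algebra_simps)
qed

text \<open>The swirl of the vorticity equations. Stretching contributes \<omega> . grad Gamma,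
  which is zero, and u1 \<omega>2 - u2 \<omega>1; transport of the coordinate factors contributes
  the same expression again. Decomposed into radial and angular parts, it becomes stretching by u_r
  / r together with the source from the swirl.\<close>

lemma Hel_equation:
  assumes z: "z \<in> Q" and r: "axis_dist2 (fst z) > 0"
  shows "dt Hel z + u z \<bullet> grad Hel z = laplacian Hel z - 2 / axis_dist2 (fst z) * radial_part (fst z) (grad Hel z)
     + 2 * (radial_part (fst z) (u z) / axis_dist2 (fst z)) * Hel z + 2 * Gam z * dx 3 Gam z / axis_dist2 (fst z)"
proof -
  define R where "R = axis_dist2 (fst z)"
  define x1 x2 where x: "x1 = coord 1 z" "x2 = coord 2 z"
  have R: "R > 0" "R = x1 * x1 + x2 * x2" using r by (simp_all add: R_def x axis_dist2_def power2_eq_square)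
  have h: "2 / R * radial_part (fst z) (grad Hel z) = 2 * (dx 1 vort2 z - dx 2 vort1 z)"
  proof -
    have "radial_part (fst z) (grad Hel z) = R * (dx 1 vort2 z - dx 2 vort1 z)"
      by (simp add: radial_part_def grad_def Hel_def swirl_horizontal_derivs[OF pair_vort z] R(2) x algebra_simps)
    then show ?thesis using R(1) by simp
  qed
  have g3: "dx 3 Gam z = x1 * dx 3 (component u 2) z - x2 * dx 3 (component u 1) z"
    using swirl_horizontal_derivs(3)[OF pair_u z] by (simp add: Gam_def swirl_def x)
  have t1: "x1 * dx 2 (component u 1) z = x2 * dx 1 (component u 1) z - component u 2 z" and t2: "x1 * dx 2 (component u 2) z = x2 * dx 1 (component u 2) z + component u 1 z"
    and t3: "x1 * dx 2 (component u 3) z = x2 * dx 1 (component u 3) z"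
    using rot_u[OF z] by (simp_all add: rot_deriv_def x)
  have v: "x1 * vort1 z + x2 * vort2 z = - dx 3 Gam z"
    using t3 unfolding g3 vort1_def vort2_def by (simp add: algebra_simps)
  \<comment> \<open>The left-hand side is \<omega> . grad Gamma. Its horizontal part is \<omega>3
    times x1 \<omega>1 + x2 \<omega>2, which by \<open>v\<close> cancels the vertical part: vortex
    lines stay on level sets of Gamma.\<close>
  have st: "vort1 z * (component u 2 z + x1 * dx 1 (component u 2) z - x2 * dx 1 (component u 1) z) + vort2 z * (- component u 1 z + x1 * dx 2 (component u 2) z - x2 * dx 2 (component u 1) z)
      + vort3 z * (x1 * dx 3 (component u 2) z - x2 * dx 3 (component u 1) z) = 0"
  proof -
    have a: "component u 2 z + x1 * dx 1 (component u 2) z - x2 * dx 1 (component u 1) z = x1 * vort3 z"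
      using t1 by (simp add: vort3_def algebra_simps)
    have b: "- component u 1 z + x1 * dx 2 (component u 2) z - x2 * dx 2 (component u 1) z = x2 * vort3 z"
      using t2 by (simp add: vort3_def algebra_simps)
    have "vort1 z * (x1 * vort3 z) + vort2 z * (x2 * vort3 z) + vort3 z * dx 3 Gam z = vort3 z * (x1 * vort1 z + x2 * vort2 z + dx 3 Gam z)"
      by (simp add: algebra_simps)
    then show ?thesis unfolding a b g3[symmetric] using v by simp
  qed
  \<comment> \<open>A planar determinant computed in the rotated frame: r^2 times it is radial part
    times swirl minus swirl times radial part, and the radial part of the vorticity is minus the
    z-derivative of Gamma.\<close>
  have uw: "2 * (component u 1 z * vort2 z - component u 2 z * vort1 z) = 2 * (radial_part (fst z) (u z) / R) * Hel z + 2 * Gam z * dx 3 Gam z / R"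
  proof -
    have "R * (component u 1 z * vort2 z - component u 2 z * vort1 z) = (x1 * component u 1 z + x2 * component u 2 z) * (x1 * vort2 z - x2 * vort1 z)
        - (x1 * component u 2 z - x2 * component u 1 z) * (x1 * vort1 z + x2 * vort2 z)"
      unfolding R(2) by (simp add: algebra_simps)
    also have "\<dots> = radial_part (fst z) (u z) * Hel z + Gam z * dx 3 Gam z"
      unfolding v by (simp add: radial_part_def Hel_def Gam_def swirl_def x)
    finally show ?thesis using R(1) by (simp add: field_simps)
  qed
  have m1: "x2 * (dt vort1 z + (component u 1 z * dx 1 vort1 z + component u 2 z * dx 2 vort1 z + component u 3 z * dx 3 vort1 z) - (dx 1 (dx 1 vort1) z + dx 2 (dx 2 vort1) z + dx 3 (dx 3 vort1) z))
     = x2 * (vort1 z * dx 1 (component u 1) z + vort2 z * dx 2 (component u 1) z + vort3 z * dx 3 (component u 1) z)"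
    using vort_equations(1)[OF z] by simp
  have m2: "x1 * (dt vort2 z + (component u 1 z * dx 1 vort2 z + component u 2 z * dx 2 vort2 z + component u 3 z * dx 3 vort2 z) - (dx 1 (dx 1 vort2) z + dx 2 (dx 2 vort2) z + dx 3 (dx 3 vort2) z))
     = x1 * (vort1 z * dx 1 (component u 2) z + vort2 z * dx 2 (component u 2) z + vort3 z * dx 3 (component u 2) z)"
    using vort_equations(2)[OF z] by simp
  have "dt Hel z + u z \<bullet> grad Hel z = laplacian Hel z - 2 * (dx 1 vort2 z - dx 2 vort1 z) + 2 * (component u 1 z * vort2 z - component u 2 z * vort1 z)"
    using m1 m2 st
    by (simp add: inner_vec_def sum_3 grad_def laplacian_def Hel_def swirl_derivs[OF pair_vort z] x[symmetric] algebra_simps)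
  then show ?thesis unfolding R_def[symmetric] h uw by simp
qed

text \<open>Averaging \<open>u\<close> with its mirror image in the plane \<open>x\<^sub>2 = 0\<close> removes the swirl and keeps smoothness at the axis.\<close>

definition swirl_free :: "3 \<Rightarrow> spacetime \<Rightarrow> real" where
  "swirl_free k z = (component u k z + (if k = 2 then - 1 else 1) * component u k (refl z)) / 2"

lemma refl_linear: "bounded_linear refl"
proof -
  have "linear refl" by (rule linearI) (simp_all add: refl_def vec_eq_iff forall_3)
  then show ?thesis by (simp add: linear_conv_bounded_linear)
qed

lemma norm_refl: "norm (fst (refl z)) = norm (fst z)"
proof -
  have "(norm (fst (refl z)))\<^sup>2 = (norm (fst z))\<^sup>2" by (simp add: norm_sq_vec3 refl_def)
  then show ?thesis by (simp add: power2_eq_iff_nonneg)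
qed

lemma refl_Q: "z \<in> Q \<Longrightarrow> refl z \<in> Q"
  using norm_refl[of z] by (cases z) (simp add: parabolic_cylinder_def refl_def)

lemma smooth_swirl_free: "smooth_on Q (swirl_free k)"
proof -
  have "smooth_on Q (\<lambda>z. component u k (refl z + 0))"
    by (rule smooth_on_affine[OF refl_linear open_Q _ sc]) (simp add: refl_Q)
  then have "smooth_on Q (\<lambda>z. (1/2) * (component u k z + (if k = 2 then - 1 else 1) * component u k (refl z)))"
    by (intro smooth_on_mult smooth_on_add smooth_on_const open_Q sc) simp
  then show ?thesis unfolding swirl_free_def[abs_def] by simp
qed

text \<open>With the sign change in the second component, \<open>Gam\<close> enters the mirror image
  with the opposite sign and cancels in the average, while \<open>Rad\<close> survives.
  Multiplication by \<open>axis_dist2 x\<close> keeps the identities true on the axis.\<close>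

lemma swirl_free_eq:
  assumes z: "(x, t) \<in> Q"
  shows "axis_dist2 x * swirl_free 1 (x, t) = x $ 1 * Rad (x, t)" "axis_dist2 x * swirl_free 2 (x, t) = x $ 2 * Rad (x, t)"
    "swirl_free 3 (x, t) = u (x, t) $ 3"
proof -
  consider "axis_dist2 x > 0" | "axis_dist2 x = 0" using axis_dist2_nonneg[of x] by linarith
  then have "axis_dist2 x * swirl_free 1 (x, t) = x $ 1 * Rad (x, t) \<and> axis_dist2 x * swirl_free 2 (x, t) = x $ 2 * Rad (x, t) \<and>
    swirl_free 3 (x, t) = u (x, t) $ 3"
  proof cases
    case 1
    have a: "axis_dist2 x * component u 1 (x, t) = x $ 1 * Rad (x, t) - x $ 2 * Gam (x, t)"
      "axis_dist2 x * component u 2 (x, t) = x $ 2 * Rad (x, t) + x $ 1 * Gam (x, t)"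
      by (simp_all add: axis_dist2_def Rad_def Gam_def radial_def swirl_def algebra_simps power2_eq_square)
    have b: "axis_dist2 x * component u 1 (refl (x, t)) = x $ 1 * Rad (x, t) + x $ 2 * Gam (x, t)"
      "axis_dist2 x * component u 2 (refl (x, t)) = x $ 1 * Gam (x, t) - x $ 2 * Rad (x, t)"
      "component u 3 (refl (x, t)) = u (x, t) $ 3"
      using 1 by (simp_all add: refl_u[OF z 1] Rad_def Gam_def)
    have "axis_dist2 x * swirl_free 1 (x, t) = (axis_dist2 x * component u 1 (x, t) + axis_dist2 x * component u 1 (refl (x, t))) / 2"
      "axis_dist2 x * swirl_free 2 (x, t) = (axis_dist2 x * component u 2 (x, t) - axis_dist2 x * component u 2 (refl (x, t))) / 2"
      by (simp_all add: swirl_free_def algebra_simps)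
    then show ?thesis unfolding a b using b(3) by (simp add: swirl_free_def)
  next
    case 2
    then have x0: "x $ 1 = 0" "x $ 2 = 0" by (simp_all add: axis_dist2_def)
    then have "refl (x, t) = (x, t)" by (simp add: refl_def vec_eq_iff forall_3)
    then show ?thesis using 2 x0 by (simp add: swirl_free_def)
  qed
  then show "axis_dist2 x * swirl_free 1 (x, t) = x $ 1 * Rad (x, t)" "axis_dist2 x * swirl_free 2 (x, t) = x $ 2 * Rad (x, t)"
    "swirl_free 3 (x, t) = u (x, t) $ 3" by blast+
qed

lemma smooth_Rad: "smooth_on Q Rad" unfolding Rad_def by (rule smooth_on_radial[OF pair_u])

lemma swirl_free_derivs:
  assumes z: "(x, t) \<in> Q"
  shows "axis_dist2 x * dx i (swirl_free 1) (x, t) = (if i = 1 then Rad (x, t) else 0) + x $ 1 * dx i Rad (x, t)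
      - (if i = 1 then 2 * x $ 1 else if i = 2 then 2 * x $ 2 else 0) * swirl_free 1 (x, t)"
    "axis_dist2 x * dx i (swirl_free 2) (x, t) = (if i = 2 then Rad (x, t) else 0) + x $ 2 * dx i Rad (x, t)
      - (if i = 1 then 2 * x $ 1 else if i = 2 then 2 * x $ 2 else 0) * swirl_free 2 (x, t)"
    "dx i (swirl_free 3) (x, t) = dx i (component u 3) (x, t)"
proof -
  note [simp] = smooth_coord smooth_on_mult smooth_on_add smooth_swirl_free smooth_Rad dx_coord z
  have e: "dx i (\<lambda>z. (coord 1 z * coord 1 z + coord 2 z * coord 2 z) * swirl_free j z) (x, t) = dx i (\<lambda>z. coord j z * Rad z) (x, t)"
    if "j = 1 \<or> j = 2" for j
  proof (rule dx_cong[OF _ z])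
    fix y assume "y \<in> Q"
    then show "(coord 1 y * coord 1 y + coord 2 y * coord 2 y) * swirl_free j y = coord j y * Rad y"
      using swirl_free_eq(1,2)[of "fst y" "snd y"] that by (auto simp: axis_dist2_def power2_eq_square)
  qed
  show "axis_dist2 x * dx i (swirl_free 1) (x, t) = (if i = 1 then Rad (x, t) else 0) + x $ 1 * dx i Rad (x, t)
      - (if i = 1 then 2 * x $ 1 else if i = 2 then 2 * x $ 2 else 0) * swirl_free 1 (x, t)"
    using e[of 1] by (auto simp: dx_calc axis_dist2_def power2_eq_square algebra_simps)
  show "axis_dist2 x * dx i (swirl_free 2) (x, t) = (if i = 2 then Rad (x, t) else 0) + x $ 2 * dx i Rad (x, t)
      - (if i = 1 then 2 * x $ 1 else if i = 2 then 2 * x $ 2 else 0) * swirl_free 2 (x, t)"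
    using e[of 2] by (auto simp: dx_calc axis_dist2_def power2_eq_square algebra_simps)
  show "dx i (swirl_free 3) (x, t) = dx i (component u 3) (x, t)"
    by (rule dx_cong[OF _ z]) (use swirl_free_eq(3) in force)
qed

text \<open>This field is u_r e_r + u_z e_z: the swirl is solenoidal by itself, and the curl of what
  is left has only the angular component of the vorticity. The identities are checked after
  multiplication by powers of r^2, which avoids differentiating quotients.\<close>

lemma swirl_free_div_curl_off_axis:
  assumes z: "(x, t) \<in> Q" and R: "axis_dist2 x > 0"
  shows "dx 1 (swirl_free 1) (x, t) + dx 2 (swirl_free 2) (x, t) + dx 3 (swirl_free 3) (x, t) = 0"
    "dx 1 (swirl_free 2) (x, t) = dx 2 (swirl_free 1) (x, t)"
    "axis_dist2 x * (dx 3 (swirl_free 1) (x, t) - dx 1 (swirl_free 3) (x, t)) = x $ 1 * Hel (x, t)"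
    "axis_dist2 x * (dx 3 (swirl_free 2) (x, t) - dx 2 (swirl_free 3) (x, t)) = x $ 2 * Hel (x, t)"
proof -
  define x1 x2 r where x: "x1 = x $ 1" "x2 = x $ 2" "r = axis_dist2 x"
  have r: "r = x1 * x1 + x2 * x2" "r > 0" using R by (simp_all add: x axis_dist2_def power2_eq_square)
  note V = swirl_free_eq(1,2)[OF z, folded x]
  note D = swirl_free_derivs[OF z, folded x]
  note dR = radial_derivs[OF pair_u z, folded Rad_def, simplified, folded x]
  have t1: "x1 * dx 2 (component u 1) (x, t) = x2 * dx 1 (component u 1) (x, t) - component u 2 (x, t)"
    and t2: "x1 * dx 2 (component u 2) (x, t) = x2 * dx 1 (component u 2) (x, t) + component u 1 (x, t)"
    and t3: "x1 * dx 2 (component u 3) (x, t) = x2 * dx 1 (component u 3) (x, t)"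
    using rot_u[OF z] by (simp_all add: rot_deriv_def x)
  let ?R1 = "dx 1 Rad (x, t)" and ?R2 = "dx 2 Rad (x, t)" and ?R3 = "dx 3 Rad (x, t)"
  have "r * (r * dx 1 (swirl_free 1) (x, t) + r * dx 2 (swirl_free 2) (x, t))
      = r * (2 * Rad (x, t) + x1 * ?R1 + x2 * ?R2) - 2 * x1 * (r * swirl_free 1 (x, t)) - 2 * x2 * (r * swirl_free 2 (x, t))"
    unfolding D by (simp add: algebra_simps)
  also have "\<dots> = r * (x1 * ?R1 + x2 * ?R2)" unfolding V by (simp add: r(1) algebra_simps)
  finally have "r * (dx 1 (swirl_free 1) (x, t) + dx 2 (swirl_free 2) (x, t)) = x1 * ?R1 + x2 * ?R2"
    using r(2) by (simp add: distrib_left[symmetric] del: distrib_left)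
  also have "\<dots> = r * (dx 1 (component u 1) (x, t) + dx 2 (component u 2) (x, t))"
  proof -
    have "x1 * ?R1 + x2 * ?R2 = x1 * component u 1 (x, t) + x2 * component u 2 (x, t) + x1 * x1 * dx 1 (component u 1) (x, t) + x2 * (x1 * dx 2 (component u 1) (x, t))
        + x1 * (x2 * dx 1 (component u 2) (x, t)) + x2 * x2 * dx 2 (component u 2) (x, t)"
      unfolding dR by (simp add: algebra_simps)
    moreover have "x2 * dx 1 (component u 2) (x, t) = x1 * dx 2 (component u 2) (x, t) - component u 1 (x, t)" using t2 by simp
    ultimately show ?thesis unfolding t1 by (simp add: r(1) algebra_simps)
  qed
  finally have "dx 1 (swirl_free 1) (x, t) + dx 2 (swirl_free 2) (x, t) = dx 1 (component u 1) (x, t) + dx 2 (component u 2) (x, t)"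
    using r(2) by simp
  then show "dx 1 (swirl_free 1) (x, t) + dx 2 (swirl_free 2) (x, t) + dx 3 (swirl_free 3) (x, t) = 0"
    using divergence[OF z] D(3)[of 3] by simp
  \<comment> \<open>The angular derivative of \<open>Rad\<close> vanishes: rotating the field and
    rotating the position compensate each other.\<close>
  have TR: "x1 * ?R2 = x2 * ?R1"
  proof -
    have "x1 * ?R2 - x2 * ?R1 = x1 * component u 2 (x, t) - x2 * component u 1 (x, t) + x1 * (x1 * dx 2 (component u 1) (x, t) - x2 * dx 1 (component u 1) (x, t))
      + x2 * (x1 * dx 2 (component u 2) (x, t) - x2 * dx 1 (component u 2) (x, t))"
      unfolding dR by (simp add: algebra_simps)
    also have "\<dots> = 0" unfolding t1 t2 by (simp add: algebra_simps)
    finally show ?thesis by simp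
  qed
  have "r * (r * dx 1 (swirl_free 2) (x, t)) = r * (x2 * ?R1) - 2 * x1 * (r * swirl_free 2 (x, t))"
    unfolding D by (simp add: algebra_simps)
  moreover have "r * (r * dx 2 (swirl_free 1) (x, t)) = r * (x1 * ?R2) - 2 * x2 * (r * swirl_free 1 (x, t))"
    unfolding D by (simp add: algebra_simps)
  ultimately have "r * (r * dx 1 (swirl_free 2) (x, t)) = r * (r * dx 2 (swirl_free 1) (x, t))"
    unfolding V TR by algebra
  then show "dx 1 (swirl_free 2) (x, t) = dx 2 (swirl_free 1) (x, t)" using r(2) by simp
  \<comment> \<open>r \<omega>_\<theta> is r times (d/dz u_r - d/dr u_z), written here in Cartesian
    terms.\<close>
  have H: "Hel (x, t) = ?R3 - (x1 * dx 1 (component u 3) (x, t) + x2 * dx 2 (component u 3) (x, t))"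
    unfolding dR Hel_def swirl_def vort1_def vort2_def by (simp add: x algebra_simps)
  have "r * (dx 3 (swirl_free 1) (x, t) - dx 1 (swirl_free 3) (x, t)) = x1 * ?R3 - r * dx 1 (component u 3) (x, t)"
    unfolding right_diff_distrib D by simp
  also have "\<dots> = x1 * Hel (x, t) + x2 * (x1 * dx 2 (component u 3) (x, t) - x2 * dx 1 (component u 3) (x, t))"
    unfolding H by (simp add: r(1) algebra_simps)
  finally show "axis_dist2 x * (dx 3 (swirl_free 1) (x, t) - dx 1 (swirl_free 3) (x, t)) = x $ 1 * Hel (x, t)"
    unfolding t3 by (simp add: x)
  have "r * (dx 3 (swirl_free 2) (x, t) - dx 2 (swirl_free 3) (x, t)) = x2 * ?R3 - r * dx 2 (component u 3) (x, t)"
    unfolding right_diff_distrib D by simp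
  also have "\<dots> = x2 * Hel (x, t) - x1 * (x1 * dx 2 (component u 3) (x, t) - x2 * dx 1 (component u 3) (x, t))"
    unfolding H by (simp add: r(1) algebra_simps)
  finally show "axis_dist2 x * (dx 3 (swirl_free 2) (x, t) - dx 2 (swirl_free 3) (x, t)) = x $ 2 * Hel (x, t)"
    unfolding t3 by (simp add: x)
qed

lemma swirl_free_divergence:
  assumes z: "(x, t) \<in> Q"
  shows "(\<Sum>i\<in>UNIV. dx i (swirl_free i) (x, t)) = 0"
proof -
  have "(\<Sum>i\<in>UNIV. dx i (swirl_free i) (x, t)) \<in> {0}"
  proof (rule off_axis_dense[OF _ _ _ z])
    show "continuous_on Q (\<lambda>z. \<Sum>i\<in>UNIV. dx i (swirl_free i) z)"
      by (intro continuous_on_sum smooth_on_imp_continuous smooth_on_dx smooth_swirl_free)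
  qed (simp_all add: sum_3 swirl_free_div_curl_off_axis(1))
  then show ?thesis by simp
qed

lemma swirl_free_curl:
  assumes z: "(x, t) \<in> Q" and R: "axis_dist2 x > 0"
  shows "\<bar>dx j (swirl_free k) (x, t) - dx k (swirl_free j) (x, t)\<bar> \<le> \<bar>Hel (x, t)\<bar> / sqrt (axis_dist2 x)"
proof -
  note c = swirl_free_div_curl_off_axis[OF z R]
  define s where "s = sqrt (axis_dist2 x)"
  have s: "s > 0" "axis_dist2 x = s * s" using R by (simp_all add: s_def)
  have q: "\<bar>d\<bar> \<le> \<bar>Hel (x, t)\<bar> / s" if "axis_dist2 x * d = y * Hel (x, t)" "\<bar>y\<bar> \<le> s" for d y
  proof -
    have "s * (s * \<bar>d\<bar>) = \<bar>y\<bar> * \<bar>Hel (x, t)\<bar>" using arg_cong[OF that(1), of abs] s by (simp add: abs_mult mult.assoc)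
    also have "\<dots> \<le> s * \<bar>Hel (x, t)\<bar>" using that(2) by (intro mult_right_mono) auto
    finally have "s * \<bar>d\<bar> \<le> \<bar>Hel (x, t)\<bar>" using s(1) by (rule mult_left_le_imp_le)
    then show ?thesis using s(1) by (simp add: pos_le_divide_eq mult.commute)
  qed
  have "(x $ 1)\<^sup>2 \<le> s\<^sup>2" "(x $ 2)\<^sup>2 \<le> s\<^sup>2"
    using s(2) zero_le_square[of "x $ 1"] zero_le_square[of "x $ 2"] unfolding axis_dist2_def power2_eq_square by linarith+
  then have y: "\<bar>x $ 1\<bar> \<le> s" "\<bar>x $ 2\<bar> \<le> s" using s(1) abs_le_square_iff[of _ s] by auto
  have a: "\<bar>dx 3 (swirl_free 1) (x, t) - dx 1 (swirl_free 3) (x, t)\<bar> \<le> \<bar>Hel (x, t)\<bar> / s" by (rule q[OF c(3) y(1)])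
  have b: "\<bar>dx 3 (swirl_free 2) (x, t) - dx 2 (swirl_free 3) (x, t)\<bar> \<le> \<bar>Hel (x, t)\<bar> / s" by (rule q[OF c(4) y(2)])
  have p: "0 \<le> \<bar>Hel (x, t)\<bar> / s" using s by simp
  show ?thesis unfolding s_def[symmetric]
    using exhaust_3[of j] exhaust_3[of k] a b p c(2) by (auto simp: abs_minus_commute)
qed

end

text \<open>The profile functions of the cylindrical decomposition come without any regularity, so
  they are never differentiated. The decomposition is turned into the behaviour of \<open>u\<close>
  and \<open>p\<close> under finite rotations off the axis; this is differentiated at angle 0 and
  then extended to the axis by continuity.\<close>

lemma axisymmetric_flowI:
  assumes sol: "suitable_weak_solution u p" and u: "smooth_on Q u" and p: "smooth_on Q p" and ax: "axisymmetric u p"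
  shows "axisymmetric_flow u p"
proof -
  obtain ur ut uz p' where
    U: "\<And>x t. (x, t) \<in> Q \<Longrightarrow> cyl_radius x \<noteq> 0 \<Longrightarrow> u (x, t) = ur (cyl_radius x) (x $ 3) t *\<^sub>R e_r x
                   + ut (cyl_radius x) (x $ 3) t *\<^sub>R e_theta x + uz (cyl_radius x) (x $ 3) t *\<^sub>R e_z"
    and P: "\<And>x t. (x, t) \<in> Q \<Longrightarrow> p (x, t) = p' (cyl_radius x) (x $ 3) t"
    using ax unfolding axisymmetric_def by (auto simp: split_beta)
  note [simp] = smooth_on_comp[OF u] p
  have c: "u (x, t) $ 1 = (ur (cyl_radius x) (x $ 3) t * x $ 1 - ut (cyl_radius x) (x $ 3) t * x $ 2) / cyl_radius x"
    "u (x, t) $ 2 = (ur (cyl_radius x) (x $ 3) t * x $ 2 + ut (cyl_radius x) (x $ 3) t * x $ 1) / cyl_radius x"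
    "u (x, t) $ 3 = uz (cyl_radius x) (x $ 3) t" if "(x, t) \<in> Q" "cyl_radius x > 0" for x t
    using U[OF that(1)] that(2) by (simp_all add: e_r_def e_theta_def e_z_def add_divide_distrib diff_divide_distrib)
  have cr: "cyl_radius (rot \<theta> x) = cyl_radius x" for \<theta> x by (simp add: cyl_radius_eq)
  have pos: "cyl_radius x > 0" if "axis_dist2 x > 0" for x using that by (simp add: cyl_radius_eq)
  have rot: "u (rot \<theta> x, t) $ 1 = cos \<theta> * u (x, t) $ 1 - sin \<theta> * u (x, t) $ 2"
     "u (rot \<theta> x, t) $ 2 = sin \<theta> * u (x, t) $ 1 + cos \<theta> * u (x, t) $ 2"
     "u (rot \<theta> x, t) $ 3 = u (x, t) $ 3" if z: "(x, t) \<in> Q" and r: "axis_dist2 x > 0" for \<theta> x t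
  proof -
    have r': "cyl_radius (rot \<theta> x) > 0" using pos[OF r] cr by simp
    note C = c[OF rot_in_Q[OF z] r'] c[OF z pos[OF r]]
    show "u (rot \<theta> x, t) $ 1 = cos \<theta> * u (x, t) $ 1 - sin \<theta> * u (x, t) $ 2"
     "u (rot \<theta> x, t) $ 2 = sin \<theta> * u (x, t) $ 1 + cos \<theta> * u (x, t) $ 2"
     "u (rot \<theta> x, t) $ 3 = u (x, t) $ 3"
      using pos[OF r] unfolding C cr rot_components by (simp_all add: field_simps)
  qed
  have D: "rot_deriv f (x, t) = d" if f: "smooth_on Q f" "(x, t) \<in> Q" and e: "\<And>\<theta>. f (rot \<theta> x, t) = cos \<theta> * a + sin \<theta> * d" for f :: "spacetime \<Rightarrow> real" and x t a d
  proof -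
    have "((\<lambda>\<theta>. cos \<theta> * a + sin \<theta> * d) has_real_derivative rot_deriv f (x, t)) (at 0)"
      using rot_derivative[OF smooth_on_imp_differentiable[OF f]] unfolding e .
    moreover have "((\<lambda>\<theta>. cos \<theta> * a + sin \<theta> * d) has_real_derivative d) (at 0)"
      by (auto intro!: derivative_eq_intros)
    ultimately show ?thesis by (rule DERIV_unique)
  qed
  have dense: "f z = 0" if "smooth_on Q f" "\<And>x t. (x, t) \<in> Q \<Longrightarrow> axis_dist2 x > 0 \<Longrightarrow> f (x, t) = 0" "z \<in> Q" for f :: "spacetime \<Rightarrow> real" and z
    using off_axis_dense[OF smooth_on_imp_continuous[OF that(1)], of "{0}" "fst z" "snd z"] that(2,3) by auto
  show ?thesis
  proof
    show "smooth_on Q u" "smooth_on Q p" by fact+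
    fix z assume z: "z \<in> Q"
    show "dx 1 (component u 1) z + dx 2 (component u 2) z + dx 3 (component u 3) z = 0"
      using classical_divergence[OF sol u z] by (simp add: sum_3)
    show "dt (component u k) z + (component u 1 z * dx 1 (component u k) z + component u 2 z * dx 2 (component u k) z + component u 3 z * dx 3 (component u k) z)
        - (dx 1 (dx 1 (component u k)) z + dx 2 (dx 2 (component u k)) z + dx 3 (dx 3 (component u k)) z) + dx k p z = 0" for k
      using classical_momentum[OF sol u p z, of k] by (simp add: sum_3)
    have "(\<lambda>z. rot_deriv (component u 1) z + component u 2 z) z = 0"
    proof (rule dense[OF _ _ z])
      fix x t assume "(x, t) \<in> Q" "axis_dist2 x > 0"
      then show "rot_deriv (component u 1) (x, t) + component u 2 (x, t) = 0"
        using D[of "component u 1" x t "u (x, t) $ 1" "- u (x, t) $ 2"] by (simp add: rot)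
    qed (intro smooth_on_add smooth_on_rot_deriv open_Q; simp)
    then show "rot_deriv (component u 1) z = - component u 2 z" by simp
    have "(\<lambda>z. rot_deriv (component u 2) z - component u 1 z) z = 0"
    proof (rule dense[OF _ _ z])
      fix x t assume "(x, t) \<in> Q" "axis_dist2 x > 0"
      then show "rot_deriv (component u 2) (x, t) - component u 1 (x, t) = 0"
        using D[of "component u 2" x t "u (x, t) $ 2" "u (x, t) $ 1"] by (simp add: rot)
    qed (intro smooth_on_diff smooth_on_rot_deriv open_Q; simp)
    then show "rot_deriv (component u 2) z = component u 1 z" by simp
    have 3: "rot_deriv f z = 0" if f: "smooth_on Q f" and inv: "\<And>x t \<theta>. (x, t) \<in> Q \<Longrightarrow> axis_dist2 x > 0 \<Longrightarrow> f (rot \<theta> x, t) = f (x, t)" for f :: "spacetime \<Rightarrow> real"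
    proof (rule dense[OF smooth_on_rot_deriv[OF f] _ z])
      fix x t assume xt: "(x, t) \<in> Q" "axis_dist2 x > 0"
      have "((\<lambda>\<theta>. f (rot \<theta> x, t)) has_real_derivative 0) (at 0)" using inv[OF xt] by simp
      then show "rot_deriv f (x, t) = 0"
        using DERIV_unique[OF rot_derivative[OF smooth_on_imp_differentiable[OF f xt(1)]]] by blast
    qed
    show "rot_deriv (component u 3) z = 0" by (rule 3) (simp_all add: rot)
    show "rot_deriv p z = 0" by (rule 3) (simp_all add: P rot_in_Q cr)
  next
    fix x t assume z: "(x, t) \<in> Q" and r: "axis_dist2 x > 0"
    define y :: "real^3" where "y = vector [x $ 1, - (x $ 2), x $ 3]"
    have y: "y $ 1 = x $ 1" "y $ 2 = - (x $ 2)" "y $ 3 = x $ 3" by (simp_all add: y_def)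
    have ny: "norm y = norm x"
    proof -
      have "(norm y)\<^sup>2 = (norm x)\<^sup>2" by (simp add: norm_sq_vec3 y)
      then show ?thesis by (simp add: power2_eq_iff_nonneg)
    qed
    have ry: "cyl_radius y = cyl_radius x" by (simp add: cyl_radius_def y)
    have yQ: "(y, t) \<in> Q" using z ny by (simp add: parabolic_cylinder_def)
    have re: "refl (x, t) = (y, t)" by (simp add: refl_def y_def)
    define \<rho> where "\<rho> = cyl_radius x"
    have \<rho>: "\<rho> > 0" "axis_dist2 x = \<rho> * \<rho>" "x $ 1 * x $ 1 + x $ 2 * x $ 2 = \<rho> * \<rho>"
      using pos[OF r] r by (simp_all add: \<rho>_def cyl_radius_eq) (simp add: axis_dist2_def power2_eq_square)
    note cx = c[OF z pos[OF r], folded \<rho>_def]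
    have cy: "u (y, t) $ 1 = (ur \<rho> (x $ 3) t * x $ 1 + ut \<rho> (x $ 3) t * x $ 2) / \<rho>"
      "u (y, t) $ 2 = (- ur \<rho> (x $ 3) t * x $ 2 + ut \<rho> (x $ 3) t * x $ 1) / \<rho>"
      "u (y, t) $ 3 = u (x, t) $ 3"
      using c[OF yQ] pos[OF r] cx(3) unfolding ry y by (simp_all add: \<rho>_def)
    have A: "radial (component u 1) (component u 2) (x, t) = ur \<rho> (x $ 3) t * \<rho>"
    proof -
      have "radial (component u 1) (component u 2) (x, t) = ur \<rho> (x $ 3) t * (x $ 1 * x $ 1 + x $ 2 * x $ 2) / \<rho>"
        using \<rho>(1) by (simp add: radial_def cx field_simps)
      then show ?thesis unfolding \<rho>(3) using \<rho>(1) by simp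
    qed
    have B: "swirl (component u 1) (component u 2) (x, t) = ut \<rho> (x $ 3) t * \<rho>"
    proof -
      have "swirl (component u 1) (component u 2) (x, t) = ut \<rho> (x $ 3) t * (x $ 1 * x $ 1 + x $ 2 * x $ 2) / \<rho>"
        using \<rho>(1) by (simp add: swirl_def cx field_simps)
      then show ?thesis unfolding \<rho>(3) using \<rho>(1) by simp
    qed
    show "u (refl (x, t)) = vector
        [(x $ 1 * radial (component u 1) (component u 2) (x, t) + x $ 2 * swirl (component u 1) (component u 2) (x, t)) / axis_dist2 x,
         (x $ 1 * swirl (component u 1) (component u 2) (x, t) - x $ 2 * radial (component u 1) (component u 2) (x, t)) / axis_dist2 x, u (x, t) $ 3]"
      unfolding re A B \<rho>(2) using \<rho>(1) by (simp add: vec_eq_iff forall_3 cy field_simps)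
  qed
qed

subsection \<open>Estimates along horizontal rays from the axis\<close>

definition ray_dir :: "real^3 \<Rightarrow> spacetime" where
  "ray_dir x = (vector [x $ 1 / sqrt (axis_dist2 x), x $ 2 / sqrt (axis_dist2 x), 0], 0)"

definition ray_base :: "real^3 \<Rightarrow> real \<Rightarrow> spacetime" where
  "ray_base x t = (vector [0, 0, x $ 3], t)"

lemma axis_unit_vector:
  assumes "axis_dist2 x > 0"
  shows "(x $ 1 / sqrt (axis_dist2 x))\<^sup>2 + (x $ 2 / sqrt (axis_dist2 x))\<^sup>2 = 1"
    "\<bar>x $ 1 / sqrt (axis_dist2 x)\<bar> \<le> 1" "\<bar>x $ 2 / sqrt (axis_dist2 x)\<bar> \<le> 1"
proof -
  show e: "(x $ 1 / sqrt (axis_dist2 x))\<^sup>2 + (x $ 2 / sqrt (axis_dist2 x))\<^sup>2 = 1"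
    using assms unfolding power_divide add_divide_distrib[symmetric] axis_dist2_def[symmetric] by simp
  show "\<bar>x $ 1 / sqrt (axis_dist2 x)\<bar> \<le> 1" "\<bar>x $ 2 / sqrt (axis_dist2 x)\<bar> \<le> 1"
    using e zero_le_power2[of "x $ 1 / sqrt (axis_dist2 x)"] zero_le_power2[of "x $ 2 / sqrt (axis_dist2 x)"]
    unfolding abs_square_le_1[symmetric] by linarith+
qed

lemma ray_simps:
  "fst (ray_base x t + s *\<^sub>R ray_dir x) $ 1 = s * (x $ 1 / sqrt (axis_dist2 x))"
  "fst (ray_base x t + s *\<^sub>R ray_dir x) $ 2 = s * (x $ 2 / sqrt (axis_dist2 x))"
  "fst (ray_base x t + s *\<^sub>R ray_dir x) $ 3 = x $ 3"
  "snd (ray_base x t + s *\<^sub>R ray_dir x) = t"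
  by (simp_all add: ray_base_def ray_dir_def)

lemma ray_axis_dist2:
  assumes "axis_dist2 x > 0" shows "axis_dist2 (fst (ray_base x t + s *\<^sub>R ray_dir x)) = s\<^sup>2"
proof -
  have "axis_dist2 (fst (ray_base x t + s *\<^sub>R ray_dir x))
      = s\<^sup>2 * ((x $ 1 / sqrt (axis_dist2 x))\<^sup>2 + (x $ 2 / sqrt (axis_dist2 x))\<^sup>2)"
    unfolding axis_dist2_def[of "fst _"] ray_simps by (simp only: power_mult_distrib distrib_left)
  then show ?thesis unfolding axis_unit_vector(1)[OF assms] by simp
qed

lemma norm_sq_axis: "(norm x)\<^sup>2 = axis_dist2 x + (x $ 3)\<^sup>2"
  by (simp add: norm_sq_vec3 axis_dist2_def)

lemma ray_norm:
  assumes "axis_dist2 x > 0" shows "(norm (fst (ray_base x t + s *\<^sub>R ray_dir x)))\<^sup>2 = s\<^sup>2 + (x $ 3)\<^sup>2"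
  unfolding norm_sq_axis ray_axis_dist2[OF assms] ray_simps ..

lemma ray_end:
  assumes "axis_dist2 x > 0" shows "ray_base x t + sqrt (axis_dist2 x) *\<^sub>R ray_dir x = (x, t)"
  using assms by (auto simp: ray_base_def ray_dir_def vec_eq_iff forall_3)

lemma ray_dir_deriv:
  fixes f :: "spacetime \<Rightarrow> real"
  assumes "f differentiable (at z)"
  shows "dir_deriv (ray_dir x) f z = x $ 1 / sqrt (axis_dist2 x) * dx 1 f z + x $ 2 / sqrt (axis_dist2 x) * dx 2 f z"
proof -
  note l = dir_deriv_linear[OF assms]
  have e: "ray_dir x = (x $ 1 / sqrt (axis_dist2 x)) *\<^sub>R (axis 1 1, 0) + (x $ 2 / sqrt (axis_dist2 x)) *\<^sub>R (axis 2 1, 0)"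
    by (simp add: ray_dir_def vec_eq_iff forall_3 axis_def)
  show ?thesis unfolding e linear_add[OF l] linear_scale[OF l] dx_eq real_scaleR_def ..
qed

lemma ray_dir_deriv_bound:
  fixes f :: "spacetime \<Rightarrow> real"
  assumes x: "axis_dist2 x > 0" and f: "f differentiable (at z)" and K: "\<bar>dx 1 f z\<bar> \<le> K" "\<bar>dx 2 f z\<bar> \<le> K"
  shows "\<bar>dir_deriv (ray_dir x) f z\<bar> \<le> 2 * K"
proof -
  have "\<bar>x $ 1 / sqrt (axis_dist2 x) * dx 1 f z\<bar> \<le> 1 * K" "\<bar>x $ 2 / sqrt (axis_dist2 x) * dx 2 f z\<bar> \<le> 1 * K"
    unfolding abs_mult using axis_unit_vector(2,3)[OF x] K by (intro mult_mono; simp)+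
  then show ?thesis unfolding ray_dir_deriv[OF f] by linarith
qed

lemma ray_second_deriv_bound:
  fixes f :: "spacetime \<Rightarrow> real"
  assumes x: "axis_dist2 x > 0" and f: "smooth_on Q f" "z \<in> Q"
    and K: "\<And>i j. i \<in> {1, 2} \<Longrightarrow> j \<in> {1, 2} \<Longrightarrow> \<bar>dx i (dx j f) z\<bar> \<le> K"
  shows "\<bar>dir_deriv (ray_dir x) (dir_deriv (ray_dir x) f) z\<bar> \<le> 4 * K"
proof -
  define e1 e2 where e12: "e1 = x $ 1 / sqrt (axis_dist2 x)" "e2 = x $ 2 / sqrt (axis_dist2 x)"
  have d: "\<bar>dx i (dir_deriv (ray_dir x) f) z\<bar> \<le> 2 * K" if i: "i \<in> {1, 2}" for i
  proof -
    note [simp] = smooth_on_dx f smooth_on_mult smooth_on_const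
    have c: "dx i (\<lambda>z. c) z = 0" for c :: real
      unfolding dx_eq by (rule dir_derivI[where f'="\<lambda>v. 0"]) simp
    have "dx i (dir_deriv (ray_dir x) f) z = dx i (\<lambda>z. e1 * dx 1 f z + e2 * dx 2 f z) z"
      unfolding e12 by (rule dx_cong[OF _ f(2)]) (rule ray_dir_deriv[OF smooth_on_imp_differentiable[OF f(1)]])
    also have "\<dots> = e1 * dx i (dx 1 f) z + e2 * dx i (dx 2 f) z"
      by (simp add: dx_calc c)
    finally have e: "dx i (dir_deriv (ray_dir x) f) z = e1 * dx i (dx 1 f) z + e2 * dx i (dx 2 f) z" .
    have "\<bar>e1 * dx i (dx 1 f) z\<bar> \<le> 1 * K" "\<bar>e2 * dx i (dx 2 f) z\<bar> \<le> 1 * K"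
      unfolding abs_mult using axis_unit_vector(2,3)[OF x, folded e12] K[OF i] by (intro mult_mono; simp)+
    then show ?thesis unfolding e by linarith
  qed
  have "\<bar>dir_deriv (ray_dir x) (dir_deriv (ray_dir x) f) z\<bar> \<le> 2 * (2 * K)"
    by (rule ray_dir_deriv_bound[OF x smooth_on_imp_differentiable[OF smooth_on_dir_deriv[OF f(1)] f(2)]]) (use d in auto)
  then show ?thesis by simp
qed

lemma ray_in_Q:
  assumes x: "axis_dist2 x > 0" and t: "-1 < t" "t < 0" and s: "s\<^sup>2 + (x $ 3)\<^sup>2 \<le> \<rho>\<^sup>2" "0 \<le> \<rho>" "\<rho> < 1"
  shows "ray_base x t + s *\<^sub>R ray_dir x \<in> Q" "norm (fst (ray_base x t + s *\<^sub>R ray_dir x)) \<le> \<rho>"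
proof -
  have "(norm (fst (ray_base x t + s *\<^sub>R ray_dir x)))\<^sup>2 \<le> \<rho>\<^sup>2" using s ray_norm[OF x] by simp
  then show n: "norm (fst (ray_base x t + s *\<^sub>R ray_dir x)) \<le> \<rho>" using s(2) by (rule power2_le_imp_le)
  then have "norm (fst (ray_base x t + s *\<^sub>R ray_dir x)) < 1" using s(3) by simp
  then show "ray_base x t + s *\<^sub>R ray_dir x \<in> Q"
    using ray_simps(4)[of x t s] t by (cases "ray_base x t + s *\<^sub>R ray_dir x") (auto simp: parabolic_cylinder_def)
qed

lemma ray_first_order:
  fixes f :: "spacetime \<Rightarrow> real"
  assumes f: "smooth_on Q f" and f0: "f (ray_base x t) = 0" and x: "axis_dist2 x > 0" "norm x \<le> \<rho>" "\<rho> < 1" and t: "-1 < t" "t < 0"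
    and K: "\<And>i y. i \<in> {1, 2} \<Longrightarrow> norm y \<le> \<rho> \<Longrightarrow> \<bar>dx i f (y, t)\<bar> \<le> K"
  shows "\<bar>f (x, t)\<bar> \<le> 2 * K * sqrt (axis_dist2 x)"
proof -
  let ?r = "sqrt (axis_dist2 x)" and ?p = "\<lambda>s. ray_base x t + s *\<^sub>R ray_dir x"
  have r: "?r > 0" using x by simp
  have \<rho>: "0 \<le> \<rho>" using x(2) norm_ge_zero order_trans by blast
  have p: "?p s \<in> Q" "norm (fst (?p s)) \<le> \<rho>" "snd (?p s) = t" if "0 \<le> s" "s \<le> ?r" for s
  proof -
    have "s\<^sup>2 \<le> ?r\<^sup>2" using that by (intro power_mono) auto
    moreover have "(norm x)\<^sup>2 \<le> \<rho>\<^sup>2" using x by (intro power_mono) auto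
    ultimately have "s\<^sup>2 + (x $ 3)\<^sup>2 \<le> \<rho>\<^sup>2" using norm_sq_axis[of x] by simp
    from ray_in_Q[OF x(1) t this \<rho> x(3)] show "?p s \<in> Q" "norm (fst (?p s)) \<le> \<rho>" .
    show "snd (?p s) = t" by (rule ray_simps)
  qed
  have d: "((\<lambda>s. f (?p s)) has_real_derivative dir_deriv (ray_dir x) f (?p s)) (at s)" if "0 \<le> s" "s \<le> ?r" for s
    by (rule DERIV_along_line_real[OF smooth_on_imp_differentiable[OF f p(1)[OF that]]])
  obtain s where s: "0 < s" "s < ?r" "f (?p ?r) - f (?p 0) = (?r - 0) * dir_deriv (ray_dir x) f (?p s)"
    using MVT2[OF r, of "\<lambda>s. f (?p s)" "\<lambda>s. dir_deriv (ray_dir x) f (?p s)", OF d] by blast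
  have ps: "?p s = (fst (?p s), t)" using ray_simps(4)[of x t s] by (metis prod.collapse)
  have "\<bar>dir_deriv (ray_dir x) f (?p s)\<bar> \<le> 2 * K"
  proof (rule ray_dir_deriv_bound[OF x(1) smooth_on_imp_differentiable[OF f p(1)]])
    have n: "norm (fst (?p s)) \<le> \<rho>" using s by (intro p(2)) auto
    show "\<bar>dx 1 f (?p s)\<bar> \<le> K" "\<bar>dx 2 f (?p s)\<bar> \<le> K"
      by (subst ps, rule K[OF _ n], simp)+
  qed (use s in auto)
  then have "?r * \<bar>dir_deriv (ray_dir x) f (?p s)\<bar> \<le> ?r * (2 * K)" using r by (intro mult_left_mono) auto
  moreover have "f (x, t) = ?r * dir_deriv (ray_dir x) f (?p s)" using s(3) f0 unfolding ray_end[OF x(1)] by simp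
  ultimately show ?thesis using r by (simp add: abs_mult mult.commute)
qed

lemma ray_second_order:
  fixes f :: "spacetime \<Rightarrow> real"
  assumes f: "smooth_on Q f" and f0: "f (ray_base x t) = 0" and x: "axis_dist2 x > 0" "sqrt (axis_dist2 x) \<le> h"
    and \<rho>: "h\<^sup>2 + (x $ 3)\<^sup>2 \<le> \<rho>\<^sup>2" "0 \<le> \<rho>" "\<rho> < 1" and t: "-1 < t" "t < 0"
    and K: "\<And>i j y. i \<in> {1, 2} \<Longrightarrow> j \<in> {1, 2} \<Longrightarrow> norm y \<le> \<rho> \<Longrightarrow> \<bar>dx i (dx j f) (y, t)\<bar> \<le> K"
  shows "\<bar>f (x, t) / sqrt (axis_dist2 x) - f (ray_base x t + h *\<^sub>R ray_dir x) / h\<bar> \<le> 4 * K * h"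
proof -
  let ?r = "sqrt (axis_dist2 x)" and ?p = "\<lambda>s. ray_base x t + s *\<^sub>R ray_dir x"
  have r: "?r > 0" using x by simp
  have p: "?p s \<in> Q" "norm (fst (?p s)) \<le> \<rho>" if "0 \<le> s" "s \<le> h" for s
  proof -
    have "s\<^sup>2 \<le> h\<^sup>2" using that by (intro power_mono) auto
    then have "s\<^sup>2 + (x $ 3)\<^sup>2 \<le> \<rho>\<^sup>2" using \<rho> by simp
    from ray_in_Q[OF x(1) t this \<rho>(2,3)] show "?p s \<in> Q" "norm (fst (?p s)) \<le> \<rho>" .
  qed
  have ps: "?p s = (fst (?p s), t)" for s using ray_simps(4)[of x t s] by (metis prod.collapse)
  have "\<bar>f (?p ?r) / ?r - f (?p h) / h\<bar> \<le> 4 * K * h"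
  proof (rule quotient_oscillation_along_line[OF f r x(2) p(1) f0])
    fix s assume s: "0 \<le> s" "s \<le> h"
    show "\<bar>dir_deriv (ray_dir x) (dir_deriv (ray_dir x) f) (?p s)\<bar> \<le> 4 * K"
    proof (rule ray_second_deriv_bound[OF x(1) f p(1)[OF s]])
      fix i j :: 3 assume ij: "i \<in> {1, 2}" "j \<in> {1, 2}"
      show "\<bar>dx i (dx j f) (?p s)\<bar> \<le> K" by (subst ps) (rule K[OF ij p(2)[OF s]])
    qed
  qed
  then show ?thesis unfolding ray_end[OF x(1)] .
qed

text \<open>Along a ray the unit vector is constant, so swirl and radial part are s times a
  combination of \<open>a\<close> and \<open>b\<close> with constant coefficients. Such a
  combination vanishes on the axis, which reduces both to a scalar function on a segment.\<close>

lemma rotating_pair_combination: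
  assumes ab: "rotating_pair a b"
  shows "smooth_on Q (\<lambda>z. \<alpha> * a z + \<beta> * b z)"
    "z \<in> Q \<Longrightarrow> dx i (\<lambda>z. \<alpha> * a z + \<beta> * b z) z = \<alpha> * dx i a z + \<beta> * dx i b z"
    "z \<in> Q \<Longrightarrow> dx i (dx j (\<lambda>z. \<alpha> * a z + \<beta> * b z)) z = \<alpha> * dx i (dx j a) z + \<beta> * dx i (dx j b) z"
    "-1 < t \<Longrightarrow> t < 0 \<Longrightarrow> \<bar>x $ 3\<bar> < 1 \<Longrightarrow> \<alpha> * a (ray_base x t) + \<beta> * b (ray_base x t) = 0"
proof -
  note s = rotating_pairD(1,2)[OF ab]
  have c: "dx i (\<lambda>z. c) z = 0" for c :: real and i z
    unfolding dx_eq by (rule dir_derivI[where f'="\<lambda>v. 0"]) simp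
  note [simp] = smooth_on_dx s smooth_on_mult smooth_on_const smooth_on_add
  show "smooth_on Q (\<lambda>z. \<alpha> * a z + \<beta> * b z)" by simp
  show 1: "dx i (\<lambda>z. \<alpha> * a z + \<beta> * b z) z = \<alpha> * dx i a z + \<beta> * dx i b z" if "z \<in> Q" for i z
    using that by (simp add: dx_calc c)
  show "dx i (dx j (\<lambda>z. \<alpha> * a z + \<beta> * b z)) z = \<alpha> * dx i (dx j a) z + \<beta> * dx i (dx j b) z" if z: "z \<in> Q"
  proof -
    have "dx i (dx j (\<lambda>z. \<alpha> * a z + \<beta> * b z)) z = dx i (\<lambda>z. \<alpha> * dx j a z + \<beta> * dx j b z) z"
      by (rule dx_cong[OF 1 z])
    then show ?thesis using z by (simp add: dx_calc c)
  qed
  assume t: "-1 < t" "t < 0" and x: "\<bar>x $ 3\<bar> < 1"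
  have "(norm (fst (ray_base x t)))\<^sup>2 = \<bar>x $ 3\<bar>\<^sup>2" unfolding norm_sq_vec3 by (simp add: ray_base_def)
  then have "norm (fst (ray_base x t)) = \<bar>x $ 3\<bar>" by (subst (asm) power2_eq_iff_nonneg) auto
  then have "ray_base x t \<in> Q" using t x by (simp add: ray_base_def parabolic_cylinder_def)
  then show "\<alpha> * a (ray_base x t) + \<beta> * b (ray_base x t) = 0"
    using rotating_pair_axis[OF ab] by (simp add: ray_base_def)
qed

lemma swirl_radial_polar:
  assumes "axis_dist2 x > 0"
  shows "swirl a b (ray_base x t + s *\<^sub>R ray_dir x) = s * (- (x $ 2 / sqrt (axis_dist2 x)) * a (ray_base x t + s *\<^sub>R ray_dir x)
      + x $ 1 / sqrt (axis_dist2 x) * b (ray_base x t + s *\<^sub>R ray_dir x))"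
    "radial a b (ray_base x t + s *\<^sub>R ray_dir x) = s * (x $ 1 / sqrt (axis_dist2 x) * a (ray_base x t + s *\<^sub>R ray_dir x)
      + x $ 2 / sqrt (axis_dist2 x) * b (ray_base x t + s *\<^sub>R ray_dir x))"
  unfolding swirl_def radial_def ray_simps by (simp_all add: algebra_simps)

lemma combination_bound:
  fixes \<alpha> \<beta> p q K :: real
  assumes "\<bar>\<alpha>\<bar> \<le> 1" "\<bar>\<beta>\<bar> \<le> 1" "\<bar>p\<bar> \<le> K" "\<bar>q\<bar> \<le> K"
  shows "\<bar>\<alpha> * p + \<beta> * q\<bar> \<le> 2 * K"
proof -
  have "\<bar>\<alpha> * p\<bar> \<le> 1 * K" "\<bar>\<beta> * q\<bar> \<le> 1 * K" unfolding abs_mult using assms by (intro mult_mono; simp)+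
  then show ?thesis by linarith
qed

text \<open>One factor r is explicit in swirl and radial part; the second comes from the pair
  vanishing on the axis and its gradient being bounded.\<close>

lemma rotating_pair_first_order:
  assumes ab: "rotating_pair a b" and x: "norm x \<le> \<rho>" "\<rho> < 1" and t: "-1 < t" "t < 0"
    and K: "\<And>i y. norm y \<le> \<rho> \<Longrightarrow> \<bar>dx i a (y, t)\<bar> \<le> K" "\<And>i y. norm y \<le> \<rho> \<Longrightarrow> \<bar>dx i b (y, t)\<bar> \<le> K"
  shows "\<bar>swirl a b (x, t)\<bar> \<le> 4 * K * axis_dist2 x" "\<bar>radial a b (x, t)\<bar> \<le> 4 * K * axis_dist2 x"
proof -
  consider "axis_dist2 x = 0" | "axis_dist2 x > 0" using axis_dist2_nonneg[of x] by linarith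
  then have "\<bar>swirl a b (x, t)\<bar> \<le> 4 * K * axis_dist2 x \<and> \<bar>radial a b (x, t)\<bar> \<le> 4 * K * axis_dist2 x"
  proof cases
    case 1
    then have "x $ 1 = 0" "x $ 2 = 0" by (simp_all add: axis_dist2_def)
    then show ?thesis using 1 by (simp add: swirl_def radial_def)
  next
    case 2
    let ?r = "sqrt (axis_dist2 x)"
    have x3: "\<bar>x $ 3\<bar> < 1" using component_le_norm_cart[of x 3] x by linarith
    note e = axis_unit_vector(2,3)[OF 2]
    have key: "\<bar>\<alpha> * a (x, t) + \<beta> * b (x, t)\<bar> \<le> 4 * K * ?r" if \<alpha>\<beta>: "\<bar>\<alpha>\<bar> \<le> 1" "\<bar>\<beta>\<bar> \<le> 1" for \<alpha> \<beta>
    proof -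
      note c = rotating_pair_combination[OF ab, where \<alpha>=\<alpha> and \<beta>=\<beta>]
      have "\<bar>\<alpha> * a (x, t) + \<beta> * b (x, t)\<bar> \<le> 2 * (2 * K) * ?r"
      proof (rule ray_first_order[OF c(1) c(4)[OF t x3] 2 x t])
        fix i y assume "norm (y :: real^3) \<le> \<rho>"
        moreover from this have "(y, t) \<in> Q" using x t by (simp add: parabolic_cylinder_def)
        ultimately show "\<bar>dx i (\<lambda>z. \<alpha> * a z + \<beta> * b z) (y, t)\<bar> \<le> 2 * K"
          using combination_bound[OF \<alpha>\<beta> K(1) K(2)] by (simp add: c(2))
      qed
      then show ?thesis by simp
    qed
    have sw: "swirl a b (x, t) = ?r * (- (x $ 2 / ?r) * a (x, t) + x $ 1 / ?r * b (x, t))"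
      and ra: "radial a b (x, t) = ?r * (x $ 1 / ?r * a (x, t) + x $ 2 / ?r * b (x, t))"
      using swirl_radial_polar[OF 2, of a b t ?r] unfolding ray_end[OF 2] by blast+
    have q: "\<bar>?r * y\<bar> \<le> 4 * K * axis_dist2 x" if "\<bar>y\<bar> \<le> 4 * K * ?r" for y
    proof -
      have "\<bar>?r * y\<bar> \<le> ?r * (4 * K * ?r)" unfolding abs_mult using that by (simp add: mult_left_mono)
      also have "\<dots> = 4 * K * (?r * ?r)" by simp
      also have "?r * ?r = axis_dist2 x" by (rule real_sqrt_mult_self[THEN trans]) simp
      finally show ?thesis .
    qed
    show ?thesis unfolding sw ra by (intro conjI q key) (use e in simp_all)
  qed
  then show "\<bar>swirl a b (x, t)\<bar> \<le> 4 * K * axis_dist2 x" "\<bar>radial a b (x, t)\<bar> \<le> 4 * K * axis_dist2 x" by blast+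
qed

text \<open>After removal of the explicit factor r, the quotients at distance r and at distance
  \<open>h\<close> on the same ray differ by at most a multiple of \<open>K * h\<close>. A bound of
  order h^2 on one cylinder surface therefore descends to a bound of order r^2 everywhere inside
  it.\<close>

lemma rotating_pair_second_order:
  assumes ab: "rotating_pair a b" and x: "sqrt (axis_dist2 x) \<le> h" "h > 0"
    and \<rho>: "h\<^sup>2 + (x $ 3)\<^sup>2 \<le> \<rho>\<^sup>2" "0 \<le> \<rho>" "\<rho> < 1" and t: "-1 < t" "t < 0"
    and K: "\<And>i j y. norm y \<le> \<rho> \<Longrightarrow> \<bar>dx i (dx j a) (y, t)\<bar> \<le> K" "\<And>i j y. norm y \<le> \<rho> \<Longrightarrow> \<bar>dx i (dx j b) (y, t)\<bar> \<le> K"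
    and F: "F = swirl a b \<or> F = radial a b"
    and \<eta>: "\<And>y. norm y \<le> \<rho> \<Longrightarrow> axis_dist2 y = h\<^sup>2 \<Longrightarrow> \<bar>F (y, t)\<bar> \<le> \<eta> * h\<^sup>2"
  shows "\<bar>F (x, t)\<bar> \<le> (\<eta> + 8 * K * h) * axis_dist2 x"
proof -
  consider "axis_dist2 x = 0" | "axis_dist2 x > 0" using axis_dist2_nonneg[of x] by linarith
  then show ?thesis
  proof cases
    case 1
    then have "x $ 1 = 0" "x $ 2 = 0" by (simp_all add: axis_dist2_def)
    then show ?thesis using 1 F by (auto simp: swirl_def radial_def)
  next
    case 2
    let ?r = "sqrt (axis_dist2 x)" and ?p = "ray_base x t + h *\<^sub>R ray_dir x"
    have r: "?r > 0" "?r * ?r = axis_dist2 x" using 2 by simp_all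
    have "(x $ 3)\<^sup>2 \<le> \<rho>\<^sup>2" using \<rho>(1) zero_le_power2[of h] by linarith
    then have x3: "\<bar>x $ 3\<bar> < 1" using \<rho> abs_le_square_iff[of "x $ 3" \<rho>] by simp
    note e = axis_unit_vector(2,3)[OF 2]
    obtain \<alpha> \<beta> where \<alpha>\<beta>: "\<bar>\<alpha>\<bar> \<le> 1" "\<bar>\<beta>\<bar> \<le> 1" and
      Fs: "\<And>s. F (ray_base x t + s *\<^sub>R ray_dir x) = s * (\<alpha> * a (ray_base x t + s *\<^sub>R ray_dir x) + \<beta> * b (ray_base x t + s *\<^sub>R ray_dir x))"
      using F
    proof
      assume F: "F = swirl a b"
      show ?thesis
      proof (rule that)
        show "\<bar>- (x $ 2 / ?r)\<bar> \<le> 1" "\<bar>x $ 1 / ?r\<bar> \<le> 1" using e by simp_all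
        show "F (ray_base x t + s *\<^sub>R ray_dir x) = s * (- (x $ 2 / ?r) * a (ray_base x t + s *\<^sub>R ray_dir x) + x $ 1 / ?r * b (ray_base x t + s *\<^sub>R ray_dir x))" for s
          unfolding F by (rule swirl_radial_polar(1)[OF 2])
      qed
    next
      assume F: "F = radial a b"
      show ?thesis
      proof (rule that)
        show "\<bar>x $ 1 / ?r\<bar> \<le> 1" "\<bar>x $ 2 / ?r\<bar> \<le> 1" using e by simp_all
        show "F (ray_base x t + s *\<^sub>R ray_dir x) = s * (x $ 1 / ?r * a (ray_base x t + s *\<^sub>R ray_dir x) + x $ 2 / ?r * b (ray_base x t + s *\<^sub>R ray_dir x))" for s
          unfolding F by (rule swirl_radial_polar(2)[OF 2])
      qed
    qed
    note c = rotating_pair_combination[OF ab, where \<alpha>=\<alpha> and \<beta>=\<beta>]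
    define g where "g z = \<alpha> * a z + \<beta> * b z" for z
    have osc: "\<bar>g (x, t) / ?r - g ?p / h\<bar> \<le> 4 * (2 * K) * h" unfolding g_def
    proof (rule ray_second_order[OF c(1) c(4)[OF t x3] 2 x(1) \<rho> t])
      fix i j y assume "norm (y :: real^3) \<le> \<rho>"
      moreover from this have "(y, t) \<in> Q" using \<rho> t by (simp add: parabolic_cylinder_def)
      ultimately show "\<bar>dx i (dx j (\<lambda>z. \<alpha> * a z + \<beta> * b z)) (y, t)\<bar> \<le> 2 * K"
        using combination_bound[OF \<alpha>\<beta> K(1) K(2)] by (simp add: c(3))
    qed
    have pe: "?p = (fst ?p, t)" using ray_simps(4)[of x t h] by (metis prod.collapse)
    have "\<bar>F ?p\<bar> \<le> \<eta> * h\<^sup>2"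
      using \<eta>[OF ray_in_Q(2)[OF 2 t \<rho>] ray_axis_dist2[OF 2]] pe by simp
    then have "\<bar>h * g ?p\<bar> \<le> \<eta> * h\<^sup>2" by (simp add: Fs g_def)
    then have "h * \<bar>g ?p\<bar> \<le> h * (\<eta> * h)" using x(2) by (simp add: abs_mult power2_eq_square mult_ac)
    then have "\<bar>g ?p\<bar> \<le> \<eta> * h" using x(2) by (rule mult_left_le_imp_le)
    then have "\<bar>g ?p / h\<bar> \<le> \<eta>" using x(2) by (simp add: pos_divide_le_eq)
    with osc have gr: "\<bar>g (x, t) / ?r\<bar> \<le> \<eta> + 8 * K * h" by linarith
    have "F (x, t) = ?r * g (x, t)" using Fs[of ?r] unfolding ray_end[OF 2] g_def .
    also have "\<dots> = axis_dist2 x * (g (x, t) / ?r)"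
    proof -
      have "s * y = q * (y / s)" if "s > 0" "s * s = q" for s q y :: real using that by auto
      then show ?thesis using r by blast
    qed
    finally have "\<bar>F (x, t)\<bar> = axis_dist2 x * \<bar>g (x, t) / ?r\<bar>" using 2 by (simp add: abs_mult)
    also have "\<dots> \<le> axis_dist2 x * (\<eta> + 8 * K * h)" using gr by (intro mult_left_mono) auto
    finally show ?thesis by (simp add: mult.commute)
  qed
qed

subsection \<open>Flows controlled by an Euler length\<close>

lemma slice_calculus:
  fixes f :: "spacetime \<Rightarrow> real"
  assumes f: "smooth_on Q f" and t: "-1 < t" "t < 0"
  shows "smooth_on (ball 0 1) (\<lambda>x. f (x, t))"
    "norm x < 1 \<Longrightarrow> dir_deriv (axis i 1) (\<lambda>x. f (x, t)) x = dx i f (x, t)"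
proof -
  have L: "bounded_linear (\<lambda>x::real^3. (x, 0::real))" by (intro bounded_linear_Pair bounded_linear_ident bounded_linear_zero)
  have e: "(x, 0) + (0, t) = (x, t)" for x :: "real^3" by simp
  have Qx: "(x, t) \<in> Q" if "norm x < 1" for x using that t by (simp add: parabolic_cylinder_def)
  show "smooth_on (ball 0 1) (\<lambda>x. f (x, t))"
    using smooth_on_affine[OF L open_ball _ f, of 0 1 "(0, t)"] Qx unfolding e by simp
  assume "norm x < 1"
  then have "f differentiable (at ((x, 0) + (0, t)))" unfolding e by (intro smooth_on_imp_differentiable[OF f] Qx)
  from dir_deriv_affine(1)[OF L this] show "dir_deriv (axis i 1) (\<lambda>x. f (x, t)) x = dx i f (x, t)"
    unfolding e dx_eq .
qed

lemma norm_le_components: "norm (v::real^3) \<le> 3 * B" if "\<And>k. \<bar>v $ k\<bar> \<le> B"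
  using norm_le_l1_cart[of v] sum_mono[of UNIV "\<lambda>k. \<bar>v $ k\<bar>" "\<lambda>_. B"] that by simp

text \<open>Pointwise forms of the hypotheses, valid at every time. The energy is stated on cubes
  because over a compact cube it depends continuously on time, so the exceptional null set of times
  can be removed.\<close>

locale euler_rate = axisymmetric_flow u p for u p +
  fixes l :: "real \<Rightarrow> real" and C0 C2 E :: real
  assumes l_pos: "-1 < t \<Longrightarrow> t < 0 \<Longrightarrow> 0 < l t"
    and l_anti: "-1 < s \<Longrightarrow> s \<le> t \<Longrightarrow> t < 0 \<Longrightarrow> l t \<le> l s"
    and l_lim: "(l \<longlongrightarrow> 0) (at_left 0)" and l_euler: "((\<lambda>t. - t / (l t)\<^sup>2) \<longlongrightarrow> 0) (at_left 0)"
    and C0: "C0 > 0" and C2: "C2 > 0" and E: "E \<ge> 0"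
    and u_bound: "norm x < 1 \<Longrightarrow> -1 < t \<Longrightarrow> t < 0 \<Longrightarrow> norm (u (x, t)) \<le> C0 * (l t / (- t))"
    and d2_bound: "norm x < 1 \<Longrightarrow> -1 < t \<Longrightarrow> t < 0 \<Longrightarrow> \<bar>dx i (dx j (component u k)) (x, t)\<bar> \<le> C2 * (1 / ((- t) * l t))"
    and energy: "-1 < t \<Longrightarrow> t < 0 \<Longrightarrow> s > 0 \<Longrightarrow> ball x (2 * s) \<subseteq> ball 0 1 \<Longrightarrow>
      integral (cbox (x - s *\<^sub>R 1) (x + s *\<^sub>R 1)) (\<lambda>y. (norm (u (y, t)))\<^sup>2) \<le> E"
begin

section \<open>A priori bounds from the two rates\<close>

lemma small_scales:
  assumes "\<epsilon> > 0"
  obtains \<tau> where "0 < \<tau>" "\<tau> < 1" "\<tau> \<le> \<epsilon>" "\<And>t. - \<tau> \<le> t \<Longrightarrow> t < 0 \<Longrightarrow> 0 < l t \<and> l t \<le> \<epsilon> \<and> - t \<le> \<epsilon> * (l t)\<^sup>2"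
proof -
  have "\<forall>\<^sub>F t in at_left 0. l t < \<epsilon>" by (rule order_tendstoD(2)[OF l_lim assms])
  moreover have "\<forall>\<^sub>F t in at_left 0. - t / (l t)\<^sup>2 < \<epsilon>" by (rule order_tendstoD(2)[OF l_euler assms])
  ultimately have "\<forall>\<^sub>F t in at_left 0. l t < \<epsilon> \<and> - t / (l t)\<^sup>2 < \<epsilon>" by eventually_elim simp
  then obtain b where b: "b < 0" "\<And>t. b < t \<Longrightarrow> t < 0 \<Longrightarrow> l t < \<epsilon> \<and> - t / (l t)\<^sup>2 < \<epsilon>"
    unfolding eventually_at_left_field by blast
  define \<tau> where "\<tau> = min (min (- b / 2) (1/2)) \<epsilon>"
  show ?thesis
  proof (rule that[of \<tau>])
    show "0 < \<tau>" "\<tau> < 1" "\<tau> \<le> \<epsilon>" using b(1) assms by (auto simp: \<tau>_def)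
    fix t assume t: "- \<tau> \<le> t" "t < 0"
    then have "b < t" "-1 < t" using b(1) by (auto simp: \<tau>_def min_def split: if_splits)
    then have l: "0 < l t" "l t < \<epsilon>" "- t / (l t)\<^sup>2 < \<epsilon>" using b(2)[of t] t l_pos by auto
    have "- t < \<epsilon> * (l t)\<^sup>2" using l(3) by (subst (asm) pos_divide_less_eq) (use l(1) in auto)
    then show "0 < l t \<and> l t \<le> \<epsilon> \<and> - t \<le> \<epsilon> * (l t)\<^sup>2" using l by simp
  qed
qed

text \<open>Interpolation over the length \<open>l t\<close>, at which both terms have size 1 /
  (-t). \<open>Gam\<close> and \<open>Rad\<close> gain r^2 from the gradient alone;
  \<open>Hel\<close> and \<open>dx 3 Gam\<close> are swirls of first derivatives, so the second
  derivatives enter and cost a further 1 / l.\<close>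

lemma basic_bounds:
  obtains K \<tau> where "K \<ge> 1" "0 < \<tau>" "\<tau> < 1"
    "\<And>x t i k. norm x \<le> 7/8 \<Longrightarrow> - \<tau> \<le> t \<Longrightarrow> t < 0 \<Longrightarrow> \<bar>dx i (component u k) (x, t)\<bar> \<le> K / (- t)"
    "\<And>x t. norm x \<le> 7/8 \<Longrightarrow> - \<tau> \<le> t \<Longrightarrow> t < 0 \<Longrightarrow> \<bar>Gam (x, t)\<bar> \<le> K / (- t) * axis_dist2 x"
    "\<And>x t. norm x \<le> 7/8 \<Longrightarrow> - \<tau> \<le> t \<Longrightarrow> t < 0 \<Longrightarrow> \<bar>Rad (x, t)\<bar> \<le> K / (- t) * axis_dist2 x"
    "\<And>x t. norm x \<le> 7/8 \<Longrightarrow> - \<tau> \<le> t \<Longrightarrow> t < 0 \<Longrightarrow> \<bar>Hel (x, t)\<bar> \<le> K / ((- t) * l t) * axis_dist2 x"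
    "\<And>x t. norm x \<le> 7/8 \<Longrightarrow> - \<tau> \<le> t \<Longrightarrow> t < 0 \<Longrightarrow> \<bar>dx 3 Gam (x, t)\<bar> \<le> K / ((- t) * l t) * axis_dist2 x"
proof -
  \<comment> \<open>With l \<le> 1/16 the interpolation segments that start within radius 7/8 stay
    inside the unit ball.\<close>
  obtain \<tau> where \<tau>: "0 < \<tau>" "\<tau> < 1" "\<And>t. - \<tau> \<le> t \<Longrightarrow> t < 0 \<Longrightarrow> 0 < l t \<and> l t \<le> 1/16 \<and> - t \<le> 1/16 * (l t)\<^sup>2"
    by (rule small_scales[of "1/16"], simp, blast)
  define K1 where "K1 = 2 * C0 + C2"
  define K where "K = 4 * K1 + 8 * C2 + 1"
  have K1: "K1 > 0" using C0 C2 by (simp add: K1_def)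
  have gr: "\<bar>dx i (component u k) (x, t)\<bar> \<le> K1 / (- t)" if x: "norm x \<le> 7/8" and t: "- \<tau> \<le> t" "t < 0" for x t i k
  proof -
    have t1: "-1 < t" using t \<tau> by simp
    note lt = \<tau>(3)[OF t]
    have line: "(x, t) + s *\<^sub>R (axis i 1, 0) = (x + s *\<^sub>R axis i 1, t)" for s by simp
    have nx: "norm (x + s *\<^sub>R axis i 1) < 1" if "0 \<le> s" "s \<le> l t" for s
      using norm_triangle_ineq[of x "s *\<^sub>R axis i 1"] x that lt by simp
    have Qs: "(x, t) + s *\<^sub>R (axis i 1, 0) \<in> Q" if "0 \<le> s" "s \<le> l t" for s
      unfolding line using nx[OF that] t t1 by (simp add: parabolic_cylinder_def)
    have ub: "\<bar>component u k (x + s *\<^sub>R axis i 1, t)\<bar> \<le> C0 * (l t / (- t))" if "0 \<le> s" "s \<le> l t" for s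
      using component_le_norm_cart[of "u (x + s *\<^sub>R axis i 1, t)" k] u_bound[OF nx[OF that] t1 t(2)] by linarith
    have "\<bar>dir_deriv (axis i 1, 0) (component u k) (x, t)\<bar> \<le> 2 * (C0 * (l t / (- t))) / l t + C2 * (1 / ((- t) * l t)) * l t"
    proof (rule interpolation_along_line[OF sc _ Qs])
      show "0 < l t" using lt by simp
      show "\<bar>component u k (x, t)\<bar> \<le> C0 * (l t / (- t))" using ub[of 0] lt by simp
      show "\<bar>component u k ((x, t) + l t *\<^sub>R (axis i 1, 0))\<bar> \<le> C0 * (l t / (- t))" unfolding line using ub[of "l t"] lt by simp
      show "\<bar>dir_deriv (axis i 1, 0) (dir_deriv (axis i 1, 0) (component u k)) ((x, t) + s *\<^sub>R (axis i 1, 0))\<bar> \<le> C2 * (1 / ((- t) * l t))"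
        if "0 \<le> s" "s \<le> l t" for s
        unfolding line using d2_bound[OF nx[OF that] t1 t(2), of i i k] unfolding dx_eq .
    qed
    also have "\<dots> = K1 / (- t)" using lt t by (simp add: K1_def field_simps)
    finally show ?thesis by (simp add: dx_eq)
  qed
  have d2: "\<bar>dx i (dx j (component u k)) (x, t)\<bar> \<le> C2 / ((- t) * l t)" if x: "norm x \<le> 7/8" and t: "- \<tau> \<le> t" "t < 0" for x t i j k
    using d2_bound[of x t i j k] x t \<tau> by simp
  have dv: "\<bar>dx i vort1 (x, t)\<bar> \<le> 2 * (C2 / ((- t) * l t))" "\<bar>dx i vort2 (x, t)\<bar> \<le> 2 * (C2 / ((- t) * l t))"
    if x: "norm x \<le> 7/8" and t: "- \<tau> \<le> t" "t < 0" for x t i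
  proof -
    have z: "(x, t) \<in> Q" using x t \<tau> by (simp add: parabolic_cylinder_def)
    have e: "dx i vort1 (x, t) = dx i (dx 2 (component u 3)) (x, t) - dx i (dx 3 (component u 2)) (x, t)"
      "dx i vort2 (x, t) = dx i (dx 3 (component u 1)) (x, t) - dx i (dx 1 (component u 3)) (x, t)"
      unfolding vort1_def[abs_def] vort2_def[abs_def] by (rule dx_calc; simp add: smooth_on_dx z)+
    have pq: "\<bar>p - q\<bar> \<le> 2 * B" if "\<bar>p\<bar> \<le> B" "\<bar>q\<bar> \<le> B" for p q B :: real using that by linarith
    show "\<bar>dx i vort1 (x, t)\<bar> \<le> 2 * (C2 / ((- t) * l t))" "\<bar>dx i vort2 (x, t)\<bar> \<le> 2 * (C2 / ((- t) * l t))"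
      unfolding e by (rule pq[OF d2[OF x t] d2[OF x t]])+
  qed
  show ?thesis
  proof (rule that[of K \<tau>])
    show "K \<ge> 1" using K1 C2 by (simp add: K_def)
    show "0 < \<tau>" "\<tau> < 1" by fact+
    fix x t assume x: "norm (x::real^3) \<le> 7/8" and t: "- \<tau> \<le> t" "t < 0"
    have t1: "-1 < t" and z: "(x, t) \<in> Q" using x t \<tau> by (simp_all add: parabolic_cylinder_def)
    have lt: "0 < l t" using \<tau>(3)[OF t] by simp
    have c0: "4 * K1 / (- t) \<le> K / (- t)" using t K1 C2 by (intro divide_right_mono) (auto simp: K_def)
    have c1: "4 * (K1 / (- t)) * R \<le> K / (- t) * R" if "R \<ge> 0" for R
      using mult_right_mono[OF c0 that] by simp
    note c0
    moreover have "K1 / (- t) \<le> 4 * K1 / (- t)" using t K1 by (intro divide_right_mono) auto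
    ultimately show "\<bar>dx i (component u k) (x, t)\<bar> \<le> K / (- t)" for i k using gr[OF x t, of i k] by linarith
    have 1: "\<bar>swirl (component u 1) (component u 2) (x, t)\<bar> \<le> 4 * (K1 / (- t)) * axis_dist2 x"
      "\<bar>radial (component u 1) (component u 2) (x, t)\<bar> \<le> 4 * (K1 / (- t)) * axis_dist2 x"
      by (rule rotating_pair_first_order[OF pair_u x _ t1 t(2) gr gr]; use t in simp)+
    show "\<bar>Gam (x, t)\<bar> \<le> K / (- t) * axis_dist2 x" "\<bar>Rad (x, t)\<bar> \<le> K / (- t) * axis_dist2 x"
      using 1 c1[of "axis_dist2 x"] unfolding Gam_def Rad_def by simp_all
    have c2: "4 * (2 * (C2 / ((- t) * l t))) * axis_dist2 x \<le> K / ((- t) * l t) * axis_dist2 x"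
      "4 * (C2 / ((- t) * l t)) * axis_dist2 x \<le> K / ((- t) * l t) * axis_dist2 x"
    proof -
      have p: "(- t) * l t > 0" by (rule mult_pos_pos) (use t lt in auto)
      have "4 * (2 * C2) / ((- t) * l t) \<le> K / ((- t) * l t)" "4 * C2 / ((- t) * l t) \<le> K / ((- t) * l t)"
        using p K1 C2 by (intro divide_right_mono; simp add: K_def)+
      then show "4 * (2 * (C2 / ((- t) * l t))) * axis_dist2 x \<le> K / ((- t) * l t) * axis_dist2 x"
        "4 * (C2 / ((- t) * l t)) * axis_dist2 x \<le> K / ((- t) * l t) * axis_dist2 x"
        by (intro mult_right_mono; simp)+
    qed
    have "\<bar>swirl vort1 vort2 (x, t)\<bar> \<le> 4 * (2 * (C2 / ((- t) * l t))) * axis_dist2 x"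
      by (rule rotating_pair_first_order(1)[OF pair_vort x _ t1 t(2) dv]) (use t in simp_all)
    then show "\<bar>Hel (x, t)\<bar> \<le> K / ((- t) * l t) * axis_dist2 x" using c2(1) unfolding Hel_def by linarith
    have "\<bar>swirl (dx 3 (component u 1)) (dx 3 (component u 2)) (x, t)\<bar> \<le> 4 * (C2 / ((- t) * l t)) * axis_dist2 x"
      by (rule rotating_pair_first_order(1)[OF rotating_pair_dx3[OF pair_u] x _ t1 t(2) d2 d2]) (use t in simp_all)
    then show "\<bar>dx 3 Gam (x, t)\<bar> \<le> K / ((- t) * l t) * axis_dist2 x"
      using c2(2) swirl_horizontal_derivs(3)[OF pair_u z] unfolding Gam_def by linarith
  qed
qed

text \<open>The curl bound of order 1 / (-t) and the energy meet at averaging radius (-t)^(2/5). The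
  resulting rate is integrable in time whatever the Euler length is, and this is the drift bound
  assumed by the moving cutoff.\<close>

lemma velocity_bound:
  obtains C \<tau> where "C \<ge> 1" "0 < \<tau>" "\<tau> < 1"
    "\<And>x t. norm x \<le> 1/2 \<Longrightarrow> - \<tau> \<le> t \<Longrightarrow> t < 0 \<Longrightarrow> norm (u (x, t)) \<le> C * (- t) powr (-3/5)"
proof -
  obtain K \<tau>1 where K: "K \<ge> 1" "0 < \<tau>1" "\<tau>1 < 1"
    and gr: "\<And>x t i k. norm x \<le> 7/8 \<Longrightarrow> - \<tau>1 \<le> t \<Longrightarrow> t < 0 \<Longrightarrow> \<bar>dx i (component u k) (x, t)\<bar> \<le> K / (- t)"
    using basic_bounds by metis
  \<comment> \<open>The second entry makes the averaging radius at most 1/16, so that balls of twice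
    this radius about points within 1/2 remain within 7/8, where the gradient is controlled.\<close>
  define \<tau> where "\<tau> = min \<tau>1 ((1/16) powr (5/2))"
  have \<tau>: "0 < \<tau>" "\<tau> \<le> \<tau>1" "\<tau> < 1" using K by (auto simp: \<tau>_def)
  define C where "C = 3 * ((48 * K + (4 + E / 2)) / bump_mass) + 1"
  have C: "C \<ge> 1" using K E bump_mass_pos by (simp add: C_def)
  show ?thesis
  proof (rule that[OF C \<tau>(1,3)])
    fix x t assume x: "norm (x::real^3) \<le> 1/2" and t: "- \<tau> \<le> t" "t < 0"
    have t1: "-1 < t" "- \<tau>1 \<le> t" using t \<tau> by simp_all
    define s where "s = (- t) powr (2/5)"
    have s: "s > 0" using t by (simp add: s_def)
    have s16: "s \<le> 1/16"
    proof -
      have "s \<le> ((1/16) powr (5/2)) powr (2/5)" unfolding s_def using t by (intro powr_mono2) (auto simp: \<tau>_def)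
      also have "\<dots> = 1/16" by (simp add: powr_powr)
      finally show ?thesis .
    qed
    have B: "ball x (2 * s) \<subseteq> ball 0 1" and B8: "norm y \<le> 7/8" if "y \<in> ball x (2 * s)" for y
    proof -
      have "norm y \<le> 7/8" if "y \<in> ball x (2 * s)" for y
        using norm_triangle_ineq[of x "y - x"] that x s16 by (simp add: dist_norm norm_minus_commute)
      then show "ball x (2 * s) \<subseteq> ball 0 1" "norm y \<le> 7/8" using that by force+
    qed
    have x2: "x \<in> ball x (2 * s)" using s by simp
    note B = B[OF x2]
    note sl = slice_calculus[OF sc t1(1) t(2)]
    have in1: "norm z < 1" if "z \<in> ball 0 1" for z :: "real^3" using that by simp
    have component: "bump_mass * \<bar>component u k (x, t)\<bar> \<le> 24 * (2 * (K / (- t))) * s + (4 + E / 2) * s powr (-3/2)" for k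
    proof (rule bounded_curl_L2_bound[where w="\<lambda>k x. component u k (x, t)" and S="ball 0 1", OF sl(1) B s])
      show "(\<Sum>j\<in>UNIV. dir_deriv (axis j 1) (\<lambda>x. component u j (x, t)) z) = 0" if "z \<in> ball 0 1" for z
        using divergence[of "(z, t)"] that t t1 by (simp add: sl(2) sum_3 parabolic_cylinder_def)
      show "\<bar>dir_deriv (axis j 1) (\<lambda>x. component u k (x, t)) z - dir_deriv (axis k 1) (\<lambda>x. component u j (x, t)) z\<bar> \<le> 2 * (K / (- t))"
        if "z \<in> ball x (2 * s)" for z j k
        using gr[OF B8[OF that] t1(2) t(2), of j k] gr[OF B8[OF that] t1(2) t(2), of k j] B8[OF that]
        by (simp add: sl(2))
      have sub: "cbox (x - s *\<^sub>R 1) (x + s *\<^sub>R 1) \<subseteq> ball 0 1" using cube_in_ball[OF s] B by blast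
      have cu: "continuous_on (ball 0 1) (\<lambda>y. u (y, t))"
        using t1 t by (intro continuous_on_compose2[OF smooth_on_imp_continuous[OF su]] continuous_intros) (auto simp: parabolic_cylinder_def)
      have "integral (cbox (x - s *\<^sub>R 1) (x + s *\<^sub>R 1)) (\<lambda>y. (component u k (y, t))\<^sup>2)
         \<le> integral (cbox (x - s *\<^sub>R 1) (x + s *\<^sub>R 1)) (\<lambda>y. (norm (u (y, t)))\<^sup>2)"
      proof (rule integral_le)
        show "(\<lambda>y. (component u k (y, t))\<^sup>2) integrable_on cbox (x - s *\<^sub>R 1) (x + s *\<^sub>R 1)"
          by (intro integrable_continuous continuous_intros continuous_on_subset[OF smooth_on_imp_continuous[OF sl(1)] sub])
        show "(\<lambda>y. (norm (u (y, t)))\<^sup>2) integrable_on cbox (x - s *\<^sub>R 1) (x + s *\<^sub>R 1)"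
          by (intro integrable_continuous continuous_intros continuous_on_subset[OF cu sub])
        show "(component u k (y, t))\<^sup>2 \<le> (norm (u (y, t)))\<^sup>2" for y
          using component_le_norm_cart[of "u (y, t)" k] by (simp add: abs_le_square_iff[symmetric])
      qed
      then show "integral (cbox (x - s *\<^sub>R 1) (x + s *\<^sub>R 1)) (\<lambda>y. (component u k (y, t))\<^sup>2) \<le> E"
        using energy[OF t1(1) t(2) s B] by linarith
    qed
    have e1: "24 * (2 * (K / (- t))) * s = 48 * K * (- t) powr (-3/5)"
    proof -
      have "s / (- t) = (- t) powr (2/5 - 1)" unfolding powr_diff s_def using t by simp
      then have "s / (- t) = (- t) powr (-3/5)" by simp
      moreover have "24 * (2 * (K / (- t))) * s = 48 * K * (s / (- t))" by simp
      ultimately show ?thesis by (simp only:)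
    qed
    have e2: "s powr (-3/2) = (- t) powr (-3/5)" unfolding s_def powr_powr by simp
    have "\<bar>u (x, t) $ k\<bar> \<le> (48 * K + (4 + E / 2)) / bump_mass * (- t) powr (-3/5)" for k
      using component[of k] bump_mass_pos unfolding e1 e2 by (simp add: field_simps)
    then have "norm (u (x, t)) \<le> 3 * ((48 * K + (4 + E / 2)) / bump_mass * (- t) powr (-3/5))" by (rule norm_le_components)
    also have "\<dots> \<le> C * (- t) powr (-3/5)" unfolding C_def by (simp add: algebra_simps)
    finally show "norm (u (x, t)) \<le> C * (- t) powr (-3/5)" .
  qed
qed

text \<open>The weighted principle for both signs of \<open>X\<close>. The bound
  \<open>3 * \<rho>\<^sup>2\<close> on the moving term confines the cutoff to radius 2 \<rho>. On
  radius \<rho>/2 the cutoff is at least 3/4 \<rho>^2; its square 9/16 \<rho>^4 accounts for the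
  loss of 2 / \<rho>^4.\<close>

lemma max_principle_abs:
  fixes X R :: "spacetime \<Rightarrow> real" and M M' \<kappa> :: "real \<Rightarrow> real"
  assumes \<rho>: "0 < \<rho>" "\<rho> \<le> 1/4" and t: "-1 < ta" "ta < tb" "tb < 0" and a: "0 \<le> a" "a < 2"
    and drift: "\<And>x t. norm x \<le> 1/2 \<Longrightarrow> ta \<le> t \<Longrightarrow> t \<le> tb \<Longrightarrow> norm (u (x, t)) \<le> C * (- t) powr (-3/5)"
    and C: "0 \<le> C" "5 * C * (- ta) powr (2/5) \<le> 3 * \<rho>\<^sup>2" and X: "smooth_on Q X"
    and XB: "\<And>x t. norm x \<le> 2 * \<rho> \<Longrightarrow> ta \<le> t \<Longrightarrow> t \<le> tb \<Longrightarrow> \<bar>X (x, t)\<bar> \<le> B * axis_dist2 x"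
    and pde: "\<And>x t. norm x \<le> 2 * \<rho> \<Longrightarrow> axis_dist2 x > 0 \<Longrightarrow> ta \<le> t \<Longrightarrow> t \<le> tb \<Longrightarrow>
      dt X (x, t) + u (x, t) \<bullet> grad X (x, t) = laplacian X (x, t)
        - 2 / axis_dist2 x * radial_part x (grad X (x, t)) + b * (radial_part x (u (x, t)) / axis_dist2 x) * X (x, t) + R (x, t)"
    and \<kappa>: "\<And>x t. norm x \<le> 2 * \<rho> \<Longrightarrow> axis_dist2 x > 0 \<Longrightarrow> ta \<le> t \<Longrightarrow> t \<le> tb \<Longrightarrow> \<bar>b - a\<bar> * \<bar>Rad (x, t) / axis_dist2 x\<bar> \<le> \<kappa> t"
    and M: "\<And>t. ta \<le> t \<Longrightarrow> t \<le> tb \<Longrightarrow> 0 < M t" "\<And>t. ta \<le> t \<Longrightarrow> t \<le> tb \<Longrightarrow> (M has_real_derivative M' t) (at t)"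
      "\<And>t. ta \<le> t \<Longrightarrow> t \<le> tb \<Longrightarrow> 0 < M' t - \<kappa> t * M t"
    and bal: "\<And>x t. norm x \<le> 2 * \<rho> \<Longrightarrow> axis_dist2 x > 0 \<Longrightarrow> ta \<le> t \<Longrightarrow> t \<le> tb \<Longrightarrow>
      (44 * \<bar>X (x, t)\<bar> + \<bar>R (x, t)\<bar>) * axis_dist2 x powr (- a / 2) \<le> M' t - \<kappa> t * M t"
    and init: "\<And>x. norm x \<le> 2 * \<rho> \<Longrightarrow> axis_dist2 x > 0 \<Longrightarrow> \<bar>X (x, ta)\<bar> * axis_dist2 x powr (- a / 2) \<le> M ta"
    and pt: "norm x \<le> \<rho> / 2" "axis_dist2 x > 0" "ta \<le> s" "s \<le> tb"
  shows "\<bar>X (x, s)\<bar> * axis_dist2 x powr (- a / 2) \<le> 2 / \<rho> ^ 4 * M s"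
proof -
  have dom: "\<rho>\<^sup>2 + 5 * C * (- ta) powr (2/5) \<le> (2 * \<rho>)\<^sup>2" using C(2) by (simp add: power2_eq_square)
  have d: "0 < 2 * \<rho>" "2 * \<rho> < 1" using \<rho> by auto
  have cut: "3/4 * \<rho>\<^sup>2 \<le> cutoff \<rho> (5 * C) (x, s)"
  proof -
    have "(norm x)\<^sup>2 \<le> (\<rho> / 2)\<^sup>2" using pt by (intro power_mono) auto
    moreover have "0 \<le> 5 * C * (- s) powr (2/5)" using C by simp
    ultimately show ?thesis by (simp add: cutoff_def power_divide)
  qed
  have radp: "radial_part x (u (x, t)) = Rad (x, t)" for x t by (simp add: radial_part_def Rad_def radial_def)
  have Xd: "X differentiable (at (x, t))" if "norm x \<le> 2 * \<rho>" "ta \<le> t" "t \<le> tb" for x t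
    using that d t by (intro smooth_on_imp_differentiable[OF X]) (simp add: parabolic_cylinder_def)
  have upper: "(cutoff \<rho> (5 * C) (x, s))\<^sup>2 * (\<sigma> * X (x, s)) * axis_dist2 x powr (- a / 2) \<le> M s" if \<sigma>: "\<sigma> = 1 \<or> \<sigma> = - 1" for \<sigma>
  proof (rule weighted_max_principle[where X="\<lambda>z. \<sigma> * X z" and R="\<lambda>z. \<sigma> * R z" and u=u and M=M and M'=M' and \<kappa>=\<kappa> and b=b and B=B and C=C and d="2 * \<rho>"])
    note [simp] = smooth_on_const smooth_on_mult X smooth_on_dx
    have c: "dx i (\<lambda>z. \<sigma>) z = 0" "dt (\<lambda>z. \<sigma>) z = 0" for i z
      unfolding dx_eq dt_eq by (rule dir_derivI[where f'="\<lambda>v. 0"]; simp)+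
    show "smooth_on Q (\<lambda>z. \<sigma> * X z)" by simp
    fix y r assume y: "norm (y::real^3) \<le> 2 * \<rho>" "ta \<le> r" "r \<le> tb"
    have yQ: "(y, r) \<in> Q" using y d t by (simp add: parabolic_cylinder_def)
    show "norm (u (y, r)) \<le> C * (- r) powr (-3/5)" using drift[of y r] y \<rho> by simp
    show "\<bar>\<sigma> * X (y, r)\<bar> \<le> B * axis_dist2 y" using XB[OF y] \<sigma> by auto
    assume yr: "axis_dist2 y > 0"
    have 1: "dx i (\<lambda>z. \<sigma> * X z) z = \<sigma> * dx i X z" if "z \<in> Q" for i z using that by (simp add: dx_calc c)
    have 2: "dx i (dx i (\<lambda>z. \<sigma> * X z)) (y, r) = \<sigma> * dx i (dx i X) (y, r)" for i
      using dx_cong[OF 1 yQ] yQ by (simp add: dx_calc c)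
    have 3: "dt (\<lambda>z. \<sigma> * X z) (y, r) = \<sigma> * dt X (y, r)" using yQ by (simp add: dx_calc c)
    have g: "grad (\<lambda>z. \<sigma> * X z) (y, r) = \<sigma> *\<^sub>R grad X (y, r)" by (simp add: grad_def vec_eq_iff 1[OF yQ])
    have lap: "laplacian (\<lambda>z. \<sigma> * X z) (y, r) = \<sigma> * laplacian X (y, r)" by (simp add: laplacian_def 2 sum_distrib_left)
    have rp: "radial_part y (\<sigma> *\<^sub>R v) = \<sigma> * radial_part y v" for v by (simp add: radial_part_def algebra_simps)
    have "\<sigma> * (dt X (y, r) + u (y, r) \<bullet> grad X (y, r)) = \<sigma> * (laplacian X (y, r)
        - 2 / axis_dist2 y * radial_part y (grad X (y, r)) + b * (radial_part y (u (y, r)) / axis_dist2 y) * X (y, r) + R (y, r))"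
      using pde[OF y(1) yr y(2,3)] by simp
    then show "dt (\<lambda>z. \<sigma> * X z) (y, r) + u (y, r) \<bullet> grad (\<lambda>z. \<sigma> * X z) (y, r) = laplacian (\<lambda>z. \<sigma> * X z) (y, r)
        - 2 / axis_dist2 y * radial_part y (grad (\<lambda>z. \<sigma> * X z) (y, r)) + b * (radial_part y (u (y, r)) / axis_dist2 y) * (\<sigma> * X (y, r)) + \<sigma> * R (y, r)"
      unfolding 3 g lap rp inner_scaleR_right by (simp add: algebra_simps)
    show "\<bar>b - a\<bar> * \<bar>radial_part y (u (y, r)) / axis_dist2 y\<bar> \<le> \<kappa> r" unfolding radp by (rule \<kappa>[OF y(1) yr y(2,3)])
    show "(44 * \<bar>\<sigma> * X (y, r)\<bar> + \<bar>\<sigma> * R (y, r)\<bar>) * axis_dist2 y powr (- a / 2) \<le> M' r - \<kappa> r * M r"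
      using bal[OF y(1) yr y(2,3)] \<sigma> by (auto simp: abs_mult)
  next
    fix y assume "norm (y::real^3) \<le> 2 * \<rho>" "axis_dist2 y > 0"
    then show "\<bar>\<sigma> * X (y, ta)\<bar> * axis_dist2 y powr (- a / 2) \<le> M ta" using init \<sigma> by (auto simp: abs_mult)
  next
    have "0 \<le> 3/4 * \<rho>\<^sup>2" by simp
    then show "0 \<le> cutoff \<rho> (5 * C) (x, s)" using cut by linarith
  qed (use t a d C dom M pt \<rho> in auto)
  define c where "c = cutoff \<rho> (5 * C) (x, s)"
  have c: "(3/4 * \<rho>\<^sup>2)\<^sup>2 \<le> c\<^sup>2" using cut \<rho> unfolding c_def by (intro power_mono) auto
  have ab: "c\<^sup>2 * (\<bar>X (x, s)\<bar> * axis_dist2 x powr (- a / 2)) \<le> M s"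
    using upper[of 1] upper[of "-1"] unfolding c_def by (cases "X (x, s) \<ge> 0") (auto simp: mult.assoc)
  have "(9/16 * \<rho> ^ 4) * (\<bar>X (x, s)\<bar> * axis_dist2 x powr (- a / 2)) \<le> c\<^sup>2 * (\<bar>X (x, s)\<bar> * axis_dist2 x powr (- a / 2))"
    using c by (intro mult_right_mono) (auto simp: power2_eq_square power4_eq_xxxx algebra_simps)
  with ab have f: "(9/16 * \<rho> ^ 4) * (\<bar>X (x, s)\<bar> * axis_dist2 x powr (- a / 2)) \<le> M s" by linarith
  have p: "\<rho> ^ 4 > 0" using \<rho> by simp
  have "\<bar>X (x, s)\<bar> * axis_dist2 x powr (- a / 2) \<le> M s / (9/16 * \<rho> ^ 4)"
    using f p by (simp add: pos_le_divide_eq mult.commute)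
  also have "\<dots> \<le> 2 / \<rho> ^ 4 * M s" using p M(1)[OF pt(3,4)] by (simp add: field_simps)
  finally show ?thesis .
qed

lemma Gam_pde:
  assumes "norm x < 1" "-1 < t" "t < 0" "axis_dist2 x > 0"
  shows "dt Gam (x, t) + u (x, t) \<bullet> grad Gam (x, t) = laplacian Gam (x, t)
        - 2 / axis_dist2 x * radial_part x (grad Gam (x, t)) + 0 * (radial_part x (u (x, t)) / axis_dist2 x) * Gam (x, t) + (\<lambda>z. 0) (x, t)"
  using Gam_equation[of "(x, t)"] assms by (simp add: parabolic_cylinder_def)

lemma Hel_pde:
  assumes "norm x < 1" "-1 < t" "t < 0" "axis_dist2 x > 0"
  shows "dt Hel (x, t) + u (x, t) \<bullet> grad Hel (x, t) = laplacian Hel (x, t)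
        - 2 / axis_dist2 x * radial_part x (grad Hel (x, t)) + 2 * (radial_part x (u (x, t)) / axis_dist2 x) * Hel (x, t)
        + (\<lambda>z. 2 * Gam z * dx 3 Gam z / axis_dist2 (fst z)) (x, t)"
  using Hel_equation[of "(x, t)"] assms by (simp add: parabolic_cylinder_def)

lemma neg_powr_deriv:
  assumes "t < 0"
  shows "((\<lambda>t. (- t) powr q) has_real_derivative - q * (- t) powr (q - 1)) (at t)"
  using assms by (auto intro!: derivative_eq_intros simp: powr_diff)

lemma Gam_Rad_velocity_bound: "\<bar>Gam (x, t)\<bar> \<le> 2 * sqrt (axis_dist2 x) * norm (u (x, t))" "\<bar>Rad (x, t)\<bar> \<le> 2 * sqrt (axis_dist2 x) * norm (u (x, t))"
proof -
  have s: "\<bar>x $ 1\<bar> \<le> sqrt (axis_dist2 x)" "\<bar>x $ 2\<bar> \<le> sqrt (axis_dist2 x)"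
    by (rule real_le_rsqrt; simp add: axis_dist2_def)+
  have v: "\<bar>u (x, t) $ k\<bar> \<le> norm (u (x, t))" for k by (rule component_le_norm_cart)
  have p: "\<bar>x $ i * u (x, t) $ k\<bar> \<le> sqrt (axis_dist2 x) * norm (u (x, t))" if "i = 1 \<or> i = 2" for i k
    unfolding abs_mult using s v that by (intro mult_mono) auto
  show "\<bar>Gam (x, t)\<bar> \<le> 2 * sqrt (axis_dist2 x) * norm (u (x, t))" "\<bar>Rad (x, t)\<bar> \<le> 2 * sqrt (axis_dist2 x) * norm (u (x, t))"
    using p[of 1 1] p[of 1 2] p[of 2 1] p[of 2 2] by (simp_all add: Gam_def Rad_def swirl_def radial_def)
qed

lemma sqrt_axis_dist2_le: "sqrt (axis_dist2 x) \<le> norm x"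
  by (rule real_le_lsqrt) (simp_all add: norm_sq_axis)

text \<open>With a = b = 0 there is neither weight nor stretching. The barrier has to absorb only
  the cutoff error, a multiple of |Gamma|, which is below |u| and hence integrable in time.\<close>

lemma Gam_bounded:
  obtains K \<tau> where "K \<ge> 1" "0 < \<tau>" "\<tau> < 1" "\<And>x t. norm x \<le> 1/8 \<Longrightarrow> - \<tau> \<le> t \<Longrightarrow> t < 0 \<Longrightarrow> \<bar>Gam (x, t)\<bar> \<le> K"
proof -
  obtain Kb \<tau>1 where Kb: "Kb \<ge> 1" "0 < \<tau>1" "\<tau>1 < 1"
    and Gb: "\<And>x t. norm x \<le> 7/8 \<Longrightarrow> - \<tau>1 \<le> t \<Longrightarrow> t < 0 \<Longrightarrow> \<bar>Gam (x, t)\<bar> \<le> Kb / (- t) * axis_dist2 x"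
    using basic_bounds by metis
  obtain C \<tau>2 where C: "C \<ge> 1" "0 < \<tau>2" "\<tau>2 < 1"
    and ub: "\<And>x t. norm x \<le> 1/2 \<Longrightarrow> - \<tau>2 \<le> t \<Longrightarrow> t < 0 \<Longrightarrow> norm (u (x, t)) \<le> C * (- t) powr (-3/5)"
    using velocity_bound by metis
  define \<tau> where "\<tau> = min (min \<tau>1 \<tau>2) ((3 / (80 * C)) powr (5/2))"
  have \<tau>: "0 < \<tau>" "\<tau> \<le> \<tau>1" "\<tau> \<le> \<tau>2" "\<tau> < 1" using Kb C by (auto simp: \<tau>_def)
  have \<tau>C: "5 * C * \<tau> powr (2/5) \<le> 3 * (1/4)\<^sup>2"
  proof -
    have "\<tau> powr (2/5) \<le> ((3 / (80 * C)) powr (5/2)) powr (2/5)" using \<tau>(1) by (intro powr_mono2) (auto simp: \<tau>_def)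
    also have "\<dots> = 3 / (80 * C)" using C by (simp add: powr_powr)
    finally have "5 * C * \<tau> powr (2/5) \<le> 5 * C * (3 / (80 * C))" using C by (intro mult_left_mono) auto
    then show ?thesis using C by (simp add: power2_eq_square)
  qed
  have Gu: "\<bar>Gam (x, t)\<bar> \<le> C * (- t) powr (-3/5)" if "norm x \<le> 1/2" "- \<tau> \<le> t" "t < 0" for x t
  proof -
    have "\<bar>Gam (x, t)\<bar> \<le> 2 * sqrt (axis_dist2 x) * norm (u (x, t))" by (rule Gam_Rad_velocity_bound)
    also have "\<dots> \<le> 1 * norm (u (x, t))" using that(1) sqrt_axis_dist2_le[of x] by (intro mult_right_mono) auto
    also have "\<dots> \<le> C * (- t) powr (-3/5)" using ub[of x t] that \<tau> by simp
    finally show ?thesis .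
  qed
  \<comment> \<open>The factor exp(5/2) undoes the smallest value of the exponential in
    \<open>M\<close>. The number 44 stands for the cutoff error, the power of \<tau> for the initial
    value.\<close>
  define A where "A = exp (5/2) * C * (44 + \<tau> powr (-3/5))"
  have A: "A > 0" using C \<tau> by (simp add: A_def add_pos_nonneg)
  \<comment> \<open>A solution of M' = (-t)^(-3/5) M that increases to the finite value
    \<open>A\<close> at t = 0.\<close>
  define M where "M t = A * exp (- (5/2) * (- t) powr (2/5))" for t
  define M' where "M' t = (- t) powr (-3/5) * M t" for t
  have Mlow: "C * (44 + \<tau> powr (-3/5)) \<le> M t" if "- \<tau> \<le> t" "t < 0" for t
  proof -
    have "(- t) powr (2/5) \<le> 1 powr (2/5)" using that \<tau> by (intro powr_mono2) auto
    then have "exp (- (5/2)) \<le> exp (- (5/2) * (- t) powr (2/5))" by simp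
    then have "A * exp (- (5/2)) \<le> M t" unfolding M_def using A by (intro mult_left_mono) auto
    moreover have "A * exp (- (5/2)) = C * (44 + \<tau> powr (-3/5))" by (simp add: A_def exp_minus)
    ultimately show ?thesis by simp
  qed
  have main: "\<bar>Gam (x, t1)\<bar> \<le> 2 / (1/4) ^ 4 * A" if x: "norm x \<le> 1/8" "axis_dist2 x > 0" and t1: "- \<tau> < t1" "t1 < 0" for x t1
  proof -
    \<comment> \<open>The constant \<open>Kb / (- t1)\<close> degenerates as t1 tends to 0. This is
      harmless: it only ensures that the quotient is small near the axis and does not enter the
      resulting bound.\<close>
    have "\<bar>Gam (x, t1)\<bar> * axis_dist2 x powr (- 0 / 2) \<le> 2 / (1/4) ^ 4 * M t1"
    proof (rule max_principle_abs[where X=Gam and R="\<lambda>z. 0" and b=0 and \<kappa>="\<lambda>t. 0" and M=M and M'=M' and C=C and ta="-\<tau>" and tb=t1 and B="Kb / (- t1)"])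
      show "smooth_on Q Gam" by (rule smooth_Gam)
      show "5 * C * (- (- \<tau>)) powr (2 / 5) \<le> 3 * (1 / 4)\<^sup>2" using \<tau>C by simp
      fix t assume t: "- \<tau> \<le> t" "t \<le> t1"
      then have t': "t < 0" "-1 < t" using t1 \<tau> by auto
      show "0 < M t" using A by (simp add: M_def)
      then show "0 < M' t - 0 * M t" using t' by (simp add: M'_def)
      show "(M has_real_derivative M' t) (at t)"
      proof -
        have "((\<lambda>t. - (5/2) * (- t) powr (2/5)) has_real_derivative - (5/2) * (- (2/5) * (- t) powr (2/5 - 1))) (at t)"
          by (rule DERIV_cmult[OF neg_powr_deriv[OF t'(1)]])
        then have d: "((\<lambda>t. - (5/2) * (- t) powr (2/5)) has_real_derivative (- t) powr (-3/5)) (at t)" by simp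
        have "(M has_real_derivative A * (exp (- (5/2) * (- t) powr (2/5)) * (- t) powr (-3/5))) (at t)"
          unfolding M_def by (rule DERIV_cmult[OF DERIV_fun_exp[OF d]])
        then show ?thesis by (simp add: M'_def M_def mult_ac)
      qed
      fix y assume y: "norm (y::real^3) \<le> 2 * (1/4)"
      show "\<bar>Gam (y, t)\<bar> \<le> Kb / (- t1) * axis_dist2 y"
      proof -
        have "\<bar>Gam (y, t)\<bar> \<le> Kb / (- t) * axis_dist2 y" using Gb[of y t] y t t' \<tau> by simp
        also have "\<dots> \<le> Kb / (- t1) * axis_dist2 y" using t t1 Kb by (intro mult_right_mono divide_left_mono) (auto simp: mult_neg_neg)
        finally show ?thesis .
      qed
      assume yr: "axis_dist2 y > 0"
      show "dt Gam (y, t) + u (y, t) \<bullet> grad Gam (y, t) = laplacian Gam (y, t)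
        - 2 / axis_dist2 y * radial_part y (grad Gam (y, t)) + 0 * (radial_part y (u (y, t)) / axis_dist2 y) * Gam (y, t) + 0"
        using Gam_pde[of y t] y yr t' by simp
      have "44 * \<bar>Gam (y, t)\<bar> \<le> 44 * (C * (- t) powr (-3/5))" using Gu[of y t] y t t' by simp
      also have "\<dots> = C * 44 * (- t) powr (-3/5)" by simp
      also have "\<dots> \<le> M t * (- t) powr (-3/5)"
        using Mlow[OF t(1) t'(1)] C by (intro mult_right_mono) (auto simp: algebra_simps intro: order_trans[rotated])
      finally show "(44 * \<bar>Gam (y, t)\<bar> + \<bar>0\<bar>) * axis_dist2 y powr (- 0 / 2) \<le> M' t - 0 * M t"
        using yr by (simp add: M'_def mult.commute)
    next
      fix y assume y: "norm (y::real^3) \<le> 2 * (1/4)" "axis_dist2 y > 0"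
      have "\<bar>Gam (y, - \<tau>)\<bar> \<le> C * \<tau> powr (-3/5)" using Gu[of y "-\<tau>"] y \<tau> by simp
      also have "\<dots> \<le> C * (44 + \<tau> powr (-3/5))" using C by (intro mult_left_mono) auto
      also have "\<dots> \<le> M (- \<tau>)" using Mlow[of "-\<tau>"] \<tau> by simp
      finally show "\<bar>Gam (y, - \<tau>)\<bar> * axis_dist2 y powr (- 0 / 2) \<le> M (- \<tau>)" using y by simp
    qed (use \<tau> t1 C x ub in auto)
    moreover have "M t1 \<le> A" unfolding M_def using A by (intro mult_left_le) auto
    then have "2 / (1/4) ^ 4 * M t1 \<le> 2 / (1/4) ^ 4 * A" by (intro mult_left_mono) auto
    ultimately show ?thesis using x by simp
  qed
  show ?thesis
  proof (rule that[of "2 / (1/4) ^ 4 * A + 1" "\<tau> / 2"])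
    show "1 \<le> 2 / (1/4) ^ 4 * A + 1" "0 < \<tau> / 2" "\<tau> / 2 < 1" using A \<tau> by auto
    fix x t assume xt: "norm (x::real^3) \<le> 1/8" "- (\<tau> / 2) \<le> t" "t < 0"
    show "\<bar>Gam (x, t)\<bar> \<le> 2 / (1/4) ^ 4 * A + 1"
    proof (cases "axis_dist2 x > 0")
      case True then show ?thesis using main[of x t] xt \<tau> by simp
    next
      case False
      then have "x $ 1 = 0" "x $ 2 = 0" by (auto simp: axis_dist2_def not_less sum_power2_le_zero_iff)
      then show ?thesis using A by (simp add: Gam_def swirl_def)
    qed
  qed
qed


subsection \<open>Smallness relative to the critical rates\<close>

lemma ratio_near_axis:
  assumes x: "sqrt (axis_dist2 x) \<le> h" "h > 0" and \<rho>: "h\<^sup>2 + (x $ 3)\<^sup>2 \<le> \<rho>\<^sup>2" "0 \<le> \<rho>" "\<rho> < 1" and t: "-1 < t" "t < 0"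
    and F: "F = Gam \<or> F = Rad" and \<eta>: "\<And>y. norm y \<le> \<rho> \<Longrightarrow> axis_dist2 y = h\<^sup>2 \<Longrightarrow> \<bar>F (y, t)\<bar> \<le> \<eta> * h\<^sup>2"
  shows "\<bar>F (x, t)\<bar> \<le> (\<eta> + 8 * (C2 / ((- t) * l t)) * h) * axis_dist2 x"
proof (rule rotating_pair_second_order[OF pair_u x \<rho> t])
  show "\<bar>dx i (dx j (component u 1)) (y, t)\<bar> \<le> C2 / ((- t) * l t)" "\<bar>dx i (dx j (component u 2)) (y, t)\<bar> \<le> C2 / ((- t) * l t)"
    if "norm y \<le> \<rho>" for i j y
    using d2_bound[of y t i j 1] d2_bound[of y t i j 2] that \<rho> t by simp_all
  show "F = swirl (component u 1) (component u 2) \<or> F = radial (component u 1) (component u 2)" using F unfolding Gam_def Rad_def .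
qed (rule \<eta>)

text \<open>From distance h = \<delta> l on, the constant bound on Gamma is already small against
  r^2 / (-t), because -t is negligible against l^2. Inside this distance, Gamma / r^2 differs from
  its value at h by at most 8 C2 h / ((-t) l), a multiple of \<delta> / (-t).\<close>

lemma Gam_small:
  assumes \<epsilon>: "\<epsilon> > 0"
  obtains \<tau> where "0 < \<tau>" "\<tau> < 1" "\<And>x t. norm x \<le> 1/16 \<Longrightarrow> - \<tau> \<le> t \<Longrightarrow> t < 0 \<Longrightarrow> \<bar>Gam (x, t)\<bar> \<le> \<epsilon> / (- t) * axis_dist2 x"
proof -
  obtain K \<tau>1 where K: "K \<ge> 1" "0 < \<tau>1" "\<tau>1 < 1" "\<And>x t. norm x \<le> 1/8 \<Longrightarrow> - \<tau>1 \<le> t \<Longrightarrow> t < 0 \<Longrightarrow> \<bar>Gam (x, t)\<bar> \<le> K"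
    by (rule Gam_bounded, rule that)
  \<comment> \<open>Makes the oscillation term 8 C2 \<delta> equal to \<epsilon>/2; the other half
    is left for the value at distance h.\<close>
  define \<delta> where "\<delta> = \<epsilon> / (16 * C2)"
  have \<delta>: "\<delta> > 0" using \<epsilon> C2 by (simp add: \<delta>_def)
  \<comment> \<open>The first entry gives h \<le> 1/16. The second gives K \<le> (\<epsilon>/2) h^2
    / (-t) through -t \<le> e l^2.\<close>
  define e where "e = min (1 / (16 * \<delta>)) (\<epsilon> * \<delta>\<^sup>2 / (2 * K))"
  have e: "e > 0" using \<epsilon> \<delta> K by (simp add: e_def)
  obtain \<tau>2 where \<tau>2: "0 < \<tau>2" "\<tau>2 < 1" "\<And>t. - \<tau>2 \<le> t \<Longrightarrow> t < 0 \<Longrightarrow> 0 < l t \<and> l t \<le> e \<and> - t \<le> e * (l t)\<^sup>2"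
    by (rule small_scales[OF e], rule that)
  show ?thesis
  proof (rule that[of "min \<tau>1 \<tau>2"])
    show "0 < min \<tau>1 \<tau>2" "min \<tau>1 \<tau>2 < 1" using K \<tau>2 by auto
    fix x t assume x: "norm (x::real^3) \<le> 1/16" and t: "- min \<tau>1 \<tau>2 \<le> t" "t < 0"
    have t1: "-1 < t" "- \<tau>1 \<le> t" using t K \<tau>2 by auto
    have lt: "0 < l t" "l t \<le> e" "- t \<le> e * (l t)\<^sup>2" using \<tau>2(3)[of t] t by auto
    define h where "h = \<delta> * l t"
    have h: "h > 0" using \<delta> lt by (simp add: h_def)
    have h16: "h \<le> 1/16"
    proof -
      have "h \<le> \<delta> * (1 / (16 * \<delta>))" unfolding h_def using lt(2) \<delta> by (intro mult_left_mono) (auto simp: e_def)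
      then show ?thesis using \<delta> by simp
    qed
    have far: "K \<le> \<epsilon> / 2 / (- t) * h\<^sup>2"
    proof -
      have "- t \<le> \<epsilon> * \<delta>\<^sup>2 / (2 * K) * (l t)\<^sup>2" using lt(3) by (rule order_trans) (intro mult_right_mono; simp add: e_def)
      then have "K * (- t) \<le> K * (\<epsilon> * \<delta>\<^sup>2 / (2 * K) * (l t)\<^sup>2)" using K by (intro mult_left_mono) auto
      also have "\<dots> = \<epsilon> / 2 * h\<^sup>2" using K by (simp add: h_def power_mult_distrib)
      finally have "K \<le> \<epsilon> / 2 * h\<^sup>2 / (- t)" using t by (subst pos_le_divide_eq) auto
      then show ?thesis by simp
    qed
    show "\<bar>Gam (x, t)\<bar> \<le> \<epsilon> / (- t) * axis_dist2 x"
    proof (cases "sqrt (axis_dist2 x) \<le> h")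
      case True
      have "\<bar>Gam (x, t)\<bar> \<le> (\<epsilon> / 2 / (- t) + 8 * (C2 / ((- t) * l t)) * h) * axis_dist2 x"
      proof (rule ratio_near_axis[OF True h _ _ _ t1(1) t(2), of "1/8"])
        have "h\<^sup>2 \<le> (1/16)\<^sup>2" using h h16 by (intro power_mono) auto
        moreover have "\<bar>x $ 3\<bar>\<^sup>2 \<le> (1/16)\<^sup>2" using x component_le_norm_cart[of x 3] by (intro power_mono) auto
        ultimately show "h\<^sup>2 + (x $ 3)\<^sup>2 \<le> (1/8)\<^sup>2" by (simp add: power2_eq_square)
        show "\<bar>Gam (y, t)\<bar> \<le> \<epsilon> / 2 / (- t) * h\<^sup>2" if "norm y \<le> 1/8" for y
          using K(4)[OF that t1(2) t(2)] far by linarith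
      qed auto
      moreover have "8 * (C2 / ((- t) * l t)) * h = \<epsilon> / 2 / (- t)"
        using lt t C2 by (simp add: h_def \<delta>_def)
      ultimately show ?thesis by (simp add: add_divide_distrib[symmetric])
    next
      case False
      then have "h\<^sup>2 \<le> (sqrt (axis_dist2 x))\<^sup>2" using h by (intro power_mono) auto
      then have hR: "h\<^sup>2 \<le> axis_dist2 x" by simp
      have "\<bar>Gam (x, t)\<bar> \<le> K" using K(4)[of x t] x t1 t by simp
      also have "\<dots> \<le> \<epsilon> / 2 / (- t) * h\<^sup>2" by (rule far)
      also have "\<dots> \<le> \<epsilon> / (- t) * axis_dist2 x"
      proof (rule mult_mono[OF _ hR])
        show "\<epsilon> / 2 / (- t) \<le> \<epsilon> / (- t)" using \<epsilon> t by (intro divide_right_mono) auto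
        show "0 \<le> \<epsilon> / (- t)" using \<epsilon> t by (intro divide_nonneg_nonneg) auto
      qed simp
      finally show ?thesis .
    qed
  qed
qed

text \<open>With weight exponent 2 - \<sigma> the stretching is reduced to \<sigma> u_r / r, at most
  1 / (2 (-t)), and the barrier N / (-t) keeps half of its growth. This half pays for the source,
  small by \<open>Gam_small\<close>, and for the cutoff error, smaller by a factor -t. The initial
  value becomes negligible because l(t1) is small against l at the starting time.\<close>

lemma Hel_small:
  assumes \<epsilon>: "\<epsilon> > 0"
  obtains \<tau> where "0 < \<tau>" "\<tau> < 1"
    "\<And>x t. norm x \<le> 1/64 \<Longrightarrow> - \<tau> \<le> t \<Longrightarrow> t < 0 \<Longrightarrow> \<bar>Hel (x, t)\<bar> \<le> \<epsilon> / ((- t) * l t) * axis_dist2 x"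
proof -
  obtain K \<tau>1 where K: "K \<ge> 1" "0 < \<tau>1" "\<tau>1 < 1"
    and Rb: "\<And>x t. norm x \<le> 7/8 \<Longrightarrow> - \<tau>1 \<le> t \<Longrightarrow> t < 0 \<Longrightarrow> \<bar>Rad (x, t)\<bar> \<le> K / (- t) * axis_dist2 x"
    and Hb: "\<And>x t. norm x \<le> 7/8 \<Longrightarrow> - \<tau>1 \<le> t \<Longrightarrow> t < 0 \<Longrightarrow> \<bar>Hel (x, t)\<bar> \<le> K / ((- t) * l t) * axis_dist2 x"
    and Gb: "\<And>x t. norm x \<le> 7/8 \<Longrightarrow> - \<tau>1 \<le> t \<Longrightarrow> t < 0 \<Longrightarrow> \<bar>dx 3 Gam (x, t)\<bar> \<le> K / ((- t) * l t) * axis_dist2 x"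
    by (rule basic_bounds, rule that)
  obtain C \<tau>2 where C: "C \<ge> 1" "0 < \<tau>2" "\<tau>2 < 1"
    and ub: "\<And>x t. norm x \<le> 1/2 \<Longrightarrow> - \<tau>2 \<le> t \<Longrightarrow> t < 0 \<Longrightarrow> norm (u (x, t)) \<le> C * (- t) powr (-3/5)"
    by (rule velocity_bound, rule that)
  define \<rho> where "\<rho> = (1/32 :: real)"
  have \<rho>: "0 < \<rho>" "\<rho> \<le> 1/4" by (auto simp: \<rho>_def)
  define e where "e = \<epsilon> * \<rho> ^ 4 / 2"
  have e: "e > 0" using \<epsilon> \<rho> by (simp add: e_def)
  define e1 where "e1 = e / (32 * K)"
  have e1: "e1 > 0" using e K by (simp add: e1_def)
  obtain \<tau>3 where G: "0 < \<tau>3" "\<tau>3 < 1" "\<And>x t. norm x \<le> 1/16 \<Longrightarrow> - \<tau>3 \<le> t \<Longrightarrow> t < 0 \<Longrightarrow> \<bar>Gam (x, t)\<bar> \<le> e1 / (- t) * axis_dist2 x"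
    by (rule Gam_small[OF e1], rule that)
  define \<tau> where "\<tau> = min (min (min \<tau>1 \<tau>2) \<tau>3) (min (e / (176 * K)) ((3 * \<rho>\<^sup>2 / (5 * C)) powr (5/2)))"
  have \<tau>: "0 < \<tau>" "\<tau> < 1" "\<tau> \<le> \<tau>1" "\<tau> \<le> \<tau>2" "\<tau> \<le> \<tau>3" "\<tau> \<le> e / (176 * K)"
    using K C G e \<rho> by (auto simp: \<tau>_def)
  have \<tau>C: "5 * C * (- (- \<tau>)) powr (2/5) \<le> 3 * \<rho>\<^sup>2"
  proof -
    have "\<tau> powr (2/5) \<le> ((3 * \<rho>\<^sup>2 / (5 * C)) powr (5/2)) powr (2/5)" using \<tau>(1) by (intro powr_mono2) (auto simp: \<tau>_def)
    also have "\<dots> = 3 * \<rho>\<^sup>2 / (5 * C)" using C \<rho> by (simp add: powr_powr)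
    finally have "5 * C * \<tau> powr (2/5) \<le> 5 * C * (3 * \<rho>\<^sup>2 / (5 * C))" using C by (intro mult_left_mono) auto
    then show ?thesis using C by simp
  qed
  have lp: "0 < l t" if "- \<tau> \<le> t" "t < 0" for t using l_pos that \<tau> by simp
  \<comment> \<open>Requiring l(t1) \<le> e2 places the initial value K / (\<tau> l(-\<tau>)) below
    the barrier e / (\<tau> l(t1)). Only after \<tau> is fixed can this second threshold be
    chosen.\<close>
  define e2 where "e2 = e * l (- \<tau>) / K"
  have e2: "e2 > 0" using e K lp[of "-\<tau>"] \<tau> by (simp add: e2_def)
  obtain \<tau>4 where \<tau>4: "0 < \<tau>4" "\<tau>4 < 1" "\<And>t. - \<tau>4 \<le> t \<Longrightarrow> t < 0 \<Longrightarrow> 0 < l t \<and> l t \<le> e2 \<and> - t \<le> e2 * (l t)\<^sup>2"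
    by (rule small_scales[OF e2], rule that)
  have R1: "axis_dist2 y \<le> 1" if "norm y \<le> 1" for y :: "real^3"
  proof -
    have "(norm y)\<^sup>2 \<le> 1" using that by (simp add: power_le_one)
    then show ?thesis using norm_sq_axis[of y] zero_le_power2[of "y $ 3"] by linarith
  qed
  have main: "\<bar>Hel (x, t1)\<bar> * axis_dist2 x powr (- (2 - \<sigma>) / 2) \<le> \<epsilon> / ((- t1) * l t1)"
    if x: "norm x \<le> 1/64" "axis_dist2 x > 0" and t1: "- \<tau> < t1" "- \<tau>4 \<le> t1" "t1 < 0" and \<sigma>: "0 < \<sigma>" "\<sigma> \<le> 1 / (2 * K)" for x t1 \<sigma>
  proof -
    \<comment> \<open>The length is frozen at the final time t1. As l is non-increasing, 1 / l(t)
      \<le> 1 / l(t1) for earlier t, so a barrier without l in its time dependence is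
      enough.\<close>
    define N where "N = e / l t1"
    have l1: "0 < l t1" "l t1 \<le> e2" using \<tau>4(3)[OF t1(2,3)] by auto
    have N: "N > 0" using e l1 by (simp add: N_def)
    have "1 / (2 * K) \<le> 1" using K by simp
    then have \<sigma>1: "\<sigma> \<le> 1" using \<sigma> by linarith
    have pw: "axis_dist2 y * axis_dist2 y powr (- (2 - \<sigma>) / 2) \<le> 1" if "norm y \<le> 1" "axis_dist2 y > 0" for y :: "real^3"
    proof -
      have "axis_dist2 y * axis_dist2 y powr (- (2 - \<sigma>) / 2) = axis_dist2 y powr 1 * axis_dist2 y powr (- (2 - \<sigma>) / 2)" using that by simp
      also have "\<dots> = axis_dist2 y powr (\<sigma> / 2)" unfolding powr_add[symmetric] by (simp add: field_simps)
      also have "\<dots> \<le> 1 powr (\<sigma> / 2)" using R1[OF that(1)] \<sigma> that by (intro powr_mono2) auto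
      finally show ?thesis by simp
    qed
    have pw': "q * axis_dist2 y * axis_dist2 y powr (- (2 - \<sigma>) / 2) \<le> q" if "norm y \<le> 1" "axis_dist2 y > 0" "q \<ge> 0" for y :: "real^3" and q
      using mult_left_mono[OF pw[OF that(1,2)] that(3)] by (simp add: mult.assoc)
    have "\<bar>Hel (x, t1)\<bar> * axis_dist2 x powr (- (2 - \<sigma>) / 2) \<le> 2 / \<rho> ^ 4 * (N / (- t1))"
    proof (rule max_principle_abs[where X=Hel and R="\<lambda>z. 2 * Gam z * dx 3 Gam z / axis_dist2 (fst z)" and b=2 and \<kappa>="\<lambda>t. 1 / (2 * (- t))"
          and M="\<lambda>t. N / (- t)" and M'="\<lambda>t. N / (- t)\<^sup>2" and C=C and ta="-\<tau>" and tb=t1 and B="K / ((- t1) * l t1)"])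
      show "smooth_on Q Hel" by (rule smooth_Hel)
      show "5 * C * (- (- \<tau>)) powr (2 / 5) \<le> 3 * \<rho>\<^sup>2" by (rule \<tau>C)
      show "norm x \<le> \<rho> / 2" using x by (simp add: \<rho>_def)
      show "0 \<le> 2 - \<sigma>" "2 - \<sigma> < 2" using \<sigma> \<sigma>1 by auto
      fix t assume t: "- \<tau> \<le> t" "t \<le> t1"
      then have t': "t < 0" "-1 < t" "- \<tau>1 \<le> t" "- \<tau>2 \<le> t" "- \<tau>3 \<le> t" using t1 \<tau> by auto
      have lt: "l t1 \<le> l t" "0 < l t" using l_anti[of t t1] t t' t1 lp[OF t(1) t'(1)] by auto
      show "0 < N / (- t)" by (rule divide_pos_pos) (use N t' in auto)
      show "((\<lambda>t. N / (- t)) has_real_derivative N / (- t)\<^sup>2) (at t)"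
        using t' by (auto intro!: derivative_eq_intros simp: power2_eq_square)
      have Mk: "N / (- t)\<^sup>2 - 1 / (2 * (- t)) * (N / (- t)) = N / (2 * (- t)\<^sup>2)"
        using t' by (simp add: power2_eq_square field_simps)
      show "0 < N / (- t)\<^sup>2 - 1 / (2 * (- t)) * (N / (- t))" unfolding Mk using N t' by simp
      fix y assume y: "norm (y::real^3) \<le> 2 * \<rho>"
      then have y8: "norm y \<le> 7/8" "norm y \<le> 1/16" "norm y \<le> 1" "norm y < 1" by (simp_all add: \<rho>_def)
      show "\<bar>Hel (y, t)\<bar> \<le> K / ((- t1) * l t1) * axis_dist2 y"
      proof -
        have "(- t1) * l t1 \<le> (- t) * l t" using t t1 lt l1 by (intro mult_mono) auto
        moreover have "0 < (- t) * l t" "0 < (- t1) * l t1" by (rule mult_pos_pos; use t' lt t1 l1 in simp)+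
        ultimately have "K / ((- t) * l t) \<le> K / ((- t1) * l t1)" using K by (intro divide_left_mono mult_pos_pos[of "(- t) * l t" "(- t1) * l t1"]) linarith+
        then have "K / ((- t) * l t) * axis_dist2 y \<le> K / ((- t1) * l t1) * axis_dist2 y" by (intro mult_right_mono) auto
        then show ?thesis using Hb[OF y8(1) t'(3,1)] by linarith
      qed
      assume yr: "axis_dist2 y > 0"
      show "dt Hel (y, t) + u (y, t) \<bullet> grad Hel (y, t) = laplacian Hel (y, t)
        - 2 / axis_dist2 y * radial_part y (grad Hel (y, t)) + 2 * (radial_part y (u (y, t)) / axis_dist2 y) * Hel (y, t)
        + 2 * Gam (y, t) * dx 3 Gam (y, t) / axis_dist2 (fst (y, t))"
        using Hel_pde[OF y8(4) t'(2,1) yr] by simp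
      show "\<bar>2 - (2 - \<sigma>)\<bar> * \<bar>Rad (y, t) / axis_dist2 y\<bar> \<le> 1 / (2 * (- t))"
      proof -
        have "\<bar>Rad (y, t) / axis_dist2 y\<bar> \<le> K / (- t)"
          using Rb[OF y8(1) t'(3,1)] yr by (simp add: abs_divide pos_divide_le_eq)
        then have "\<sigma> * \<bar>Rad (y, t) / axis_dist2 y\<bar> \<le> 1 / (2 * K) * (K / (- t))" using \<sigma> K by (intro mult_mono) auto
        then show ?thesis using \<sigma> K by simp
      qed
      have p: "(- t) * l t > 0" by (rule mult_pos_pos) (use t' lt in auto)
      have src: "\<bar>2 * Gam (y, t) * dx 3 Gam (y, t) / axis_dist2 y\<bar> \<le> 2 * (e1 / (- t)) * (K / ((- t) * l t)) * axis_dist2 y"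
      proof -
        have "\<bar>Gam (y, t) * dx 3 Gam (y, t)\<bar> \<le> (e1 / (- t) * axis_dist2 y) * (K / ((- t) * l t) * axis_dist2 y)"
          unfolding abs_mult using G(3)[OF y8(2) t'(5,1)] Gb[OF y8(1) t'(3,1)] by (intro mult_mono) auto
        then have "2 * \<bar>Gam (y, t) * dx 3 Gam (y, t)\<bar> / axis_dist2 y \<le> 2 * ((e1 / (- t) * axis_dist2 y) * (K / ((- t) * l t) * axis_dist2 y)) / axis_dist2 y"
          using yr by (intro divide_right_mono mult_left_mono) auto
        moreover have "2 * ((e1 / (- t) * axis_dist2 y) * (K / ((- t) * l t) * axis_dist2 y)) / axis_dist2 y = 2 * (e1 / (- t)) * (K / ((- t) * l t)) * axis_dist2 y"
          using yr by simp
        moreover have "\<bar>2 * Gam (y, t) * dx 3 Gam (y, t) / axis_dist2 y\<bar> = 2 * \<bar>Gam (y, t) * dx 3 Gam (y, t)\<bar> / axis_dist2 y"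
          using yr by (simp add: abs_mult)
        ultimately show ?thesis by simp
      qed
      let ?q = "44 * (K / ((- t) * l t)) + 2 * (e1 / (- t)) * (K / ((- t) * l t))"
      have q0: "?q \<ge> 0"
      proof -
        have "0 \<le> K / ((- t) * l t)" by (rule divide_nonneg_pos[OF _ p]) (use K in simp)
        moreover have "0 \<le> e1 / (- t)" by (rule divide_nonneg_pos) (use e1 t' in auto)
        ultimately show ?thesis by (intro add_nonneg_nonneg mult_nonneg_nonneg; (assumption | simp only: zero_le_numeral))
      qed
      have "44 * \<bar>Hel (y, t)\<bar> + \<bar>2 * Gam (y, t) * dx 3 Gam (y, t) / axis_dist2 y\<bar> \<le> ?q * axis_dist2 y"
      proof -
        have "44 * h + r \<le> (44 * p + q) * w" if "h \<le> p * w" "r \<le> q * w" for h r p q w :: real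
          using that by (simp add: distrib_right)
        from this[OF Hb[OF y8(1) t'(3,1)] src] show ?thesis .
      qed
      then have "(44 * \<bar>Hel (y, t)\<bar> + \<bar>2 * Gam (y, t) * dx 3 Gam (y, t) / axis_dist2 y\<bar>) * axis_dist2 y powr (- (2 - \<sigma>) / 2)
          \<le> (?q * axis_dist2 y) * axis_dist2 y powr (- (2 - \<sigma>) / 2)"
        by (rule mult_right_mono) simp
      also have "\<dots> \<le> ?q" by (rule pw'[OF y8(3) yr q0])
      also have "\<dots> = (44 * K * (- t) + 2 * e1 * K) / ((- t)\<^sup>2 * l t)"
      proof -
        have "44 * (K / (s * m)) + 2 * (e1 / s) * (K / (s * m)) = (44 * K * s + 2 * e1 * K) / (s\<^sup>2 * m)" if "s > 0" "m > 0" for s m :: real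
          using that by (simp add: field_simps power2_eq_square)
        from this[of "-t" "l t"] show ?thesis using t' lt by simp
      qed
      \<comment> \<open>The choice of \<tau> makes the cutoff part at most e/4, and e1 makes the
        source part e/16.\<close>
      also have "\<dots> \<le> (e / 2) / ((- t)\<^sup>2 * l t)"
      proof (rule divide_right_mono)
        have "44 * K * (- t) \<le> 44 * K * (e / (176 * K))" using K t \<tau> by (intro mult_left_mono) auto
        also have "\<dots> = e / 4" using K by simp
        finally show "44 * K * (- t) + 2 * e1 * K \<le> e / 2" using K e by (simp add: e1_def)
      qed (use lt in simp)
      also have "\<dots> \<le> (e / 2) / ((- t)\<^sup>2 * l t1)"
        using e lt l1 t' by (intro divide_left_mono mult_left_mono mult_pos_pos) auto
      also have "\<dots> = N / (2 * (- t)\<^sup>2)" by (simp add: N_def)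
      finally show "(44 * \<bar>Hel (y, t)\<bar> + \<bar>2 * Gam (y, t) * dx 3 Gam (y, t) / axis_dist2 (fst (y, t))\<bar>) * axis_dist2 y powr (- (2 - \<sigma>) / 2)
          \<le> N / (- t)\<^sup>2 - 1 / (2 * (- t)) * (N / (- t))" unfolding Mk fst_conv .
    next
      fix y assume y: "norm (y::real^3) \<le> 2 * \<rho>" "axis_dist2 y > 0"
      then have y8: "norm y \<le> 7/8" "norm y \<le> 1" by (simp_all add: \<rho>_def)
      have l0: "0 < l (- \<tau>)" using lp[of "-\<tau>"] \<tau> by simp
      have "\<bar>Hel (y, - \<tau>)\<bar> * axis_dist2 y powr (- (2 - \<sigma>) / 2) \<le> K / (\<tau> * l (- \<tau>)) * axis_dist2 y * axis_dist2 y powr (- (2 - \<sigma>) / 2)"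
        using Hb[OF y8(1), of "-\<tau>"] \<tau> by (intro mult_right_mono) auto
      also have "\<dots> \<le> K / (\<tau> * l (- \<tau>))" by (rule pw'[OF y8(2) y(2)]) (use K \<tau> l0 in simp)
      also have "\<dots> \<le> N / (- (- \<tau>))"
      proof -
        have "K * l t1 \<le> e * l (- \<tau>)" using l1(2) K by (simp add: e2_def pos_le_divide_eq mult.commute)
        then have "K \<le> e * l (- \<tau>) / l t1" using l1(1) by (subst pos_le_divide_eq)
        then have "K / l (- \<tau>) \<le> e * l (- \<tau>) / l t1 / l (- \<tau>)" using l0 by (intro divide_right_mono) auto
        then have "K / l (- \<tau>) \<le> e / l t1" using l0 by simp
        then have "K / l (- \<tau>) / \<tau> \<le> e / l t1 / \<tau>" using \<tau> by (intro divide_right_mono) auto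
        then show ?thesis by (simp add: N_def mult.commute)
      qed
      finally show "\<bar>Hel (y, - \<tau>)\<bar> * axis_dist2 y powr (- (2 - \<sigma>) / 2) \<le> N / (- (- \<tau>))" .
    qed (use \<tau> t1 C x ub \<rho> in auto)
    also have "2 / \<rho> ^ 4 * (N / (- t1)) = \<epsilon> / ((- t1) * l t1)" using \<rho> by (simp add: N_def e_def mult.commute)
    finally show ?thesis .
  qed
  show ?thesis
  proof (rule that[of "min (\<tau> / 2) \<tau>4"])
    show "0 < min (\<tau> / 2) \<tau>4" "min (\<tau> / 2) \<tau>4 < 1" using \<tau> \<tau>4 by auto
    fix x t assume x: "norm (x::real^3) \<le> 1/64" and t: "- min (\<tau> / 2) \<tau>4 \<le> t" "t < 0"
    have t': "- \<tau> < t" "- \<tau>4 \<le> t" using t \<tau> by auto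
    show "\<bar>Hel (x, t)\<bar> \<le> \<epsilon> / ((- t) * l t) * axis_dist2 x"
    proof (cases "axis_dist2 x > 0")
      case False
      then have "x $ 1 = 0" "x $ 2 = 0" by (auto simp: axis_dist2_def not_less sum_power2_le_zero_iff)
      then show ?thesis by (simp add: Hel_def swirl_def axis_dist2_def)
    next
      case True
      \<comment> \<open>The bound is uniform in \<sigma>, so the limit \<sigma> \<rightarrow> 0
        reaches the exponent 2 that the maximum principle itself excludes.\<close>
      have "((\<lambda>\<sigma>. \<bar>Hel (x, t)\<bar> * axis_dist2 x powr (- (2 - \<sigma>) / 2)) \<longlongrightarrow> \<bar>Hel (x, t)\<bar> * axis_dist2 x powr (- (2 - 0) / 2)) (at_right 0)"
        using True by (intro tendsto_intros) auto
      moreover have "\<forall>\<^sub>F \<sigma> in at_right 0. \<bar>Hel (x, t)\<bar> * axis_dist2 x powr (- (2 - \<sigma>) / 2) \<le> \<epsilon> / ((- t) * l t)"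
      proof -
        have "\<forall>\<^sub>F \<sigma> in at_right 0. \<sigma> < 1 / (2 * K)" using K by (intro order_tendstoD(2)[OF tendsto_ident_at]) auto
        moreover have "\<forall>\<^sub>F \<sigma> in at_right (0::real). 0 < \<sigma>" by (rule eventually_at_right_less)
        ultimately show ?thesis by eventually_elim (rule main[OF x True t' t(2)], auto)
      qed
      ultimately have "\<bar>Hel (x, t)\<bar> * axis_dist2 x powr (- (2 - 0) / 2) \<le> \<epsilon> / ((- t) * l t)"
        by (rule tendsto_upperbound) simp
      moreover have "axis_dist2 x powr (- (2 - 0) / 2) = 1 / axis_dist2 x" using powr_neg_one[OF True] by simp
      ultimately have "\<bar>Hel (x, t)\<bar> / axis_dist2 x \<le> \<epsilon> / ((- t) * l t)" by (simp only: times_divide_eq_right mult_1_right)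
      then show ?thesis by (subst (asm) pos_divide_le_eq[OF True])
    qed
  qed
qed


section \<open>The part of the velocity without swirl\<close>

lemma on_axisD: "\<not> 0 < axis_dist2 x \<Longrightarrow> x $ 1 = 0 \<and> x $ 2 = 0 \<and> axis_dist2 x = 0"
  by (auto simp: axis_dist2_def not_less sum_power2_le_zero_iff)

lemma axis_component_le: "\<bar>x $ 1\<bar> \<le> sqrt (axis_dist2 x)" "\<bar>x $ 2\<bar> \<le> sqrt (axis_dist2 x)"
  by (rule real_le_rsqrt; simp add: axis_dist2_def)+

text \<open>r^2 times the squared horizontal speed is Rad^2 + Gam^2, so discarding Gam can only
  decrease it. The comparison is with \<open>u\<close> at the same point, not at the mirror image,
  and therefore transfers energy and rate bounds directly.\<close>

lemma swirl_free_le: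
  assumes z: "(x, t) \<in> Q" shows "\<bar>swirl_free k (x, t)\<bar> \<le> norm (u (x, t))"
proof (cases "axis_dist2 x > 0")
  case False
  then have "refl (x, t) = (x, t)" using on_axisD[of x] by (simp add: refl_def vec_eq_iff forall_3)
  moreover have "\<bar>a + a\<bar> / 2 \<le> B" "\<bar>a - a\<bar> / 2 \<le> B" if "\<bar>a\<bar> \<le> B" for a B :: real using that by auto
  ultimately show ?thesis using component_le_norm_cart[of "u (x, t)" k] by (auto simp: swirl_free_def abs_mult)
next
  case True
  let ?R = "axis_dist2 x" and ?h = "(u (x, t) $ 1)\<^sup>2 + (u (x, t) $ 2)\<^sup>2"
  have "?R * ?h = (Rad (x, t))\<^sup>2 + (Gam (x, t))\<^sup>2"
    by (simp add: axis_dist2_def Rad_def Gam_def radial_def swirl_def power2_eq_square algebra_simps)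
  then have RR: "(Rad (x, t))\<^sup>2 \<le> ?R * ?h" by simp
  have hu: "?h \<le> (norm (u (x, t)))\<^sup>2" unfolding norm_sq_vec3 by simp
  have key: "\<bar>v\<bar> \<le> norm (u (x, t))" if "?R * v = x $ i * Rad (x, t)" "i = 1 \<or> i = 2" for v i
  proof -
    have "\<bar>x $ i\<bar>\<^sup>2 \<le> (sqrt ?R)\<^sup>2" using that(2) axis_component_le[of x] by (intro power_mono) auto
    then have xi: "(x $ i)\<^sup>2 \<le> ?R" by simp
    have "?R\<^sup>2 * v\<^sup>2 = (x $ i)\<^sup>2 * (Rad (x, t))\<^sup>2" using arg_cong[OF that(1), of "\<lambda>a. a\<^sup>2"] by (simp add: power_mult_distrib)
    also have "\<dots> \<le> ?R * (?R * ?h)" using xi RR by (intro mult_mono) auto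
    finally have "?R\<^sup>2 * v\<^sup>2 \<le> ?R\<^sup>2 * ?h" by (simp add: power2_eq_square mult.assoc)
    then have "v\<^sup>2 \<le> ?h" using True by (simp add: mult_le_cancel_left_pos)
    then have "v\<^sup>2 \<le> (norm (u (x, t)))\<^sup>2" using hu by linarith
    then show ?thesis using abs_le_square_iff[of v "norm (u (x, t))"] by simp
  qed
  consider "k = 1" | "k = 2" | "k = 3" using exhaust_3[of k] by blast
  then show ?thesis
  proof cases
    case 1 then show ?thesis using key[OF swirl_free_eq(1)[OF z]] by simp
  next
    case 2 then show ?thesis using key[OF swirl_free_eq(2)[OF z]] by simp
  next
    case 3 then show ?thesis using swirl_free_eq(3)[OF z] component_le_norm_cart[of "u (x, t)" 3] by simp
  qed
qed

lemma Rad_swirl_free: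
  assumes z: "(x, t) \<in> Q" and B: "\<bar>swirl_free 1 (x, t)\<bar> \<le> B" "\<bar>swirl_free 2 (x, t)\<bar> \<le> B"
  shows "\<bar>Rad (x, t)\<bar> \<le> 2 * sqrt (axis_dist2 x) * B"
proof (cases "axis_dist2 x > 0")
  case False then show ?thesis using on_axisD[of x] by (simp add: Rad_def radial_def)
next
  case True
  have "axis_dist2 x * (x $ 1 * swirl_free 1 (x, t) + x $ 2 * swirl_free 2 (x, t))
      = x $ 1 * (axis_dist2 x * swirl_free 1 (x, t)) + x $ 2 * (axis_dist2 x * swirl_free 2 (x, t))" by (simp add: algebra_simps)
  also have "\<dots> = axis_dist2 x * Rad (x, t)"
    unfolding swirl_free_eq(1,2)[OF z] by (simp add: axis_dist2_def power2_eq_square algebra_simps)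
  finally have e: "Rad (x, t) = x $ 1 * swirl_free 1 (x, t) + x $ 2 * swirl_free 2 (x, t)" using True by simp
  have "\<bar>x $ 1 * swirl_free 1 (x, t)\<bar> \<le> sqrt (axis_dist2 x) * B" "\<bar>x $ 2 * swirl_free 2 (x, t)\<bar> \<le> sqrt (axis_dist2 x) * B"
    unfolding abs_mult using axis_component_le[of x] B by (intro mult_mono; simp)+
  then show ?thesis unfolding e by linarith
qed

lemma swirl_free_curl_slice:
  assumes U: "open U" "U \<subseteq> ball 0 1" "x \<in> U" and t: "-1 < t" "t < 0"
    and m: "\<And>y. y \<in> U \<Longrightarrow> axis_dist2 y > 0 \<Longrightarrow> \<bar>Hel (y, t)\<bar> \<le> m * sqrt (axis_dist2 y)"
  shows "\<bar>dx j (swirl_free k) (x, t) - dx k (swirl_free j) (x, t)\<bar> \<le> m"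
proof -
  let ?f = "\<lambda>y. dx j (swirl_free k) (y, t) - dx k (swirl_free j) (y, t)"
  have off: "\<bar>?f y\<bar> \<le> m" if "y \<in> U" "axis_dist2 y > 0" for y
  proof -
    have "(y, t) \<in> Q" using that U t by (auto simp: parabolic_cylinder_def)
    from swirl_free_curl[OF this that(2), of j k] m[OF that] show ?thesis
      using that(2) by (meson order_trans pos_divide_le_eq real_sqrt_gt_zero)
  qed
  show ?thesis
  proof (cases "axis_dist2 x > 0")
    case False
    then have x0: "x $ 1 = 0" "x $ 2 = 0" using on_axisD by blast+
    define g where "g h = x + h *\<^sub>R axis 1 1" for h :: real
    have "(g \<longlongrightarrow> g 0) (at_right 0)" unfolding g_def by (intro tendsto_intros)
    then have g: "(g \<longlongrightarrow> x) (at_right 0)" by (simp add: g_def)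
    have "continuous_on U ?f"
      using smooth_on_imp_continuous[OF smooth_on_dx[OF smooth_swirl_free]] U t
      by (intro continuous_on_diff continuous_on_compose2[OF smooth_on_imp_continuous[OF smooth_on_dx[OF smooth_swirl_free]]] continuous_intros)
        (auto simp: parabolic_cylinder_def)
    then have "isCont ?f x" using U by (simp add: continuous_on_eq_continuous_at)
    then have "((\<lambda>h. ?f (g h)) \<longlongrightarrow> ?f x) (at_right 0)" using g by (rule isCont_tendsto_compose)
    then have lim: "((\<lambda>h. \<bar>?f (g h)\<bar>) \<longlongrightarrow> \<bar>?f x\<bar>) (at_right 0)" by (rule tendsto_rabs)
    have "\<forall>\<^sub>F h in at_right 0. g h \<in> U" using topological_tendstoD[OF g U(1,3)] .
    then have "\<forall>\<^sub>F h in at_right 0. \<bar>?f (g h)\<bar> \<le> m"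
      using eventually_at_right_less[of "0::real"]
    proof eventually_elim
      case (elim h)
      have "axis_dist2 (g h) > 0" using x0 elim by (simp add: g_def axis_dist2_def axis_def)
      then show ?case using off elim by blast
    qed
    then show ?thesis by (rule tendsto_upperbound[OF lim]) simp
  qed (use off U in blast)
qed

lemma swirl_free_L2_bound:
  assumes B: "ball x (2 * s) \<subseteq> ball 0 1" and s: "s > 0" and t: "-1 < t" "t < 0"
    and m: "\<And>y. y \<in> ball x (2 * s) \<Longrightarrow> axis_dist2 y > 0 \<Longrightarrow> \<bar>Hel (y, t)\<bar> \<le> m * sqrt (axis_dist2 y)"
  shows "bump_mass * \<bar>swirl_free k (x, t)\<bar> \<le> 24 * m * s + (4 + E / 2) * s powr (-3/2)"
proof (rule bounded_curl_L2_bound[where w="\<lambda>k x. swirl_free k (x, t)" and S="ball 0 1", OF _ B s])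
  note sl = slice_calculus[OF smooth_swirl_free t]
  show "smooth_on (ball 0 1) (\<lambda>x. swirl_free j (x, t))" for j by (rule sl(1))
  show "(\<Sum>j\<in>UNIV. dir_deriv (axis j 1) (\<lambda>x. swirl_free j (x, t)) z) = 0" if "z \<in> ball 0 1" for z
    using swirl_free_divergence[of z t] that t by (simp add: sl(2) parabolic_cylinder_def)
  show "\<bar>dir_deriv (axis j 1) (\<lambda>x. swirl_free k (x, t)) z - dir_deriv (axis k 1) (\<lambda>x. swirl_free j (x, t)) z\<bar> \<le> m"
    if "z \<in> ball x (2 * s)" for z j k
  proof -
    have "norm z < 1" using that B by auto
    then show ?thesis using swirl_free_curl_slice[OF open_ball B that t m, of j k] by (simp add: sl(2))
  qed
  have sub: "cbox (x - s *\<^sub>R 1) (x + s *\<^sub>R 1) \<subseteq> ball 0 1" using cube_in_ball[OF s] B by blast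
  have cu: "continuous_on (ball 0 1) (\<lambda>y. u (y, t))"
    using t by (intro continuous_on_compose2[OF smooth_on_imp_continuous[OF su]] continuous_intros) (auto simp: parabolic_cylinder_def)
  have "integral (cbox (x - s *\<^sub>R 1) (x + s *\<^sub>R 1)) (\<lambda>y. (swirl_free k (y, t))\<^sup>2)
     \<le> integral (cbox (x - s *\<^sub>R 1) (x + s *\<^sub>R 1)) (\<lambda>y. (norm (u (y, t)))\<^sup>2)"
  proof (rule integral_le)
    show "(\<lambda>y. (swirl_free k (y, t))\<^sup>2) integrable_on cbox (x - s *\<^sub>R 1) (x + s *\<^sub>R 1)"
      by (intro integrable_continuous continuous_intros continuous_on_subset[OF smooth_on_imp_continuous[OF sl(1)] sub])
    show "(\<lambda>y. (norm (u (y, t)))\<^sup>2) integrable_on cbox (x - s *\<^sub>R 1) (x + s *\<^sub>R 1)"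
      by (intro integrable_continuous continuous_intros continuous_on_subset[OF cu sub])
    show "(swirl_free k (y, t))\<^sup>2 \<le> (norm (u (y, t)))\<^sup>2" if "y \<in> cbox (x - s *\<^sub>R 1) (x + s *\<^sub>R 1)" for y
    proof -
      have "(y, t) \<in> Q" using that sub t by (auto simp: parabolic_cylinder_def)
      from swirl_free_le[OF this, of k] show ?thesis by (simp add: abs_le_square_iff[symmetric])
    qed
  qed
  then show "integral (cbox (x - s *\<^sub>R 1) (x + s *\<^sub>R 1)) (\<lambda>y. (swirl_free k (y, t))\<^sup>2) \<le> E"
    using energy[OF t s B] by linarith
qed

text \<open>Three ranges of r relative to l. For r \<ge> L l the rate of \<open>u\<close> suffices
  once \<open>L\<close> is large. For \<delta> l \<le> r \<le> L l the horizontal part of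
  \<open>swirl_free\<close> vanishes on the axis and has small curl by \<open>Hel_small\<close>, so
  averages of radius L l show that it is small at distance r. For r \<le> \<delta> l the bound at
  distance \<delta> l descends by means of the second derivatives.\<close>

lemma Rad_small:
  assumes \<epsilon>: "\<epsilon> > 0"
  obtains \<tau> where "0 < \<tau>" "\<tau> < 1" "\<And>x t. norm x \<le> 1/256 \<Longrightarrow> - \<tau> \<le> t \<Longrightarrow> t < 0 \<Longrightarrow> \<bar>Rad (x, t)\<bar> \<le> \<epsilon> / (- t) * axis_dist2 x"
proof -
  define \<beta> where "\<beta> = bump_mass"
  have \<beta>: "\<beta> > 0" using bump_mass_pos by (simp add: \<beta>_def)
  define \<delta> where "\<delta> = \<epsilon> / (16 * C2)"
  have \<delta>: "\<delta> > 0" using \<epsilon> C2 by (simp add: \<delta>_def)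
  \<comment> \<open>The first summand serves the far range, the second makes the term 32 C0 / L of
    the middle range at most \<epsilon> \<beta> / 8, and \<delta> keeps the ranges in order.\<close>
  define L where "L = 2 * C0 / \<epsilon> + 256 * C0 / (\<beta> * \<epsilon>) + \<delta> + 1"
  have Lp: "0 \<le> 2 * C0 / \<epsilon>" "0 \<le> 256 * C0 / (\<beta> * \<epsilon>)" using C0 \<epsilon> \<beta> by auto
  have L: "L > 0" "2 * C0 / \<epsilon> \<le> L" "256 * C0 / (\<beta> * \<epsilon>) \<le> L" "\<delta> \<le> L"
    using Lp \<delta> unfolding L_def by linarith+
  \<comment> \<open>Chosen after \<open>L\<close> and \<delta>: the curl contributes 192 L^2 e5 /
    \<delta>, which becomes \<epsilon> \<beta> / 8.\<close>
  define e5 where "e5 = \<epsilon> * \<beta> * \<delta> / (1536 * L\<^sup>2)"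
  have e5: "e5 > 0" using \<epsilon> \<beta> \<delta> L by (simp add: e5_def)
  obtain \<tau>1 where H: "0 < \<tau>1" "\<tau>1 < 1"
    "\<And>x t. norm x \<le> 1/64 \<Longrightarrow> - \<tau>1 \<le> t \<Longrightarrow> t < 0 \<Longrightarrow> \<bar>Hel (x, t)\<bar> \<le> e5 / ((- t) * l t) * axis_dist2 x"
    by (rule Hel_small[OF e5], rule that)
  define e where "e = 1 / (1024 * L)"
  have e: "e > 0" using L by (simp add: e_def)
  obtain \<tau>2 where \<tau>2: "0 < \<tau>2" "\<tau>2 < 1" "\<tau>2 \<le> e" "\<And>t. - \<tau>2 \<le> t \<Longrightarrow> t < 0 \<Longrightarrow> 0 < l t \<and> l t \<le> e \<and> - t \<le> e * (l t)\<^sup>2"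
    by (rule small_scales[OF e], rule that)
  show ?thesis
  proof (rule that[of "min \<tau>1 \<tau>2"])
    show "0 < min \<tau>1 \<tau>2" "min \<tau>1 \<tau>2 < 1" using H \<tau>2 by auto
    fix x0 t assume x0: "norm (x0::real^3) \<le> 1/256" and t: "- min \<tau>1 \<tau>2 \<le> t" "t < 0"
    have t1: "-1 < t" "- \<tau>1 \<le> t" using t H \<tau>2 by auto
    have lt: "0 < l t" "l t \<le> e" using \<tau>2(4)[of t] t by auto
    define T where "T = - t"
    have T: "T > 0" using t by (simp add: T_def)
    have Ll: "4 * (L * l t) \<le> 1/256"
    proof -
      have "L * l t \<le> L * e" using lt L by (intro mult_left_mono) auto
      then show ?thesis using L by (simp add: e_def)
    qed
    have far: "\<bar>Rad (x, t)\<bar> \<le> \<epsilon> / T * axis_dist2 x" if x: "norm x \<le> 1/64" "L * l t \<le> sqrt (axis_dist2 x)" for x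
    proof -
      have "\<bar>Rad (x, t)\<bar> \<le> 2 * sqrt (axis_dist2 x) * norm (u (x, t))" by (rule Gam_Rad_velocity_bound)
      also have "\<dots> \<le> 2 * sqrt (axis_dist2 x) * (C0 * (l t / T))"
        using u_bound[of x t] x t1 t by (intro mult_left_mono) (auto simp: T_def)
      also have "\<dots> = 2 * C0 / T * sqrt (axis_dist2 x) * l t" by simp
      also have "\<dots> \<le> 2 * C0 / T * sqrt (axis_dist2 x) * (sqrt (axis_dist2 x) / L)"
        using x(2) L C0 T by (intro mult_left_mono) (auto simp: pos_le_divide_eq mult.commute)
      also have "\<dots> = 2 * C0 / L / T * (sqrt (axis_dist2 x) * sqrt (axis_dist2 x))" by (simp add: mult_ac)
      also have "\<dots> = 2 * C0 / L / T * axis_dist2 x" by simp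
      also have "\<dots> \<le> \<epsilon> / T * axis_dist2 x"
      proof (intro mult_right_mono divide_right_mono)
        show "2 * C0 / L \<le> \<epsilon>" using L(2) \<epsilon> L(1) by (simp add: pos_divide_le_eq mult.commute)
      qed (use T in auto)
      finally show ?thesis .
    qed
    have mid: "\<bar>Rad (x, t)\<bar> \<le> \<epsilon> / 2 / T * axis_dist2 x"
      if x: "norm x \<le> 1/128" "\<delta> * l t \<le> sqrt (axis_dist2 x)" "sqrt (axis_dist2 x) \<le> L * l t" for x
    proof -
      define r where "r = sqrt (axis_dist2 x)"
      have "\<delta> * l t > 0" using \<delta> lt by simp
      then have r: "r > 0" using x(2) unfolding r_def by linarith
      then have xR: "axis_dist2 x > 0" "r * r = axis_dist2 x" by (auto simp: r_def)
      define b where "b = fst (ray_base x t)"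
      define v where "v = fst (ray_dir x)"
      have bc: "b $ 1 = 0" "b $ 2 = 0" "b $ 3 = x $ 3" by (simp_all add: b_def ray_base_def)
      have nb: "norm b \<le> 1/128"
      proof -
        have "(norm b)\<^sup>2 \<le> (norm x)\<^sup>2" unfolding norm_sq_vec3 bc by simp
        then have "norm b \<le> norm x" by (rule power2_le_imp_le) simp
        then show ?thesis using x by linarith
      qed
      have nv: "norm v = 1"
      proof -
        have "(norm v)\<^sup>2 = 1" unfolding norm_sq_vec3 v_def ray_dir_def using axis_unit_vector(1)[OF xR(1)] by simp
        then have "norm v = 1 \<or> norm v = - 1" by (simp only: power2_eq_1_iff)
        then show ?thesis using norm_ge_zero[of v] by linarith
      qed
      have xe: "b + r *\<^sub>R v = x" using arg_cong[OF ray_end[OF xR(1), of t], of fst] by (simp add: b_def v_def r_def)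
      \<comment> \<open>Contains the balls of radius 2 L l about all points of the segment from the
        axis to \<open>x\<close>, whose length is at most L l.\<close>
      let ?S = "ball b (4 * (L * l t))"
      have S64: "norm y \<le> 1/64" if "y \<in> ?S" for y
        using norm_triangle_ineq[of b "y - b"] that nb Ll by (simp add: dist_norm norm_minus_commute)
      have S1: "?S \<subseteq> ball 0 1" using S64 by force
      have Sr: "sqrt (axis_dist2 y) \<le> 4 * (L * l t)" if "y \<in> ?S" for y
      proof -
        have "axis_dist2 y = axis_dist2 (y - b)" by (simp add: axis_dist2_def bc)
        also have "sqrt \<dots> \<le> norm (y - b)" by (rule sqrt_axis_dist2_le)
        finally show ?thesis using that by (simp add: dist_norm norm_minus_commute)
      qed
      \<comment> \<open>The curl is bounded by |Hel| / r, which by \<open>Hel_small\<close> is at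
        most e5 r / (T l), and r \<le> 4 L l on \<open>?S\<close>.\<close>
      define m where "m = 4 * L * e5 / T"
      have Hm: "\<bar>Hel (y, t)\<bar> \<le> m * sqrt (axis_dist2 y)" if "y \<in> ?S" for y
      proof -
        have "\<bar>Hel (y, t)\<bar> \<le> e5 / (T * l t) * (sqrt (axis_dist2 y) * sqrt (axis_dist2 y))"
          using H(3)[OF S64[OF that] t1(2) t(2)] by (simp add: T_def)
        also have "\<dots> \<le> e5 / (T * l t) * (4 * (L * l t) * sqrt (axis_dist2 y))"
          using Sr[OF that] e5 T lt by (intro mult_left_mono mult_right_mono) auto
        also have "\<dots> = m * sqrt (axis_dist2 y)" using lt T by (simp add: m_def)
        finally show ?thesis .
      qed
      note sl = slice_calculus[OF smooth_swirl_free t1(1) t(2)]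
      have s: "L * l t > 0" using L lt by simp
      have diff: "\<beta> * \<bar>swirl_free k (b + r *\<^sub>R v, t) - swirl_free k (b, t)\<bar> \<le> 48 * m * (L * l t) + 32 * (C0 * (l t / T)) * r / (L * l t)" for k
        unfolding \<beta>_def
      proof (rule bounded_curl_difference_bound[where w="\<lambda>k x. swirl_free k (x, t)" and S="?S", OF _ s _ nv])
        show "smooth_on ?S (\<lambda>x. swirl_free j (x, t))" for j by (rule smooth_on_subset[OF sl(1) S1])
        show "0 \<le> r" using r by simp
        show "ball (b + a *\<^sub>R v) (2 * (L * l t)) \<subseteq> ?S" if "0 \<le> a" "a \<le> r" for a
        proof
          fix y assume "y \<in> ball (b + a *\<^sub>R v) (2 * (L * l t))"
          then have "norm (y - (b + a *\<^sub>R v)) < 2 * (L * l t)" by (simp add: dist_norm norm_minus_commute)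
          moreover have "norm (y - b) \<le> norm (y - (b + a *\<^sub>R v)) + norm (a *\<^sub>R v)"
            using norm_triangle_ineq[of "y - (b + a *\<^sub>R v)" "a *\<^sub>R v"] by simp
          moreover have "norm (a *\<^sub>R v) \<le> L * l t" using that nv x(3) by (simp add: r_def)
          ultimately show "y \<in> ?S" using s by (simp add: dist_norm norm_minus_commute)
        qed
        fix z assume z: "z \<in> ?S"
        then have z1: "norm z < 1" using S1 by auto
        show "(\<Sum>j\<in>UNIV. dir_deriv (axis j 1) (\<lambda>x. swirl_free j (x, t)) z) = 0"
          using swirl_free_divergence[of z t] z1 t t1 by (simp add: sl(2) parabolic_cylinder_def)
        show "\<bar>dir_deriv (axis j 1) (\<lambda>x. swirl_free i (x, t)) z - dir_deriv (axis i 1) (\<lambda>x. swirl_free j (x, t)) z\<bar> \<le> m" for j i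
          using swirl_free_curl_slice[OF open_ball S1 z t1(1) t(2) Hm, of j i] z1 by (simp add: sl(2))
        show "\<bar>swirl_free k (z, t)\<bar> \<le> C0 * (l t / T)"
          using swirl_free_le[of z t k] u_bound[OF z1 t1(1) t(2)] z1 t t1 by (simp add: parabolic_cylinder_def T_def)
      qed
      have bQ: "(b, t) \<in> Q" using nb t t1 by (simp add: parabolic_cylinder_def)
      have rb: "refl (b, t) = (b, t)" using bc by (simp add: refl_def vec_eq_iff forall_3)
      have b0: "swirl_free 1 (b, t) = 0" "swirl_free 2 (b, t) = 0"
        using rotating_pair_axis[OF pair_u bQ] bc by (simp_all add: swirl_free_def rb)
      define W where "W = (192 * L\<^sup>2 * e5 / \<delta> + 32 * C0 / L) * r / T / \<beta>"
      have Wb: "\<bar>swirl_free k (x, t)\<bar> \<le> W" if k: "k = 1 \<or> k = 2" for k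
      proof -
        have "\<beta> * \<bar>swirl_free k (x, t)\<bar> \<le> 48 * m * (L * l t) + 32 * (C0 * (l t / T)) * r / (L * l t)"
          using diff[of k] k b0 unfolding xe by auto
        also have "32 * (C0 * (l t / T)) * r / (L * l t) = 32 * C0 / L * r / T" using lt by (simp add: mult_ac)
        also have "48 * m * (L * l t) = 192 * L\<^sup>2 * e5 / T * l t" by (simp add: m_def power2_eq_square)
        also have "192 * L\<^sup>2 * e5 / T * l t \<le> 192 * L\<^sup>2 * e5 / T * (r / \<delta>)"
          using x(2) \<delta> e5 T by (intro mult_left_mono) (auto simp: r_def pos_le_divide_eq mult.commute)
        finally have "\<beta> * \<bar>swirl_free k (x, t)\<bar> \<le> 192 * L\<^sup>2 * e5 / T * (r / \<delta>) + 32 * C0 / L * r / T" by simp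
        also have "\<dots> = (192 * L\<^sup>2 * e5 / \<delta> + 32 * C0 / L) * r / T" by (simp add: add_divide_distrib distrib_right)
        finally show ?thesis unfolding W_def using \<beta> by (subst pos_le_divide_eq) (auto simp: mult.commute)
      qed
      have xQ: "(x, t) \<in> Q" using x(1) t t1 by (simp add: parabolic_cylinder_def)
      have "\<bar>Rad (x, t)\<bar> \<le> 2 * r * W" unfolding r_def by (rule Rad_swirl_free[OF xQ]) (use Wb in auto)
      also have "\<dots> = 2 * (192 * L\<^sup>2 * e5 / \<delta> + 32 * C0 / L) / \<beta> / T * (r * r)" by (simp add: W_def mult_ac)
      also have "\<dots> \<le> \<epsilon> / 2 / T * (r * r)"
      proof (intro mult_right_mono divide_right_mono)
        have "192 * L\<^sup>2 * e5 / \<delta> = \<epsilon> * \<beta> / 8" using L \<delta> by (simp add: e5_def)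
        moreover have "32 * C0 / L \<le> \<epsilon> * \<beta> / 8"
        proof -
          have "256 * C0 \<le> L * (\<beta> * \<epsilon>)" using L(3) \<beta> \<epsilon> by (simp add: pos_divide_le_eq)
          then have "32 * C0 \<le> \<epsilon> * \<beta> / 8 * L" by (simp add: algebra_simps)
          then show ?thesis using L by (simp add: pos_divide_le_eq)
        qed
        moreover have "2 * (p + q) \<le> \<epsilon> / 2 * \<beta>" if "p = \<epsilon> * \<beta> / 8" "q \<le> \<epsilon> * \<beta> / 8" for p q using that by simp
        ultimately have "2 * (192 * L\<^sup>2 * e5 / \<delta> + 32 * C0 / L) \<le> \<epsilon> / 2 * \<beta>" by blast
        then show "2 * (192 * L\<^sup>2 * e5 / \<delta> + 32 * C0 / L) / \<beta> \<le> \<epsilon> / 2" using \<beta> by (simp add: pos_divide_le_eq)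
      qed (use T r in auto)
      finally show ?thesis unfolding xR(2) .
    qed
    show "\<bar>Rad (x0, t)\<bar> \<le> \<epsilon> / (- t) * axis_dist2 x0"
    proof -
      have half: "\<epsilon> / 2 / T * axis_dist2 x0 \<le> \<epsilon> / T * axis_dist2 x0"
        using \<epsilon> T by (intro mult_right_mono divide_right_mono) auto
      define h where "h = \<delta> * l t"
      have h: "h > 0" using \<delta> lt by (simp add: h_def)
      have hL: "h \<le> L * l t" using L lt by (simp add: h_def mult_right_mono)
      consider "L * l t \<le> sqrt (axis_dist2 x0)" | "h \<le> sqrt (axis_dist2 x0)" "sqrt (axis_dist2 x0) \<le> L * l t" | "sqrt (axis_dist2 x0) \<le> h"
        using hL by linarith
      then have "\<bar>Rad (x0, t)\<bar> \<le> \<epsilon> / T * axis_dist2 x0"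
      proof cases
        case 1 then show ?thesis using far[of x0] x0 by simp
      next
        case 2 then show ?thesis using mid[of x0] x0 half by (simp add: h_def)
      next
        case 3
        have "\<bar>Rad (x0, t)\<bar> \<le> (\<epsilon> / 2 / T + 8 * (C2 / ((- t) * l t)) * h) * axis_dist2 x0"
        proof (rule ratio_near_axis[OF 3 h _ _ _ t1(1) t(2), of "1/128"])
          have "h\<^sup>2 \<le> (1/256)\<^sup>2" using h hL Ll by (intro power_mono) auto
          moreover have "\<bar>x0 $ 3\<bar>\<^sup>2 \<le> (1/256)\<^sup>2" using x0 component_le_norm_cart[of x0 3] by (intro power_mono) auto
          ultimately show "h\<^sup>2 + (x0 $ 3)\<^sup>2 \<le> (1/128)\<^sup>2" by (simp add: power2_eq_square)
          show "\<bar>Rad (y, t)\<bar> \<le> \<epsilon> / 2 / T * h\<^sup>2" if y: "norm y \<le> 1/128" "axis_dist2 y = h\<^sup>2" for y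
          proof -
            have "sqrt (axis_dist2 y) = h" using y(2) h by simp
            then show ?thesis using mid[OF y(1)] hL y(2) by (simp add: h_def)
          qed
        qed auto
        moreover have "8 * (C2 / ((- t) * l t)) * h = \<epsilon> / 2 / T"
          unfolding T_def[symmetric] using lt T C2 by (simp add: h_def \<delta>_def)
        ultimately have "\<bar>Rad (x0, t)\<bar> \<le> (\<epsilon> / 2 / T + \<epsilon> / 2 / T) * axis_dist2 x0" by (simp only:)
        moreover have "\<epsilon> / 2 / T + \<epsilon> / 2 / T = \<epsilon> / T" by (simp add: field_simps)
        ultimately show ?thesis by (simp only:)
      qed
      then show ?thesis by (simp only: T_def)
    qed
  qed
qed


subsection \<open>The bootstrap\<close>

lemma axis_dist2_le_one: "norm x \<le> 1 \<Longrightarrow> axis_dist2 x \<le> 1"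
  using norm_sq_axis[of x] zero_le_power2[of "x $ 3"] power_le_one[OF norm_ge_zero[of x], of 2] by linarith

lemma Gam_axis: "\<not> 0 < axis_dist2 x \<Longrightarrow> Gam (x, t) = 0" "\<not> 0 < axis_dist2 x \<Longrightarrow> Hel (x, t) = 0"
  using on_axisD[of x] by (simp_all add: Gam_def Hel_def swirl_def)

lemma Hel_a_priori:
  assumes "\<And>i k. \<bar>dx i (component u k) (x, t)\<bar> \<le> B"
  shows "\<bar>Hel (x, t)\<bar> \<le> 4 * B * sqrt (axis_dist2 x)"
proof -
  have "\<bar>vort1 (x, t)\<bar> \<le> 2 * B" "\<bar>vort2 (x, t)\<bar> \<le> 2 * B"
    using assms[of 2 3] assms[of 3 2] assms[of 3 1] assms[of 1 3] by (auto simp: vort1_def vort2_def)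
  then have "\<bar>x $ 1 * vort2 (x, t)\<bar> \<le> sqrt (axis_dist2 x) * (2 * B)" "\<bar>x $ 2 * vort1 (x, t)\<bar> \<le> sqrt (axis_dist2 x) * (2 * B)"
    unfolding abs_mult using axis_component_le[of x] by (intro mult_mono; simp)+
  moreover have "\<bar>a - b\<bar> \<le> 4 * B * w" if "\<bar>a\<bar> \<le> w * (2 * B)" "\<bar>b\<bar> \<le> w * (2 * B)" for a b w
    using that abs_triangle_ineq4[of a b] by (simp add: mult.commute)
  ultimately show ?thesis unfolding Hel_def swirl_def fst_conv by blast
qed

text \<open>Moving in the z-direction keeps the distance from the axis, so a bound weighted in r may
  be used unchanged along the segment. The second z-derivative of \<open>Gam\<close> is again a
  swirl and brings its own factor r.\<close>

lemma dx3_Gam_interpolation: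
  assumes R: "axis_dist2 x > 0" and h: "h > 0" "norm x + h < 1" and t: "-1 < t" "t < 0"
    and A: "\<And>y. norm y \<le> norm x + h \<Longrightarrow> axis_dist2 y = axis_dist2 x \<Longrightarrow> \<bar>Gam (y, t)\<bar> \<le> A"
  shows "\<bar>dx 3 Gam (x, t)\<bar> \<le> 2 * A / h + 2 * sqrt (axis_dist2 x) * (C2 * (1 / ((- t) * l t))) * h"
proof -
  have line: "(x, t) + s *\<^sub>R (axis 3 1, 0) = (x + s *\<^sub>R axis 3 1, t)" for s by simp
  have nx: "norm (x + s *\<^sub>R axis 3 1) \<le> norm x + h" if "0 \<le> s" "s \<le> h" for s
    using norm_triangle_ineq[of x "s *\<^sub>R axis 3 1"] that by simp
  have ax: "axis_dist2 (x + s *\<^sub>R axis 3 1) = axis_dist2 x" for s by (simp add: axis_dist2_def axis_def)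
  have Qs: "(x + s *\<^sub>R axis 3 1, t) \<in> Q" if "0 \<le> s" "s \<le> h" for s
    using nx[OF that] h t by (simp add: parabolic_cylinder_def)
  show ?thesis unfolding dx_eq
  proof (rule interpolation_along_line[OF smooth_Gam h(1)])
    show "(x, t) + s *\<^sub>R (axis 3 1, 0) \<in> Q" if "0 \<le> s" "s \<le> h" for s unfolding line by (rule Qs[OF that])
    show "\<bar>Gam (x, t)\<bar> \<le> A" using A[of x] h by simp
    show "\<bar>Gam ((x, t) + h *\<^sub>R (axis 3 1, 0))\<bar> \<le> A" unfolding line by (rule A) (use nx[of h] h ax in auto)
    show "\<bar>dir_deriv (axis 3 1, 0) (dir_deriv (axis 3 1, 0) Gam) ((x, t) + s *\<^sub>R (axis 3 1, 0))\<bar>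
        \<le> 2 * sqrt (axis_dist2 x) * (C2 * (1 / ((- t) * l t)))" if s: "0 \<le> s" "s \<le> h" for s
    proof -
      let ?y = "x + s *\<^sub>R axis 3 1"
      have y1: "norm ?y < 1" using nx[OF s] h by simp
      have "dx 3 (dx 3 Gam) (?y, t) = ?y $ 1 * dx 3 (dx 3 (component u 2)) (?y, t) - ?y $ 2 * dx 3 (dx 3 (component u 1)) (?y, t)"
        unfolding Gam_def using swirl_derivs(3)[OF pair_u Qs[OF s], of 3] by simp
      moreover have "\<bar>?y $ i * dx 3 (dx 3 (component u k)) (?y, t)\<bar> \<le> sqrt (axis_dist2 x) * (C2 * (1 / ((- t) * l t)))"
        if "i = 1 \<or> i = 2" for i k
        unfolding abs_mult using axis_component_le[of ?y] that d2_bound[OF y1 t, of 3 3 k] unfolding ax by (intro mult_mono) auto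
      from this[of 1 2] this[of 2 1] have "\<bar>?y $ 1 * dx 3 (dx 3 (component u 2)) (?y, t)\<bar> \<le> sqrt (axis_dist2 x) * (C2 * (1 / ((- t) * l t)))"
        "\<bar>?y $ 2 * dx 3 (dx 3 (component u 1)) (?y, t)\<bar> \<le> sqrt (axis_dist2 x) * (C2 * (1 / ((- t) * l t)))" by blast+
      ultimately have "\<bar>dx 3 (dx 3 Gam) (?y, t)\<bar> \<le> 2 * (sqrt (axis_dist2 x) * (C2 * (1 / ((- t) * l t))))" by linarith
      then show ?thesis unfolding line dx_eq[symmetric] by (simp only: mult.assoc)
    qed
  qed
qed

text \<open>Here l is at least the diffusive length, the square root of -t. In the bootstrap the
  second derivatives are then measured by powers of -t alone.\<close>

lemma second_derivative_scale:
  assumes "-1 < t" "t < 0" "- t \<le> (l t)\<^sup>2"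
  shows "1 / ((- t) * l t) \<le> (- t) powr (-3/2)"
proof -
  have l: "0 < l t" using l_pos assms by simp
  have "(- t) powr (1/2) \<le> l t" using assms l by (simp add: powr_half_sqrt real_le_lsqrt)
  then have "(- t) powr 1 * (- t) powr (1/2) \<le> (- t) * l t" using assms by (simp add: mult_left_mono)
  then have "(- t) powr (3/2) \<le> (- t) * l t" unfolding powr_add[symmetric] by simp
  moreover have p: "(- t) powr (3/2) > 0" using assms by simp
  ultimately have "1 / ((- t) * l t) \<le> 1 / (- t) powr (3/2)" by (intro divide_left_mono mult_pos_pos) (use assms l in auto)
  then show ?thesis by (simp add: powr_minus_divide)
qed

text \<open>
  If \<open>2 |u\<^sub>r / r| \<le> \<kappa>\<close>, then multiples of \<open>\<mu>\<close> are barriers for \<open>\<Gamma> r\<^bsup>-5/3\<^esup>\<close> and \<open>H r\<^sup>-\<^sup>1\<close>; the surplus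
  \<open>\<sigma>\<close> in \<open>\<mu>' \<ge> \<kappa> \<mu> + \<sigma>\<close> absorbs the source term and the cutoff errors.
\<close>

lemma bootstrap:
  fixes \<kappa> \<mu> \<mu>' \<sigma> :: "real \<Rightarrow> real"
  assumes \<rho>: "0 < \<rho>" "\<rho> \<le> 1/512" and \<tau>: "0 < \<tau>" "\<tau> < 1"
    and rad: "\<And>x t. norm x \<le> 2 * \<rho> \<Longrightarrow> - \<tau> \<le> t \<Longrightarrow> t < 0 \<Longrightarrow> \<bar>Rad (x, t)\<bar> \<le> \<kappa> t / 2 * axis_dist2 x"
    and \<mu>: "\<And>t. - \<tau> \<le> t \<Longrightarrow> t < 0 \<Longrightarrow> 0 < \<mu> t" "\<And>t. - \<tau> \<le> t \<Longrightarrow> t < 0 \<Longrightarrow> (\<mu> has_real_derivative \<mu>' t) (at t)"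
    and \<sigma>: "\<And>t. - \<tau> \<le> t \<Longrightarrow> t < 0 \<Longrightarrow> 0 < \<sigma> t" "\<And>t. - \<tau> \<le> t \<Longrightarrow> t < 0 \<Longrightarrow> \<sigma> t \<le> \<mu>' t - \<kappa> t * \<mu> t"
      "\<And>t. - \<tau> \<le> t \<Longrightarrow> t < 0 \<Longrightarrow> (1 + \<mu> t)\<^sup>2 * (- t) powr (-3/4) \<le> N * \<sigma> t" and N: "N > 0"
    and gam: "\<And>x t. norm x \<le> 2 * \<rho> \<Longrightarrow> - \<tau> \<le> t \<Longrightarrow> t < 0 \<Longrightarrow> \<bar>Gam (x, t)\<bar> \<le> N * \<sigma> t * axis_dist2 x powr (5/6)"
    and hel: "\<And>x t. norm x \<le> 2 * \<rho> \<Longrightarrow> - \<tau> \<le> t \<Longrightarrow> t < 0 \<Longrightarrow> \<bar>Hel (x, t)\<bar> \<le> N * \<sigma> t * axis_dist2 x powr (1/2)"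
  obtains C \<tau>' where "0 < C" "0 < \<tau>'" "\<tau>' \<le> \<tau>"
    "\<And>x t. norm x \<le> \<rho> / 32 \<Longrightarrow> - \<tau>' \<le> t \<Longrightarrow> t < 0 \<Longrightarrow> \<bar>Gam (x, t)\<bar> \<le> C * \<mu> t * axis_dist2 x powr (5/6)"
    "\<And>x t. norm x \<le> \<rho> / 32 \<Longrightarrow> - \<tau>' \<le> t \<Longrightarrow> t < 0 \<Longrightarrow> \<bar>Hel (x, t)\<bar> \<le> C * \<mu> t * axis_dist2 x powr (1/2)"
    "\<And>x t k. norm x \<le> \<rho> / 32 \<Longrightarrow> - \<tau>' \<le> t \<Longrightarrow> t < 0 \<Longrightarrow> \<bar>swirl_free k (x, t)\<bar> \<le> C * (1 + \<mu> t)"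
proof -
  obtain K \<tau>1 where K: "K \<ge> 1" "0 < \<tau>1" "\<tau>1 < 1"
    and Gb: "\<And>x t. norm x \<le> 7/8 \<Longrightarrow> - \<tau>1 \<le> t \<Longrightarrow> t < 0 \<Longrightarrow> \<bar>Gam (x, t)\<bar> \<le> K / (- t) * axis_dist2 x"
    and Hb: "\<And>x t. norm x \<le> 7/8 \<Longrightarrow> - \<tau>1 \<le> t \<Longrightarrow> t < 0 \<Longrightarrow> \<bar>Hel (x, t)\<bar> \<le> K / ((- t) * l t) * axis_dist2 x"
    by (rule basic_bounds, rule that)
  obtain C \<tau>2 where C: "C \<ge> 1" "0 < \<tau>2" "\<tau>2 < 1"
    and ub: "\<And>x t. norm x \<le> 1/2 \<Longrightarrow> - \<tau>2 \<le> t \<Longrightarrow> t < 0 \<Longrightarrow> norm (u (x, t)) \<le> C * (- t) powr (-3/5)"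
    by (rule velocity_bound, rule that)
  obtain \<tau>3 where \<tau>3: "0 < \<tau>3" "\<tau>3 < 1" "\<And>t. - \<tau>3 \<le> t \<Longrightarrow> t < 0 \<Longrightarrow> 0 < l t \<and> l t \<le> 1 \<and> - t \<le> 1 * (l t)\<^sup>2"
    by (rule small_scales[of 1], simp, blast)
  \<comment> \<open>The pass for \<open>Hel\<close> works on radius 2 r = \<rho>/4, inside which the
    estimates for \<open>Gam\<close> and \<open>dx 3 Gam\<close> of the first pass are
    available.\<close>
  define r where "r = \<rho> / 8"
  have r: "0 < r" "r \<le> \<rho>" "r \<le> 1/4" using \<rho> by (auto simp: r_def)
  \<comment> \<open>The entry (\<rho>/4)^(4/3) bounds (-t)^(3/4), and with it the length of the
    interpolation in z, by \<rho>/4. The last entry is the condition on the moving cutoff for the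
    smaller radius r.\<close>
  define ta where "ta = - min (min (min \<tau> \<tau>1) (min \<tau>2 \<tau>3)) (min ((\<rho> / 4) powr (4/3)) ((3 * r\<^sup>2 / (5 * C)) powr (5/2)))"
  have ta: "ta < 0" "-1 < ta" "- \<tau> \<le> ta" "- \<tau>1 \<le> ta" "- \<tau>2 \<le> ta" "- \<tau>3 \<le> ta" "- ta \<le> (\<rho> / 4) powr (4/3)"
    using \<tau> K C \<tau>3 \<rho> r by (auto simp: ta_def)
  have taC: "5 * C * (- ta) powr (2/5) \<le> 3 * r\<^sup>2"
  proof -
    have "(- ta) powr (2/5) \<le> ((3 * r\<^sup>2 / (5 * C)) powr (5/2)) powr (2/5)" using ta(1) by (intro powr_mono2) (auto simp: ta_def)
    also have "\<dots> = 3 * r\<^sup>2 / (5 * C)" using C r by (simp add: powr_powr)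
    finally have "5 * C * (- ta) powr (2/5) \<le> 5 * C * (3 * r\<^sup>2 / (5 * C))" using C by (intro mult_left_mono) auto
    then show ?thesis using C by simp
  qed
  have "r\<^sup>2 \<le> \<rho>\<^sup>2" using r by (intro power_mono) auto
  then have taC': "5 * C * (- ta) powr (2/5) \<le> 3 * \<rho>\<^sup>2" using taC by linarith
  have hs: "(- t) powr (3/4) \<le> \<rho> / 4" if "ta \<le> t" "t < 0" for t
  proof -
    have "(- t) powr (3/4) \<le> ((\<rho> / 4) powr (4/3)) powr (3/4)" using that ta by (intro powr_mono2) auto
    then show ?thesis using \<rho> by (simp add: powr_powr)
  qed
  \<comment> \<open>The first summand absorbs the cutoff error 44 N \<sigma>, the second the initial
    value.\<close>
  define A where "A = 45 * N + N * \<sigma> ta / \<mu> ta"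
  have ip: "\<mu> ta > 0" "\<sigma> ta > 0" using \<mu>(1) \<sigma>(1) ta by auto
  have A: "A > 0" "44 * N \<le> A" "N * \<sigma> ta \<le> A * \<mu> ta"
    using N ip by (auto simp: A_def field_simps intro: add_pos_pos)
  define G where "G = 2 / \<rho> ^ 4 * A"
  have G: "G > 0" using A \<rho> by (simp add: G_def)
  have pw: "q * axis_dist2 x powr b * axis_dist2 x powr (- b) = q" if "axis_dist2 x > 0" for x q b
    using that by (simp add: mult.assoc powr_add[symmetric])
  have pwle: "Y * axis_dist2 x powr (- b) \<le> q" if "axis_dist2 x > 0" "Y \<le> q * axis_dist2 x powr b" for Y x q b
    using mult_right_mono[OF that(2), of "axis_dist2 x powr (- b)"] pw[OF that(1), of q b] by simp
  have lepw: "Y \<le> q * axis_dist2 x powr b" if "axis_dist2 x > 0" "Y * axis_dist2 x powr (- b) \<le> q" for Y x q b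
    using mult_right_mono[OF that(2), of "axis_dist2 x powr b"] pw[OF that(1), of Y "- b"] unfolding minus_minus by simp
  have Gam0: "\<bar>Gam (x, s)\<bar> \<le> G * \<mu> s * axis_dist2 x powr (5/6)" if x: "norm x \<le> \<rho> / 2" and s: "ta < s" "s < 0" for x s
  proof (cases "axis_dist2 x > 0")
    case False then show ?thesis using \<mu>(1)[of s] s ta G by (simp add: Gam_axis)
  next
    case True
    \<comment> \<open>The exponent 5/3 is dictated by the pass for \<open>Hel\<close>: if Gamma has
      order r^\<alpha>, interpolation gives its z-derivative order r^((\<alpha> + 1) / 2), and the
      source, their product over r^2, has order r exactly for \<alpha> = 5/3. The weight costs 5/3
      |u_r / r|, which is below \<kappa>.\<close>
    have "\<bar>Gam (x, s)\<bar> * axis_dist2 x powr (- (5/3) / 2) \<le> 2 / \<rho> ^ 4 * (A * \<mu> s)"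
    proof (rule max_principle_abs[where X=Gam and R="\<lambda>z. 0" and b=0 and \<kappa>=\<kappa> and M="\<lambda>t. A * \<mu> t" and M'="\<lambda>t. A * \<mu>' t" and C=C and ta=ta and tb=s and B="K / (- s)"])
      show "smooth_on Q Gam" by (rule smooth_Gam)
      fix t assume t: "ta \<le> t" "t \<le> s"
      then have t': "t < 0" "-1 < t" "- \<tau> \<le> t" "- \<tau>1 \<le> t" using s ta by auto
      show "0 < A * \<mu> t" using A \<mu>(1)[OF t'(3,1)] by simp
      show "((\<lambda>t. A * \<mu> t) has_real_derivative A * \<mu>' t) (at t)" by (rule DERIV_cmult[OF \<mu>(2)[OF t'(3,1)]])
      have "A * \<sigma> t \<le> A * (\<mu>' t - \<kappa> t * \<mu> t)" using A \<sigma>(2)[OF t'(3,1)] by (intro mult_left_mono) auto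
      then have As: "A * \<sigma> t \<le> A * \<mu>' t - \<kappa> t * (A * \<mu> t)" by (simp add: algebra_simps)
      moreover have sp: "0 < \<sigma> t" by (rule \<sigma>(1)[OF t'(3,1)])
      moreover have "0 < A * \<sigma> t" using A sp by simp
      ultimately show "0 < A * \<mu>' t - \<kappa> t * (A * \<mu> t)" by linarith
      fix y assume y: "norm (y::real^3) \<le> 2 * \<rho>"
      then have y1: "norm y < 1" "norm y \<le> 7/8" using \<rho> by auto
      show "\<bar>Gam (y, t)\<bar> \<le> K / (- s) * axis_dist2 y"
      proof -
        have "K / (- t) * axis_dist2 y \<le> K / (- s) * axis_dist2 y" using t s K by (intro mult_right_mono divide_left_mono) (auto simp: mult_neg_neg)
        then show ?thesis using Gb[OF y1(2) t'(4,1)] by linarith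
      qed
      assume yr: "axis_dist2 y > 0"
      show "dt Gam (y, t) + u (y, t) \<bullet> grad Gam (y, t) = laplacian Gam (y, t)
        - 2 / axis_dist2 y * radial_part y (grad Gam (y, t)) + 0 * (radial_part y (u (y, t)) / axis_dist2 y) * Gam (y, t) + 0"
        using Gam_pde[OF y1(1) t'(2,1) yr] by simp
      have "\<bar>Rad (y, t) / axis_dist2 y\<bar> \<le> \<kappa> t / 2"
        using rad[OF y t'(3,1)] yr by (simp add: abs_divide pos_divide_le_eq)
      moreover have "\<bar>0 - 5/3\<bar> * a \<le> k" if "a \<le> k / 2" "0 \<le> a" for a k :: real using that by simp
      ultimately show "\<bar>0 - 5/3\<bar> * \<bar>Rad (y, t) / axis_dist2 y\<bar> \<le> \<kappa> t" by (metis abs_ge_zero)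
      have "\<bar>Gam (y, t)\<bar> * axis_dist2 y powr (- (5/6)) \<le> N * \<sigma> t" by (rule pwle[OF yr gam[OF y t'(3,1)]])
      moreover have "44 * N * \<sigma> t \<le> A * \<sigma> t" using A sp by (intro mult_right_mono) auto
      ultimately show "(44 * \<bar>Gam (y, t)\<bar> + \<bar>0\<bar>) * axis_dist2 y powr (- (5/3) / 2) \<le> A * \<mu>' t - \<kappa> t * (A * \<mu> t)"
        using As by simp
    next
      fix y assume y: "norm (y::real^3) \<le> 2 * \<rho>" "axis_dist2 y > 0"
      have "\<bar>Gam (y, ta)\<bar> * axis_dist2 y powr (- (5/6)) \<le> N * \<sigma> ta" by (rule pwle[OF y(2) gam[OF y(1) ta(3,1)]])
      then show "\<bar>Gam (y, ta)\<bar> * axis_dist2 y powr (- (5/3) / 2) \<le> A * \<mu> ta" using A by simp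
    qed (use \<rho> ta taC' s C x True ub in auto)
    then have "\<bar>Gam (x, s)\<bar> * axis_dist2 x powr (- (5/6)) \<le> G * \<mu> s" by (simp add: G_def)
    then show ?thesis by (rule lepw[OF True])
  qed
  \<comment> \<open>The maximum principle needs a time interval of positive length, so the initial
    time is added separately.\<close>
  have Gam1: "\<bar>Gam (x, s)\<bar> \<le> G * \<mu> s * axis_dist2 x powr (5/6)" if x: "norm x \<le> \<rho> / 2" and s: "ta \<le> s" "s < 0" for x s
  proof (cases "s = ta")
    case True
    have "1 * A \<le> 2 / \<rho> ^ 4 * A" using A \<rho> power_le_one[of \<rho> 4] by (intro mult_right_mono) (auto simp: pos_le_divide_eq)
    then have "A * \<mu> ta \<le> G * \<mu> ta" using ip unfolding G_def by (intro mult_right_mono) auto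
    then have "N * \<sigma> ta * axis_dist2 x powr (5/6) \<le> G * \<mu> ta * axis_dist2 x powr (5/6)" using A(3) by (intro mult_right_mono) auto
    then show ?thesis using gam[of x ta] x ta \<rho> True by simp
  qed (use Gam0 x s in auto)
  have dGam: "\<bar>dx 3 Gam (x, s)\<bar> \<le> 2 * (G + C2) * (1 + \<mu> s) * (- s) powr (-3/4) * axis_dist2 x powr (2/3)"
    if x: "norm x \<le> \<rho> / 4" "axis_dist2 x > 0" and s: "ta \<le> s" "s < 0" for x s
  proof -
    \<comment> \<open>In terms of r the length is r^(1/3) (-s)^(3/4). It balances r^(5/3) / h
      against r (-s)^(-3/2) h: both become r^(4/3) (-s)^(-3/4).\<close>
    define h where "h = axis_dist2 x powr (1/6) * (- s) powr (3/4)"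
    have h: "h > 0" using x s by (simp add: h_def)
    have "axis_dist2 x powr (1/6) \<le> 1 powr (1/6)" using axis_dist2_le_one[of x] x \<rho> by (intro powr_mono2) auto
    then have "h \<le> 1 * (\<rho> / 4)" unfolding h_def using hs[of s] s by (intro mult_mono) auto
    then have xh: "norm x + h \<le> \<rho> / 2" using x by simp
    have t1: "-1 < s" using ta s by simp
    have \<mu>s: "\<mu> s > 0" using \<mu>(1) ta s by simp
    have "\<bar>dx 3 Gam (x, s)\<bar> \<le> 2 * (G * \<mu> s * axis_dist2 x powr (5/6)) / h + 2 * sqrt (axis_dist2 x) * (C2 * (1 / ((- s) * l s))) * h"
    proof (rule dx3_Gam_interpolation[OF x(2) h _ t1 s(2)])
      show "norm x + h < 1" using xh \<rho> by simp
      show "\<bar>Gam (y, s)\<bar> \<le> G * \<mu> s * axis_dist2 x powr (5/6)" if "norm y \<le> norm x + h" "axis_dist2 y = axis_dist2 x" for y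
        using Gam1[of y s] that xh s by simp
    qed
    also have "\<dots> \<le> 2 * (G * \<mu> s * axis_dist2 x powr (5/6)) / h + 2 * sqrt (axis_dist2 x) * (C2 * (- s) powr (-3/2)) * h"
      using second_derivative_scale[OF t1 s(2)] \<tau>3(3)[of s] s ta C2 h by (intro add_left_mono mult_right_mono mult_left_mono) auto
    also have "2 * (G * \<mu> s * axis_dist2 x powr (5/6)) / h = 2 * G * \<mu> s * (axis_dist2 x powr (5/6) / axis_dist2 x powr (1/6)) / (- s) powr (3/4)"
      by (simp add: h_def)
    also have "\<dots> = 2 * G * \<mu> s * (- s) powr (-3/4) * axis_dist2 x powr (2/3)"
      unfolding powr_diff[symmetric] by (simp add: powr_minus_divide)
    also have "2 * sqrt (axis_dist2 x) * (C2 * (- s) powr (-3/2)) * h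
       = 2 * C2 * ((- s) powr (-3/2) * (- s) powr (3/4)) * (axis_dist2 x powr (1/2) * axis_dist2 x powr (1/6))"
      using x by (simp add: h_def powr_half_sqrt mult_ac)
    also have "\<dots> = 2 * C2 * (- s) powr (-3/4) * axis_dist2 x powr (2/3)"
      unfolding powr_add[symmetric] by simp
    also have "2 * G * \<mu> s * (- s) powr (-3/4) * axis_dist2 x powr (2/3) + 2 * C2 * (- s) powr (-3/4) * axis_dist2 x powr (2/3)
       = (2 * G * \<mu> s + 2 * C2) * ((- s) powr (-3/4) * axis_dist2 x powr (2/3))" by (simp add: algebra_simps)
    also have "\<dots> \<le> (2 * (G + C2) * (1 + \<mu> s)) * ((- s) powr (-3/4) * axis_dist2 x powr (2/3))"
    proof (rule mult_right_mono)
      have "0 \<le> C2 * \<mu> s" using C2 \<mu>s by simp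
      then show "2 * G * \<mu> s + 2 * C2 \<le> 2 * (G + C2) * (1 + \<mu> s)" using G by (simp add: algebra_simps)
    qed simp
    finally show ?thesis by (simp only: mult.assoc)
  qed
  \<comment> \<open>In order of the summands: cutoff error, source, initial value.\<close>
  define A2 where "A2 = 44 * N + 4 * G * (G + C2) * N + N * \<sigma> ta / \<mu> ta"
  have "0 < 4 * G * (G + C2) * N" "0 < N * \<sigma> ta / \<mu> ta" using G C2 N ip by auto
  then have A2: "A2 > 0" "44 * N + 4 * G * (G + C2) * N \<le> A2" "N * \<sigma> ta / \<mu> ta \<le> A2" using N unfolding A2_def by linarith+
  have A2i: "N * \<sigma> ta \<le> A2 * \<mu> ta" using A2(3) ip by (simp add: pos_divide_le_eq)
  define H where "H = 2 / r ^ 4 * A2"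
  have H: "H > 0" using A2 r by (simp add: H_def)
  have Hel1: "\<bar>Hel (x, s)\<bar> \<le> H * \<mu> s * axis_dist2 x powr (1/2)" if x: "norm x \<le> r / 2" and s: "ta < s" "s < 0" for x s
  proof (cases "axis_dist2 x > 0")
    case False then show ?thesis using \<mu>(1)[of s] s ta H by (simp add: Gam_axis)
  next
    case True
    \<comment> \<open>The weight exponent 1 is the one that bounds the curl Hel / r of the part
      without swirl. The stretching factor becomes 2 - 1 = 1.\<close>
    have "\<bar>Hel (x, s)\<bar> * axis_dist2 x powr (- 1 / 2) \<le> 2 / r ^ 4 * (A2 * \<mu> s)"
    proof (rule max_principle_abs[where X=Hel and R="\<lambda>z. 2 * Gam z * dx 3 Gam z / axis_dist2 (fst z)" and b=2 and \<kappa>=\<kappa>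
          and M="\<lambda>t. A2 * \<mu> t" and M'="\<lambda>t. A2 * \<mu>' t" and C=C and ta=ta and tb=s and B="K / ((- s) * l s)"])
      show "smooth_on Q Hel" by (rule smooth_Hel)
      fix t assume t: "ta \<le> t" "t \<le> s"
      then have t': "t < 0" "-1 < t" "- \<tau> \<le> t" "- \<tau>1 \<le> t" using s ta by auto
      have \<mu>t: "\<mu> t > 0" by (rule \<mu>(1)[OF t'(3,1)])
      then show "0 < A2 * \<mu> t" using A2 by simp
      show "((\<lambda>t. A2 * \<mu> t) has_real_derivative A2 * \<mu>' t) (at t)" by (rule DERIV_cmult[OF \<mu>(2)[OF t'(3,1)]])
      have "A2 * \<sigma> t \<le> A2 * (\<mu>' t - \<kappa> t * \<mu> t)" using A2 \<sigma>(2)[OF t'(3,1)] by (intro mult_left_mono) auto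
      then have As: "A2 * \<sigma> t \<le> A2 * \<mu>' t - \<kappa> t * (A2 * \<mu> t)" by (simp add: algebra_simps)
      moreover have sp: "0 < \<sigma> t" by (rule \<sigma>(1)[OF t'(3,1)])
      moreover have "0 < A2 * \<sigma> t" using A2 sp by simp
      ultimately show "0 < A2 * \<mu>' t - \<kappa> t * (A2 * \<mu> t)" by linarith
      fix y assume y: "norm (y::real^3) \<le> 2 * r"
      then have y1: "norm y < 1" "norm y \<le> 7/8" "norm y \<le> 2 * \<rho>" "norm y \<le> \<rho> / 4" "norm y \<le> \<rho> / 2" using \<rho> by (auto simp: r_def)
      show "\<bar>Hel (y, t)\<bar> \<le> K / ((- s) * l s) * axis_dist2 y"
      proof -
        have ls: "l s \<le> l t" "0 < l t" "0 < l s" using l_anti[of t s] l_pos[of t] l_pos[of s] t t' s by auto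
        have "(- s) * l s \<le> (- t) * l t" using t s ls by (intro mult_mono) auto
        moreover have "0 < (- t) * l t" "0 < (- s) * l s" by (rule mult_pos_pos; use t' ls s in simp)+
        ultimately have "K / ((- t) * l t) \<le> K / ((- s) * l s)" using K by (intro divide_left_mono mult_pos_pos[of "(- t) * l t" "(- s) * l s"]) linarith+
        then have "K / ((- t) * l t) * axis_dist2 y \<le> K / ((- s) * l s) * axis_dist2 y" by (intro mult_right_mono) auto
        then show ?thesis using Hb[OF y1(2) t'(4,1)] by linarith
      qed
      assume yr: "axis_dist2 y > 0"
      show "dt Hel (y, t) + u (y, t) \<bullet> grad Hel (y, t) = laplacian Hel (y, t)
        - 2 / axis_dist2 y * radial_part y (grad Hel (y, t)) + 2 * (radial_part y (u (y, t)) / axis_dist2 y) * Hel (y, t)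
        + 2 * Gam (y, t) * dx 3 Gam (y, t) / axis_dist2 (fst (y, t))"
        using Hel_pde[OF y1(1) t'(2,1) yr] by simp
      have "\<bar>Rad (y, t) / axis_dist2 y\<bar> \<le> \<kappa> t / 2"
        using rad[OF y1(3) t'(3,1)] yr by (simp add: abs_divide pos_divide_le_eq)
      moreover have "\<bar>2 - 1\<bar> * a \<le> k" if "a \<le> k / 2" "0 \<le> a" for a k :: real using that by simp
      ultimately show "\<bar>2 - 1\<bar> * \<bar>Rad (y, t) / axis_dist2 y\<bar> \<le> \<kappa> t" by (metis abs_ge_zero)
      have src: "\<bar>2 * Gam (y, t) * dx 3 Gam (y, t) / axis_dist2 y\<bar> * axis_dist2 y powr (- (1/2)) \<le> 4 * G * (G + C2) * N * \<sigma> t"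
      proof (rule pwle[OF yr])
        let ?T = "(- t) powr (-3/4)"
        have "\<bar>Gam (y, t)\<bar> * \<bar>dx 3 Gam (y, t)\<bar> \<le> (G * \<mu> t * axis_dist2 y powr (5/6)) * (2 * (G + C2) * (1 + \<mu> t) * ?T * axis_dist2 y powr (2/3))"
          using Gam1[OF y1(5) t(1) t'(1)] dGam[OF y1(4) yr t(1) t'(1)] by (intro mult_mono) auto
        also have "\<dots> = 2 * G * (G + C2) * (\<mu> t * (1 + \<mu> t)) * ?T * (axis_dist2 y powr (5/6) * axis_dist2 y powr (2/3))"
          by (simp add: mult_ac)
        also have "axis_dist2 y powr (5/6) * axis_dist2 y powr (2/3) = axis_dist2 y powr (1/2) * axis_dist2 y powr 1"
          unfolding powr_add[symmetric] by simp
        also have "\<dots> = axis_dist2 y powr (1/2) * axis_dist2 y" using yr by simp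
        also have "2 * G * (G + C2) * (\<mu> t * (1 + \<mu> t)) * ?T * (axis_dist2 y powr (1/2) * axis_dist2 y)
           \<le> 2 * G * (G + C2) * (1 + \<mu> t)\<^sup>2 * ?T * (axis_dist2 y powr (1/2) * axis_dist2 y)"
          using G C2 \<mu>t by (intro mult_right_mono mult_left_mono) (auto simp: power2_eq_square)
        also have "\<dots> = 2 * G * (G + C2) * ((1 + \<mu> t)\<^sup>2 * ?T) * (axis_dist2 y powr (1/2) * axis_dist2 y)" by (simp only: mult.assoc)
        also have "\<dots> \<le> 2 * G * (G + C2) * (N * \<sigma> t) * (axis_dist2 y powr (1/2) * axis_dist2 y)"
          using G C2 \<sigma>(3)[OF t'(3,1)] by (intro mult_right_mono mult_left_mono) auto
        finally have "\<bar>Gam (y, t)\<bar> * \<bar>dx 3 Gam (y, t)\<bar> \<le> (2 * G * (G + C2) * (N * \<sigma> t) * axis_dist2 y powr (1/2)) * axis_dist2 y"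
          by (simp only: mult.assoc)
        then have "\<bar>Gam (y, t)\<bar> * \<bar>dx 3 Gam (y, t)\<bar> / axis_dist2 y \<le> 2 * G * (G + C2) * (N * \<sigma> t) * axis_dist2 y powr (1/2)"
          by (subst pos_divide_le_eq[OF yr])
        moreover have "\<bar>2 * a * b / w\<bar> \<le> 4 * G * (G + C2) * N * \<sigma> t * q"
          if "\<bar>a\<bar> * \<bar>b\<bar> / w \<le> 2 * G * (G + C2) * (N * \<sigma> t) * q" "w > 0" for a b w q
          using that by (simp add: abs_mult mult.assoc)
        ultimately show "\<bar>2 * Gam (y, t) * dx 3 Gam (y, t) / axis_dist2 y\<bar> \<le> 4 * G * (G + C2) * N * \<sigma> t * axis_dist2 y powr (1/2)" using yr by blast
      qed
      have "\<bar>Hel (y, t)\<bar> * axis_dist2 y powr (- (1/2)) \<le> N * \<sigma> t" by (rule pwle[OF yr hel[OF y1(3) t'(3,1)]])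
      moreover have "(44 * N + 4 * G * (G + C2) * N) * \<sigma> t \<le> A2 * \<sigma> t" using A2 sp by (intro mult_right_mono) auto
      moreover have "(44 * h + q) * w \<le> m" if "h * w \<le> N * \<sigma> t" "q * w \<le> 4 * G * (G + C2) * N * \<sigma> t"
        "(44 * N + 4 * G * (G + C2) * N) * \<sigma> t \<le> A2 * \<sigma> t" "A2 * \<sigma> t \<le> m" for h q w m
        using that by (simp add: distrib_right)
      ultimately show "(44 * \<bar>Hel (y, t)\<bar> + \<bar>2 * Gam (y, t) * dx 3 Gam (y, t) / axis_dist2 (fst (y, t))\<bar>) * axis_dist2 y powr (- 1 / 2)
          \<le> A2 * \<mu>' t - \<kappa> t * (A2 * \<mu> t)"
        using src As unfolding fst_conv minus_divide_left[symmetric] by blast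
    next
      fix y assume y: "norm (y::real^3) \<le> 2 * r" "axis_dist2 y > 0"
      have "\<bar>Hel (y, ta)\<bar> * axis_dist2 y powr (- (1/2)) \<le> N * \<sigma> ta" by (rule pwle[OF y(2) hel[OF _ ta(3,1)]]) (use y r in simp)
      then show "\<bar>Hel (y, ta)\<bar> * axis_dist2 y powr (- 1 / 2) \<le> A2 * \<mu> ta" using A2i by simp
    qed (use r ta taC s C x True ub in auto)
    then have "\<bar>Hel (x, s)\<bar> * axis_dist2 x powr (- (1/2)) \<le> H * \<mu> s" by (simp add: H_def)
    then show ?thesis by (rule lepw[OF True])
  qed
  define \<beta> where "\<beta> = bump_mass"
  have \<beta>: "\<beta> > 0" using bump_mass_pos by (simp add: \<beta>_def)
  define s where "s = \<rho> / 64"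
  have s: "s > 0" using \<rho> by (simp add: s_def)
  define V where "V = (24 * H * s + (4 + E / 2) * s powr (-3/2)) / \<beta>"
  have V: "V \<ge> 0" using H s E \<beta> by (simp add: V_def)
  show ?thesis
  proof (rule that[of "G + H + V" "- ta / 2"])
    show "0 < G + H + V" "0 < - ta / 2" "- ta / 2 \<le> \<tau>" using G H V ta by auto
    fix x t assume x: "norm (x::real^3) \<le> \<rho> / 32" and t: "- (- ta / 2) \<le> t" "t < 0"
    have t': "ta < t" "-1 < t" using t ta by auto
    have \<mu>t: "\<mu> t > 0" using \<mu>(1)[of t] t' t ta by simp
    have up: "c * \<mu> t * w \<le> (G + H + V) * \<mu> t * w" if "c \<le> G + H + V" "w \<ge> 0" for c w
      using that \<mu>t by (intro mult_right_mono) auto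
    show "\<bar>Gam (x, t)\<bar> \<le> (G + H + V) * \<mu> t * axis_dist2 x powr (5/6)"
      by (rule order_trans[OF Gam0[OF _ t'(1) t(2)] up]) (use x \<rho> H V in auto)
    show "\<bar>Hel (x, t)\<bar> \<le> (G + H + V) * \<mu> t * axis_dist2 x powr (1/2)"
      by (rule order_trans[OF Hel1[OF _ t'(1) t(2)] up]) (use x \<rho> G V in \<open>auto simp: r_def\<close>)
    show "\<bar>swirl_free k (x, t)\<bar> \<le> (G + H + V) * (1 + \<mu> t)" for k
    proof -
      have near: "norm y \<le> \<rho> / 16" if "y \<in> ball x (2 * s)" for y
        using norm_triangle_ineq[of x "y - x"] that x by (simp add: s_def dist_norm norm_minus_commute)
      have "\<beta> * \<bar>swirl_free k (x, t)\<bar> \<le> 24 * (H * \<mu> t) * s + (4 + E / 2) * s powr (-3/2)"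
        unfolding \<beta>_def
      proof (rule swirl_free_L2_bound[OF _ s t'(2) t(2)])
        show "ball x (2 * s) \<subseteq> ball 0 1" using near \<rho> by force
        show "\<bar>Hel (y, t)\<bar> \<le> H * \<mu> t * sqrt (axis_dist2 y)" if "y \<in> ball x (2 * s)" for y
          using Hel1[OF _ t'(1) t(2), of y] near[OF that] by (simp add: r_def powr_half_sqrt)
      qed
      also have "\<dots> \<le> (24 * H * s + (4 + E / 2) * s powr (-3/2)) * (1 + \<mu> t)"
      proof -
        have "24 * (H * m) * s + p \<le> (24 * H * s + p) * (1 + m)" if "0 \<le> H * s" "0 \<le> p * m" for m p
          using that by (simp add: algebra_simps)
        then show ?thesis using H s E \<mu>t by simp
      qed
      finally have "\<bar>swirl_free k (x, t)\<bar> \<le> V * (1 + \<mu> t)" using \<beta> by (simp add: V_def pos_le_divide_eq mult.commute)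
      also have "\<dots> \<le> (G + H + V) * (1 + \<mu> t)" using G H \<mu>t by (intro mult_right_mono) auto
      finally show ?thesis .
    qed
  qed
qed

text \<open>\<open>Rad_small\<close> with constant 1/48 gives \<kappa> = 1 / (24 (-t)). Since 1/24 <
  1/16, the power (-t)^(-1/16) grows fast enough to be a barrier, and the difference 1/48 is its
  surplus \<sigma>. This surplus has order (-t)^(-17/16) and dominates the a priori bounds of order
  1 / (-t), which therefore can serve as input.\<close>

lemma first_velocity_bound:
  obtains C \<tau> where "0 < C" "0 < \<tau>" "\<tau> < 1"
    "\<And>x t. norm x \<le> 1/16384 \<Longrightarrow> - \<tau> \<le> t \<Longrightarrow> t < 0 \<Longrightarrow> \<bar>Gam (x, t)\<bar> \<le> C * (- t) powr (-1/16) * axis_dist2 x powr (5/6)"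
    "\<And>x t. norm x \<le> 1/16384 \<Longrightarrow> - \<tau> \<le> t \<Longrightarrow> t < 0 \<Longrightarrow> \<bar>Hel (x, t)\<bar> \<le> C * (- t) powr (-1/16) * axis_dist2 x powr (1/2)"
    "\<And>x t k. norm x \<le> 1/16384 \<Longrightarrow> - \<tau> \<le> t \<Longrightarrow> t < 0 \<Longrightarrow> \<bar>swirl_free k (x, t)\<bar> \<le> 2 * C * (- t) powr (-1/16)"
proof -
  obtain K \<tau>1 where K: "K \<ge> 1" "0 < \<tau>1" "\<tau>1 < 1"
    and grad: "\<And>x t i k. norm x \<le> 7/8 \<Longrightarrow> - \<tau>1 \<le> t \<Longrightarrow> t < 0 \<Longrightarrow> \<bar>dx i (component u k) (x, t)\<bar> \<le> K / (- t)"
    and Gb: "\<And>x t. norm x \<le> 7/8 \<Longrightarrow> - \<tau>1 \<le> t \<Longrightarrow> t < 0 \<Longrightarrow> \<bar>Gam (x, t)\<bar> \<le> K / (- t) * axis_dist2 x"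
    by (rule basic_bounds, rule that)
  obtain \<tau>2 where \<tau>2: "0 < \<tau>2" "\<tau>2 < 1" "\<And>x t. norm x \<le> 1/256 \<Longrightarrow> - \<tau>2 \<le> t \<Longrightarrow> t < 0 \<Longrightarrow> \<bar>Rad (x, t)\<bar> \<le> 1/48 / (- t) * axis_dist2 x"
    by (rule Rad_small[of "1/48"], simp, rule that)
  define \<tau> where "\<tau> = min \<tau>1 \<tau>2"
  have \<tau>: "0 < \<tau>" "\<tau> < 1" "\<tau> \<le> \<tau>1" "\<tau> \<le> \<tau>2" using K \<tau>2 by (auto simp: \<tau>_def)
  define \<kappa> :: "real \<Rightarrow> real" where "\<kappa> t = 1 / (24 * (- t))" for t
  define \<mu> :: "real \<Rightarrow> real" where "\<mu> t = (- t) powr (-1/16)" for t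
  define \<mu>' :: "real \<Rightarrow> real" where "\<mu>' t = 1/16 * (- t) powr (-17/16)" for t
  define \<sigma> :: "real \<Rightarrow> real" where "\<sigma> t = 1/48 * (- t) powr (-17/16)" for t
  have inv: "1 / (- t) = (- t) powr (-1)" if "t < 0" for t :: real using powr_neg_one[of "- t"] that by simp
  have lowest: "(- t) powr a \<le> (- t) powr b" if "b \<le> a" "- \<tau> \<le> t" "t < 0" for t a b :: real
    using that \<tau> by (intro powr_mono') auto
  have main: "K / (- t) \<le> 48 * K * \<sigma> t" if t: "- \<tau> \<le> t" "t < 0" for t
  proof -
    have "K * (1 / (- t)) \<le> K * (- t) powr (-17/16)" unfolding inv[OF t(2)] using lowest[of "-17/16" "-1" t] t K by (intro mult_left_mono) auto
    then show ?thesis by (simp add: \<sigma>_def)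
  qed
  have \<mu>1: "1 \<le> \<mu> t" if t: "- \<tau> \<le> t" "t < 0" for t
    using lowest[of "-1/16" 0 t] t by (simp add: \<mu>_def)
  \<comment> \<open>In N = 192 + 192 K the factor 48 inverts the constant of \<sigma>. One 4 comes
    from (1 + \<mu>)^2 \<le> 4 \<mu>^2, the other from the a priori bound 4 K / (-t) on
    \<open>Hel\<close>.\<close>
  obtain C \<tau>' where C: "0 < C" "0 < \<tau>'" "\<tau>' \<le> \<tau>"
    and b: "\<And>x t. norm x \<le> 1/512 / 32 \<Longrightarrow> - \<tau>' \<le> t \<Longrightarrow> t < 0 \<Longrightarrow> \<bar>Gam (x, t)\<bar> \<le> C * \<mu> t * axis_dist2 x powr (5/6)"
      "\<And>x t. norm x \<le> 1/512 / 32 \<Longrightarrow> - \<tau>' \<le> t \<Longrightarrow> t < 0 \<Longrightarrow> \<bar>Hel (x, t)\<bar> \<le> C * \<mu> t * axis_dist2 x powr (1/2)"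
      "\<And>x t k. norm x \<le> 1/512 / 32 \<Longrightarrow> - \<tau>' \<le> t \<Longrightarrow> t < 0 \<Longrightarrow> \<bar>swirl_free k (x, t)\<bar> \<le> C * (1 + \<mu> t)"
  proof (rule bootstrap[where \<rho>="1/512" and \<tau>=\<tau> and \<kappa>=\<kappa> and \<mu>=\<mu> and \<mu>'=\<mu>' and \<sigma>=\<sigma> and N="192 + 192 * K"])
    fix x :: "real^3" and t :: real assume t: "- \<tau> \<le> t" "t < 0"
    show "0 < \<mu> t" "0 < \<sigma> t" using t by (simp_all add: \<mu>_def \<sigma>_def)
    have sp: "0 < \<sigma> t" using t by (simp add: \<sigma>_def)
    show "(\<mu> has_real_derivative \<mu>' t) (at t)"
      unfolding \<mu>_def \<mu>'_def using neg_powr_deriv[OF t(2), of "-1/16"] by simp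
    have "\<kappa> t * \<mu> t = 1/24 * (1 / (- t) * (- t) powr (-1/16))" by (simp add: \<kappa>_def \<mu>_def)
    also have "\<dots> = 1/24 * (- t) powr (-17/16)" unfolding inv[OF t(2)] powr_add[symmetric] by simp
    finally show "\<sigma> t \<le> \<mu>' t - \<kappa> t * \<mu> t" by (simp add: \<sigma>_def \<mu>'_def)
    have "(1 + \<mu> t)\<^sup>2 \<le> (2 * \<mu> t)\<^sup>2" using \<mu>1[OF t] by (intro power_mono) auto
    then have "(1 + \<mu> t)\<^sup>2 * (- t) powr (-3/4) \<le> (2 * \<mu> t)\<^sup>2 * (- t) powr (-3/4)" by (rule mult_right_mono) simp
    also have "\<dots> = 4 * ((- t) powr (-1/16) * (- t) powr (-1/16) * (- t) powr (-3/4))" by (simp add: \<mu>_def power2_eq_square)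
    also have "\<dots> = 4 * (- t) powr (-7/8)" unfolding powr_add[symmetric] by simp
    also have "\<dots> \<le> 192 * \<sigma> t" using lowest[of "-17/16" "-7/8" t] t by (simp add: \<sigma>_def)
    also have "\<dots> \<le> (192 + 192 * K) * \<sigma> t" using K sp by (intro mult_right_mono) auto
    finally show "(1 + \<mu> t)\<^sup>2 * (- t) powr (-3/4) \<le> (192 + 192 * K) * \<sigma> t" .
    assume x: "norm x \<le> 2 * (1/512)"
    have x7: "norm x \<le> 7/8" using x by simp
    have t1: "- \<tau>1 \<le> t" using t \<tau> by simp
    show "\<bar>Rad (x, t)\<bar> \<le> \<kappa> t / 2 * axis_dist2 x"
      using \<tau>2(3)[of x t] x t \<tau> by (simp add: \<kappa>_def)
    have Kt: "0 \<le> K / (- t)" by (rule divide_nonneg_pos) (use K t in auto)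
    have "axis_dist2 x powr 1 \<le> axis_dist2 x powr (5/6)" using axis_dist2_le_one[of x] x by (intro powr_mono') auto
    then have R: "axis_dist2 x \<le> axis_dist2 x powr (5/6)" by simp
    have "\<bar>Gam (x, t)\<bar> \<le> K / (- t) * axis_dist2 x" by (rule Gb[OF x7 t1 t(2)])
    also have "\<dots> \<le> (192 + 192 * K) * \<sigma> t * axis_dist2 x powr (5/6)"
    proof (rule mult_mono[OF _ R])
      have "K * \<sigma> t \<ge> 0" using K sp by simp
      then show "K / (- t) \<le> (192 + 192 * K) * \<sigma> t" using main[OF t] sp unfolding distrib_right by linarith
    qed (use K sp in auto)
    finally show "\<bar>Gam (x, t)\<bar> \<le> (192 + 192 * K) * \<sigma> t * axis_dist2 x powr (5/6)" .
    have "\<bar>Hel (x, t)\<bar> \<le> 4 * (K / (- t)) * sqrt (axis_dist2 x)" by (rule Hel_a_priori[OF grad[OF x7 t1 t(2)]])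
    also have "\<dots> \<le> (192 + 192 * K) * \<sigma> t * sqrt (axis_dist2 x)"
    proof (rule mult_right_mono)
      show "4 * (K / (- t)) \<le> (192 + 192 * K) * \<sigma> t" using main[OF t] sp unfolding distrib_right by linarith
    qed simp
    finally show "\<bar>Hel (x, t)\<bar> \<le> (192 + 192 * K) * \<sigma> t * axis_dist2 x powr (1/2)" by (simp add: powr_half_sqrt)
  qed (use \<tau> K in \<open>auto intro: add_pos_pos\<close>)
  show ?thesis
  proof (rule that[of C \<tau>'])
    show "0 < C" "0 < \<tau>'" "\<tau>' < 1" using C \<tau> by auto
    fix x :: "real^3" and t assume x: "norm x \<le> 1/16384" and t: "- \<tau>' \<le> t" "t < 0"
    then have x': "norm x \<le> 1/512 / 32" by simp
    show "\<bar>Gam (x, t)\<bar> \<le> C * (- t) powr (-1/16) * axis_dist2 x powr (5/6)" using b(1)[OF x' t] unfolding \<mu>_def .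
    show "\<bar>Hel (x, t)\<bar> \<le> C * (- t) powr (-1/16) * axis_dist2 x powr (1/2)" using b(2)[OF x' t] unfolding \<mu>_def .
    fix k
    have "\<bar>swirl_free k (x, t)\<bar> \<le> C * (1 + \<mu> t)" by (rule b(3)[OF x' t])
    also have "\<dots> \<le> C * (2 * \<mu> t)" using \<mu>1[of t] t C by (intro mult_left_mono) auto
    finally show "\<bar>swirl_free k (x, t)\<bar> \<le> 2 * C * (- t) powr (-1/16)" by (simp add: \<mu>_def)
  qed
qed

text \<open>At distances r \<ge> h = (-t)^(3/4), the bound r (-t)^(-1/16) turns into r^2 at the
  price of 1 / h, with exponent -1/16 - 3/4 = -13/16. Below h the second derivatives cost
  (-t)^(-3/2) h = (-t)^(-3/4), which is less. The exponent is above -1, so from here on stretching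
  is integrable in time.\<close>

lemma improved_Rad_bound:
  assumes C: "0 < C" and \<tau>: "0 < \<tau>" "\<tau> < 1"
    and V: "\<And>x t k. norm x \<le> 1/16384 \<Longrightarrow> - \<tau> \<le> t \<Longrightarrow> t < 0 \<Longrightarrow> \<bar>swirl_free k (x, t)\<bar> \<le> 2 * C * (- t) powr (-1/16)"
  obtains \<tau>' where "0 < \<tau>'" "\<tau>' \<le> \<tau>"
    "\<And>x t. norm x \<le> 1/32768 \<Longrightarrow> - \<tau>' \<le> t \<Longrightarrow> t < 0 \<Longrightarrow> \<bar>Rad (x, t)\<bar> \<le> (4 * C + 8 * C2) * (- t) powr (-13/16) * axis_dist2 x"
proof -
  obtain \<tau>3 where \<tau>3: "0 < \<tau>3" "\<tau>3 < 1" "\<And>t. - \<tau>3 \<le> t \<Longrightarrow> t < 0 \<Longrightarrow> 0 < l t \<and> l t \<le> 1 \<and> - t \<le> 1 * (l t)\<^sup>2"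
    by (rule small_scales[of 1], simp, blast)
  define \<tau>' where "\<tau>' = min (min \<tau> \<tau>3) ((1/32768) powr (4/3))"
  have \<tau>': "0 < \<tau>'" "\<tau>' \<le> \<tau>" "\<tau>' \<le> \<tau>3" using \<tau> \<tau>3 by (auto simp: \<tau>'_def)
  show ?thesis
  proof (rule that[OF \<tau>'(1,2)])
    fix x0 t assume x0: "norm (x0::real^3) \<le> 1/32768" and t: "- \<tau>' \<le> t" "t < 0"
    have t': "- \<tau> \<le> t" "-1 < t" using t \<tau>' \<tau> by auto
    define q where "q a = (- t) powr a" for a
    have qp: "q a > 0" for a using t by (simp add: q_def)
    have qm: "q a * q b = q (a + b)" for a b by (simp add: q_def powr_add)
    define h where "h = q (3/4)"
    have h: "h > 0" using qp by (simp add: h_def)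
    have hs: "h \<le> 1/32768"
    proof -
      have "(- t) powr (3/4) \<le> ((1/32768) powr (4/3)) powr (3/4)" using t by (intro powr_mono2) (auto simp: \<tau>'_def)
      then show ?thesis by (simp add: powr_powr h_def q_def)
    qed
    have far: "\<bar>Rad (x, t)\<bar> \<le> 4 * C * q (-13/16) * axis_dist2 x" if x: "norm x \<le> 1/16384" "h \<le> sqrt (axis_dist2 x)" for x
    proof -
      have "(x, t) \<in> Q" using x t t' by (simp add: parabolic_cylinder_def)
      then have "\<bar>Rad (x, t)\<bar> \<le> 2 * sqrt (axis_dist2 x) * (2 * C * q (-1/16))"
        using V[OF x(1) t'(1) t(2)] by (intro Rad_swirl_free) (auto simp: q_def)
      also have "q (-1/16) = q (-13/16) * h" by (simp add: h_def qm)
      also have "2 * sqrt (axis_dist2 x) * (2 * C * (q (-13/16) * h)) \<le> 2 * sqrt (axis_dist2 x) * (2 * C * (q (-13/16) * sqrt (axis_dist2 x)))"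
        using x(2) C qp[of "-13/16"] by (intro mult_left_mono) auto
      also have "\<dots> = 4 * C * q (-13/16) * (sqrt (axis_dist2 x) * sqrt (axis_dist2 x))" by (simp add: mult_ac)
      finally show ?thesis by simp
    qed
    have "\<bar>Rad (x0, t)\<bar> \<le> (4 * C + 8 * C2) * q (-13/16) * axis_dist2 x0"
    proof (cases "h \<le> sqrt (axis_dist2 x0)")
      case True
      have "\<bar>Rad (x0, t)\<bar> \<le> 4 * C * q (-13/16) * axis_dist2 x0" using far[OF _ True] x0 by simp
      also have "\<dots> \<le> (4 * C + 8 * C2) * q (-13/16) * axis_dist2 x0" using C2 qp[of "-13/16"] by (intro mult_right_mono) auto
      finally show ?thesis .
    next
      case False
      have "\<bar>Rad (x0, t)\<bar> \<le> (4 * C * q (-13/16) + 8 * (C2 / ((- t) * l t)) * h) * axis_dist2 x0"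
      proof (rule ratio_near_axis[OF _ h _ _ _ t'(2) t(2), of _ "1/16384"])
        have "h\<^sup>2 \<le> (1/32768)\<^sup>2" using h hs by (intro power_mono) auto
        moreover have "\<bar>x0 $ 3\<bar>\<^sup>2 \<le> (1/32768)\<^sup>2" using x0 component_le_norm_cart[of x0 3] by (intro power_mono) auto
        ultimately show "h\<^sup>2 + (x0 $ 3)\<^sup>2 \<le> (1/16384)\<^sup>2" by (simp add: power2_eq_square)
        show "\<bar>Rad (y, t)\<bar> \<le> 4 * C * q (-13/16) * h\<^sup>2" if y: "norm y \<le> 1/16384" "axis_dist2 y = h\<^sup>2" for y
        proof -
          have "sqrt (axis_dist2 y) = h" using y(2) h by simp
          then show ?thesis using far[OF y(1)] y(2) by simp
        qed
      qed (use False in auto)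
      also have "\<dots> \<le> ((4 * C + 8 * C2) * q (-13/16)) * axis_dist2 x0"
      proof (rule mult_right_mono)
        have "1 / ((- t) * l t) \<le> q (-3/2)" unfolding q_def by (rule second_derivative_scale) (use t t' \<tau>3(3)[of t] \<tau>' in auto)
        then have "C2 * (1 / ((- t) * l t)) \<le> C2 * q (-3/2)" using C2 by (intro mult_left_mono) auto
        then have "8 * (C2 / ((- t) * l t)) * h \<le> 8 * (C2 * q (-3/2)) * h" using h by (intro mult_right_mono mult_left_mono) auto
        also have "\<dots> = 8 * C2 * (q (-3/2) * q (3/4))" by (simp add: h_def)
        also have "\<dots> = 8 * C2 * q (-3/4)" by (simp add: qm)
        also have "\<dots> \<le> 8 * C2 * q (-13/16)" unfolding q_def using C2 t t' by (intro mult_left_mono powr_mono') auto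
        finally show "4 * C * q (-13/16) + 8 * (C2 / ((- t) * l t)) * h \<le> (4 * C + 8 * C2) * q (-13/16)" by (simp only: distrib_right)
      qed simp
      finally show ?thesis .
    qed
    then show "\<bar>Rad (x0, t)\<bar> \<le> (4 * C + 8 * C2) * (- t) powr (-13/16) * axis_dist2 x0" by (simp only: q_def)
  qed
qed

text \<open>The swirl is Gam / r in size, hence at most B r^(2/3) \<le> B, so each Cartesian
  component is at most 2 B.\<close>

lemma velocity_from_parts:
  assumes x: "norm x \<le> 1" and z: "(x, t) \<in> Q" and V: "\<And>k. \<bar>swirl_free k (x, t)\<bar> \<le> B" and \<Gamma>: "\<bar>Gam (x, t)\<bar> \<le> B * axis_dist2 x powr (5/6)"
  shows "norm (u (x, t)) \<le> 6 * B"
proof -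
  have B: "0 \<le> B" using V[of 1] abs_ge_zero order_trans by blast
  have horizontal: "\<bar>w\<bar> \<le> 2 * B" if w: "axis_dist2 x * w = axis_dist2 x * v + c * Gam (x, t)" "\<bar>v\<bar> \<le> B" "\<bar>c\<bar> \<le> sqrt (axis_dist2 x)" "axis_dist2 x > 0" for w v c
  proof -
    have "axis_dist2 x * \<bar>w - v\<bar> = \<bar>c\<bar> * \<bar>Gam (x, t)\<bar>"
    proof -
      have "axis_dist2 x * (w - v) = c * Gam (x, t)" using w(1) by (simp add: algebra_simps)
      then have "\<bar>axis_dist2 x * (w - v)\<bar> = \<bar>c * Gam (x, t)\<bar>" by simp
      then show ?thesis by (simp add: abs_mult)
    qed
    also have "\<dots> \<le> axis_dist2 x powr (1/2) * (B * axis_dist2 x powr (5/6))"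
      using w(3) \<Gamma> by (intro mult_mono) (auto simp: powr_half_sqrt)
    also have "\<dots> = B * (axis_dist2 x powr (1/2) * axis_dist2 x powr (5/6))" by simp
    also have "axis_dist2 x powr (1/2) * axis_dist2 x powr (5/6) = axis_dist2 x powr (4/3)" unfolding powr_add[symmetric] by simp
    also have "B * axis_dist2 x powr (4/3) \<le> B * axis_dist2 x powr 1" using B axis_dist2_le_one[OF x] by (intro mult_left_mono powr_mono') auto
    finally have "axis_dist2 x * \<bar>w - v\<bar> \<le> axis_dist2 x * B" using w(4) by (simp add: mult.commute)
    then have "\<bar>w - v\<bar> \<le> B" using w(4) by simp
    then show ?thesis using w(2) by linarith
  qed
  have "\<bar>u (x, t) $ k\<bar> \<le> 2 * B" for k
  proof (cases "axis_dist2 x > 0")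
    case True
    have e: "axis_dist2 x * u (x, t) $ 1 = axis_dist2 x * swirl_free 1 (x, t) + (- x $ 2) * Gam (x, t)"
      "axis_dist2 x * u (x, t) $ 2 = axis_dist2 x * swirl_free 2 (x, t) + x $ 1 * Gam (x, t)"
      unfolding swirl_free_eq(1,2)[OF z] by (simp_all add: axis_dist2_def Gam_def Rad_def swirl_def radial_def power2_eq_square algebra_simps)
    consider "k = 1" | "k = 2" | "k = 3" using exhaust_3[of k] by blast
    then show ?thesis
    proof cases
      case 1 then show ?thesis using horizontal[OF e(1) V _ True] axis_component_le(2)[of x] by simp
    next
      case 2 then show ?thesis using horizontal[OF e(2) V axis_component_le(1) True] by simp
    next
      case 3 then show ?thesis using swirl_free_eq(3)[OF z] V[of 3] B by simp
    qed
  next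
    case False
    then have x0: "x $ 1 = 0" "x $ 2 = 0" using on_axisD by blast+
    consider "k = 1" | "k = 2" | "k = 3" using exhaust_3[of k] by blast
    then show ?thesis using rotating_pair_axis[OF pair_u z] x0 swirl_free_eq(3)[OF z] V[of 3] B by cases auto
  qed
  then have "norm (u (x, t)) \<le> 3 * (2 * B)" by (rule norm_le_components)
  then show ?thesis by simp
qed

text \<open>A second application of \<open>bootstrap\<close>, fed with the output of the first. As
  \<kappa> is now integrable up to t = 0, an exponential barrier stays between two positive
  constants, and the conclusions become bounds uniform in time.\<close>

theorem velocity_bounded:
  obtains \<rho> B where "0 < \<rho>" "\<rho> \<le> 1" "\<And>x t. (x, t) \<in> parabolic_cylinder \<rho> \<Longrightarrow> norm (u (x, t)) \<le> B"
proof -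
  obtain C \<tau>1 where C: "0 < C" "0 < \<tau>1" "\<tau>1 < 1"
    and G: "\<And>x t. norm x \<le> 1/16384 \<Longrightarrow> - \<tau>1 \<le> t \<Longrightarrow> t < 0 \<Longrightarrow> \<bar>Gam (x, t)\<bar> \<le> C * (- t) powr (-1/16) * axis_dist2 x powr (5/6)"
    and H: "\<And>x t. norm x \<le> 1/16384 \<Longrightarrow> - \<tau>1 \<le> t \<Longrightarrow> t < 0 \<Longrightarrow> \<bar>Hel (x, t)\<bar> \<le> C * (- t) powr (-1/16) * axis_dist2 x powr (1/2)"
    and V: "\<And>x t k. norm x \<le> 1/16384 \<Longrightarrow> - \<tau>1 \<le> t \<Longrightarrow> t < 0 \<Longrightarrow> \<bar>swirl_free k (x, t)\<bar> \<le> 2 * C * (- t) powr (-1/16)"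
    by (rule first_velocity_bound, rule that)
  obtain \<tau> where \<tau>: "0 < \<tau>" "\<tau> \<le> \<tau>1"
    and Rb: "\<And>x t. norm x \<le> 1/32768 \<Longrightarrow> - \<tau> \<le> t \<Longrightarrow> t < 0 \<Longrightarrow> \<bar>Rad (x, t)\<bar> \<le> (4 * C + 8 * C2) * (- t) powr (-13/16) * axis_dist2 x"
    by (rule improved_Rad_bound[OF C(1,2,3) V]) (assumption | rule that)+
  define D where "D = 8 * C + 16 * C2"
  have D: "D > 0" using C C2 by (simp add: D_def)
  \<comment> \<open>The value of the barrier formula at -t = 1, hence a lower bound on (-1,
    0).\<close>
  define c where "c = exp (- (16/3 * (D + 1)))"
  have c: "c > 0" by (simp add: c_def)
  define \<kappa> :: "real \<Rightarrow> real" where "\<kappa> t = D * (- t) powr (-13/16)" for t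
  \<comment> \<open>Solves \<mu>' = (D + 1) (-t)^(-13/16) \<mu>, with 16/3 the reciprocal of 3/16.
    The summand 1 next to \<open>D\<close> is the surplus over \<kappa> \<mu>.\<close>
  define \<mu> :: "real \<Rightarrow> real" where "\<mu> t = exp (- (16/3 * (D + 1)) * (- t) powr (3/16))" for t
  define \<mu>' :: "real \<Rightarrow> real" where "\<mu>' t = (D + 1) * (- t) powr (-13/16) * \<mu> t" for t
  define \<sigma> :: "real \<Rightarrow> real" where "\<sigma> t = c * (- t) powr (-13/16)" for t
  have \<mu>b: "c \<le> \<mu> t" "\<mu> t \<le> 1" if t: "- \<tau> \<le> t" "t < 0" for t
  proof -
    have "(- t) powr (3/16) \<le> 1 powr (3/16)" using t \<tau> C by (intro powr_mono2) auto
    then have "16/3 * (D + 1) * (- t) powr (3/16) \<le> 16/3 * (D + 1) * 1" using D by (intro mult_left_mono) auto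
    then show "c \<le> \<mu> t" by (simp add: c_def \<mu>_def)
    show "\<mu> t \<le> 1" using D by (simp add: \<mu>_def)
  qed
  have lowest: "(- t) powr a \<le> (- t) powr b" if "b \<le> a" "- \<tau> \<le> t" "t < 0" for t a b :: real
    using that \<tau> C by (intro powr_mono') auto
  \<comment> \<open>The number 4 bounds (1 + \<mu>)^2, \<open>C\<close> stands for the bounds of the
    first pass, and division by \<open>c\<close> undoes the factor in \<sigma>.\<close>
  define N where "N = (4 + C) / c"
  have N: "N > 0" using C c by (simp add: N_def)
  have N\<sigma>: "N * \<sigma> t = (4 + C) * (- t) powr (-13/16)" for t using c by (simp add: N_def \<sigma>_def)
  obtain C' \<tau>' where C': "0 < C'" "0 < \<tau>'" "\<tau>' \<le> \<tau>"
    and b: "\<And>x t. norm x \<le> 1/65536 / 32 \<Longrightarrow> - \<tau>' \<le> t \<Longrightarrow> t < 0 \<Longrightarrow> \<bar>Gam (x, t)\<bar> \<le> C' * \<mu> t * axis_dist2 x powr (5/6)"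
      "\<And>x t k. norm x \<le> 1/65536 / 32 \<Longrightarrow> - \<tau>' \<le> t \<Longrightarrow> t < 0 \<Longrightarrow> \<bar>swirl_free k (x, t)\<bar> \<le> C' * (1 + \<mu> t)"
  proof (rule bootstrap[where \<rho>="1/65536" and \<tau>=\<tau> and \<kappa>=\<kappa> and \<mu>=\<mu> and \<mu>'=\<mu>' and \<sigma>=\<sigma> and N=N])
    fix x :: "real^3" and t :: real assume t: "- \<tau> \<le> t" "t < 0"
    show "0 < \<mu> t" "0 < \<sigma> t" using t c by (simp_all add: \<mu>_def \<sigma>_def)
    show "(\<mu> has_real_derivative \<mu>' t) (at t)"
    proof -
      have "((\<lambda>t. - (16/3 * (D + 1)) * (- t) powr (3/16)) has_real_derivative - (16/3 * (D + 1)) * (- (3/16) * (- t) powr (3/16 - 1))) (at t)"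
        by (rule DERIV_cmult[OF neg_powr_deriv[OF t(2)]])
      then have "(\<mu> has_real_derivative exp (- (16/3 * (D + 1)) * (- t) powr (3/16)) * (- (16/3 * (D + 1)) * (- (3/16) * (- t) powr (3/16 - 1)))) (at t)"
        unfolding \<mu>_def by (rule DERIV_fun_exp)
      moreover have "exp (- (16/3 * (D + 1)) * (- t) powr (3/16)) * (- (16/3 * (D + 1)) * (- (3/16) * (- t) powr (3/16 - 1))) = \<mu>' t"
        by (simp add: \<mu>_def \<mu>'_def field_simps)
      ultimately show ?thesis by (simp only:)
    qed
    have "\<mu>' t - \<kappa> t * \<mu> t = (- t) powr (-13/16) * \<mu> t" by (simp add: \<mu>'_def \<kappa>_def algebra_simps)
    moreover have "(- t) powr (-13/16) * c \<le> (- t) powr (-13/16) * \<mu> t" using \<mu>b[OF t] by (intro mult_left_mono) auto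
    ultimately show "\<sigma> t \<le> \<mu>' t - \<kappa> t * \<mu> t" by (simp add: \<sigma>_def mult.commute)
    have "(1 + \<mu> t)\<^sup>2 \<le> 2\<^sup>2" using \<mu>b[OF t] c by (intro power_mono) auto
    then have "(1 + \<mu> t)\<^sup>2 * (- t) powr (-3/4) \<le> (4 + C) * (- t) powr (-13/16)"
      using lowest[of "-13/16" "-3/4" t] t C by (intro mult_mono) auto
    then show "(1 + \<mu> t)\<^sup>2 * (- t) powr (-3/4) \<le> N * \<sigma> t" unfolding N\<sigma> .
    have weaken: "Y \<le> N * \<sigma> t * w" if "Y \<le> C * (- t) powr (-1/16) * w" "0 \<le> w" for Y w
    proof -
      have "C * (- t) powr (-1/16) \<le> (4 + C) * (- t) powr (-13/16)" using lowest[of "-13/16" "-1/16" t] t C by (intro mult_mono) auto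
      then have "C * (- t) powr (-1/16) * w \<le> (4 + C) * (- t) powr (-13/16) * w" using that(2) by (rule mult_right_mono)
      then show ?thesis using that(1) unfolding N\<sigma> by linarith
    qed
    assume x: "norm x \<le> 2 * (1/65536)"
    then have x1: "norm x \<le> 1/32768" "norm x \<le> 1/16384" by simp_all
    have t1: "- \<tau>1 \<le> t" using t \<tau> by simp
    have "(4 * C + 8 * C2) * (- t) powr (-13/16) = \<kappa> t / 2" by (simp add: \<kappa>_def D_def)
    then show "\<bar>Rad (x, t)\<bar> \<le> \<kappa> t / 2 * axis_dist2 x" using Rb[OF x1(1) t] by (simp only:)
    show "\<bar>Gam (x, t)\<bar> \<le> N * \<sigma> t * axis_dist2 x powr (5/6)" by (rule weaken[OF G[OF x1(2) t1 t(2)]]) simp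
    show "\<bar>Hel (x, t)\<bar> \<le> N * \<sigma> t * axis_dist2 x powr (1/2)" by (rule weaken[OF H[OF x1(2) t1 t(2)]]) simp
  qed (use \<tau> C N in auto)
  \<comment> \<open>1/2097152 is 1/65536 divided by 32, the radius delivered by
    \<open>bootstrap\<close>. Since \<rho>^2 \<le> \<rho> \<le> \<tau>', the times of the cylinder
    are covered as well.\<close>
  define \<rho> where "\<rho> = min (1/2097152) \<tau>'"
  have \<rho>: "0 < \<rho>" "\<rho> \<le> 1/2097152" "\<rho> \<le> \<tau>'" using C' by (auto simp: \<rho>_def)
  show ?thesis
  proof (rule that[of \<rho> "6 * (2 * C')"])
    show "0 < \<rho>" "\<rho> \<le> 1" using \<rho> by auto
    fix x t assume "(x, t) \<in> parabolic_cylinder \<rho>"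
    then have xt: "norm x < \<rho>" "- (\<rho>\<^sup>2) < t" "t < 0" by (auto simp: parabolic_cylinder_def)
    have "\<rho>\<^sup>2 \<le> \<rho> * 1" unfolding power2_eq_square using \<rho> by (intro mult_left_mono) auto
    then have t: "- \<tau>' \<le> t" "-1 < t" using xt \<rho> by auto
    have x: "norm x \<le> 1/65536 / 32" "norm x < 1" using xt \<rho> by auto
    have \<mu>t: "0 < \<mu> t" "\<mu> t \<le> 1" using \<mu>b(2)[of t] t xt C' by (auto simp: \<mu>_def)
    show "norm (u (x, t)) \<le> 6 * (2 * C')"
    proof (rule velocity_from_parts)
      show "norm x \<le> 1" "(x, t) \<in> Q" using x t xt by (auto simp: parabolic_cylinder_def)
      show "\<bar>swirl_free k (x, t)\<bar> \<le> 2 * C'" for k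
      proof -
        have "C' * (1 + \<mu> t) \<le> C' * 2" using \<mu>t C' by (intro mult_left_mono) auto
        then show ?thesis using b(2)[OF x(1) t(1) xt(3), of k] by linarith
      qed
      have "C' * \<mu> t \<le> 2 * C'" using mult_left_mono[of "\<mu> t" 1 C'] \<mu>t C' by simp
      then have "C' * \<mu> t * axis_dist2 x powr (5/6) \<le> 2 * C' * axis_dist2 x powr (5/6)" by (rule mult_right_mono) simp
      then show "\<bar>Gam (x, t)\<bar> \<le> 2 * C' * axis_dist2 x powr (5/6)" using b(1)[OF x(1) t(1) xt(3)] by linarith
    qed
  qed
qed

end

subsection \<open>From essential bounds to pointwise bounds\<close>

text \<open>The set where the bound fails is open and negligible, hence empty.\<close>

lemma AE_bound_continuous:
  fixes g :: "'a::euclidean_space \<Rightarrow> real"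
  assumes S: "open S" "x \<in> S" and g: "continuous_on S g" and b: "AE x in lebesgue_on S. g x \<le> B"
  shows "g x \<le> B"
proof (rule ccontr)
  assume "\<not> ?thesis"
  then have x: "x \<in> {x \<in> S. B < g x}" using S by simp
  have "AE x in lebesgue. x \<in> S \<longrightarrow> g x \<le> B" using b S by (subst (asm) AE_restrict_space_iff) auto
  then have "AE x in lebesgue. x \<notin> {x \<in> S. B < g x}" by eventually_elim auto
  then obtain T where "T \<in> null_sets lebesgue" "{x \<in> S. B < g x} \<subseteq> T" by (auto simp: eventually_ae_filter)
  then have "negligible {x \<in> S. B < g x}" using negligible_subset negligible_iff_null_sets by blast
  moreover have "open {x \<in> S. B < g x}"
    using continuous_open_preimage[OF g S(1) open_greaterThan[of B]] by (simp add: vimage_def Int_def)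
  ultimately show False using x open_not_negligible by blast
qed

lemma Linf_norm_pointwise:
  assumes f: "continuous_on (ball 0 1) f" and b: "Linf_norm (ball 0 1) f \<le> ereal B" and x: "x \<in> ball 0 1"
  shows "norm (f x) \<le> B"
proof (rule AE_bound_continuous[OF open_ball x])
  show "continuous_on (ball 0 1) (\<lambda>x. norm (f x))" using f by (intro continuous_intros)
  have "AE x in lebesgue_on (ball 0 1). ereal (norm (f x)) \<le> ereal B"
    by (rule eventually_mono[OF esssup_AE order_trans]) (use b in \<open>simp_all add: Linf_norm_def\<close>)
  then show "AE x in lebesgue_on (ball 0 1). norm (f x) \<le> B" by simp
qed

lemma second_gradient_component:
  assumes u: "smooth_on Q u" and z: "z \<in> Q"
  shows "second_gradient u z $ i $ j $ k = dx i (dx j (component u k)) z"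
proof -
  have "dx i (dx j u) z $ k = dx i (component (dx j u) k) z" by (rule dx_component[OF smooth_on_dx[OF u] z])
  also have "\<dots> = dx i (dx j (component u k)) z" by (rule dx_cong[OF _ z]) (rule dx_component[OF u])
  finally show ?thesis by (simp add: second_gradient_def)
qed

lemma continuous_on_slice:
  assumes f: "continuous_on Q f" and t: "-1 < t" "t < 0"
  shows "continuous_on (ball 0 1) (\<lambda>x. f (x, t))"
  using t by (intro continuous_on_compose2[OF f] continuous_intros) (auto simp: parabolic_cylinder_def)

lemma second_gradient_pointwise:
  assumes u: "smooth_on Q u" and t: "-1 < t" "t < 0" and x: "norm x < 1"
    and b: "Linf_norm (ball 0 1) (\<lambda>x. second_gradient u (x, t)) \<le> ereal B"
  shows "\<bar>dx i (dx j (component u k)) (x, t)\<bar> \<le> B"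
proof -
  have Q: "(y, t) \<in> Q" if "y \<in> ball 0 1" for y using that t by (simp add: parabolic_cylinder_def)
  have "continuous_on (ball 0 1) (\<lambda>y. second_gradient u (y, t))"
    unfolding second_gradient_def
    by (intro continuous_on_vec_lambda continuous_intros continuous_on_slice[OF _ t] smooth_on_imp_continuous smooth_on_dx u)
  then have "norm (second_gradient u (x, t)) \<le> B" using b x by (intro Linf_norm_pointwise) auto
  moreover have "\<bar>second_gradient u (x, t) $ i $ j $ k\<bar> \<le> norm (second_gradient u (x, t))"
    by (meson component_le_norm_cart Finite_Cartesian_Product.norm_nth_le order_trans)
  ultimately show ?thesis using x by (simp add: second_gradient_component[OF u Q])
qed

text \<open>The maximum with 0 appears because \<open>ennreal\<close> truncates a negative
  \<open>K\<close> to 0.\<close>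

lemma integral_cbox_le_nn_integral:
  fixes f :: "'a::euclidean_space \<Rightarrow> real"
  assumes f: "continuous_on (cbox a b) f" "\<And>x. 0 \<le> f x" and S: "cbox a b \<subseteq> S" "S \<in> sets lebesgue"
    and b: "(\<integral>\<^sup>+x. ennreal (f x) \<partial>lebesgue_on S) \<le> ennreal K"
  shows "integral (cbox a b) f \<le> max K 0"
proof -
  have i: "integrable (lebesgue_on (cbox a b)) f" by (rule continuous_imp_integrable[OF f(1)])
  have "ennreal (integral (cbox a b) f) = (\<integral>\<^sup>+x. ennreal (f x) \<partial>lebesgue_on (cbox a b))"
    using nn_integral_eq_integral[OF i] f(2) by (simp add: lebesgue_integral_eq_integral[OF i])
  also have "\<dots> = (\<integral>\<^sup>+x. ennreal (f x) * indicator (cbox a b) x \<partial>lebesgue)" by (rule nn_integral_restrict_space) simp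
  also have "\<dots> \<le> (\<integral>\<^sup>+x. ennreal (f x) * indicator S x \<partial>lebesgue)"
    using S by (intro nn_integral_mono) (auto split: split_indicator)
  also have "\<dots> = (\<integral>\<^sup>+x. ennreal (f x) \<partial>lebesgue_on S)" using S by (intro nn_integral_restrict_space[symmetric]) simp
  also have "\<dots> \<le> ennreal (max K 0)" using b ennreal_leI[of K "max K 0"] by (auto intro: order_trans)
  finally show ?thesis by (subst (asm) ennreal_le_iff) auto
qed

text \<open>Continuity on the open cylinder gives no continuity in time of the energy of the full
  ball. Over a fixed compact cube it does, and the bound for almost every time extends to every
  time, with a constant independent of the cube.\<close>

lemma energy_on_cubes:
  assumes u: "continuous_on Q u" "in_LinfL2 u"
  obtains E where "0 \<le> E" "\<And>t a b. -1 < t \<Longrightarrow> t < 0 \<Longrightarrow> cbox a b \<subseteq> ball 0 1 \<Longrightarrow> integral (cbox a b) (\<lambda>y. (norm (u (y, t)))\<^sup>2) \<le> E"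
proof -
  obtain K where K: "AE t in lebesgue_on {-1<..<0}. (\<integral>\<^sup>+x. ennreal ((norm (u (x, t)))\<^sup>2) \<partial>lebesgue_on (ball 0 1)) \<le> ennreal K"
    using u(2) by (auto simp: in_LinfL2_def)
  show ?thesis
  proof (rule that[of "max K 0"])
    fix t :: real and a b :: "real^3" assume t: "-1 < t" "t < 0" and ab: "cbox a b \<subseteq> ball 0 1"
    show "integral (cbox a b) (\<lambda>y. (norm (u (y, t)))\<^sup>2) \<le> max K 0"
    proof (rule AE_bound_continuous[where S="{-1<..<0}" and x=t and g="\<lambda>t. integral (cbox a b) (\<lambda>y. (norm (u (y, t)))\<^sup>2)"])
      show "t \<in> {-1<..<0}" using t by simp
      have "continuous_on ({-1<..<0} \<times> cbox a b) (\<lambda>z. u (snd z, fst z))"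
        using ab by (intro continuous_on_compose2[OF u(1)] continuous_intros) (auto simp: parabolic_cylinder_def)
      then show "continuous_on {-1<..<0} (\<lambda>t. integral (cbox a b) (\<lambda>y. (norm (u (y, t)))\<^sup>2))"
        by (intro integral_continuous_on_param) (auto simp: case_prod_beta intro!: continuous_intros)
      have inside: "AE t in lebesgue_on {-1<..<0}. t \<in> {-1<..<0::real}" by (rule AE_I2) simp
      show "AE t in lebesgue_on {-1<..<0}. integral (cbox a b) (\<lambda>y. (norm (u (y, t)))\<^sup>2) \<le> max K 0"
        using K inside
      proof eventually_elim
        case (elim t)
        have "continuous_on (ball 0 1) (\<lambda>y. u (y, t))" using continuous_on_slice[OF u(1), of t] elim(2) by simp
        then have "continuous_on (cbox a b) (\<lambda>y. (norm (u (y, t)))\<^sup>2)"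
          by (intro continuous_intros continuous_on_subset[OF _ ab])
        from integral_cbox_le_nn_integral[OF this _ ab _ elim(1)] show ?case by simp
      qed
    qed simp
  qed simp
qed

theorem theorem1p2:
  fixes u :: "spacetime \<Rightarrow> real^3" and p :: "spacetime \<Rightarrow> real"
    and l :: "real \<Rightarrow> real" and C\<^sub>0 C\<^sub>2 :: real
  assumes "suitable_weak_solution u p"
    and "smooth_on Q u" and "smooth_on Q p"
    and "axisymmetric u p"
    and "euler_length l"
    and "C\<^sub>0 > 0" and "C\<^sub>2 > 0"
    and "\<And>t. t \<in> {-1<..<0} \<Longrightarrow>
           Linf_norm (ball 0 1) (\<lambda>x. u (x, t)) \<le> ereal (C\<^sub>0 * (l t / (- t)))"
    and "\<And>t. t \<in> {-1<..<0} \<Longrightarrow>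
           Linf_norm (ball 0 1) (\<lambda>x. second_gradient u (x, t)) \<le> ereal (C\<^sub>2 * (1 / ((- t) * l t)))"
  shows "regular_at_origin u"
proof -
  have cu: "continuous_on Q u" using assms(2) by (rule smooth_on_imp_continuous)
  obtain E where E: "0 \<le> E" "\<And>t a b. -1 < t \<Longrightarrow> t < 0 \<Longrightarrow> cbox a b \<subseteq> ball 0 1 \<Longrightarrow> integral (cbox a b) (\<lambda>y. (norm (u (y, t)))\<^sup>2) \<le> E"
    using energy_on_cubes[OF cu] assms(1) unfolding suitable_weak_solution_def by blast
  interpret axisymmetric_flow u p using assms(1-4) by (rule axisymmetric_flowI)
  interpret euler_rate u p l C\<^sub>0 C\<^sub>2 E
  proof
    show "l t \<le> l s" if "-1 < s" "s \<le> t" "t < 0" for s t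
      using assms(5) that unfolding euler_length_def monotone_on_def by simp
    show "norm (u (x, t)) \<le> C\<^sub>0 * (l t / (- t))" if "norm x < 1" "-1 < t" "t < 0" for x t
      using Linf_norm_pointwise[OF continuous_on_slice[OF cu] assms(8), of t x] that by simp
    show "\<bar>dx i (dx j (component u k)) (x, t)\<bar> \<le> C\<^sub>2 * (1 / ((- t) * l t))" if "norm x < 1" "-1 < t" "t < 0" for x t i j k
      by (rule second_gradient_pointwise[OF assms(2) that(2,3,1)], rule assms(9)) (use that in simp)
    show "integral (cbox (x - s *\<^sub>R 1) (x + s *\<^sub>R 1)) (\<lambda>y. (norm (u (y, t)))\<^sup>2) \<le> E"
      if "-1 < t" "t < 0" "s > 0" "ball x (2 * s) \<subseteq> ball 0 1" for t s x
      by (rule E(2)[OF that(1,2)]) (use cube_in_ball[OF that(3)] that(4) in blast)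
    show "0 < l t" if "-1 < t" "t < 0" for t using assms(5) that by (simp add: euler_length_def)
    show "(l \<longlongrightarrow> 0) (at_left 0)" "((\<lambda>t. - t / (l t)\<^sup>2) \<longlongrightarrow> 0) (at_left 0)"
      using assms(5) unfolding euler_length_def by blast+
  qed (rule assms E)+
  obtain \<rho> B where \<rho>: "0 < \<rho>" "\<rho> \<le> 1" and B: "\<And>x t. (x, t) \<in> parabolic_cylinder \<rho> \<Longrightarrow> norm (u (x, t)) \<le> B"
    by (rule velocity_bounded, rule that)
  have "\<rho>\<^sup>2 \<le> 1" using \<rho> by (simp add: power_le_one)
  then have sub: "parabolic_cylinder \<rho> \<subseteq> Q" using \<rho> by (auto simp: parabolic_cylinder_def)
  have "open (parabolic_cylinder \<rho>)" unfolding parabolic_cylinder_def by (intro open_Times) auto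
  then have meas: "parabolic_cylinder \<rho> \<in> sets lebesgue" by (intro sets_completionI_sets) simp
  have "Linf_norm (parabolic_cylinder \<rho>) u \<le> ereal B" unfolding Linf_norm_def
  proof (rule esssup_I)
    have "(\<lambda>z. norm (u z)) \<in> borel_measurable (lebesgue_on (parabolic_cylinder \<rho>))"
      by (rule continuous_imp_measurable_on_sets_lebesgue[OF continuous_on_norm[OF continuous_on_subset[OF cu sub]] meas])
    then show "(\<lambda>z. ereal (norm (u z))) \<in> borel_measurable (lebesgue_on (parabolic_cylinder \<rho>))" by simp
    show "AE z in lebesgue_on (parabolic_cylinder \<rho>). ereal (norm (u z)) \<le> ereal B"
      using B by (intro AE_I2) auto
  qed
  then have "Linf_norm (parabolic_cylinder \<rho>) u < \<infinity>" by (rule le_less_trans) simp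
  then show ?thesis unfolding regular_at_origin_def using \<rho> by blast
qed

end
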